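(* Let $N\ge 3$ and assume $[A]$, $[V]$, $[K]$ (see context). Assume there are $R_1,R_2>0$, $\alpha_0,\alpha_\infty\in\mathbb{R}$, $\beta_0,\beta_\infty\in[0,1]$ such that $$\operatorname*{ess\,sup}_{|x|<R_1}\frac{K(|x|)}{|x|^{\alpha_0}V(|x|)^{\beta_0}}<+\infty,\qquad \operatorname*{ess\,sup}_{|x|\ge R_2}\frac{K(|x|)}{|x|^{\alpha_\infty}V(|x|)^{\beta_\infty}}<+\infty .$$ Let $q_1,q_2>2$ satisfy $$q_1\in\mathcal{I}_1=\big(\max\{1,2\beta_0\},\,q^*(a_0,\alpha_0,\beta_0)\big),\qquad q_2\in\mathcal{I}_2=\big(\max\{1,2\beta_\infty,q^*(a_\infty,\alpha_\infty,\beta_\infty)\},+\infty\big).$$ Let $f:\mathbb{R}\to\mathbb{R}$ be a continuous function and $F(t)=\int_0^t f(s)\,ds$, and assume: $(f_1)$ there is $M>0$ such that $|f(t)|\le M\min\{|t|^{q_1-1},|t|^{q_2-1}\}$ for all $t\in\mathbb{R}$; $(f_2)$ there is $\theta>2$ such that $0\le\theta F(t)\le f(t)t$ for all $t\in\mathbb{R}$, and there is $t_0>0$ such that $F(t_0)>0$. Then the functional $I:X\to\mathbb{R}$, $$I(u)=\frac12\int_{\mathbb{R}^N}A(|x|)|\nabla u|^2dx+\frac12\int_{\mathbb{R}^N}V(|x|)u^2dx-\int_{\mathbb{R}^N}K(|x|)F(u)\,dx,$$ has a non negative and non trivial critical point.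
   Context: Hypotheses on the potentials. $[A]$: $A:(0,+\infty)\to(0,+\infty)$ is continuous and there are real numbers $2-N<a_0,a_\infty\le 2$ and $c_0,c_\infty>0$ with $$c_0\le\liminf_{r\to0^+}\frac{A(r)}{r^{a_0}}\le\limsup_{r\to0^+}\frac{A(r)}{r^{a_0}}<+\infty,\qquad c_\infty\le\liminf_{r\to+\infty}\frac{A(r)}{r^{a_\infty}}\le\limsup_{r\to+\infty}\frac{A(r)}{r^{a_\infty}}<+\infty.$$ $[V]$: $V:(0,+\infty)\to[0,+\infty)$ belongs to $L^1_{loc}(0,+\infty)$. $[K]$: $K:(0,+\infty)\to(0,+\infty)$ belongs to $L^s_{loc}(0,+\infty)$ for some $s>\max\{\frac{2N}{N-a_0+2},\frac{2N}{N-a_\infty+2}\}$. Function spaces. $p_0=\frac{2N}{N+a_0-2}$, $p_\infty=\frac{2N}{N+a_\infty-2}$. $L^{p_0}+L^{p_\infty}$ is the space of sums $u=u_1+u_2$ with $u_1\in L^{p_0}(\mathbb{R}^N)$, $u_2\in L^{p_\infty}(\mathbb{R}^N)$, normed by $\inf\max\{\|u_1\|_{L^{p_0}},\|u_2\|_{L^{p_\infty}}\}$ over all such decompositions. $S_A$ is the set of radial $u\in C_c^\infty(\mathbb{R}^N)$ with $\|u\|_A=(\int_{\mathbb{R}^N}A(|x|)|\nabla u|^2dx)^{1/2}<\infty$. $D_A$ is the space of $u\in L^{p_0}+L^{p_\infty}$ for which there is a sequence $\{u_n\}\subset S_A$ that converges to $u$ in $L^{p_0}+L^{p_\infty}$ and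 is Cauchy with respect to $\|\cdot\|_A$; each $u\in D_A$ has a weak gradient in $L^2_{loc}(\mathbb{R}^N\setminus\{0\})$, and $\|u\|_A$ is defined on $D_A$ by the same formula. $X=\{u\in D_A:\int_{\mathbb{R}^N}V(|x|)|u|^2dx<\infty\}$, a Hilbert space with norm $\|u\|^2=\int_{\mathbb{R}^N}A(|x|)|\nabla u|^2dx+\int_{\mathbb{R}^N}V(|x|)|u|^2dx$. For $\alpha\in\mathbb{R}$, $\beta\in[0,1]$, $a\in(2-N,2]$: $q^*(a,\alpha,\beta)=2\,\frac{\alpha-2\beta+N+a\beta}{N+a-2}$. Conventions: $V^0\equiv1$; for $\beta>0$ the quotient $K/(|x|^\alpha V^\beta)$ is $+\infty$ where $V=0$. A critical point of $I$ is $u\in X$ with $I'(u)=0$, $I'$ being the Fréchet derivative on $X$. *)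

theory Defs
  imports "HOL-Analysis.Analysis" "HOL-Probability.Essential_Supremum"
begin

text \<open>
  The space \<open>\<real>\<^sup>N\<close> is a Euclidean space \<open>'a\<close> with \<open>N = DIM('a)\<close>. Elements of Lebesgue spaces are
  represented by functions rather than classes modulo null sets; \<open>Lp\<close>, \<open>Lp_sum\<close>, \<open>D_A\<close>,
  \<open>X_space\<close>, their norms and \<open>I_functional\<close> are invariant under modification on null sets. The
  potentials are functions on the whole of \<open>real\<close> of which only the restriction to \<open>{0<..}\<close> is relevant.
\<close>

subsection \<open>Lebesgue spaces\<close>

definition Lp :: "real \<Rightarrow> ('a::euclidean_space \<Rightarrow> real) set" where
  "Lp p = {u. u \<in> borel_measurable lebesgue \<and> integrable lebesgue (\<lambda>x. \<bar>u x\<bar> powr p)}"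

definition Lp_norm :: "real \<Rightarrow> ('a::euclidean_space \<Rightarrow> real) \<Rightarrow> real" where
  "Lp_norm p u = (\<integral>x. \<bar>u x\<bar> powr p \<partial>lebesgue) powr (1 / p)"

definition Lp_loc ::
    "real \<Rightarrow> 'a::euclidean_space set \<Rightarrow> ('a \<Rightarrow> 'b::real_normed_vector) set" where
  "Lp_loc p \<Omega> = {u. u \<in> borel_measurable (lebesgue_on \<Omega>) \<and>
     (\<forall>C. compact C \<and> C \<subseteq> \<Omega> \<longrightarrow> (\<lambda>x. norm (u x) powr p) absolutely_integrable_on C)}"

definition Lp_sum :: "real \<Rightarrow> real \<Rightarrow> ('a::euclidean_space \<Rightarrow> real) set" where
  "Lp_sum p q = {u. \<exists>u1\<in>Lp p. \<exists>u2\<in>Lp q. u = (\<lambda>x. u1 x + u2 x)}"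

definition Lp_sum_norm :: "real \<Rightarrow> real \<Rightarrow> ('a::euclidean_space \<Rightarrow> real) \<Rightarrow> real" where
  "Lp_sum_norm p q u =
     Inf {max (Lp_norm p u1) (Lp_norm q u2) | u1 u2.
            u1 \<in> Lp p \<and> u2 \<in> Lp q \<and> u = (\<lambda>x. u1 x + u2 x)}"

subsection \<open>Smooth functions and gradients\<close>

primrec Ck :: "nat \<Rightarrow> ('a::euclidean_space \<Rightarrow> real) \<Rightarrow> bool" where
  "Ck 0 u \<longleftrightarrow> continuous_on UNIV u"
| "Ck (Suc k) u \<longleftrightarrow> (\<forall>x. u differentiable (at x)) \<and>
     (\<forall>b\<in>Basis. Ck k (\<lambda>x. frechet_derivative u (at x) b))"

definition test_functions :: "'a::euclidean_space set \<Rightarrow> ('a \<Rightarrow> real) set" where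
  "test_functions \<Omega> = {\<phi>. (\<forall>k. Ck k \<phi>) \<and>
     compact (closure {x. \<phi> x \<noteq> 0}) \<and> closure {x. \<phi> x \<noteq> 0} \<subseteq> \<Omega>}"

definition grad :: "('a::euclidean_space \<Rightarrow> real) \<Rightarrow> 'a \<Rightarrow> 'a" where
  "grad u x = (\<Sum>b\<in>Basis. frechet_derivative u (at x) b *\<^sub>R b)"

definition is_weak_grad ::
    "'a::euclidean_space set \<Rightarrow> ('a \<Rightarrow> real) \<Rightarrow> ('a \<Rightarrow> 'a) \<Rightarrow> bool" where
  "is_weak_grad \<Omega> u g \<longleftrightarrow> u \<in> Lp_loc 1 \<Omega> \<and> g \<in> Lp_loc 1 \<Omega> \<and>
     (\<forall>\<phi>\<in>test_functions \<Omega>. \<forall>b\<in>Basis.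
        (\<integral>x. u x * frechet_derivative \<phi> (at x) b \<partial>lebesgue)
          = - (\<integral>x. (g x \<bullet> b) * \<phi> x \<partial>lebesgue))"

text \<open>
  The weak gradient on \<open>\<real>\<^sup>N - {0}\<close> in \<open>L\<^sup>2\<^sub>l\<^sub>o\<^sub>c\<close>. It is unique up to null sets, so it does not matter
  which representative is chosen.
\<close>
definition wgrad :: "('a::euclidean_space \<Rightarrow> real) \<Rightarrow> 'a \<Rightarrow> 'a" where
  "wgrad u = (SOME g. is_weak_grad (- {0}) u g \<and> g \<in> Lp_loc 2 (- {0}))"

subsection \<open>The potentials\<close>

definition hyp_A :: "nat \<Rightarrow> (real \<Rightarrow> real) \<Rightarrow> real \<Rightarrow> real \<Rightarrow> bool" where
  "hyp_A N A a0 ainf \<longleftrightarrow>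
     continuous_on {0<..} A \<and> (\<forall>r>0. 0 < A r) \<and>
     2 - real N < a0 \<and> a0 \<le> 2 \<and> 2 - real N < ainf \<and> ainf \<le> 2 \<and>
     (\<exists>c0>0. \<exists>cinf>0.
        ereal c0 \<le> Liminf (at_right 0) (\<lambda>r. ereal (A r / r powr a0)) \<and>
        Limsup (at_right 0) (\<lambda>r. ereal (A r / r powr a0)) < \<infinity> \<and>
        ereal cinf \<le> Liminf at_top (\<lambda>r. ereal (A r / r powr ainf)) \<and>
        Limsup at_top (\<lambda>r. ereal (A r / r powr ainf)) < \<infinity>)"

definition hyp_V :: "(real \<Rightarrow> real) \<Rightarrow> bool" where
  "hyp_V V \<longleftrightarrow> (\<forall>r>0. 0 \<le> V r) \<and> V \<in> Lp_loc 1 {0<..}"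

definition hyp_K :: "nat \<Rightarrow> (real \<Rightarrow> real) \<Rightarrow> real \<Rightarrow> real \<Rightarrow> bool" where
  "hyp_K N K a0 ainf \<longleftrightarrow> (\<forall>r>0. 0 < K r) \<and>
     (\<exists>s. s > max (2 * real N / (real N - a0 + 2)) (2 * real N / (real N - ainf + 2)) \<and>
          K \<in> Lp_loc s {0<..})"

text \<open>
  The quotient \<open>K / (r\<^sup>\<alpha> V\<^sup>\<beta>)\<close> with the conventions \<open>V\<^sup>0 = 1\<close> (whereas \<open>0 powr 0 = 0\<close> in HOL)
  and, for \<open>\<beta> > 0\<close>, value \<open>\<infinity>\<close> where \<open>V = 0\<close>.
\<close>
definition KV_quotient ::
    "(real \<Rightarrow> real) \<Rightarrow> (real \<Rightarrow> real) \<Rightarrow> real \<Rightarrow> real \<Rightarrow> real \<Rightarrow> ereal" where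
  "KV_quotient K V \<alpha> \<beta> r =
     (if \<beta> = 0 then ereal (K r / r powr \<alpha>)
      else if V r = 0 then \<infinity>
      else ereal (K r / (r powr \<alpha> * V r powr \<beta>)))"

definition q_star :: "nat \<Rightarrow> real \<Rightarrow> real \<Rightarrow> real \<Rightarrow> real" where
  "q_star N a \<alpha> \<beta> = 2 * ((\<alpha> - 2 * \<beta> + real N + a * \<beta>) / (real N + a - 2))"

subsection \<open>The function spaces\<close>

definition p_crit :: "nat \<Rightarrow> real \<Rightarrow> real" where
  "p_crit N a = 2 * real N / (real N + a - 2)"

definition S_A :: "(real \<Rightarrow> real) \<Rightarrow> ('a::euclidean_space \<Rightarrow> real) set" where
  "S_A A = {u \<in> test_functions UNIV. (\<forall>x y. norm x = norm y \<longrightarrow> u x = u y) \<and>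
     integrable lebesgue (\<lambda>x. A (norm x) * (norm (grad u x))\<^sup>2)}"

definition norm_A_smooth :: "(real \<Rightarrow> real) \<Rightarrow> ('a::euclidean_space \<Rightarrow> real) \<Rightarrow> real" where
  "norm_A_smooth A u = sqrt (\<integral>x. A (norm x) * (norm (grad u x))\<^sup>2 \<partial>lebesgue)"

definition D_A :: "(real \<Rightarrow> real) \<Rightarrow> real \<Rightarrow> real \<Rightarrow> ('a::euclidean_space \<Rightarrow> real) set" where
  "D_A A a0 ainf =
     (let p0 = p_crit DIM('a) a0; pinf = p_crit DIM('a) ainf in
      {u \<in> Lp_sum p0 pinf. \<exists>w. (\<forall>n. w n \<in> S_A A) \<and>
         (\<lambda>n. Lp_sum_norm p0 pinf (\<lambda>x. w n x - u x)) \<longlonglongrightarrow> 0 \<and>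
         (\<forall>e>0. \<exists>n0. \<forall>m\<ge>n0. \<forall>n\<ge>n0. norm_A_smooth A (\<lambda>x. w m x - w n x) < e)})"

definition energy_A :: "(real \<Rightarrow> real) \<Rightarrow> ('a::euclidean_space \<Rightarrow> real) \<Rightarrow> real" where
  "energy_A A u = (\<integral>x. A (norm x) * (norm (wgrad u x))\<^sup>2 \<partial>lebesgue)"

definition energy_V :: "(real \<Rightarrow> real) \<Rightarrow> ('a::euclidean_space \<Rightarrow> real) \<Rightarrow> real" where
  "energy_V V u = (\<integral>x. V (norm x) * (u x)\<^sup>2 \<partial>lebesgue)"

definition X_space ::
    "(real \<Rightarrow> real) \<Rightarrow> (real \<Rightarrow> real) \<Rightarrow> real \<Rightarrow> real \<Rightarrow> ('a::euclidean_space \<Rightarrow> real) set" where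
  "X_space A V a0 ainf =
     {u \<in> D_A A a0 ainf. integrable lebesgue (\<lambda>x. V (norm x) * (u x)\<^sup>2)}"

definition X_norm ::
    "(real \<Rightarrow> real) \<Rightarrow> (real \<Rightarrow> real) \<Rightarrow> ('a::euclidean_space \<Rightarrow> real) \<Rightarrow> real" where
  "X_norm A V u = sqrt (energy_A A u + energy_V V u)"

subsection \<open>The functional and its critical points\<close>

definition primitive :: "(real \<Rightarrow> real) \<Rightarrow> real \<Rightarrow> real" where
  "primitive f t = (LBINT s=ereal 0..ereal t. f s)"

definition I_functional ::
    "(real \<Rightarrow> real) \<Rightarrow> (real \<Rightarrow> real) \<Rightarrow> (real \<Rightarrow> real) \<Rightarrow> (real \<Rightarrow> real) \<Rightarrow>
     ('a::euclidean_space \<Rightarrow> real) \<Rightarrow> real" where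
  "I_functional A V K F u =
     1 / 2 * energy_A A u + 1 / 2 * energy_V V u
       - (\<integral>x. K (norm x) * F (u x) \<partial>lebesgue)"

text \<open>
  Frechet derivative on a vector space \<open>X\<close> of functions with (semi)norm \<open>nrm\<close>; the library notion
  is not applicable since it requires the normed space to be a type.
\<close>
definition has_frechet_derivative_in ::
    "('a \<Rightarrow> real) set \<Rightarrow> (('a \<Rightarrow> real) \<Rightarrow> real) \<Rightarrow> (('a \<Rightarrow> real) \<Rightarrow> real) \<Rightarrow>
     (('a \<Rightarrow> real) \<Rightarrow> real) \<Rightarrow> ('a \<Rightarrow> real) \<Rightarrow> bool" where
  "has_frechet_derivative_in X nrm J L u \<longleftrightarrow>
     (\<forall>v\<in>X. \<forall>w\<in>X. L (\<lambda>x. v x + w x) = L v + L w) \<and>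
     (\<forall>c. \<forall>v\<in>X. L (\<lambda>x. c * v x) = c * L v) \<and>
     (\<exists>C. \<forall>v\<in>X. \<bar>L v\<bar> \<le> C * nrm v) \<and>
     (\<forall>e>0. \<exists>d>0. \<forall>h\<in>X. nrm h < d \<longrightarrow>
        \<bar>J (\<lambda>x. u x + h x) - J u - L h\<bar> \<le> e * nrm h)"

definition critical_point ::
    "('a \<Rightarrow> real) set \<Rightarrow> (('a \<Rightarrow> real) \<Rightarrow> real) \<Rightarrow> (('a \<Rightarrow> real) \<Rightarrow> real) \<Rightarrow>
     ('a \<Rightarrow> real) \<Rightarrow> bool" where
  "critical_point X nrm J u \<longleftrightarrow> u \<in> X \<and> has_frechet_derivative_in X nrm J (\<lambda>_. 0) u"

end

(*
  Weighted radial estimates bound u in D_A pointwise by the energy norm times an explicit power of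
  |x|, and show that u is Hoelder continuous in |x| away from the origin. Interpolating
  K <= C |x|^alpha V^beta between the V-term of the norm and this decay bounds K |u|^q by
  epsilon V u^2 plus a fixed integrable function on bounded sets of X. Since bounded sequences
  converge pointwise along a subsequence (Arzela-Ascoli), the nonlinear term is of class C^1 with
  compact derivative. The mountain pass theorem, proved by discrete steepest descent, then gives a
  nontrivial critical point for the nonlinearity f(max(t,0)); testing with psi(u), where psi is
  smooth, nondecreasing, negative on the negative half-line and 0 elsewhere, shows u >= 0, so u is
  also critical for f. Weak gradients are handled through limits H of A^(1/2) grad w_n with w_n
  smooth and radial: u is in D_A iff such a limit exists, and H determines the weak gradient.
*)
theory Submission
  imports Defs "HOL-Library.Function_Algebras" "HOL-Complex_Analysis.Great_Picard"
begin

subsection \<open>A mountain pass theorem\<close>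

text \<open>The points of \<open>X\<close> are functions rather than classes, so the abstract part
  works on a carrier set with a semi-inner product, in which a nonzero vector may have norm 0. The
  nonlinearity is only continuous: the gradient of the functional is merely uniformly continuous on
  bounded sets and its flow need not be defined, which is why the descent is discrete. Weak
  convergence is avoided: compactness says that \<open>D\<close> is Cauchy in the dual norm along a
  subsequence, and together with small gradients this makes a Palais-Smale sequence itself Cauchy.
  On bounded sets V u^2 is controlled only in L1, so no fixed integrable majorant of K |u|^q
  results; hence the epsilon in the domination and a matching variant of dominated convergence. The
  strict inequalities on q1 and q2 supply that epsilon, as a positive power of |x| near 0 and a
  negative one near infinity. Differentiability, uniform continuity and compactness of the nonlinear
  term all reduce to \<open>vanishing\<close>: sequences violating the claim are thinned until they
  converge a.e., while the test functions need only be bounded in norm.\<close>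

locale semi_hilbert =
  fixes X :: "'v::real_vector set" and ip :: "'v \<Rightarrow> 'v \<Rightarrow> real"
  assumes subspace_X: "subspace X"
    and ip_sym: "u \<in> X \<Longrightarrow> v \<in> X \<Longrightarrow> ip u v = ip v u"
    and ip_add: "u \<in> X \<Longrightarrow> v \<in> X \<Longrightarrow> w \<in> X \<Longrightarrow> ip (u + v) w = ip u w + ip v w"
    and ip_scale: "u \<in> X \<Longrightarrow> w \<in> X \<Longrightarrow> ip (c *\<^sub>R u) w = c * ip u w"
    and ip_nonneg: "u \<in> X \<Longrightarrow> 0 \<le> ip u u"
    and complete: "(\<And>n. s n \<in> X) \<Longrightarrow>
      (\<And>e. e > 0 \<Longrightarrow> \<exists>N. \<forall>m\<ge>N. \<forall>n\<ge>N. sqrt (ip (s m - s n) (s m - s n)) < e) \<Longrightarrow>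
      \<exists>l\<in>X. (\<lambda>n::nat. sqrt (ip (s n - l) (s n - l))) \<longlonglongrightarrow> 0"
begin

definition nrm :: "'v \<Rightarrow> real" where "nrm u = sqrt (ip u u)"

lemma X_add [simp]: "u \<in> X \<Longrightarrow> v \<in> X \<Longrightarrow> u + v \<in> X"
  and X_scale [simp]: "u \<in> X \<Longrightarrow> c *\<^sub>R u \<in> X"
  and X_diff [simp]: "u \<in> X \<Longrightarrow> v \<in> X \<Longrightarrow> u - v \<in> X"
  and X_0 [simp]: "0 \<in> X"
  using subspace_X by (auto simp: subspace_add subspace_scale subspace_diff subspace_0)

lemma ip_diff: "u \<in> X \<Longrightarrow> v \<in> X \<Longrightarrow> w \<in> X \<Longrightarrow> ip (u - v) w = ip u w - ip v w"
  using ip_add[of u "- 1 *\<^sub>R v" w] ip_scale[of v w "-1"] X_scale[of v "-1"] by simp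

lemma ip_add2: "u \<in> X \<Longrightarrow> v \<in> X \<Longrightarrow> w \<in> X \<Longrightarrow> ip w (u + v) = ip w u + ip w v"
  and ip_scale2: "u \<in> X \<Longrightarrow> w \<in> X \<Longrightarrow> ip w (c *\<^sub>R u) = c * ip w u"
  and ip_diff2: "u \<in> X \<Longrightarrow> v \<in> X \<Longrightarrow> w \<in> X \<Longrightarrow> ip w (u - v) = ip w u - ip w v"
  by (simp_all add: ip_sym[of w] ip_add ip_scale ip_diff)

lemma nrm_nonneg [simp]: "u \<in> X \<Longrightarrow> 0 \<le> nrm u"
  by (simp add: nrm_def ip_nonneg)

lemma nrm_sq: "u \<in> X \<Longrightarrow> (nrm u)\<^sup>2 = ip u u"
  by (simp add: nrm_def ip_nonneg)

lemma nrm_scale: "u \<in> X \<Longrightarrow> nrm (c *\<^sub>R u) = \<bar>c\<bar> * nrm u"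
  by (simp add: nrm_def ip_scale ip_scale2 real_sqrt_mult flip: mult.assoc power2_eq_square)

lemma nrm_0 [simp]: "nrm 0 = 0"
  using nrm_scale[of 0 0] by simp

lemma nrm_add_sq:
  assumes "u \<in> X" "v \<in> X"
  shows "(nrm (u + v))\<^sup>2 = (nrm u)\<^sup>2 + 2 * ip u v + (nrm v)\<^sup>2"
  using assms by (simp add: nrm_sq ip_add ip_add2 ip_sym[of v u])

lemma cauchy_schwarz:
  assumes u: "u \<in> X" and v: "v \<in> X"
  shows "\<bar>ip u v\<bar> \<le> nrm u * nrm v"
proof -
  have *: "0 \<le> ip u u + 2 * t * ip u v + t\<^sup>2 * ip v v" for t
  proof -
    have "(nrm (u + t *\<^sub>R v))\<^sup>2 = ip u u + 2 * t * ip u v + t\<^sup>2 * ip v v"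
      using u v nrm_add_sq[of u "t *\<^sub>R v"] by (simp add: nrm_scale power_mult_distrib nrm_sq ip_scale2)
    then show ?thesis by (metis zero_le_power2)
  qed
  have "(ip u v)\<^sup>2 \<le> ip u u * ip v v"
  proof (cases "ip v v = 0")
    case True
    have "ip u v = 0"
    proof (rule ccontr)
      assume "ip u v \<noteq> 0"
      \<comment> \<open>With \<open>ip v v = 0\<close> the quadratic in \<open>t\<close> is affine;
        at this \<open>t\<close> it would equal -1.\<close>
      then show False using *[of "- (ip u u + 1) / (2 * ip u v)"] True by (simp add: field_simps)
    qed
    then show ?thesis using True by simp
  next
    case False
    then have "ip v v > 0" using ip_nonneg[OF v] by simp
    then show ?thesis using *[of "- ip u v / ip v v"]
      by (simp add: field_simps power2_eq_square)
  qed
  then have "sqrt ((ip u v)\<^sup>2) \<le> sqrt (ip u u * ip v v)"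
    by (rule real_sqrt_le_mono)
  then show ?thesis by (simp add: nrm_def real_sqrt_mult)
qed

lemma nrm_triangle:
  assumes u: "u \<in> X" and v: "v \<in> X"
  shows "nrm (u + v) \<le> nrm u + nrm v"
proof (rule power2_le_imp_le)
  show "(nrm (u + v))\<^sup>2 \<le> (nrm u + nrm v)\<^sup>2"
    using cauchy_schwarz[OF u v] by (simp add: nrm_add_sq[OF u v] power2_sum)
qed (use u v in simp)

lemma nrm_minus_commute: "u \<in> X \<Longrightarrow> v \<in> X \<Longrightarrow> nrm (u - v) = nrm (v - u)"
  using nrm_scale[of "v - u" "-1"] by simp

lemma nrm_triangle_sub: "u \<in> X \<Longrightarrow> v \<in> X \<Longrightarrow> nrm u \<le> nrm v + nrm (u - v)"
  using nrm_triangle[of v "u - v"] by simp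

lemma nrm_diff_abs: "u \<in> X \<Longrightarrow> v \<in> X \<Longrightarrow> \<bar>nrm u - nrm v\<bar> \<le> nrm (u - v)"
  using nrm_triangle_sub[of u v] nrm_triangle_sub[of v u] by (simp add: nrm_minus_commute[of u v] abs_if)

lemma nrm_diff_triangle: "u \<in> X \<Longrightarrow> v \<in> X \<Longrightarrow> w \<in> X \<Longrightarrow> nrm (u - w) \<le> nrm (u - v) + nrm (v - w)"
  using nrm_triangle[of "u - v" "v - w"] by simp

lemma complete':
  assumes "\<And>n. s n \<in> X" "\<And>e. e > 0 \<Longrightarrow> \<exists>N. \<forall>m\<ge>N. \<forall>n\<ge>N. nrm (s m - s n) < e"
  obtains l where "l \<in> X" "(\<lambda>n::nat. nrm (s n - l)) \<longlonglongrightarrow> 0"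
  using complete[of s] assms unfolding nrm_def by blast

lemma ip_tendsto:
  assumes "\<And>n. s n \<in> X" "l \<in> X" "(\<lambda>n::nat. nrm (s n - l)) \<longlonglongrightarrow> 0" "w \<in> X"
  shows "(\<lambda>n. ip (s n) w) \<longlonglongrightarrow> ip l w"
proof (rule LIMSEQ_I)
  fix e :: real assume "e > 0"
  have "(\<lambda>n. nrm (s n - l) * nrm w) \<longlonglongrightarrow> 0"
    using tendsto_mult_left_zero[OF assms(3)] .
  then obtain N where N: "\<And>n. n \<ge> N \<Longrightarrow> norm (nrm (s n - l) * nrm w - 0) < e"
    using LIMSEQ_D[OF _ \<open>e > 0\<close>] by metis
  have "norm (ip (s n) w - ip l w) < e" if "n \<ge> N" for n
  proof -
    have "\<bar>ip (s n) w - ip l w\<bar> \<le> nrm (s n - l) * nrm w"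
      using cauchy_schwarz[of "s n - l" w] assms by (simp add: ip_diff)
    then show ?thesis using N[OF that] by simp
  qed
  then show "\<exists>no. \<forall>n\<ge>no. norm (ip (s n) w - ip l w) < e" by blast
qed

text \<open>An approximate minimiser \<open>v\<close> of \<open>\<parallel>v\<parallel>\<^sup>2 / 2 - lf v\<close> nearly represents \<open>lf\<close>, which makes
  every minimising sequence Cauchy.\<close>
theorem riesz_representation:
  assumes add: "\<And>u v. u \<in> X \<Longrightarrow> v \<in> X \<Longrightarrow> lf (u + v) = lf u + lf v"
    and scale: "\<And>c u. u \<in> X \<Longrightarrow> lf (c *\<^sub>R u) = c * lf u"
    and bound: "\<And>u. u \<in> X \<Longrightarrow> \<bar>lf u\<bar> \<le> C * nrm u"
  shows "\<exists>g\<in>X. \<forall>v\<in>X. ip g v = lf v"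
proof -
  define Q where "Q v = (nrm v)\<^sup>2 / 2 - lf v" for v
  define m where "m = Inf (Q ` X)"
  have "- C\<^sup>2 / 2 \<le> Q v" if "v \<in> X" for v
  proof -
    have "0 \<le> (nrm v - C)\<^sup>2" by simp
    then have "C * nrm v \<le> (nrm v)\<^sup>2 / 2 + C\<^sup>2 / 2" by (simp add: power2_eq_square algebra_simps)
    then show ?thesis using bound[OF that] by (auto simp: Q_def)
  qed
  then have bdd: "bdd_below (Q ` X)" by (auto intro!: bdd_belowI)
  have le: "m \<le> Q v" if "v \<in> X" for v
    unfolding m_def using bdd that by (auto intro: cInf_lower)
  have "\<exists>v\<in>X. Q v < m + e" if "e > 0" for e
    using cInf_lessD[of "Q ` X" "m + e"] that X_0 unfolding m_def by fastforce
  \<comment> \<open>The tolerance is 1 / (2 (n+1)^2) because minimising the quadratic in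
    \<open>key\<close> over \<open>t\<close> turns a tolerance d into an error of sqrt (2 d) times
    \<open>nrm w\<close>, which here is \<open>nrm w / real (Suc n)\<close>.\<close>
  then have "\<forall>n. \<exists>v\<in>X. Q v < m + 1 / (2 * real (Suc n)^2)" by simp
  then obtain s where s: "\<And>n. s n \<in> X" "\<And>n. Q (s n) < m + 1 / (2 * real (Suc n)^2)"
    by metis
  have key: "\<bar>ip (s n) w - lf w\<bar> \<le> nrm w / real (Suc n)" if w: "w \<in> X" for n w
  proof -
    define a where "a = ip (s n) w - lf w"
    have *: "0 < 1 / (2 * real (Suc n)^2) + t * a + t\<^sup>2 * (nrm w)\<^sup>2 / 2" for t
    proof -
      have "m \<le> Q (s n + t *\<^sub>R w)" using s w by (intro le) simp
      also have "Q (s n + t *\<^sub>R w) = Q (s n) + t * a + t\<^sup>2 * (nrm w)\<^sup>2 / 2"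
        using s w by (simp add: Q_def nrm_add_sq add scale nrm_scale ip_scale2 a_def power_mult_distrib field_simps)
      finally show ?thesis using s(2)[of n] by linarith
    qed
    show ?thesis
    proof (cases "nrm w = 0")
      case True
      then show ?thesis using bound[OF w] cauchy_schwarz[OF s(1) w, of n] by simp
    next
      case False
      then have p: "nrm w > 0" using nrm_nonneg[OF w] by linarith
      have "a\<^sup>2 \<le> (nrm w / real (Suc n))\<^sup>2"
      proof -
        have "- a / (nrm w)\<^sup>2 * a + (- a / (nrm w)\<^sup>2)\<^sup>2 * (nrm w)\<^sup>2 / 2 = - (a\<^sup>2 / (nrm w)\<^sup>2) / 2"
          using p by (simp add: field_simps power2_eq_square)
        then have "a\<^sup>2 / (nrm w)\<^sup>2 < 1 / real (Suc n)^2" using *[of "- a / (nrm w)\<^sup>2"] by simp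
        then have "a\<^sup>2 < (1 / real (Suc n)^2) * (nrm w)\<^sup>2" using p by (simp only: pos_divide_less_eq zero_less_power)
        then show ?thesis by (simp add: power_divide)
      qed
      then have "\<bar>a\<bar> \<le> \<bar>nrm w / real (Suc n)\<bar>" by (simp only: abs_le_square_iff)
      then show ?thesis using p by (simp add: a_def)
    qed
  qed
  \<comment> \<open>Testing \<open>key\<close> for both indices with the difference itself cancels
    \<open>lf\<close>.\<close>
  have diff: "nrm (s n - s k) \<le> 1 / real (Suc n) + 1 / real (Suc k)" for n k
  proof -
    let ?w = "s n - s k"
    have w: "?w \<in> X" using s by simp
    have "(nrm ?w)\<^sup>2 = (ip (s n) ?w - lf ?w) - (ip (s k) ?w - lf ?w)"
      using s by (simp add: nrm_sq ip_diff)
    also have "\<dots> \<le> nrm ?w / real (Suc n) + nrm ?w / real (Suc k)"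
      using key[OF w, of n] key[OF w, of k] by linarith
    finally have "nrm ?w * nrm ?w \<le> nrm ?w * (1 / real (Suc n) + 1 / real (Suc k))"
      by (simp add: power2_eq_square algebra_simps)
    moreover have "0 \<le> 1 / real (Suc n) + 1 / real (Suc k)" by simp
    ultimately show ?thesis using nrm_nonneg[OF w]
      by (metis mult_le_cancel_left_pos order_le_less)
  qed
  have "\<exists>N. \<forall>m\<ge>N. \<forall>n\<ge>N. nrm (s m - s n) < e" if "e > 0" for e
  proof -
    obtain N where N: "1 / real (Suc N) < e / 2" using nat_approx_posE[of "e/2"] \<open>e > 0\<close> by auto
    have "nrm (s m - s n) < e" if "m \<ge> N" "n \<ge> N" for m n
    proof -
      have "1 / real (Suc m) \<le> 1 / real (Suc N)" "1 / real (Suc n) \<le> 1 / real (Suc N)"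
        using that by (auto intro!: divide_left_mono)
      then show ?thesis using diff[of m n] N by linarith
    qed
    then show ?thesis by blast
  qed
  then obtain g where g: "g \<in> X" "(\<lambda>n. nrm (s n - g)) \<longlonglongrightarrow> 0"
    using complete'[of s] s(1) by blast
  have "ip g v = lf v" if v: "v \<in> X" for v
  proof -
    have "(\<lambda>n. nrm v / real (Suc n)) \<longlonglongrightarrow> 0"
      by (rule LIMSEQ_Suc[OF lim_const_over_n])
    then have "(\<lambda>n. ip (s n) v - lf v) \<longlonglongrightarrow> 0"
      by (rule Lim_null_comparison[rotated]) (use key[OF v] in auto)
    then have "(\<lambda>n. ip (s n) v) \<longlonglongrightarrow> lf v" by (simp add: LIM_zero_iff)
    then show ?thesis using ip_tendsto[OF s(1) g v] LIMSEQ_unique by blast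
  qed
  then show ?thesis using g by blast
qed

end

text \<open>The functional is half the squared norm minus \<open>\<Phi>\<close>, and
  \<open>D u\<close> is the derivative of \<open>\<Phi>\<close> at \<open>u\<close>.
  Differentiability and continuity are required uniformly on bounded sets, so that one step length
  serves all iterates of the descent. \<open>compact\<close> asks for a subsequence along which the
  derivatives are Cauchy as functionals, and \<open>AR\<close> is the Ambrosetti-Rabinowitz
  condition, which bounds almost critical sequences.\<close>

locale mountain_pass = semi_hilbert +
  fixes \<Phi> :: "'a \<Rightarrow> real" and D :: "'a \<Rightarrow> 'a \<Rightarrow> real" and \<theta> q C0 :: real
  assumes D_add: "u \<in> X \<Longrightarrow> v \<in> X \<Longrightarrow> w \<in> X \<Longrightarrow> D u (v + w) = D u v + D u w"
    and D_scale: "u \<in> X \<Longrightarrow> v \<in> X \<Longrightarrow> D u (c *\<^sub>R v) = c * D u v"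
    and D_bounded: "u \<in> X \<Longrightarrow> \<exists>C. \<forall>v\<in>X. \<bar>D u v\<bar> \<le> C * sqrt (ip v v)"
    and D_0: "v \<in> X \<Longrightarrow> D 0 v = 0"
    and frechet: "e > 0 \<Longrightarrow> \<exists>d>0. \<forall>u\<in>X. \<forall>h\<in>X. sqrt (ip u u) \<le> B \<longrightarrow> sqrt (ip h h) < d \<longrightarrow>
        \<bar>\<Phi> (u + h) - \<Phi> u - D u h\<bar> \<le> e * sqrt (ip h h)"
    and unif_cont: "e > 0 \<Longrightarrow> \<exists>d>0. \<forall>u\<in>X. \<forall>w\<in>X. \<forall>v\<in>X. sqrt (ip u u) \<le> B \<longrightarrow> sqrt (ip w w) \<le> B \<longrightarrow>
        sqrt (ip (u - w) (u - w)) < d \<longrightarrow> \<bar>D u v - D w v\<bar> \<le> e * sqrt (ip v v)"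
    and compact: "(\<And>n. s n \<in> X) \<Longrightarrow> (\<And>n. sqrt (ip (s n) (s n)) \<le> B) \<Longrightarrow>
        \<exists>r::nat\<Rightarrow>nat. strict_mono r \<and> (\<forall>e>0. \<exists>N. \<forall>m\<ge>N. \<forall>n\<ge>N. \<forall>v\<in>X.
          \<bar>D (s (r m)) v - D (s (r n)) v\<bar> \<le> e * sqrt (ip v v))"
    and theta: "\<theta> > 2"
    and AR: "u \<in> X \<Longrightarrow> 0 \<le> \<Phi> u" "u \<in> X \<Longrightarrow> \<theta> * \<Phi> u \<le> D u u"
    and superquadratic: "q > 2" "C0 > 0" "u \<in> X \<Longrightarrow> sqrt (ip u u) \<le> 1 \<Longrightarrow> \<Phi> u \<le> C0 * sqrt (ip u u) powr q"
    and negative: "\<exists>e\<in>X. ip e e / 2 < \<Phi> e"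
begin

definition J where "J u = (nrm u)\<^sup>2 / 2 - \<Phi> u"

lemma ex_gradient: "u \<in> X \<Longrightarrow> \<exists>g\<in>X. \<forall>v\<in>X. ip g v = ip u v - D u v"
proof -
  assume u: "u \<in> X"
  obtain C where C: "\<And>v. v \<in> X \<Longrightarrow> \<bar>D u v\<bar> \<le> C * nrm v" using D_bounded[OF u] unfolding nrm_def by blast
  have "\<bar>ip u v - D u v\<bar> \<le> (nrm u + C) * nrm v" if "v \<in> X" for v
    using C[OF that] cauchy_schwarz[OF u that] by (simp add: algebra_simps)
  then show ?thesis
    using u by (intro riesz_representation[where C="nrm u + C"]) (auto simp: D_add D_scale ip_add2 ip_scale2 algebra_simps)
qed

text \<open>A gradient of \<open>J\<close>. The Riesz vector is determined only up to norm 0, so one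
  is chosen.\<close>

definition g where "g u = (SOME g. g \<in> X \<and> (\<forall>v\<in>X. ip g v = ip u v - D u v))"

lemma g_X [simp]: "u \<in> X \<Longrightarrow> g u \<in> X"
  and g_ip: "u \<in> X \<Longrightarrow> v \<in> X \<Longrightarrow> ip (g u) v = ip u v - D u v"
  using someI_ex[of "\<lambda>g. g \<in> X \<and> (\<forall>v\<in>X. ip g v = ip u v - D u v)"] ex_gradient[of u]
  unfolding g_def by blast+

text \<open>The origin is critical, so the descent fixes it and the moved path still starts
  there.\<close>

lemma g_zero: "nrm (g 0) = 0"
  using nrm_sq[of "g 0"] g_ip[of 0 "g 0"] ip_scale[of 0 "g 0" 0] by (simp add: D_0)

lemma g_unif_cont:
  assumes "e > 0"
  shows "\<exists>d>0. \<forall>u\<in>X. \<forall>w\<in>X. nrm u \<le> B \<longrightarrow> nrm w \<le> B \<longrightarrow> nrm (u - w) < d \<longrightarrow> nrm (g u - g w) \<le> e"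
proof -
  obtain d where d: "d > 0" "\<And>u w v. u\<in>X \<Longrightarrow> w\<in>X \<Longrightarrow> v\<in>X \<Longrightarrow> nrm u \<le> B \<Longrightarrow> nrm w \<le> B \<Longrightarrow>
        nrm (u - w) < d \<Longrightarrow> \<bar>D u v - D w v\<bar> \<le> e/2 * nrm v"
    using unif_cont[of "e/2" B] assms unfolding nrm_def by (auto simp del: times_divide_eq_left)
  have "nrm (g u - g w) \<le> e" if *: "u \<in> X" "w \<in> X" "nrm u \<le> B" "nrm w \<le> B" "nrm (u - w) < min d (e/2)" for u w
  proof -
    let ?v = "g u - g w"
    have v: "?v \<in> X" using * by simp
    have "(nrm ?v)\<^sup>2 = ip (u - w) ?v - (D u ?v - D w ?v)"
      using * by (simp add: nrm_sq ip_diff g_ip)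
    also have "\<dots> \<le> nrm (u - w) * nrm ?v + e/2 * nrm ?v"
    proof -
      have "\<bar>ip (u - w) ?v\<bar> \<le> nrm (u - w) * nrm ?v" using * v by (intro cauchy_schwarz) auto
      moreover have "\<bar>D u ?v - D w ?v\<bar> \<le> e/2 * nrm ?v" using * v by (intro d(2)) auto
      ultimately show ?thesis by (simp add: abs_le_iff del: times_divide_eq_left)
    qed
    also have "\<dots> \<le> e/2 * nrm ?v + e/2 * nrm ?v"
      using * nrm_nonneg[OF v] by (intro add_mono mult_right_mono) auto
    finally have "nrm ?v * nrm ?v \<le> nrm ?v * e" by (simp add: power2_eq_square algebra_simps)
    then show ?thesis using nrm_nonneg[OF v] assms by (metis mult_le_cancel_left_pos order_le_less)
  qed
  then show ?thesis using d(1) assms by (intro exI[of _ "min d (e/2)"]) auto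
qed

lemma J_frechet:
  assumes "e > 0"
  shows "\<exists>d>0. \<forall>u\<in>X. \<forall>h\<in>X. nrm u \<le> B \<longrightarrow> nrm h < d \<longrightarrow> \<bar>J (u + h) - J u - ip (g u) h\<bar> \<le> e * nrm h"
proof -
  obtain d where d: "d > 0" "\<And>u h. u\<in>X \<Longrightarrow> h\<in>X \<Longrightarrow> nrm u \<le> B \<Longrightarrow> nrm h < d \<Longrightarrow>
        \<bar>\<Phi> (u + h) - \<Phi> u - D u h\<bar> \<le> e/2 * nrm h"
    using frechet[of "e/2" B] assms unfolding nrm_def by (auto simp del: times_divide_eq_left)
  have "\<bar>J (u + h) - J u - ip (g u) h\<bar> \<le> e * nrm h" if *: "u \<in> X" "h \<in> X" "nrm u \<le> B" "nrm h < min d e" for u h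
  proof -
    have "J (u + h) - J u - ip (g u) h = (nrm h)\<^sup>2 / 2 - (\<Phi> (u + h) - \<Phi> u - D u h)"
      using * by (simp add: J_def nrm_add_sq g_ip add_divide_distrib)
    moreover have "(nrm h)\<^sup>2 / 2 \<le> e/2 * nrm h"
      using * mult_right_mono[of "nrm h" e "nrm h"] by (simp add: power2_eq_square)
    moreover have "0 \<le> (nrm h)\<^sup>2 / 2" by simp
    moreover have "\<bar>\<Phi> (u + h) - \<Phi> u - D u h\<bar> \<le> e/2 * nrm h" using * by (intro d(2)) auto
    moreover have "e/2 * nrm h + e/2 * nrm h = e * nrm h" by simp
    ultimately show ?thesis by (simp only: abs_le_iff) linarith
  qed
  then show ?thesis using d(1) assms by (intro exI[of _ "min d e"]) auto
qed

lemma sphere: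
  obtains \<rho> \<alpha> where "\<rho> > 0" "\<alpha> > 0" "\<And>u. u \<in> X \<Longrightarrow> nrm u \<le> \<rho> \<Longrightarrow> 0 \<le> J u" "\<And>u. u \<in> X \<Longrightarrow> nrm u = \<rho> \<Longrightarrow> \<alpha> \<le> J u"
proof -
  \<comment> \<open>Up to this radius \<open>C0\<close> times the power q - 2 of the norm is at most
    1/4, so \<open>\<Phi>\<close> takes at most half of the quadratic term; the cap at 1 is the
    range of \<open>superquadratic\<close>.\<close>
  define \<rho> where "\<rho> = min 1 ((1 / (4 * C0)) powr (1 / (q - 2)))"
  have \<rho>: "\<rho> > 0" "\<rho> \<le> 1" using superquadratic by (auto simp: \<rho>_def)
  have J: "(nrm u)\<^sup>2 / 4 \<le> J u" if u: "u \<in> X" "nrm u \<le> \<rho>" for u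
  proof (cases "nrm u = 0")
    case True
    then have "\<Phi> u \<le> 0" using superquadratic(3)[of u] u \<rho> by (simp add: nrm_def)
    then show ?thesis using True by (simp add: J_def)
  next
    case False
    then have p: "nrm u > 0" using nrm_nonneg[OF u(1)] by linarith
    have "nrm u powr (q - 2) \<le> ((1 / (4 * C0)) powr (1 / (q - 2))) powr (q - 2)"
      using u p superquadratic by (intro powr_mono2) (auto simp: \<rho>_def)
    also have "\<dots> = 1 / (4 * C0)" using superquadratic by (simp add: powr_powr)
    finally have *: "C0 * nrm u powr (q - 2) \<le> 1 / 4" using superquadratic by (simp add: field_simps)
    have "nrm u powr q = nrm u powr (q - 2) * (nrm u)\<^sup>2"
      using p by (simp add: powr_diff)
    then have "\<Phi> u \<le> (C0 * nrm u powr (q - 2)) * (nrm u)\<^sup>2"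
    proof -
      have "\<Phi> u \<le> C0 * nrm u powr q" using superquadratic(3)[of u] u \<rho> by (simp only: nrm_def)
      then show ?thesis using \<open>nrm u powr q = _\<close> by (simp add: mult.assoc)
    qed
    also have "\<dots> \<le> 1/4 * (nrm u)\<^sup>2" using * by (intro mult_right_mono) auto
    finally show ?thesis by (simp add: J_def)
  qed
  show ?thesis
  proof (rule that[of \<rho> "\<rho>\<^sup>2 / 4"])
    show "0 \<le> J u" if "u \<in> X" "nrm u \<le> \<rho>" for u using J[OF that] by (smt (verit) zero_le_power2 divide_nonneg_pos)
  qed (use \<rho> J in auto)
qed

lemma g_tendsto:
  assumes "\<And>n. s n \<in> X" "u \<in> X" "(\<lambda>n::nat. nrm (s n - u)) \<longlonglongrightarrow> 0"
  shows "(\<lambda>n. nrm (g (s n) - g u)) \<longlonglongrightarrow> 0"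
proof (rule LIMSEQ_I)
  fix e :: real assume e: "e > 0"
  obtain d where d: "d > 0" "\<And>v w. v\<in>X \<Longrightarrow> w\<in>X \<Longrightarrow> nrm v \<le> nrm u + 1 \<Longrightarrow> nrm w \<le> nrm u + 1 \<Longrightarrow> nrm (v - w) < d \<Longrightarrow> nrm (g v - g w) \<le> e/2"
    using g_unif_cont[of "e/2" "nrm u + 1"] e by auto
  obtain N where N: "\<And>n. n \<ge> N \<Longrightarrow> norm (nrm (s n - u) - 0) < min d 1"
    using LIMSEQ_D[OF assms(3), of "min d 1"] d by auto
  have "norm (nrm (g (s n) - g u) - 0) < e" if "n \<ge> N" for n
  proof -
    have "nrm (s n) \<le> nrm u + 1" using nrm_triangle_sub[of "s n" u] assms N[OF that] by simp
    then have "nrm (g (s n) - g u) \<le> e/2" using N[OF that] assms by (intro d(2)) auto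
    then show ?thesis using assms e by simp
  qed
  then show "\<exists>no. \<forall>n\<ge>no. norm (nrm (g (s n) - g u) - 0) < e" by blast
qed

text \<open>Discrete steepest descent moves every point of the segment from \<open>0\<close> to \<open>e\<close>. The moved
  segments always cross the sphere of radius \<open>\<rho>\<close>, where \<open>J \<ge> \<alpha>\<close>; were the gradient bounded
  below on \<open>\<alpha> \<le> J \<le> \<parallel>e\<parallel>\<^sup>2 / 2\<close>, the trajectory hitting the sphere would lose too much energy.\<close>
lemma ex_almost_critical:
  assumes \<rho>: "\<rho> > 0" "\<alpha> > 0" "\<And>u. u \<in> X \<Longrightarrow> nrm u \<le> \<rho> \<Longrightarrow> 0 \<le> J u" "\<And>u. u \<in> X \<Longrightarrow> nrm u = \<rho> \<Longrightarrow> \<alpha> \<le> J u"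
    and e: "e \<in> X" "J e < 0" and \<delta>: "\<delta> > 0"
  shows "\<exists>u\<in>X. \<alpha> \<le> J u \<and> J u \<le> (nrm e)\<^sup>2 / 2 \<and> nrm (g u) \<le> \<delta>"
proof (rule ccontr)
  assume "\<not> ?thesis"
  then have neg: "\<delta> < nrm (g u)" if "u \<in> X" "\<alpha> \<le> J u" "J u \<le> (nrm e)\<^sup>2 / 2" for u
    using that by force
  \<comment> \<open>Since \<open>\<Phi>\<close> is nonnegative, \<open>C\<close> bounds
    \<open>J\<close> on the whole segment from 0 to \<open>e\<close>.\<close>
  define C where "C = (nrm e)\<^sup>2 / 2"
  \<comment> \<open>Contains every iterate of a point of the segment: \<open>k\<close> steps of
    length at most \<open>s\<close> move it by at most \<open>2 * C / \<delta> + 2\<close>.\<close>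
  define R where "R = nrm e + 2 * C / \<delta> + 2"
  obtain d where d: "d > 0" "\<And>u h. u \<in> X \<Longrightarrow> h \<in> X \<Longrightarrow> nrm u \<le> R \<Longrightarrow> nrm h < d \<Longrightarrow> \<bar>J (u + h) - J u - ip (g u) h\<bar> \<le> \<delta>/2 * nrm h"
    using J_frechet[of "\<delta>/2" R] \<delta> by (auto simp del: times_divide_eq_left)
  define s where "s = min 1 d / 2"
  have s: "0 < s" "s < d" "s \<le> 1" using d by (auto simp: s_def)
  \<comment> \<open>A continuous version of 1/r: it vanishes for r at most
    \<open>\<delta> / 2\<close> and equals 1/r from \<open>\<delta>\<close> on. Thus
    \<open>\<eta>\<close> moves by exactly \<open>s\<close> against the normalised gradient where
    the gradient is large, and stays continuous where it is small. The maximum keeps the denominator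
    positive.\<close>
  define \<psi> where "\<psi> r = min 1 (max 0 (2 * r / \<delta> - 1)) / max r (\<delta> / 2)" for r
  define \<eta> where "\<eta> u = u - (s * \<psi> (nrm (g u))) *\<^sub>R g u" for u
  have \<psi>_nonneg: "0 \<le> \<psi> r" for r using \<delta> by (auto simp: \<psi>_def intro!: divide_nonneg_pos)
  have \<psi>_small: "\<psi> r = 0" if "r \<le> \<delta>/2" for r using \<delta> that by (auto simp: \<psi>_def field_simps max_def)
  have \<psi>_le: "\<psi> r * r \<le> 1" if "0 \<le> r" for r
  proof (cases "r \<le> \<delta>/2")
    case False
    then show ?thesis using \<delta> by (simp add: \<psi>_def max_def field_simps min_def)
  qed (simp add: \<psi>_small)
  have \<psi>_large: "\<psi> r * r = 1" if "\<delta> \<le> r" for r using \<delta> that by (simp add: \<psi>_def field_simps max_def)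
  have \<psi>_bound: "\<psi> r \<le> 2 / \<delta>" for r
  proof -
    have "\<psi> r \<le> 1 / (\<delta>/2)" unfolding \<psi>_def using \<delta> by (intro frac_le) auto
    then show ?thesis by simp
  qed
  have \<psi>_cont: "isCont \<psi> r" for r
    unfolding \<psi>_def using \<delta> by (intro continuous_intros) auto
  have \<eta>_X [simp]: "\<eta> u \<in> X" if "u \<in> X" for u using that by (simp add: \<eta>_def)
  have pow_X [simp]: "(\<eta> ^^ j) u \<in> X" if "u \<in> X" for u j using that by (induction j) auto
  have \<eta>_0: "\<eta> 0 = 0" using \<delta> by (simp add: \<eta>_def g_zero \<psi>_small)
  have move: "nrm (\<eta> u - u) \<le> s" if u: "u \<in> X" for u
  proof -
    have "nrm (\<eta> u - u) = s * (\<psi> (nrm (g u)) * nrm (g u))"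
      using u nrm_scale[of "g u" "- (s * \<psi> (nrm (g u)))"] s \<psi>_nonneg by (simp add: \<eta>_def)
    then show ?thesis using \<psi>_le[of "nrm (g u)"] s u by simp
  qed
  have pow_move: "nrm ((\<eta> ^^ j) u) \<le> nrm u + real j * s" if u: "u \<in> X" for u j
  proof (induction j)
    case (Suc j)
    have "nrm (\<eta> ((\<eta> ^^ j) u)) \<le> nrm ((\<eta> ^^ j) u) + s"
      using nrm_triangle_sub[of "\<eta> ((\<eta> ^^ j) u)" "(\<eta> ^^ j) u"] move[of "(\<eta> ^^ j) u"] u by simp
    then show ?case using Suc by (simp add: algebra_simps)
  qed simp
  have descent: "J (\<eta> u) \<le> J u \<and> (\<delta> \<le> nrm (g u) \<longrightarrow> J (\<eta> u) \<le> J u - s * \<delta> / 2)" if u: "u \<in> X" "nrm u \<le> R" for u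
  proof -
    define r where "r = nrm (g u)"
    define \<sigma> where "\<sigma> = s * \<psi> r"
    have \<sigma>: "0 \<le> \<sigma>" using s \<psi>_nonneg by (simp add: \<sigma>_def)
    have h: "\<eta> u = u + (- \<sigma>) *\<^sub>R g u" by (simp add: \<eta>_def \<sigma>_def r_def)
    have n: "nrm ((- \<sigma>) *\<^sub>R g u) = \<sigma> * r" using u \<sigma> nrm_scale[of "g u" "- \<sigma>"] by (simp add: r_def)
    have r0: "r \<ge> 0" using u by (simp add: r_def)
    have "\<sigma> * r \<le> s" using \<psi>_le[OF r0] s by (simp add: \<sigma>_def mult.assoc)
    then have "\<bar>J (u + (- \<sigma>) *\<^sub>R g u) - J u - ip (g u) ((- \<sigma>) *\<^sub>R g u)\<bar> \<le> \<delta>/2 * (\<sigma> * r)"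
      using u n s d(2)[of u "(- \<sigma>) *\<^sub>R g u"] X_scale[OF g_X[OF u(1)], of "- \<sigma>"] by simp
    moreover have "ip (g u) ((- \<sigma>) *\<^sub>R g u) = - (\<sigma> * r * r)"
      using u nrm_sq[of "g u"] ip_scale2[of "g u" "g u" "-\<sigma>"] by (simp add: r_def power2_eq_square)
    ultimately have "J (\<eta> u) \<le> J u - \<sigma> * r * r + \<delta>/2 * (\<sigma> * r)" unfolding h by linarith
    then have le: "J (\<eta> u) \<le> J u - (\<sigma> * r) * (r - \<delta>/2)" by (simp add: algebra_simps)
    have "0 \<le> (\<sigma> * r) * (r - \<delta>/2)"
      using \<psi>_small[of r] \<sigma> r0 by (cases "r \<le> \<delta>/2") (auto simp: \<sigma>_def)
    moreover have "s * \<delta> / 2 \<le> (\<sigma> * r) * (r - \<delta>/2)" if "\<delta> \<le> r"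
    proof -
      have "\<sigma> * r = s" using \<psi>_large[OF that] by (simp add: \<sigma>_def mult.assoc)
      then show ?thesis using that s by simp
    qed
    ultimately show ?thesis using le unfolding r_def by linarith
  qed
  \<comment> \<open>Continuity is expressed by sequences, as the semi-norm on \<open>X\<close> is
    not attached to a topology of the type.\<close>
  have \<eta>_cont: "(\<lambda>n. nrm (\<eta> (t n) - \<eta> u)) \<longlonglongrightarrow> 0"
    if t: "\<And>n. t n \<in> X" "u \<in> X" "(\<lambda>n::nat. nrm (t n - u)) \<longlonglongrightarrow> 0" for t u
  proof -
    define p where "p n = \<psi> (nrm (g (t n)))" for n
    define P where "P = \<psi> (nrm (g u))"
    have gt: "(\<lambda>n. nrm (g (t n) - g u)) \<longlonglongrightarrow> 0" by (rule g_tendsto[OF t])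
    have "(\<lambda>n. nrm (g (t n)) - nrm (g u)) \<longlonglongrightarrow> 0"
      by (rule Lim_null_comparison[OF _ gt]) (use t nrm_diff_abs in auto)
    then have "(\<lambda>n. nrm (g (t n))) \<longlonglongrightarrow> nrm (g u)" by (simp add: LIM_zero_iff)
    then have pP: "p \<longlonglongrightarrow> P" unfolding p_def P_def by (rule isCont_tendsto_compose[OF \<psi>_cont])
    have "nrm (\<eta> (t n) - \<eta> u) \<le> nrm (t n - u) + s * (2/\<delta>) * nrm (g (t n) - g u) + s * \<bar>p n - P\<bar> * nrm (g u)" for n
    proof -
      have eq: "\<eta> (t n) - \<eta> u = (t n - u) + ((- (s * p n)) *\<^sub>R (g (t n) - g u) + (- (s * (p n - P))) *\<^sub>R g u)"
        by (simp add: \<eta>_def p_def P_def algebra_simps)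
      have "nrm (\<eta> (t n) - \<eta> u) \<le> nrm (t n - u) + (nrm ((- (s * p n)) *\<^sub>R (g (t n) - g u)) + nrm ((- (s * (p n - P))) *\<^sub>R g u))"
        unfolding eq using t by (intro order_trans[OF nrm_triangle] add_left_mono nrm_triangle X_add X_scale X_diff g_X)
      also have "\<dots> = nrm (t n - u) + (s * p n * nrm (g (t n) - g u) + s * \<bar>p n - P\<bar> * nrm (g u))"
        using t s \<psi>_nonneg by (simp only: nrm_scale X_diff g_X) (simp add: abs_mult p_def)
      also have "\<dots> \<le> nrm (t n - u) + (s * (2/\<delta>) * nrm (g (t n) - g u) + s * \<bar>p n - P\<bar> * nrm (g u))"
        using t s \<psi>_bound by (intro add_mono mult_right_mono mult_left_mono) (auto simp: p_def)
      finally show ?thesis by (simp only: add.assoc)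
    qed
    moreover have "(\<lambda>n. nrm (t n - u) + s * (2/\<delta>) * nrm (g (t n) - g u) + s * \<bar>p n - P\<bar> * nrm (g u)) \<longlonglongrightarrow> 0 + s * (2/\<delta>) * 0 + s * \<bar>P - P\<bar> * nrm (g u)"
      by (intro tendsto_intros t gt pP)
    ultimately show ?thesis using t by (intro Lim_null_comparison[of "\<lambda>n. nrm (\<eta> (t n) - \<eta> u)"]) auto
  qed
  have pow_cont: "(\<lambda>n. nrm ((\<eta> ^^ j) (t n) - (\<eta> ^^ j) u)) \<longlonglongrightarrow> 0"
    if t: "\<And>n. t n \<in> X" "u \<in> X" "(\<lambda>n::nat. nrm (t n - u)) \<longlonglongrightarrow> 0" for t u j
    using t by (induction j) (simp_all add: \<eta>_cont)
  \<comment> \<open>The least number of losses of \<open>s * \<delta> / 2\<close> whose sum exceeds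
    \<open>C\<close>, the height available at the start.\<close>
  define k where "k = nat \<lfloor>2 * C / (s * \<delta>)\<rfloor> + 1"
  have C0: "C \<ge> 0" by (simp add: C_def)
  have nn: "0 \<le> 2 * C / (s * \<delta>)" using C0 s \<delta> by simp
  have k: "real k > 2 * C / (s * \<delta>)" "real k \<le> 2 * C / (s * \<delta>) + 1"
    using nn unfolding k_def by linarith+
  have ks: "real k * s \<le> 2 * C / \<delta> + 2"
  proof -
    have "real k * s \<le> (2 * C / (s * \<delta>) + 1) * s" using k s by (intro mult_right_mono) auto
    also have "\<dots> = 2 * C / \<delta> + s" using s by (simp add: field_simps)
    finally show ?thesis using s by linarith
  qed
  have inR: "nrm ((\<eta> ^^ j) u) \<le> R" if "u \<in> X" "nrm u \<le> nrm e" "j \<le> k" for u j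
  proof -
    have "real j * s \<le> real k * s" using that s by (intro mult_right_mono) auto
    then show ?thesis using pow_move[of u j] that ks by (simp add: R_def)
  qed
  have mono: "J ((\<eta> ^^ k) u) \<le> J ((\<eta> ^^ j) u)" if u: "u \<in> X" "nrm u \<le> nrm e" and "j \<le> k" for u j
    using \<open>j \<le> k\<close>
  proof (induction rule: inc_induct)
    case (step n)
    then show ?case using descent[of "(\<eta> ^^ n) u"] inR[OF u, of n] u by simp
  qed simp
  define h where "h t = nrm ((\<eta> ^^ k) (t *\<^sub>R e))" for t
  have "continuous_on {0..1} h"
  proof (rule continuous_on_sequentiallyI)
    fix t :: "nat \<Rightarrow> real" and a assume a: "t \<longlonglongrightarrow> a"
    have "nrm (t n *\<^sub>R e - a *\<^sub>R e) = \<bar>t n - a\<bar> * nrm e" for n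
      using nrm_scale[OF e(1), of "t n - a"] by (simp add: algebra_simps)
    moreover have "(\<lambda>n. \<bar>t n - a\<bar> * nrm e) \<longlonglongrightarrow> \<bar>a - a\<bar> * nrm e" by (intro tendsto_intros a)
    ultimately have "(\<lambda>n. nrm (t n *\<^sub>R e - a *\<^sub>R e)) \<longlonglongrightarrow> 0" by simp
    then have *: "(\<lambda>n. nrm ((\<eta> ^^ k) (t n *\<^sub>R e) - (\<eta> ^^ k) (a *\<^sub>R e))) \<longlonglongrightarrow> 0"
      using e by (intro pow_cont) auto
    have "(\<lambda>n. h (t n) - h a) \<longlonglongrightarrow> 0"
      by (rule Lim_null_comparison[OF _ *]) (use e nrm_diff_abs in \<open>auto simp: h_def\<close>)
    then show "(\<lambda>n. h (t n)) \<longlonglongrightarrow> h a" by (simp add: LIM_zero_iff)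
  qed
  moreover have "(\<eta> ^^ j) 0 = 0" for j by (induction j) (auto simp: \<eta>_0)
  then have "h 0 \<le> \<rho>" using \<rho> by (simp add: h_def)
  \<comment> \<open>Descent keeps \<open>J\<close> negative at the end \<open>e\<close>, whereas
    \<open>J\<close> is nonnegative on the ball of radius \<open>\<rho>\<close>; so that end stays
    outside the ball.\<close>
  moreover have "\<rho> \<le> h 1"
  proof (rule ccontr)
    assume "\<not> \<rho> \<le> h 1"
    then have "0 \<le> J ((\<eta> ^^ k) e)" using e by (intro \<rho>(3)) (auto simp: h_def)
    then show False using mono[of e 0] e by simp
  qed
  ultimately obtain t where t: "0 \<le> t" "t \<le> 1" "h t = \<rho>" using IVT'[of h 0 \<rho> 1] by auto
  define u where "u = t *\<^sub>R e"
  have u: "u \<in> X" "nrm u \<le> nrm e" using e t by (auto simp: u_def nrm_scale intro: mult_left_le_one_le)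
  have Jk: "\<alpha> \<le> J ((\<eta> ^^ k) u)" using t u by (intro \<rho>(4)) (auto simp: h_def u_def)
  have "J u \<le> C"
  proof -
    have "(nrm u)\<^sup>2 \<le> (nrm e)\<^sup>2" using u by (intro power_mono) auto
    then show ?thesis using AR(1)[OF u(1)] by (simp add: J_def C_def)
  qed
  \<comment> \<open>The last iterate lies on the sphere, so by monotonicity every earlier one has
    \<open>J\<close> at least \<open>\<alpha>\<close>, and the induction keeps \<open>J\<close>
    below \<open>C\<close>. The assumption then makes its gradient larger than
    \<open>\<delta>\<close>, so each step loses the full amount.\<close>
  have "J ((\<eta> ^^ j) u) \<le> C - real j * (s * \<delta> / 2)" if "j \<le> k" for j
    using that
  proof (induction j)
    case 0
    then show ?case using \<open>J u \<le> C\<close> by simp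
  next
    case (Suc j)
    have "0 \<le> real j * (s * \<delta> / 2)" using s \<delta> by simp
    then have "\<delta> \<le> nrm (g ((\<eta> ^^ j) u))"
      using Suc Jk mono[OF u, of j] u neg[of "(\<eta> ^^ j) u"] by (simp add: C_def)
    then have "J ((\<eta> ^^ Suc j) u) \<le> J ((\<eta> ^^ j) u) - s * \<delta> / 2"
      using descent[of "(\<eta> ^^ j) u"] inR[OF u, of j] u Suc by simp
    then show ?case using Suc by (simp add: field_simps)
  qed
  from this[of k] have "J ((\<eta> ^^ k) u) \<le> C - real k * (s * \<delta> / 2)" by simp
  moreover have "C < real k * (s * \<delta> / 2)" using k(1) s \<delta> by (simp add: field_simps)
  ultimately show False using Jk \<rho> by linarith
qed

theorem ex_critical: "\<exists>u\<in>X. nrm u \<noteq> 0 \<and> (\<forall>v\<in>X. ip u v = D u v)"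
proof -
  obtain \<rho> \<alpha> where \<rho>: "\<rho> > 0" "\<alpha> > 0" "\<And>u. u \<in> X \<Longrightarrow> nrm u \<le> \<rho> \<Longrightarrow> 0 \<le> J u" "\<And>u. u \<in> X \<Longrightarrow> nrm u = \<rho> \<Longrightarrow> \<alpha> \<le> J u"
    using sphere by blast
  obtain e where e: "e \<in> X" "ip e e / 2 < \<Phi> e" by (rule bexE[OF negative])
  then have e: "e \<in> X" "J e < 0" by (simp_all add: J_def nrm_sq)
  define C where "C = (nrm e)\<^sup>2 / 2"
  have "\<forall>n. \<exists>u\<in>X. \<alpha> \<le> J u \<and> J u \<le> C \<and> nrm (g u) \<le> 1 / real (Suc n)"
    unfolding C_def by (intro allI ex_almost_critical[OF \<rho> e]) auto
  then obtain u where u: "\<And>n. u n \<in> X" "\<And>n. \<alpha> \<le> J (u n)" "\<And>n. J (u n) \<le> C" "\<And>n. nrm (g (u n)) \<le> 1 / real (Suc n)"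
    by metis
  \<comment> \<open>In \<open>J u - ip (g u) u / \<theta>\<close> the terms in \<open>\<Phi>\<close>
    contribute with a favourable sign by \<open>AR\<close>, and \<open>c\<close> times the squared
    norm remains. This bounds the almost critical sequence by \<open>B\<close>.\<close>
  define c where "c = 1/2 - 1/\<theta>"
  have c: "c > 0" using theta by (simp add: c_def field_simps)
  define B where "B = max 1 ((C + 1) / c)"
  have bounded: "nrm (u n) \<le> B" for n
  proof (cases "nrm (u n) \<le> 1")
    case False
    have "nrm (g (u n)) \<le> 1" using order_trans[OF u(4)[of n]] by (simp add: field_simps)
    then have "nrm (g (u n)) * nrm (u n) \<le> 1 * nrm (u n)" using u(1) by (intro mult_right_mono) auto
    then have "\<bar>ip (g (u n)) (u n)\<bar> \<le> nrm (u n)" using cauchy_schwarz[of "g (u n)" "u n"] u(1)[of n] by simp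
    then have "\<bar>ip (g (u n)) (u n) / \<theta>\<bar> \<le> nrm (u n) / \<theta>" using theta by (simp add: divide_right_mono abs_divide)
    moreover have "nrm (u n) / \<theta> \<le> nrm (u n)" using theta u(1)[of n] False by (simp add: field_simps)
    moreover have "c * (nrm (u n))\<^sup>2 \<le> J (u n) - ip (g (u n)) (u n) / \<theta>"
    proof -
      have "\<Phi> (u n) \<le> D (u n) (u n) / \<theta>" using AR(2)[OF u(1)[of n]] theta by (simp add: field_simps)
      then show ?thesis using u(1)[of n] by (simp add: J_def g_ip nrm_sq c_def diff_divide_distrib left_diff_distrib)
    qed
    ultimately have "c * (nrm (u n))\<^sup>2 \<le> C + nrm (u n)" using u(3)[of n] by linarith
    also have "\<dots> \<le> C * nrm (u n) + nrm (u n)"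
      using False mult_left_mono[of 1 "nrm (u n)" C] by (simp add: C_def)
    finally have "nrm (u n) * (c * nrm (u n)) \<le> nrm (u n) * (C + 1)" by (simp add: power2_eq_square algebra_simps)
    then have "c * nrm (u n) \<le> C + 1" using False by (subst (asm) mult_le_cancel_left_pos) auto
    then show ?thesis using c by (simp add: B_def field_simps le_max_iff_disj)
  qed (simp add: B_def)
  obtain r :: "nat \<Rightarrow> nat" where r: "strict_mono r" "\<And>e. e > 0 \<Longrightarrow> \<exists>N. \<forall>m\<ge>N. \<forall>n\<ge>N. \<forall>v\<in>X. \<bar>D (u (r m)) v - D (u (r n)) v\<bar> \<le> e * nrm v"
    using compact[OF u(1) bounded[unfolded nrm_def]] unfolding nrm_def by force
  define s where "s n = u (r n)" for n
  have s: "s n \<in> X" for n using u by (simp add: s_def)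
  have gs: "nrm (g (s n)) \<le> 1 / real (Suc n)" for n
  proof -
    have "1 / real (Suc (r n)) \<le> 1 / real (Suc n)" using seq_suble[OF r(1), of n] by (auto intro!: divide_left_mono)
    then show ?thesis using u(4)[of "r n"] by (simp add: s_def)
  qed
  \<comment> \<open>A point is its gradient plus the Riesz vector of \<open>D\<close>. The squared
    distance of two points is therefore a sum of two gradient terms and one difference of
    derivatives, each at most a quarter of \<open>e\<close> times the distance.\<close>
  have "\<exists>N. \<forall>m\<ge>N. \<forall>n\<ge>N. nrm (s m - s n) < e" if e: "e > 0" for e
  proof -
    obtain N where N: "\<And>m n v. m \<ge> N \<Longrightarrow> n \<ge> N \<Longrightarrow> v \<in> X \<Longrightarrow> \<bar>D (s m) v - D (s n) v\<bar> \<le> e/4 * nrm v"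
      using r(2)[of "e/4"] e unfolding s_def by (auto simp del: times_divide_eq_left)
    obtain M where M: "1 / real (Suc M) < e/4" using nat_approx_posE[of "e/4"] e by auto
    have "nrm (s m - s n) < e" if mn: "m \<ge> max N M" "n \<ge> max N M" for m n
    proof -
      let ?w = "s m - s n"
      have w: "?w \<in> X" using s by simp
      have "1 / real (Suc m) \<le> 1 / real (Suc M)" "1 / real (Suc n) \<le> 1 / real (Suc M)"
        using mn by (auto intro!: divide_left_mono)
      then have g: "nrm (g (s m)) \<le> e/4" "nrm (g (s n)) \<le> e/4" using gs[of m] gs[of n] M by linarith+
      have ipg: "\<bar>ip (g (s k)) ?w\<bar> \<le> e/4 * nrm ?w" if "nrm (g (s k)) \<le> e/4" for k
        using cauchy_schwarz[of "g (s k)" ?w] mult_right_mono[OF that nrm_nonneg[OF w]] s by (simp del: times_divide_eq_left)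
      have "(nrm ?w)\<^sup>2 = ip (g (s m)) ?w - ip (g (s n)) ?w + (D (s m) ?w - D (s n) ?w)"
        using s by (simp add: nrm_sq ip_diff g_ip)
      also have "\<dots> \<le> e/4 * nrm ?w + e/4 * nrm ?w + e/4 * nrm ?w"
        using ipg[OF g(1)] ipg[OF g(2)] N[of m n ?w] mn w by linarith
      finally have *: "nrm ?w * nrm ?w \<le> nrm ?w * (3/4 * e)" by (simp add: power2_eq_square algebra_simps)
      show ?thesis
      proof (rule ccontr)
        assume "\<not> nrm ?w < e"
        then have "nrm ?w > 0" "nrm ?w > 3/4 * e" using e by auto
        then show False using * by (simp only: mult_le_cancel_left_pos)
      qed
    qed
    then show ?thesis by blast
  qed
  then obtain l where l: "l \<in> X" "(\<lambda>n. nrm (s n - l)) \<longlonglongrightarrow> 0"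
    using complete'[of s] s by blast
  have gl: "nrm (g l) = 0"
  proof -
    have "(\<lambda>n. 1 / real (Suc n) + nrm (g (s n) - g l)) \<longlonglongrightarrow> 0 + 0"
      by (intro tendsto_add LIMSEQ_Suc[OF lim_const_over_n] g_tendsto s l)
    moreover have "nrm (g l) \<le> 1 / real (Suc n) + nrm (g (s n) - g l)" for n
    proof -
      have "nrm (g l) \<le> nrm (g (s n)) + nrm (g l - g (s n))" using s l by (intro nrm_triangle_sub) auto
      then show ?thesis using gs[of n] nrm_minus_commute[of "g l" "g (s n)"] s l by simp
    qed
    ultimately have "nrm (g l) \<le> 0 + 0" by (intro LIMSEQ_le_const) auto
    then show ?thesis using nrm_nonneg[of "g l"] l g_X by fastforce
  qed
  have "ip l v = D l v" if v: "v \<in> X" for v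
    using cauchy_schwarz[of "g l" v] gl v l g_ip[of l v] by simp
  \<comment> \<open>Since \<open>\<Phi>\<close> is nonnegative, a limit of norm 0 would push the
    values of \<open>J\<close> along the sequence down to 0, below \<open>\<alpha>\<close>.\<close>
  moreover have "nrm l \<noteq> 0"
  proof
    assume "nrm l = 0"
    then have le: "nrm (s n) \<le> nrm (s n - l)" for n using nrm_triangle_sub[of "s n" l] s l by simp
    have "\<alpha> \<le> (nrm (s n - l))\<^sup>2 / 2" for n
    proof -
      have "(nrm (s n))\<^sup>2 \<le> (nrm (s n - l))\<^sup>2" using le s by (intro power_mono) auto
      then show ?thesis using u(2)[of "r n"] AR(1)[OF s[of n]] by (simp add: J_def s_def)
    qed
    moreover have "(\<lambda>n. (nrm (s n - l))\<^sup>2 / 2) \<longlonglongrightarrow> 0\<^sup>2 / 2" by (intro tendsto_intros l) auto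
    ultimately have "\<alpha> \<le> 0\<^sup>2 / 2" by (intro LIMSEQ_le_const[of "\<lambda>n. (nrm (s n - l))\<^sup>2 / 2"]) blast+
    then show False using \<rho> by simp
  qed
  ultimately show ?thesis using l by blast
qed

end

text \<open>The abstract spaces are subsets of a real vector space type; the pointwise structure
  makes \<open>L2\<close> and the energy space such subsets.\<close>

instantiation "fun" :: (type, real_vector) real_vector
begin

definition scaleR_fun :: "real \<Rightarrow> ('a \<Rightarrow> 'b) \<Rightarrow> 'a \<Rightarrow> 'b" where
  "scaleR_fun c u = (\<lambda>x. c *\<^sub>R u x)"

instance
  by standard (auto simp: scaleR_fun_def fun_eq_iff algebra_simps)

end

lemma scaleR_fun_apply [simp]: "(c *\<^sub>R u) x = c *\<^sub>R (u x :: 'b::real_vector)"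
  by (simp add: scaleR_fun_def)

subsection \<open>Square integrable functions\<close>

definition L2 :: "('a::euclidean_space \<Rightarrow> 'b::euclidean_space) set" where
  "L2 = {F. F \<in> borel_measurable lebesgue \<and> integrable lebesgue (\<lambda>x. (norm (F x))\<^sup>2)}"

definition l2_ip :: "('a::euclidean_space \<Rightarrow> 'b::euclidean_space) \<Rightarrow> ('a \<Rightarrow> 'b) \<Rightarrow> real" where
  "l2_ip F G = (\<integral>x. F x \<bullet> G x \<partial>lebesgue)"

lemma L2_measurable: "F \<in> L2 \<Longrightarrow> F \<in> borel_measurable lebesgue"
  and L2_integrable: "F \<in> L2 \<Longrightarrow> integrable lebesgue (\<lambda>x. (norm (F x))\<^sup>2)"
  by (auto simp: L2_def)

lemma L2_bound:
  assumes F: "F \<in> borel_measurable lebesgue" and g: "integrable lebesgue g"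
    and le: "AE x in lebesgue. (norm (F x))\<^sup>2 \<le> g x"
  shows "F \<in> L2"
proof -
  have "integrable lebesgue (\<lambda>x. (norm (F x))\<^sup>2)"
    by (rule Bochner_Integration.integrable_bound[OF g]) (use F le in auto)
  then show ?thesis using F by (simp add: L2_def)
qed

lemma L2_add_aux: "(norm (x + y))\<^sup>2 \<le> 2 * (norm x)\<^sup>2 + 2 * (norm y)\<^sup>2" for x y :: "'b::real_inner"
proof -
  have "(norm (x + y))\<^sup>2 + (norm (x - y))\<^sup>2 = 2 * (norm x)\<^sup>2 + 2 * (norm y)\<^sup>2"
    by (simp add: power2_norm_eq_inner inner_add inner_diff inner_commute)
  then show ?thesis by (smt (verit) zero_le_power2)
qed

lemma L2_subspace: "subspace L2"
proof (rule subspaceI)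
  show "(0 :: 'a \<Rightarrow> 'b) \<in> L2" by (simp add: L2_def zero_fun_def)
next
  fix F G :: "'a \<Rightarrow> 'b" assume F: "F \<in> L2" and G: "G \<in> L2"
  have [measurable]: "F \<in> borel_measurable lebesgue" "G \<in> borel_measurable lebesgue"
    using F G by (auto simp: L2_def)
  show "F + G \<in> L2"
    unfolding plus_fun_def
    by (rule L2_bound[where g="\<lambda>x. 2 * (norm (F x))\<^sup>2 + 2 * (norm (G x))\<^sup>2"])
       (auto simp: L2_add_aux intro!: Bochner_Integration.integrable_add integrable_mult_right L2_integrable F G)
next
  fix c and F :: "'a \<Rightarrow> 'b" assume F: "F \<in> L2"
  then show "c *\<^sub>R F \<in> L2" by (auto simp: L2_def scaleR_fun_def power_mult_distrib)
qed

lemma L2_inner_integrable: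
  assumes "F \<in> L2" "G \<in> L2"
  shows "integrable lebesgue (\<lambda>x. F x \<bullet> G x)"
proof (rule Bochner_Integration.integrable_bound)
  show "integrable lebesgue (\<lambda>x. (norm (F x))\<^sup>2 + (norm (G x))\<^sup>2)"
    using assms by (intro Bochner_Integration.integrable_add L2_integrable)
  show "(\<lambda>x. F x \<bullet> G x) \<in> borel_measurable lebesgue"
    using assms[THEN L2_measurable] by measurable
  have "\<bar>a \<bullet> b\<bar> \<le> (norm a)\<^sup>2 + (norm b)\<^sup>2" for a b :: 'b
    using Cauchy_Schwarz_ineq2[of a b] sum_squares_bound[of "norm a" "norm b"]
      mult_nonneg_nonneg[OF norm_ge_zero[of a] norm_ge_zero[of b]] by linarith
  then show "AE x in lebesgue. norm (F x \<bullet> G x) \<le> norm ((norm (F x))\<^sup>2 + (norm (G x))\<^sup>2)" by simp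
qed

lemma l2_ip_self: "l2_ip F F = (\<integral>x. (norm (F x))\<^sup>2 \<partial>lebesgue)"
  by (simp add: l2_ip_def power2_norm_eq_inner)

lemma ennreal_l2_ip_self:
  assumes "F \<in> L2"
  shows "ennreal (l2_ip F F) = (\<integral>\<^sup>+x. ennreal ((norm (F x))\<^sup>2) \<partial>lebesgue)"
  unfolding l2_ip_self by (rule nn_integral_eq_integral[symmetric]) (use assms L2_integrable in auto)

lemma L2_fatou:
  fixes F :: "nat \<Rightarrow> 'a::euclidean_space \<Rightarrow> 'b::euclidean_space"
  assumes F: "\<And>k. F k \<in> L2" and lim: "AE x in lebesgue. (\<lambda>k. F k x) \<longlonglongrightarrow> G x"
    and G [measurable]: "G \<in> borel_measurable lebesgue"
    and bound: "\<forall>\<^sub>F k in sequentially. l2_ip (F k) (F k) \<le> C"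
  shows "G \<in> L2" "l2_ip G G \<le> C"
proof -
  have [measurable]: "\<And>k. F k \<in> borel_measurable lebesgue" using F by (auto simp: L2_def)
  have C: "C \<ge> 0"
  proof -
    obtain k where "l2_ip (F k) (F k) \<le> C" using bound by (auto simp: eventually_sequentially)
    moreover have "0 \<le> l2_ip (F k) (F k)" by (simp add: l2_ip_self)
    ultimately show ?thesis by linarith
  qed
  have "(\<integral>\<^sup>+x. ennreal ((norm (G x))\<^sup>2) \<partial>lebesgue) = (\<integral>\<^sup>+x. liminf (\<lambda>k. ennreal ((norm (F k x))\<^sup>2)) \<partial>lebesgue)"
  proof (rule nn_integral_cong_AE)
    show "AE x in lebesgue. ennreal ((norm (G x))\<^sup>2) = liminf (\<lambda>k. ennreal ((norm (F k x))\<^sup>2))"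
      using lim
    proof eventually_elim
      case (elim x)
      then have "(\<lambda>k. ennreal ((norm (F k x))\<^sup>2)) \<longlonglongrightarrow> ennreal ((norm (G x))\<^sup>2)"
        by (intro tendsto_intros) auto
      then show ?case using lim_imp_Liminf trivial_limit_sequentially by metis
    qed
  qed
  also have "\<dots> \<le> liminf (\<lambda>k. \<integral>\<^sup>+x. ennreal ((norm (F k x))\<^sup>2) \<partial>lebesgue)"
    by (rule nn_integral_liminf) measurable
  also have "\<dots> \<le> limsup (\<lambda>k. \<integral>\<^sup>+x. ennreal ((norm (F k x))\<^sup>2) \<partial>lebesgue)"
    by (rule Liminf_le_Limsup) simp
  also have "\<dots> \<le> ennreal C"
    by (rule Limsup_bounded) (use bound F in \<open>auto simp: ennreal_l2_ip_self[symmetric] intro!: ennreal_leI elim: eventually_mono\<close>)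
  finally have le: "(\<integral>\<^sup>+x. ennreal ((norm (G x))\<^sup>2) \<partial>lebesgue) \<le> ennreal C" .
  then have "integrable lebesgue (\<lambda>x. (norm (G x))\<^sup>2)"
    using order_le_less_trans[OF le] by (intro integrableI_bounded) auto
  then show G2: "G \<in> L2" by (simp add: L2_def)
  show "l2_ip G G \<le> C" using le C by (simp add: ennreal_l2_ip_self[OF G2, symmetric])
qed

lemma ex_fast_cauchy_subseq:
  fixes P :: "nat \<Rightarrow> nat \<Rightarrow> nat \<Rightarrow> bool"
  assumes "\<And>k. \<exists>N. \<forall>m\<ge>N. \<forall>n\<ge>N. P k m n"
  shows "\<exists>r::nat\<Rightarrow>nat. strict_mono r \<and> (\<forall>k. \<forall>m\<ge>r k. \<forall>n\<ge>r k. P k m n)"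
proof -
  obtain N where N: "\<And>k m n. m \<ge> N k \<Longrightarrow> n \<ge> N k \<Longrightarrow> P k m n" using assms by metis
  \<comment> \<open>The partial sums dominate each \<open>N k\<close>, and the added
    \<open>k\<close> makes \<open>r\<close> strictly increasing.\<close>
  define r where "r k = (\<Sum>i\<le>k. N i) + k" for k
  have "strict_mono r" by (rule strict_mono_Suc_iff[THEN iffD2]) (simp add: r_def)
  moreover have "N k \<le> r k" for k
    using member_le_sum[of k "{..k}" N] by (simp add: r_def)
  ultimately show ?thesis using N by (intro exI[of _ r]) (meson order_trans)
qed

lemma ennreal_le_suminf: "(a k :: ennreal) \<le> (\<Sum>k. a k)"
  using sum_le_suminf[of a "{k}"] by (simp add: summableI)

text \<open>Along the subsequence the squared norms of the increments are at most 16^-k, so the sum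
  of 4^k times the squared increments has a finite integral. Where this sum is finite the increments
  are O(2^-k) and the telescoping series converges.\<close>

lemma L2_cauchy_AE_subseq:
  fixes F :: "nat \<Rightarrow> 'a::euclidean_space \<Rightarrow> 'b::euclidean_space"
  assumes F: "\<And>n. F n \<in> L2"
    and cauchy: "\<And>e. e > 0 \<Longrightarrow> \<exists>N. \<forall>m\<ge>N. \<forall>n\<ge>N. sqrt (l2_ip (F m - F n) (F m - F n)) < e"
  obtains r where "strict_mono r" "AE x in lebesgue. convergent (\<lambda>k. F (r k) x)"
proof -
  have "\<exists>r::nat\<Rightarrow>nat. strict_mono r \<and> (\<forall>k. \<forall>m\<ge>r k. \<forall>n\<ge>r k. sqrt (l2_ip (F m - F n) (F m - F n)) < (1/4)^k)"
    by (rule ex_fast_cauchy_subseq) (use cauchy in simp)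
  then obtain r :: "nat \<Rightarrow> nat" where r: "strict_mono r"
    "\<And>k m n. m \<ge> r k \<Longrightarrow> n \<ge> r k \<Longrightarrow> sqrt (l2_ip (F m - F n) (F m - F n)) < (1/4)^k" by blast
  define \<Delta> where "\<Delta> k = F (r (Suc k)) - F (r k)" for k
  have \<Delta>: "\<Delta> k \<in> L2" for k unfolding \<Delta>_def by (intro subspace_diff L2_subspace F)
  have [measurable]: "\<Delta> k \<in> borel_measurable lebesgue" for k using \<Delta> by (auto simp: L2_def)
  have ip: "l2_ip (\<Delta> k) (\<Delta> k) \<le> (1/16)^k" for k
  proof -
    have "sqrt (l2_ip (\<Delta> k) (\<Delta> k)) < (1/4)^k"
      unfolding \<Delta>_def using r(1) by (intro r(2)) (auto simp: strict_mono_less_eq)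
    then have "(sqrt (l2_ip (\<Delta> k) (\<Delta> k)))\<^sup>2 \<le> ((1/4)^k)\<^sup>2" by (intro power_mono) (auto simp: l2_ip_self)
    moreover have "((1/4)^k)\<^sup>2 = (1/16::real)^k" by (simp add: power2_eq_square flip: power_mult_distrib)
    ultimately show ?thesis by (simp add: l2_ip_self)
  qed
  have "(\<integral>\<^sup>+x. (\<Sum>k. ennreal (4^k * (norm (\<Delta> k x))\<^sup>2)) \<partial>lebesgue)
      = (\<Sum>k. \<integral>\<^sup>+x. ennreal (4^k * (norm (\<Delta> k x))\<^sup>2) \<partial>lebesgue)"
    by (rule nn_integral_suminf) measurable
  also have "\<dots> \<le> (\<Sum>k. ennreal ((1/4)^k))"
  proof (rule suminf_le)
    fix k
    have "(\<integral>\<^sup>+x. ennreal (4^k * (norm (\<Delta> k x))\<^sup>2) \<partial>lebesgue) = ennreal (4^k) * ennreal (l2_ip (\<Delta> k) (\<Delta> k))"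
      unfolding ennreal_l2_ip_self[OF \<Delta>] by (subst nn_integral_cmult[symmetric]) (auto simp: ennreal_mult)
    also have "\<dots> \<le> ennreal (4^k) * ennreal ((1/16)^k)" by (intro mult_left_mono ennreal_leI ip) simp
    also have "\<dots> = ennreal ((1/4)^k)" by (simp add: ennreal_mult[symmetric] flip: power_mult_distrib)
    finally show "(\<integral>\<^sup>+x. ennreal (4^k * (norm (\<Delta> k x))\<^sup>2) \<partial>lebesgue) \<le> ennreal ((1/4)^k)" .
  qed auto
  also have "\<dots> = ennreal (\<Sum>k. (1/4)^k)" by (rule suminf_ennreal2) (auto intro: summable_geometric)
  finally have "(\<integral>\<^sup>+x. (\<Sum>k. ennreal (4^k * (norm (\<Delta> k x))\<^sup>2)) \<partial>lebesgue) \<noteq> \<infinity>"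
    by (auto simp: top_unique)
  then have "AE x in lebesgue. (\<Sum>k. ennreal (4^k * (norm (\<Delta> k x))\<^sup>2)) \<noteq> \<infinity>"
    by (intro nn_integral_PInf_AE) measurable
  then have "AE x in lebesgue. convergent (\<lambda>k. F (r k) x)"
  proof eventually_elim
    case (elim x)
    obtain T where T: "(\<Sum>k. ennreal (4^k * (norm (\<Delta> k x))\<^sup>2)) = ennreal T" "T \<ge> 0"
    proof (cases "\<Sum>k. ennreal (4^k * (norm (\<Delta> k x))\<^sup>2)" rule: ennreal_cases)
      case top
      with elim show ?thesis by (simp only: infinity_ennreal_def)
    qed
    have "norm (\<Delta> k x) \<le> sqrt T * (1/2)^k" for k
    proof -
      have "ennreal (4^k * (norm (\<Delta> k x))\<^sup>2) \<le> ennreal T"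
        unfolding T(1)[symmetric] by (rule ennreal_le_suminf)
      then have "4^k * (norm (\<Delta> k x))\<^sup>2 \<le> T" using T by simp
      then have "sqrt (4^k * (norm (\<Delta> k x))\<^sup>2) \<le> sqrt T" by simp
      moreover have "sqrt (4^k) = (2::real)^k" by (simp add: real_sqrt_power)
      ultimately have "2^k * norm (\<Delta> k x) \<le> sqrt T" by (simp add: real_sqrt_mult)
      then show ?thesis by (simp add: field_simps power_divide)
    qed
    then have "summable (\<lambda>k. \<Delta> k x)"
      by (intro summable_comparison_test'[where g="\<lambda>k. sqrt T * (1/2)^k" and N=0, OF summable_mult[OF summable_geometric]]) simp_all
    then have "convergent (\<lambda>n. \<Sum>k<n. \<Delta> k x)" by (simp add: summable_iff_convergent)
    moreover have "(\<Sum>k<n. \<Delta> k x) = F (r n) x - F (r 0) x" for n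
      using sum_lessThan_telescope[of "\<lambda>k. F (r k) x" n] by (simp only: \<Delta>_def minus_apply)
    ultimately have "convergent (\<lambda>n. F (r n) x - F (r 0) x)" by simp
    then have "convergent (\<lambda>n. F (r n) x - F (r 0) x + F (r 0) x)" by (intro convergent_add convergent_const)
    then show ?case by simp
  qed
  then show ?thesis using that r by blast
qed

text \<open>Fatou along the a.e. convergent subsequence passes the Cauchy bound from
  \<open>F n - F (r k)\<close> to \<open>F n - G\<close>; \<open>G\<close> is then in
  \<open>L2\<close> as a difference of two members.\<close>

theorem L2_complete:
  fixes F :: "nat \<Rightarrow> 'a::euclidean_space \<Rightarrow> 'b::euclidean_space"
  assumes F: "\<And>n. F n \<in> L2"
    and cauchy: "\<And>e. e > 0 \<Longrightarrow> \<exists>N. \<forall>m\<ge>N. \<forall>n\<ge>N. sqrt (l2_ip (F m - F n) (F m - F n)) < e"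
  obtains G where "G \<in> L2" "(\<lambda>n. sqrt (l2_ip (F n - G) (F n - G))) \<longlonglongrightarrow> 0"
proof -
  obtain r where r: "strict_mono r" "AE x in lebesgue. convergent (\<lambda>k. F (r k) x)"
    using L2_cauchy_AE_subseq[OF assms] by blast
  define G where "G x = lim (\<lambda>k. F (r k) x)" for x
  have [measurable]: "F n \<in> borel_measurable lebesgue" for n using F by (auto simp: L2_def)
  have G [measurable]: "G \<in> borel_measurable lebesgue"
    unfolding G_def[abs_def] by measurable
  have lim: "AE x in lebesgue. (\<lambda>k. F (r k) x) \<longlonglongrightarrow> G x"
    using r(2) by eventually_elim (simp add: G_def convergent_LIMSEQ_iff)
  have key: "\<exists>N. \<forall>n\<ge>N. F n - G \<in> L2 \<and> sqrt (l2_ip (F n - G) (F n - G)) \<le> e" if e: "e > 0" for e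
  proof -
    obtain N where N: "\<And>m n. m \<ge> N \<Longrightarrow> n \<ge> N \<Longrightarrow> sqrt (l2_ip (F m - F n) (F m - F n)) < e" using cauchy[OF e] by blast
    have "F n - G \<in> L2 \<and> l2_ip (F n - G) (F n - G) \<le> e\<^sup>2" if n: "n \<ge> N" for n
    proof -
      have "l2_ip (F n - F (r k)) (F n - F (r k)) \<le> e\<^sup>2" if "k \<ge> N" for k
      proof -
        have "sqrt (l2_ip (F n - F (r k)) (F n - F (r k))) < e" using n seq_suble[OF r(1), of k] that by (intro N) auto
        then have "(sqrt (l2_ip (F n - F (r k)) (F n - F (r k))))\<^sup>2 \<le> e\<^sup>2" by (intro power_mono) (auto simp: l2_ip_self)
        then show ?thesis by (simp add: l2_ip_self)
      qed
      then have ev: "\<forall>\<^sub>F k in sequentially. l2_ip (F n - F (r k)) (F n - F (r k)) \<le> e\<^sup>2" by (auto simp: eventually_sequentially)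
      have "AE x in lebesgue. (\<lambda>k. (F n - F (r k)) x) \<longlonglongrightarrow> (F n - G) x"
        using lim by eventually_elim (auto intro: tendsto_intros)
      moreover have "F n - F (r k) \<in> L2" for k by (intro subspace_diff L2_subspace F)
      moreover have "F n - G \<in> borel_measurable lebesgue" unfolding fun_diff_def by measurable
      ultimately show ?thesis using L2_fatou[of "\<lambda>k. F n - F (r k)" "F n - G" "e\<^sup>2"] ev by blast
    qed
    then show ?thesis using e by (intro exI[of _ N]) (auto intro!: real_le_lsqrt simp: l2_ip_self)
  qed
  obtain N where "\<forall>n\<ge>N. F n - G \<in> L2" using key[of 1] by auto
  then have "F N - G \<in> L2" by simp
  from subspace_diff[OF L2_subspace F[of N] this] have "G \<in> L2" by simp
  moreover have "(\<lambda>n. sqrt (l2_ip (F n - G) (F n - G))) \<longlonglongrightarrow> 0"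
  proof (rule LIMSEQ_I)
    fix e :: real assume "e > 0"
    then obtain N where N: "\<forall>n\<ge>N. sqrt (l2_ip (F n - G) (F n - G)) \<le> e/2" using key[of "e/2"] by auto
    have "norm (sqrt (l2_ip (F n - G) (F n - G)) - 0) < e" if "n \<ge> N" for n
      using N that \<open>e > 0\<close> by (auto simp: l2_ip_self intro: order_le_less_trans[of _ "e/2"])
    then show "\<exists>no. \<forall>n\<ge>no. norm (sqrt (l2_ip (F n - G) (F n - G)) - 0) < e" by blast
  qed
  ultimately show ?thesis using that by blast
qed

interpretation L2: semi_hilbert "L2 :: ('a::euclidean_space \<Rightarrow> 'b::euclidean_space) set" l2_ip
proof
  show "subspace (L2 :: ('a \<Rightarrow> 'b) set)" by (rule L2_subspace)
next
  fix F G :: "'a \<Rightarrow> 'b" show "l2_ip F G = l2_ip G F" by (simp add: l2_ip_def inner_commute)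
next
  fix F G H :: "'a \<Rightarrow> 'b" assume "F \<in> L2" "G \<in> L2" "H \<in> L2"
  then show "l2_ip (F + G) H = l2_ip F H + l2_ip G H"
    by (simp add: l2_ip_def inner_add_left L2_inner_integrable)
next
  fix c and F G :: "'a \<Rightarrow> 'b" show "l2_ip (c *\<^sub>R F) G = c * l2_ip F G" by (simp add: l2_ip_def)
next
  fix F :: "'a \<Rightarrow> 'b" show "0 \<le> l2_ip F F" by (simp add: l2_ip_self)
next
  fix F :: "nat \<Rightarrow> 'a \<Rightarrow> 'b" assume *: "\<And>n. F n \<in> L2" "\<And>e. e > 0 \<Longrightarrow> \<exists>N. \<forall>m\<ge>N. \<forall>n\<ge>N. sqrt (l2_ip (F m - F n) (F m - F n)) < e"
  obtain G where "G \<in> L2" "(\<lambda>n. sqrt (l2_ip (F n - G) (F n - G))) \<longlonglongrightarrow> 0" by (rule L2_complete[OF *])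
  then show "\<exists>G\<in>L2. (\<lambda>n. sqrt (l2_ip (F n - G) (F n - G))) \<longlonglongrightarrow> 0" by blast
qed

lemma L2_tendsto_AE_subseq:
  fixes F :: "nat \<Rightarrow> 'a::euclidean_space \<Rightarrow> 'b::euclidean_space"
  assumes "\<And>n. F n \<in> L2" "G \<in> L2" "(\<lambda>n. L2.nrm (F n - G)) \<longlonglongrightarrow> 0"
  obtains r where "strict_mono r" "AE x in lebesgue. (\<lambda>k. F (r k) x) \<longlonglongrightarrow> G x"
proof -
  have D: "F n - G \<in> L2" for n using assms by simp
  have "(\<lambda>n. (L2.nrm (F n - G))\<^sup>2) \<longlonglongrightarrow> 0\<^sup>2" by (intro tendsto_intros assms)
  moreover have "(L2.nrm (F n - G))\<^sup>2 = (\<integral>x. norm ((norm (F n x - G x))\<^sup>2) \<partial>lebesgue)" for n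
    using D by (simp add: L2.nrm_sq l2_ip_self)
  ultimately have *: "(\<lambda>n. \<integral>x. norm ((norm (F n x - G x))\<^sup>2) \<partial>lebesgue) \<longlonglongrightarrow> 0" by simp
  have "integrable lebesgue (\<lambda>x. (norm (F n x - G x))\<^sup>2)" for n using L2_integrable[OF D[of n]] by simp
  from tendsto_L1_AE_subseq[OF this *] obtain r :: "nat \<Rightarrow> nat"
    where r: "strict_mono r" "AE x in lebesgue. (\<lambda>k. (norm (F (r k) x - G x))\<^sup>2) \<longlonglongrightarrow> 0" by blast
  from r(2) have "AE x in lebesgue. (\<lambda>k. F (r k) x) \<longlonglongrightarrow> G x"
  proof eventually_elim
    case (elim x)
    then have "(\<lambda>k. sqrt ((norm (F (r k) x - G x))\<^sup>2)) \<longlonglongrightarrow> sqrt 0" by (rule tendsto_real_sqrt)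
    then have "(\<lambda>k. norm (F (r k) x - G x)) \<longlonglongrightarrow> 0" by simp
    then show ?case using LIM_zero_iff tendsto_norm_zero_iff by metis
  qed
  then show ?thesis using that r by blast
qed

lemma L2_cong_AE:
  assumes "F \<in> L2" "AE x in lebesgue. F x = G x"
  shows "G \<in> L2"
proof (rule L2_bound[OF borel_measurable_AE L2_integrable[OF assms(1)]])
  show "F \<in> borel_measurable lebesgue" by (rule L2_measurable[OF assms(1)])
  show "AE x in lebesgue. (norm (G x))\<^sup>2 \<le> (norm (F x))\<^sup>2" using assms(2) by eventually_elim simp
qed (rule assms)

lemma l2_ip_cong_AE:
  assumes "AE x in lebesgue. F x = F' x" "AE x in lebesgue. G x = G' x"
    and "F \<in> L2" "G \<in> L2"
  shows "l2_ip F G = l2_ip F' G'"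
proof -
  have "F' \<in> L2" "G' \<in> L2" using assms L2_cong_AE by blast+
  note [measurable] = this[THEN L2_measurable] assms(3,4)[THEN L2_measurable]
  show ?thesis unfolding l2_ip_def
    by (rule integral_cong_AE) (use assms in auto)
qed

subsection \<open>Integration of radial functions\<close>

definition sphere_area :: "'a::euclidean_space itself \<Rightarrow> real" where
  "sphere_area _ = real DIM('a) * unit_ball_vol (real DIM('a))"

lemma sphere_area_pos: "sphere_area TYPE('a::euclidean_space) > 0"
  by (simp add: sphere_area_def)

text \<open>Polar coordinates for radial integrands without a surface measure: the image of Lebesgue
  measure under the norm is determined by its values on half-lines, which are volumes of balls, and
  the density is the derivative of that volume in the radius.\<close>

lemma distr_norm_lborel:
  "distr (lborel :: 'a::euclidean_space measure) borel norm =
    density lborel (\<lambda>r. ennreal (sphere_area TYPE('a) * r ^ (DIM('a) - 1)) * indicator {0..} r)"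
  (is "?M = ?D")
proof (rule measure_eqI_generator_eq[where \<Omega>=UNIV and E="range atMost" and A="\<lambda>i. {..real i}"])
  show "Int_stable (range (atMost :: real \<Rightarrow> real set))" by (auto simp: Int_stable_def)
  have b: "sets borel = sigma_sets UNIV (range (atMost :: real \<Rightarrow> real set))"
    by (simp add: borel_eq_atMost)
  show "sets ?M = sigma_sets UNIV (range atMost)" "sets ?D = sigma_sets UNIV (range atMost)" using b by auto
  show "(\<Union>i. {..real i}) = UNIV" by (auto intro: real_arch_simple)
  have M: "emeasure ?M {..a} = (if a \<ge> 0 then ennreal (unit_ball_vol DIM('a) * a ^ DIM('a)) else 0)" for a
  proof -
    have "emeasure ?M {..a} = emeasure lborel (norm -` {..a} :: 'a set)" by (simp add: emeasure_distr)
    also have "norm -` {..a} = (cball 0 a :: 'a set)" by auto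
    finally show ?thesis by (simp add: emeasure_cball)
  qed
  show "emeasure ?M {..real i} \<noteq> \<infinity>" for i by (simp add: M)
  fix S :: "real set" assume "S \<in> range atMost"
  then obtain a where S: "S = {..a}" by auto
  have "emeasure ?D S = (\<integral>\<^sup>+r. ennreal (sphere_area TYPE('a) * r ^ (DIM('a) - 1)) * indicator {0..a} r \<partial>lborel)"
    unfolding S by (subst emeasure_density) (auto intro!: nn_integral_cong split: split_indicator)
  also have "\<dots> = (if a \<ge> 0 then ennreal (unit_ball_vol DIM('a) * a ^ DIM('a)) else 0)"
  proof (cases "a \<ge> 0")
    case True
    have "(\<integral>\<^sup>+r. ennreal (sphere_area TYPE('a) * r ^ (DIM('a) - 1)) * indicator {0..a} r \<partial>lborel)
        = ennreal (unit_ball_vol DIM('a) * a ^ DIM('a) - unit_ball_vol DIM('a) * 0 ^ DIM('a))"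
    proof (rule nn_integral_FTC_Icc)
      show "((\<lambda>r. unit_ball_vol DIM('a) * r ^ DIM('a)) has_real_derivative sphere_area TYPE('a) * r ^ (DIM('a) - 1)) (at r)" for r
        by (auto simp: sphere_area_def intro!: derivative_eq_intros)
    qed (use True sphere_area_pos[where 'a='a] in auto)
    then show ?thesis using True by (simp add: power_0_left)
  qed auto
  finally show "emeasure ?M S = emeasure ?D S" unfolding S M ..
qed auto

lemma nn_integral_radial:
  assumes [measurable]: "g \<in> borel_measurable borel"
  shows "(\<integral>\<^sup>+x. g (norm (x::'a::euclidean_space)) \<partial>lborel) =
    (\<integral>\<^sup>+r. ennreal (sphere_area TYPE('a) * r ^ (DIM('a) - 1)) * (g r * indicator {0..} r) \<partial>lborel)"
proof -
  have "(\<integral>\<^sup>+x. g (norm (x::'a)) \<partial>lborel) = (\<integral>\<^sup>+r. g r \<partial>distr (lborel :: 'a measure) borel norm)"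
    by (subst nn_integral_distr) auto
  then show ?thesis unfolding distr_norm_lborel
    by (subst (asm) nn_integral_density) (auto simp: ac_simps)
qed

text \<open>The image measure has a density, so a null set of radii pulls back to a null set of
  points. Radius 0 is left out because the potentials are specified only on positive radii.\<close>

lemma AE_norm:
  assumes "AE r in lborel. r > 0 \<longrightarrow> P r"
  shows "AE x in lebesgue. x \<noteq> (0::'a::euclidean_space) \<longrightarrow> P (norm x)"
proof -
  obtain S where S: "{r \<in> space lborel. \<not> (r > 0 \<longrightarrow> P r)} \<subseteq> S" "S \<in> null_sets lborel"
    using assms by (rule AE_E) (auto simp: null_sets_def)
  then have [measurable]: "S \<in> sets borel" by (auto simp: null_sets_def)
  have "emeasure (distr (lborel :: 'a measure) borel norm) S = 0"
  proof -
    have "AE r in lborel. r \<notin> S" using S(2) by (rule AE_not_in)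
    then have "AE r in lborel. ennreal (sphere_area TYPE('a) * r ^ (DIM('a) - 1)) * indicator {0..} r * indicator S r = 0"
      by eventually_elim auto
    then show ?thesis unfolding distr_norm_lborel
      by (subst emeasure_density) (auto simp: nn_integral_0_iff_AE)
  qed
  then have "emeasure lborel (norm -` S :: 'a set) = 0" by (simp add: emeasure_distr)
  moreover have "(norm -` S :: 'a set) \<in> sets lborel" using measurable_sets[of norm "borel :: 'a measure" borel S] by simp
  ultimately have "(norm -` S :: 'a set) \<in> null_sets lborel" by auto
  then have "AE x in (lborel :: 'a measure). x \<notin> norm -` S" by (rule AE_not_in)
  then have "AE x in (lebesgue :: 'a measure). x \<notin> norm -` S" by (rule AE_completion)
  then show ?thesis
  proof eventually_elim
    case (elim x)
    then have "norm x \<notin> S" by simp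
    have "r \<in> S" if "r > 0" "\<not> P r" for r using S(1) that by auto
    then show ?case using \<open>norm x \<notin> S\<close> by (intro impI) (rule ccontr, simp)
  qed
qed

lemma AE_nonzero: "AE x in lebesgue. x \<noteq> (0::'a::euclidean_space)"
  by (rule AE_completion) (rule AE_lborel_singleton)

text \<open>For a merely Lebesgue measurable function the measurability of its composition with the
  norm is not immediate; a Borel function that agrees with it almost everywhere settles this through
  \<open>AE_norm\<close>.\<close>

lemma ex_borel_profile:
  assumes "f \<in> borel_measurable (lebesgue_on {0<..})"
  obtains f' :: "real \<Rightarrow> real" where "f' \<in> borel_measurable borel" "AE r in lborel. r > 0 \<longrightarrow> f r = f' r"
    "AE x in lebesgue. f (norm (x::'a::euclidean_space)) = f' (norm x)"
proof -
  have "(\<lambda>r. indicator {0<..} r *\<^sub>R f r) \<in> borel_measurable lebesgue"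
    using assms by (subst (asm) borel_measurable_restrict_space_iff) auto
  then obtain f' :: "real \<Rightarrow> real" where f': "f' \<in> borel_measurable lborel" "AE r in lborel. indicator {0<..} r *\<^sub>R f r = f' r"
    using completion_ex_borel_measurable_real by blast
  have ae: "AE r in lborel. r > 0 \<longrightarrow> f r = f' r" using f'(2) by eventually_elim auto
  have "AE x in lebesgue. f (norm (x::'a)) = f' (norm x)"
    using AE_norm[OF ae] AE_nonzero by eventually_elim auto
  then show ?thesis using that[of f'] f'(1) ae by simp
qed

lemma measurable_radial:
  fixes f :: "real \<Rightarrow> real"
  assumes "f \<in> borel_measurable (lebesgue_on {0<..})"
  shows "(\<lambda>x. f (norm (x::'a::euclidean_space)) :: real) \<in> borel_measurable lebesgue"
proof -
  obtain f' where f': "f' \<in> borel_measurable borel" "AE x in lebesgue. f (norm (x::'a)) = f' (norm x)"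
    using ex_borel_profile[OF assms] by metis
  have "(\<lambda>x::'a. f' (norm x)) \<in> borel_measurable lborel" using f'(1) by measurable
  then have "(\<lambda>x::'a. f' (norm x)) \<in> borel_measurable lebesgue" by (rule measurable_completion)
  then show ?thesis by (rule borel_measurable_AE) (use f'(2) in \<open>auto elim: eventually_mono\<close>)
qed

text \<open>Carries local integrability on the half-line over to annuli: the density of the radius
  is bounded by its value at the outer radius.\<close>

lemma integrable_radial_annulus:
  fixes f :: "real \<Rightarrow> real"
  assumes f: "f \<in> borel_measurable (lebesgue_on {0<..})" and r: "0 < r"
    and int: "(\<lambda>t. \<bar>f t\<bar>) absolutely_integrable_on {r..s}"
  shows "integrable lebesgue (\<lambda>x::'a::euclidean_space. indicator {x. r \<le> norm x \<and> norm x \<le> s} x * f (norm x))"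
proof (rule integrableI_bounded)
  have [measurable]: "(\<lambda>x. f (norm (x::'a)) :: real) \<in> borel_measurable lebesgue" by (rule measurable_radial[OF f])
  have [measurable]: "(norm :: 'a \<Rightarrow> real) \<in> borel_measurable lebesgue" by (intro measurable_completion) simp
  have [measurable]: "{x::'a. r \<le> norm x \<and> norm x \<le> s} \<in> sets lebesgue"
  proof -
    have "{x::'a. r \<le> norm x \<and> norm x \<le> s} \<in> sets borel" by measurable
    then show ?thesis by simp
  qed
  show "(\<lambda>x::'a. indicator {x. r \<le> norm x \<and> norm x \<le> s} x * f (norm x)) \<in> borel_measurable lebesgue" by measurable
  obtain f' where f': "f' \<in> borel_measurable borel" "AE r in lborel. r > 0 \<longrightarrow> f r = f' r" "AE x in lebesgue. f (norm (x::'a)) = f' (norm x)"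
    using ex_borel_profile[OF f] by metis
  note [measurable] = f'(1)
  let ?c = "sphere_area TYPE('a)"
  have "(\<integral>\<^sup>+x. ennreal (norm (indicator {x. r \<le> norm x \<and> norm x \<le> s} x * f (norm (x::'a)))) \<partial>lebesgue)
      = (\<integral>\<^sup>+x. ennreal (indicator {r..s} (norm (x::'a)) * \<bar>f' (norm x)\<bar>) \<partial>lebesgue)"
    by (rule nn_integral_cong_AE) (use f'(3) in eventually_elim, auto split: split_indicator)
  also have "\<dots> = (\<integral>\<^sup>+x. ennreal (indicator {r..s} (norm (x::'a)) * \<bar>f' (norm x)\<bar>) \<partial>lborel)"
    by (rule nn_integral_completion)
  also have "\<dots> = (\<integral>\<^sup>+t. ennreal (?c * t ^ (DIM('a) - 1)) * (ennreal (indicator {r..s} t * \<bar>f' t\<bar>) * indicator {0..} t) \<partial>lborel)"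
    by (rule nn_integral_radial) measurable
  also have "\<dots> \<le> (\<integral>\<^sup>+t. ennreal (?c * s ^ (DIM('a) - 1)) * ennreal (indicator {r..s} t * \<bar>f t\<bar>) \<partial>lborel)"
  proof (rule nn_integral_mono_AE)
    show "AE t in lborel. ennreal (?c * t ^ (DIM('a) - 1)) * (ennreal (indicator {r..s} t * \<bar>f' t\<bar>) * indicator {0..} t)
       \<le> ennreal (?c * s ^ (DIM('a) - 1)) * ennreal (indicator {r..s} t * \<bar>f t\<bar>)"
      using f'(2)
    proof eventually_elim
      case (elim t)
      show ?case
      proof (cases "t \<in> {r..s}")
        case True
        then show ?thesis using elim r sphere_area_pos[where 'a='a]
          by (auto intro!: mult_right_mono ennreal_leI mult_left_mono power_mono)
      qed simp
    qed
  qed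
  also have "\<dots> = (\<integral>\<^sup>+t. ennreal (?c * s ^ (DIM('a) - 1)) * ennreal (indicator {r..s} t * \<bar>f t\<bar>) \<partial>lebesgue)"
    by (rule nn_integral_completion[symmetric])
  also have "\<dots> = ennreal (?c * s ^ (DIM('a) - 1)) * (\<integral>\<^sup>+t. ennreal (norm (indicator {r..s} t *\<^sub>R \<bar>f t\<bar>)) \<partial>lebesgue)"
    using int by (subst nn_integral_cmult) (auto simp: set_integrable_def abs_mult dest: borel_measurable_integrable)
  also have "\<dots> < \<infinity>"
    using int by (auto simp: set_integrable_def integrable_iff_bounded ennreal_mult_less_top)
  finally show "(\<integral>\<^sup>+x. ennreal (norm (indicator {x. r \<le> norm x \<and> norm x \<le> s} x * f (norm (x::'a)))) \<partial>lebesgue) < \<infinity>" .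
qed

subsection \<open>Smooth functions\<close>

lemma Ck_SucI:
  assumes "\<And>x. (u has_derivative D x) (at x)" "\<And>b. b \<in> Basis \<Longrightarrow> Ck k (\<lambda>x. D x b)"
  shows "Ck (Suc k) u"
proof -
  have "frechet_derivative u (at x) = D x" for x using frechet_derivative_at[OF assms(1)] by simp
  then show ?thesis using assms unfolding Ck.simps by (auto simp: differentiable_def)
qed

lemma Ck_Suc_D:
  assumes "Ck (Suc k) u"
  shows "(u has_derivative frechet_derivative u (at x)) (at x)"
    "b \<in> Basis \<Longrightarrow> Ck k (\<lambda>x. frechet_derivative u (at x) b)"
  using assms by (auto simp: frechet_derivative_works)

declare Ck.simps(2) [simp del]

lemma Ck_Suc_imp: "Ck (Suc k) u \<Longrightarrow> Ck k u"
proof (induction k arbitrary: u)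
  case 0
  then show ?case by (auto simp: Ck.simps(2) continuous_at_imp_continuous_on differentiable_imp_continuous_within)
next
  case (Suc k)
  then show ?case by (simp only: Ck.simps(2)) blast
qed

lemma Ck_const: "Ck k (\<lambda>_. c)"
proof (induction k arbitrary: c)
  case (Suc k)
  show ?case by (rule Ck_SucI[where D="\<lambda>x v. 0"]) (auto intro: Suc)
qed simp

lemma Ck_bounded_linear:
  assumes "bounded_linear u"
  shows "Ck k u"
proof (cases k)
  case 0
  then show ?thesis using linear_continuous_on[OF assms] by simp
next
  case (Suc n)
  show ?thesis unfolding Suc
    by (rule Ck_SucI[where D="\<lambda>x. u"]) (auto intro: bounded_linear_imp_has_derivative assms Ck_const)
qed

lemma Ck_add: "Ck k u \<Longrightarrow> Ck k v \<Longrightarrow> Ck k (\<lambda>x. u x + v x)"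
proof (induction k arbitrary: u v)
  case 0
  then show ?case by (auto intro: continuous_intros)
next
  case (Suc k)
  note u = Ck_Suc_D[OF Suc.prems(1)] and v = Ck_Suc_D[OF Suc.prems(2)]
  show ?case
    by (rule Ck_SucI[OF has_derivative_add[OF u(1) v(1)]]) (intro Suc.IH u v)
qed

lemma Ck_mult: "Ck k u \<Longrightarrow> Ck k v \<Longrightarrow> Ck k (\<lambda>x. u x * v x)"
proof (induction k arbitrary: u v)
  case 0
  then show ?case by (auto intro: continuous_intros)
next
  case (Suc k)
  note u = Ck_Suc_D[OF Suc.prems(1)] and v = Ck_Suc_D[OF Suc.prems(2)]
  show ?case
    by (rule Ck_SucI[OF has_derivative_mult[OF u(1) v(1)]]) (intro Ck_add Suc.IH u v Ck_Suc_imp[OF Suc.prems(1)] Ck_Suc_imp[OF Suc.prems(2)])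
qed

lemma Ck_cmult: "Ck k u \<Longrightarrow> Ck k (\<lambda>x. c * u x)"
  by (intro Ck_mult Ck_const)

lemma Ck_uminus: "Ck k u \<Longrightarrow> Ck k (\<lambda>x. - u x)"
  using Ck_cmult[of k u "-1"] by simp

lemma Ck_diff: "Ck k u \<Longrightarrow> Ck k v \<Longrightarrow> Ck k (\<lambda>x. u x - v x)"
  using Ck_add[OF _ Ck_uminus, of k u v] by simp

lemma Ck_sum: "finite S \<Longrightarrow> (\<And>i. i \<in> S \<Longrightarrow> Ck k (u i)) \<Longrightarrow> Ck k (\<lambda>x. \<Sum>i\<in>S. u i x)"
  by (induction S rule: finite_induct) (auto intro: Ck_const Ck_add)

lemma Ck_prod: "finite S \<Longrightarrow> (\<And>i. i \<in> S \<Longrightarrow> Ck k (u i)) \<Longrightarrow> Ck k (\<lambda>x. \<Prod>i\<in>S. u i x)"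
  by (induction S rule: finite_induct) (auto intro: Ck_const Ck_mult)

lemma Ck_norm_sq: "Ck k (\<lambda>x::'a::euclidean_space. (norm x)\<^sup>2)"
proof -
  have "(\<lambda>x::'a. (norm x)\<^sup>2) = (\<lambda>x. \<Sum>b\<in>Basis. (x \<bullet> b) * (x \<bullet> b))"
    unfolding power2_norm_eq_inner by (rule ext) (rule euclidean_inner)
  moreover have "Ck k (\<lambda>x::'a. \<Sum>b\<in>Basis. (x \<bullet> b) * (x \<bullet> b))"
    by (rule Ck_sum[OF finite_Basis]) (rule Ck_mult; intro Ck_bounded_linear bounded_linear_inner_left)
  ultimately show ?thesis by simp
qed

lemma Ck_compose: "Ck k (\<psi> :: real \<Rightarrow> real) \<Longrightarrow> Ck k u \<Longrightarrow> Ck k (\<lambda>x. \<psi> (u x))"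
proof (induction k arbitrary: u \<psi>)
  case 0
  then show ?case by (auto intro: continuous_on_compose2)
next
  case (Suc k)
  note p = Ck_Suc_D[OF Suc.prems(1)] and u = Ck_Suc_D[OF Suc.prems(2)]
  \<comment> \<open>\<open>Ck\<close> sees a real function only through its derivative in the
    direction 1, the sole basis vector of \<open>real\<close>; linearity recovers the other
    directions.\<close>
  have lin: "frechet_derivative \<psi> (at y) t = frechet_derivative \<psi> (at y) 1 * t" for y t
    using linear_scale[OF has_derivative_linear[OF p(1)[of y]], of t 1] by (simp add: mult.commute)
  show ?case
  proof (rule Ck_SucI)
    show "((\<lambda>x. \<psi> (u x)) has_derivative (\<lambda>h. frechet_derivative \<psi> (at (u x)) 1 * frechet_derivative u (at x) h)) (at x)" for x
      using has_derivative_compose[OF u(1)[of x] p(1)[of "u x"]] by (simp add: lin[symmetric])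
    show "Ck k (\<lambda>x. frechet_derivative \<psi> (at (u x)) 1 * frechet_derivative u (at x) b)" if "b \<in> Basis" for b
      using that Ck_Suc_imp[OF Suc.prems(2)] p(2)[of 1]
      by (intro Ck_mult[OF Suc.IH[of "\<lambda>y. frechet_derivative \<psi> (at y) 1" u] u(2)]) auto
  qed
qed

text \<open>The span of this family is closed under differentiation, so its members are smooth.\<close>
definition flat :: "nat \<Rightarrow> real \<Rightarrow> real" where
  "flat n t = (if t > 0 then (1 / t) ^ n * exp (- (1 / t)) else 0)"

lemma flat_nonneg [simp]: "0 \<le> flat n t" by (simp add: flat_def)

lemma flat_nonpos [simp]: "t \<le> 0 \<Longrightarrow> flat n t = 0" by (simp add: flat_def)

lemma flat_pos: "t > 0 \<Longrightarrow> 0 < flat n t" by (simp add: flat_def)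

lemma flat_0_le_1: "flat 0 t \<le> 1" by (simp add: flat_def)

text \<open>\<open>flat 2\<close> is the derivative of \<open>flat 0\<close>, see
  \<open>flat_DERIV\<close>; the bound comes from y^2 / 2 <= exp y with y = 1/t. It makes
  \<open>flat_neg\<close> admissible in the chain rule.\<close>

lemma flat_2_le: "flat 2 t \<le> 2"
proof (cases "t > 0")
  case True
  have "1 + 1/t + (1/t)\<^sup>2 / 2 \<le> exp (1/t)" using True by (intro exp_lower_Taylor_quadratic) auto
  moreover have "1/t > 0" using True by simp
  ultimately have "(1/t)\<^sup>2 \<le> 2 * exp (1/t)" by linarith
  then show ?thesis using True by (simp add: flat_def exp_minus field_simps)
qed simp

lemma flat_tendsto_0: "(flat n \<longlongrightarrow> 0) (at_right 0)"
proof -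
  have "((\<lambda>t. (inverse t) ^ n / exp (inverse t)) \<longlongrightarrow> 0) (at_right (0::real))"
    by (rule filterlim_compose[OF tendsto_power_div_exp_0 filterlim_inverse_at_top_right])
  then show ?thesis
    by (rule Lim_transform_eventually)
       (auto simp: eventually_at_filter flat_def exp_minus field_simps)
qed

lemma flat_DERIV: "(flat n has_real_derivative (flat (n + 2) t - real n * flat (n + 1) t)) (at t)"
proof -
  consider "t > 0" | "t < 0" | "t = 0" by linarith
  then show ?thesis
  proof cases
    case 1
    have "((\<lambda>t. (1/t)^n * exp (- (1 / t))) has_real_derivative (flat (n + 2) t - real n * flat (n + 1) t)) (at t)"
    proof -
      have "((\<lambda>t. 1/t) has_real_derivative - (1/t)\<^sup>2) (at t)"
        using 1 by (auto intro!: derivative_eq_intros simp: power2_eq_square divide_simps)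
      from DERIV_power[OF this, of n]
      have d1: "((\<lambda>t. (1/t)^n) has_real_derivative real n * (- (1/t)\<^sup>2 * (1/t)^(n - Suc 0))) (at t)" by simp
      have d2: "((\<lambda>t. exp (- (1/t))) has_real_derivative exp (- (1/t)) * (1/t)\<^sup>2) (at t)"
        using 1 by (auto intro!: derivative_eq_intros simp: power2_eq_square divide_simps)
      have "real n * (- u\<^sup>2 * u^(n - Suc 0)) * e + e * u\<^sup>2 * u^n = u ^ (n + 2) * e - real n * (u ^ (n + 1) * e)" for u e :: real
        by (cases n) (simp_all add: algebra_simps power2_eq_square)
      from this[of "1/t" "exp (- (1/t))"] show ?thesis using DERIV_mult[OF d1 d2] 1 by (simp add: flat_def)
    qed
    then show ?thesis
      by (rule has_field_derivative_transform_within_open[where S="{0<..}"]) (use 1 in \<open>auto simp: flat_def\<close>)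
  next
    case 2
    have "((\<lambda>t. 0) has_real_derivative 0) (at t)" by simp
    then have "(flat n has_real_derivative 0) (at t)"
      by (rule has_field_derivative_transform_within_open[where S="{..<0}"]) (use 2 in auto)
    then show ?thesis using 2 by simp
  next
    case 3
    have "((\<lambda>h. (flat n (0 + h) - flat n 0) / h) \<longlongrightarrow> 0) (at 0)"
    proof (rule filterlim_split_at)
      show "((\<lambda>h. (flat n (0 + h) - flat n 0) / h) \<longlongrightarrow> 0) (at_left 0)"
        by (rule tendsto_eventually) (auto simp: eventually_at_filter)
      \<comment> \<open>To the right of 0 the difference quotient is \<open>flat (Suc n)\<close>,
        which tends to 0.\<close>
      show "((\<lambda>h. (flat n (0 + h) - flat n 0) / h) \<longlongrightarrow> 0) (at_right 0)"
        by (rule Lim_transform_eventually[OF flat_tendsto_0[of "Suc n"]])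
           (auto simp: eventually_at_filter flat_def)
    qed
    then show ?thesis using 3 by (simp add: DERIV_def)
  qed
qed

lemma flat_Ck: "Ck k (flat n)"
proof (induction k arbitrary: n)
  case 0
  have "isCont (flat n) t" for t using flat_DERIV DERIV_isCont by blast
  then show ?case by (simp add: continuous_at_imp_continuous_on)
next
  case (Suc k)
  show ?case
  proof (rule Ck_SucI)
    show "(flat n has_derivative (\<lambda>h. h * (flat (n + 2) x - real n * flat (n + 1) x))) (at x)" for x
      using flat_DERIV[of n x] by (simp add: has_field_derivative_def mult_commute_abs)
    show "Ck k (\<lambda>x. b * (flat (n + 2) x - real n * flat (n + 1) x))" if "b \<in> Basis" for b
      by (intro Ck_cmult Ck_diff Suc)
  qed
qed

text \<open>Smooth approximation of the indicator of the positive half-line; products of these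
  approximate indicators of boxes.\<close>

lemma flat_tendsto_1: "(\<lambda>n. flat 0 (real n * t)) \<longlonglongrightarrow> (if t > 0 then 1 else 0)"
proof (cases "t > 0")
  case True
  have "(\<lambda>n. exp (- (1 / t * inverse (real n)))) \<longlonglongrightarrow> exp (- (1 / t * 0))"
    by (intro tendsto_intros lim_inverse_n)
  moreover have "\<forall>\<^sub>F n in sequentially. exp (- (1 / t * inverse (real n))) = flat 0 (real n * t)"
    using eventually_gt_at_top[of 0] by eventually_elim (use True in \<open>simp add: flat_def field_simps\<close>)
  ultimately show ?thesis using True Lim_transform_eventually by fastforce
qed (simp add: mult_nonneg_nonpos)

subsection \<open>Gradients and test functions\<close>

lemma grad_inner:
  assumes "Ck (Suc 0) u"
  shows "frechet_derivative u (at x) v = grad u x \<bullet> v"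
proof -
  have lin: "linear (frechet_derivative u (at x))"
    using has_derivative_linear[OF Ck_Suc_D(1)[OF assms]] .
  have "frechet_derivative u (at x) v = frechet_derivative u (at x) (\<Sum>b\<in>Basis. (v \<bullet> b) *\<^sub>R b)"
    by (simp add: euclidean_representation)
  also have "\<dots> = (\<Sum>b\<in>Basis. (v \<bullet> b) * frechet_derivative u (at x) b)"
    by (simp add: linear_sum[OF lin] linear_scale[OF lin])
  also have "\<dots> = grad u x \<bullet> v"
    unfolding grad_def by (simp add: inner_sum_left inner_commute[of v] mult.commute)
  finally show ?thesis .
qed

lemma has_derivative_grad: "Ck (Suc 0) u \<Longrightarrow> (u has_derivative (\<lambda>v. grad u x \<bullet> v)) (at x)"
proof -
  assume u: "Ck (Suc 0) u"
  have "frechet_derivative u (at x) = (\<lambda>v. grad u x \<bullet> v)" using grad_inner[OF u] by (intro ext)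
  then show ?thesis using Ck_Suc_D(1)[OF u, of x] by simp
qed

lemma grad_eqI:
  assumes "(u has_derivative (\<lambda>v. g \<bullet> v)) (at x)"
  shows "grad u x = g"
  unfolding grad_def frechet_derivative_at[OF assms, symmetric] by (rule euclidean_representation)

lemma continuous_grad:
  assumes "Ck (Suc 0) u"
  shows "continuous_on UNIV (grad u)"
  unfolding grad_def using Ck_Suc_D(2)[OF assms] by (intro continuous_intros) auto

lemma grad_add: "Ck (Suc 0) u \<Longrightarrow> Ck (Suc 0) v \<Longrightarrow> grad (\<lambda>x. u x + v x) x = grad u x + grad v x"
  by (rule grad_eqI) (auto intro!: derivative_eq_intros has_derivative_grad simp: inner_add_left)

lemma grad_cmult: "Ck (Suc 0) u \<Longrightarrow> grad (\<lambda>x. c * u x) x = c *\<^sub>R grad u x"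
  by (rule grad_eqI) (auto intro!: derivative_eq_intros has_derivative_grad)

lemma grad_mult: "Ck (Suc 0) u \<Longrightarrow> Ck (Suc 0) v \<Longrightarrow> grad (\<lambda>x. u x * v x) x = v x *\<^sub>R grad u x + u x *\<^sub>R grad v x"
  by (rule grad_eqI) (auto intro!: derivative_eq_intros has_derivative_grad simp: inner_add_left)

lemma grad_compose:
  assumes "(\<psi> has_real_derivative d) (at (u x))" "Ck (Suc 0) u"
  shows "grad (\<lambda>x. \<psi> (u x)) x = d *\<^sub>R grad u x"
  by (rule grad_eqI)
     (use has_derivative_compose[OF has_derivative_grad[OF assms(2), of x] assms(1)[unfolded has_field_derivative_def]] in simp)

lemma test_functions_Ck: "u \<in> test_functions \<Omega> \<Longrightarrow> Ck k u"
  by (simp add: test_functions_def)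

lemma test_functions_support:
  assumes "u \<in> test_functions \<Omega>"
  obtains C where "compact C" "C \<subseteq> \<Omega>" "\<And>x. x \<notin> C \<Longrightarrow> u x = 0" "\<And>x. x \<notin> C \<Longrightarrow> grad u x = 0"
proof (rule that)
  let ?C = "closure {x. u x \<noteq> 0}"
  show "compact ?C" "?C \<subseteq> \<Omega>" using assms by (auto simp: test_functions_def)
  show z: "u x = 0" if "x \<notin> ?C" for x using that closure_subset[of "{x. u x \<noteq> 0}"] by auto
  fix x assume x: "x \<notin> ?C"
  have "((\<lambda>_. 0) has_derivative (\<lambda>v. 0 \<bullet> v)) (at x)" by simp
  then have "(u has_derivative (\<lambda>v. 0 \<bullet> v)) (at x)"
  proof (rule has_derivative_transform_within_open)
    show "open (- ?C)" by (rule open_Compl[OF closed_closure])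
    show "x \<in> - ?C" using x by simp
    show "0 = u y" if "y \<in> - ?C" for y using z[of y] that by simp
  qed
  then show "grad u x = 0" by (rule grad_eqI)
qed

lemma test_functionsI:
  assumes "\<And>k. Ck k u" "compact C" "C \<subseteq> \<Omega>" "\<And>x. x \<notin> C \<Longrightarrow> u x = 0"
  shows "u \<in> test_functions \<Omega>"
proof -
  have "closure {x. u x \<noteq> 0} \<subseteq> C"
    using assms(2,4) by (intro closure_minimal) (auto intro: compact_imp_closed)
  moreover from this have "compact (closure {x. u x \<noteq> 0})"
    using assms(2) by (metis closed_closure compact_Int_closed inf.absorb_iff2)
  ultimately show ?thesis using assms by (auto simp: test_functions_def)
qed

lemma test_functions_mono: "\<Omega> \<subseteq> \<Omega>' \<Longrightarrow> test_functions \<Omega> \<subseteq> test_functions \<Omega>'"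
  by (auto simp: test_functions_def)

lemma test_functions_lincomb:
  assumes u: "u \<in> test_functions \<Omega>" and v: "v \<in> test_functions \<Omega>"
  shows "(\<lambda>x. c * u x + d * v x) \<in> test_functions \<Omega>"
proof -
  obtain C where C: "compact C" "C \<subseteq> \<Omega>" "\<And>x. x \<notin> C \<Longrightarrow> u x = 0" using test_functions_support[OF u] by metis
  obtain D where D: "compact D" "D \<subseteq> \<Omega>" "\<And>x. x \<notin> D \<Longrightarrow> v x = 0" using test_functions_support[OF v] by metis
  show ?thesis
    by (rule test_functionsI[where C="C \<union> D"])
       (use C D in \<open>auto intro!: Ck_add Ck_cmult test_functions_Ck[OF u] test_functions_Ck[OF v]\<close>)
qed

lemma test_functions_bounded:
  assumes u: "u \<in> test_functions \<Omega>"
  obtains M where "M > 0" "\<And>x. \<bar>u x\<bar> \<le> M" "\<And>x. norm (grad u x) \<le> M"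
proof -
  obtain C where C: "compact C" "\<And>x. x \<notin> C \<Longrightarrow> u x = 0" "\<And>x. x \<notin> C \<Longrightarrow> grad u x = 0" using test_functions_support[OF u] by metis
  have "continuous_on C u" using test_functions_Ck[OF u, of 0] continuous_on_subset by auto
  then have "bounded (u ` C)" using C compact_imp_bounded compact_continuous_image by blast
  then obtain M1 where M1: "\<And>x. x \<in> C \<Longrightarrow> \<bar>u x\<bar> \<le> M1" by (auto simp: bounded_iff)
  have "continuous_on C (grad u)" using continuous_grad[OF test_functions_Ck[OF u]] continuous_on_subset by blast
  then have "bounded (grad u ` C)" using C compact_imp_bounded compact_continuous_image by blast
  then obtain M2 where M2: "\<And>x. x \<in> C \<Longrightarrow> norm (grad u x) \<le> M2" by (auto simp: bounded_iff)
  show ?thesis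
  proof (rule that[of "\<bar>M1\<bar> + \<bar>M2\<bar> + 1"])
    show "\<bar>u x\<bar> \<le> \<bar>M1\<bar> + \<bar>M2\<bar> + 1" for x using M1[of x] C(2)[of x] by (cases "x \<in> C") auto
    show "norm (grad u x) \<le> \<bar>M1\<bar> + \<bar>M2\<bar> + 1" for x using M2[of x] C(3)[of x] by (cases "x \<in> C") auto
  qed auto
qed

lemma test_functions_integrable:
  assumes u: "u \<in> test_functions \<Omega>"
  shows "integrable lborel u"
proof -
  obtain C where C: "compact C" "\<And>x. x \<notin> C \<Longrightarrow> u x = 0" using test_functions_support[OF u] by metis
  have "continuous_on C u" using test_functions_Ck[OF u, of 0] continuous_on_subset by auto
  then have "integrable lborel (\<lambda>x. indicator C x *\<^sub>R u x)" using C by (intro borel_integrable_compact) auto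
  moreover have "(\<lambda>x. indicator C x *\<^sub>R u x) = u" using C(2) by (auto simp: fun_eq_iff split: split_indicator)
  ultimately show ?thesis by simp
qed

lemma continuous_measurable_lebesgue:
  "continuous_on UNIV u \<Longrightarrow> u \<in> borel_measurable lebesgue"
  by (intro measurable_completion) (simp add: borel_measurable_continuous_onI)

lemma test_functions_measurable:
  assumes "u \<in> test_functions \<Omega>"
  shows "u \<in> borel_measurable lebesgue" "grad u \<in> borel_measurable lebesgue"
  using continuous_grad[OF test_functions_Ck[OF assms]] test_functions_Ck[OF assms, of 0]
  by (auto intro: continuous_measurable_lebesgue)

text \<open>Differentiate the translation-invariant integral \<open>\<integral> u (x + t v) dx\<close> at \<open>t = 0\<close>.\<close>
lemma integral_grad_eq_0:
  assumes u: "u \<in> test_functions UNIV"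
  shows "(\<integral>x. grad u x \<bullet> v \<partial>lborel) = 0"
proof -
  obtain M where M: "M > 0" "\<And>x. norm (grad u x) \<le> M" using test_functions_bounded[OF u] by metis
  obtain C where C: "compact C" "\<And>x. x \<notin> C \<Longrightarrow> u x = 0" using test_functions_support[OF u] by metis
  obtain R where R: "\<And>x. x \<in> C \<Longrightarrow> norm x \<le> R" using compact_imp_bounded[OF C(1)] by (auto simp: bounded_iff)
  have C1: "Ck (Suc 0) u" by (rule test_functions_Ck[OF u])
  have [measurable]: "u \<in> borel_measurable borel" using test_functions_Ck[OF u, of 0] by (auto intro: borel_measurable_continuous_onI)
  have [measurable]: "grad u \<in> borel_measurable borel" by (intro borel_measurable_continuous_onI continuous_grad C1)
  define t where "t n = 1 / real (Suc n)" for n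
  define h where "h n x = (u (t n *\<^sub>R v + x) - u x) / t n" for n x
  have "onorm (\<lambda>v. grad u x \<bullet> v) \<le> M" for x
    by (rule onorm_bound) (use M in \<open>auto intro!: order_trans[OF Cauchy_Schwarz_ineq2] mult_right_mono simp: less_imp_le\<close>)
  then have lip: "\<bar>u x - u y\<bar> \<le> M * norm (x - y)" for x y
    using differentiable_bound[of UNIV u "\<lambda>x v. grad u x \<bullet> v" M x y] has_derivative_grad[OF C1] by simp
  have t0: "t n > 0" "t n \<le> 1" for n by (simp_all add: t_def)
  \<comment> \<open>The Lipschitz bound dominates the quotients inside a ball. Since
    \<open>t n\<close> is at most 1, the support of \<open>u\<close> is shifted by at most
    \<open>norm v\<close>, so outside that ball both values vanish.\<close>
  have bound: "\<bar>h n x\<bar> \<le> M * norm v * indicator (cball 0 (\<bar>R\<bar> + norm v)) x" for n x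
  proof (cases "norm x \<le> \<bar>R\<bar> + norm v")
    case True
    have "\<bar>u (t n *\<^sub>R v + x) - u x\<bar> \<le> M * norm v * t n" using lip[of "t n *\<^sub>R v + x" x] t0[of n] by (simp add: mult.assoc mult.commute[of "norm v"])
    then show ?thesis using True t0[of n] by (simp add: h_def abs_divide pos_divide_le_eq)
  next
    case False
    have "norm x \<le> norm (t n *\<^sub>R v + x) + norm (t n *\<^sub>R v)" using norm_triangle_ineq4[of "t n *\<^sub>R v + x" "t n *\<^sub>R v"] by simp
    moreover have "norm (t n *\<^sub>R v) \<le> norm v" using mult_left_le_one_le[of "norm v" "t n"] t0[of n] by simp
    ultimately have "\<not> norm x \<le> R" "\<not> norm (t n *\<^sub>R v + x) \<le> R" using False norm_ge_zero[of v] by linarith+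
    then have "x \<notin> C" "t n *\<^sub>R v + x \<notin> C" using R by blast+
    then show ?thesis using C(2) False by (simp add: h_def)
  qed
  have lim: "(\<lambda>n. h n x) \<longlonglongrightarrow> grad u x \<bullet> v" for x
  proof -
    have "((\<lambda>s. u (s *\<^sub>R v + x)) has_derivative (\<lambda>s. grad u x \<bullet> (s *\<^sub>R v))) (at 0)"
    proof -
      have "((\<lambda>s. s *\<^sub>R v + x) has_derivative (\<lambda>s. s *\<^sub>R v)) (at 0)" by (auto intro!: derivative_eq_intros)
      from has_derivative_compose[OF this has_derivative_grad[OF C1]] show ?thesis by simp
    qed
    then have "((\<lambda>s. u (s *\<^sub>R v + x)) has_real_derivative (grad u x \<bullet> v)) (at 0)"
      by (simp add: has_field_derivative_def mult_commute_abs)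
    then have "((\<lambda>s. (u (s *\<^sub>R v + x) - u x) / s) \<longlongrightarrow> grad u x \<bullet> v) (at 0)"
      by (simp add: DERIV_def)
    moreover have "t \<longlonglongrightarrow> 0" unfolding t_def by (rule LIMSEQ_Suc[OF lim_const_over_n])
    then have "filterlim t (at 0) sequentially"
      unfolding filterlim_at using t0(1) by (auto simp: less_imp_neq[THEN not_sym])
    ultimately show ?thesis unfolding h_def by (rule filterlim_compose)
  qed
  have "(\<lambda>n. \<integral>x. h n x \<partial>lborel) \<longlonglongrightarrow> (\<integral>x. grad u x \<bullet> v \<partial>lborel)"
  proof (rule integral_dominated_convergence)
    show "integrable lborel (\<lambda>x. M * norm v * indicator (cball 0 (\<bar>R\<bar> + norm v)) x)"
      by (intro integrable_mult_right integrable_real_indicator emeasure_bounded_finite) auto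
  qed (use bound lim in \<open>auto simp: h_def[abs_def]\<close>)
  moreover have "(\<integral>x. h n x \<partial>lborel) = 0" for n
  proof -
    have i: "integrable lborel u" by (rule test_functions_integrable[OF u])
    have i2: "integrable lborel (\<lambda>x. u (t n *\<^sub>R v + x))"
      using integrable_distr[of "(+) (t n *\<^sub>R v)" lborel borel u] i by (simp add: lborel_distr_plus)
    have "(\<integral>x. u (t n *\<^sub>R v + x) \<partial>lborel) = (\<integral>x. u x \<partial>distr lborel borel ((+) (t n *\<^sub>R v)))"
      by (subst integral_distr) auto
    then have "(\<integral>x. u (t n *\<^sub>R v + x) \<partial>lborel) = (\<integral>x. u x \<partial>lborel)" by (simp add: lborel_distr_plus)
    then show ?thesis using i i2 by (simp add: h_def)
  qed
  ultimately have "(\<lambda>n. 0) \<longlonglongrightarrow> (\<integral>x. grad u x \<bullet> v \<partial>lborel)" by simp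
  then show ?thesis using LIMSEQ_unique[OF _ tendsto_const] by metis
qed

lemma test_functions_mult:
  assumes "\<And>k. Ck k u" "v \<in> test_functions \<Omega>"
  shows "(\<lambda>x. u x * v x) \<in> test_functions \<Omega>"
proof -
  obtain C where C: "compact C" "C \<subseteq> \<Omega>" "\<And>x. x \<notin> C \<Longrightarrow> v x = 0" using test_functions_support[OF assms(2)] by metis
  show ?thesis by (rule test_functionsI[where C=C]) (use C in \<open>auto intro!: Ck_mult assms test_functions_Ck[OF assms(2)]\<close>)
qed

text \<open>Each partial derivative of the compactly supported product integrates to 0.\<close>

lemma integral_by_parts:
  assumes u: "u \<in> test_functions UNIV" and \<phi>: "\<phi> \<in> test_functions UNIV"
  shows "(\<integral>x. u x * (grad \<phi> x \<bullet> b) \<partial>lebesgue) = - (\<integral>x. (grad u x \<bullet> b) * \<phi> x \<partial>lebesgue)"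
proof -
  have C1: "Ck (Suc 0) u" "Ck (Suc 0) \<phi>" by (rule test_functions_Ck[OF u] test_functions_Ck[OF \<phi>])+
  have [measurable]: "u \<in> borel_measurable borel" "\<phi> \<in> borel_measurable borel"
    using test_functions_Ck[OF u, of 0] test_functions_Ck[OF \<phi>, of 0] by (auto intro: borel_measurable_continuous_onI)
  have [measurable]: "grad u \<in> borel_measurable borel" "grad \<phi> \<in> borel_measurable borel"
    using C1 by (auto intro!: borel_measurable_continuous_onI continuous_grad)
  have int: "integrable lborel (\<lambda>x. w x * (grad z x \<bullet> b))"
    if w: "w \<in> test_functions UNIV" and z: "z \<in> test_functions UNIV" for w z
  proof -
    have [measurable]: "w \<in> borel_measurable borel" "grad z \<in> borel_measurable borel"
      using test_functions_Ck[OF w, of 0] test_functions_Ck[OF z, of "Suc 0"]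
      by (auto intro!: borel_measurable_continuous_onI continuous_grad simp del: Ck.simps(2))
    obtain M where M: "M > 0" "\<And>x. norm (grad z x) \<le> M" using test_functions_bounded[OF z] by metis
    show ?thesis
    proof (rule Bochner_Integration.integrable_bound)
      show "integrable lborel (\<lambda>x. (M * norm b) * w x)" by (intro integrable_mult_right test_functions_integrable[OF w])
      have "\<bar>w x * (grad z x \<bullet> b)\<bar> \<le> \<bar>(M * norm b) * w x\<bar>" for x
      proof -
        have "\<bar>grad z x \<bullet> b\<bar> \<le> M * norm b"
          using Cauchy_Schwarz_ineq2[of "grad z x" b] mult_right_mono[OF M(2)[of x] norm_ge_zero[of b]] by linarith
        then have "\<bar>grad z x \<bullet> b\<bar> * \<bar>w x\<bar> \<le> M * norm b * \<bar>w x\<bar>" by (intro mult_right_mono) auto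
        then show ?thesis using M(1) by (simp add: abs_mult ac_simps)
      qed
      then show "AE x in lborel. norm (w x * (grad z x \<bullet> b)) \<le> norm ((M * norm b) * w x)" by simp
    qed measurable
  qed
  have "(\<lambda>x. u x * \<phi> x) \<in> test_functions UNIV" by (intro test_functions_mult test_functions_Ck[OF u] \<phi>)
  moreover have "grad (\<lambda>x. u x * \<phi> x) x \<bullet> b = u x * (grad \<phi> x \<bullet> b) + \<phi> x * (grad u x \<bullet> b)" for x
    by (simp add: grad_mult[OF C1] inner_add_left)
  ultimately have "(\<integral>x. u x * (grad \<phi> x \<bullet> b) + \<phi> x * (grad u x \<bullet> b) \<partial>lborel) = 0"
    using integral_grad_eq_0[of "\<lambda>x. u x * \<phi> x" b] by simp
  then have "(\<integral>x. u x * (grad \<phi> x \<bullet> b) \<partial>lborel) = - (\<integral>x. (grad u x \<bullet> b) * \<phi> x \<partial>lborel)"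
    by (subst (asm) Bochner_Integration.integral_add) (auto intro!: int u \<phi> simp: mult.commute)
  then show ?thesis by (simp add: integral_completion)
qed

subsection \<open>The fundamental lemma of the calculus of variations\<close>

lemma Lp_loc_compact_integrable:
  assumes g: "g \<in> Lp_loc 1 \<Omega>" and \<Omega>: "open \<Omega>" and C: "compact C" "C \<subseteq> \<Omega>"
  shows "integrable lebesgue (\<lambda>x. indicator C x *\<^sub>R (g x :: 'b::euclidean_space))"
proof (rule Bochner_Integration.integrable_bound)
  have Cm: "C \<in> sets lebesgue" using C(1) by (simp add: borel_compact)
  show "integrable lebesgue (\<lambda>x. indicator C x *\<^sub>R (norm (g x) powr 1))"
    using g C by (auto simp: Lp_loc_def set_integrable_def)
  have "(\<lambda>x. indicator \<Omega> x *\<^sub>R g x) \<in> borel_measurable lebesgue"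
    using g \<Omega> by (subst borel_measurable_restrict_space_iff[symmetric]) (auto simp: Lp_loc_def)
  then have "(\<lambda>x. indicator C x *\<^sub>R (indicator \<Omega> x *\<^sub>R g x)) \<in> borel_measurable lebesgue"
    using Cm by measurable
  moreover have "(\<lambda>x. indicator C x *\<^sub>R (indicator \<Omega> x *\<^sub>R g x)) = (\<lambda>x. indicator C x *\<^sub>R g x)"
    using C(2) by (auto simp: fun_eq_iff split: split_indicator)
  ultimately show "(\<lambda>x. indicator C x *\<^sub>R g x) \<in> borel_measurable lebesgue" by simp
qed (auto simp: split: split_indicator)

lemma Lp_loc_test_integrable:
  fixes g :: "'a::euclidean_space \<Rightarrow> 'b::euclidean_space"
  assumes g: "g \<in> Lp_loc 1 \<Omega>" and \<Omega>: "open \<Omega>" and \<phi>: "\<phi> \<in> test_functions \<Omega>"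
  shows "integrable lebesgue (\<lambda>x. \<phi> x *\<^sub>R g x)"
proof -
  obtain M where M: "M > 0" "\<And>x. \<bar>\<phi> x\<bar> \<le> M" using test_functions_bounded[OF \<phi>] by metis
  obtain C where C: "compact C" "C \<subseteq> \<Omega>" "\<And>x. x \<notin> C \<Longrightarrow> \<phi> x = 0" using test_functions_support[OF \<phi>] by metis
  have int: "integrable lebesgue (\<lambda>x. indicator C x *\<^sub>R g x)" by (rule Lp_loc_compact_integrable[OF g \<Omega> C(1,2)])
  have [measurable]: "\<phi> \<in> borel_measurable lebesgue" by (rule test_functions_measurable[OF \<phi>])
  have "integrable lebesgue (\<lambda>x. \<phi> x *\<^sub>R (indicator C x *\<^sub>R g x))"
  proof (rule Bochner_Integration.integrable_bound)
    show "integrable lebesgue (\<lambda>x. M *\<^sub>R (indicator C x *\<^sub>R g x))" using int by (rule integrable_scaleR_right)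
    show "(\<lambda>x. \<phi> x *\<^sub>R (indicator C x *\<^sub>R g x)) \<in> borel_measurable lebesgue"
      by (intro borel_measurable_scaleR borel_measurable_integrable[OF int]) measurable
    show "AE x in lebesgue. norm (\<phi> x *\<^sub>R (indicator C x *\<^sub>R g x)) \<le> norm (M *\<^sub>R (indicator C x *\<^sub>R g x))"
      using M by (auto simp: abs_mult intro!: mult_right_mono AE_I2)
  qed
  moreover have "(\<lambda>x. \<phi> x *\<^sub>R (indicator C x *\<^sub>R g x)) = (\<lambda>x. \<phi> x *\<^sub>R g x)"
    using C(3) by (auto simp: fun_eq_iff split: split_indicator)
  ultimately show ?thesis by simp
qed

text \<open>Products of \<open>flat 0\<close> over the coordinates are test functions that vanish
  outside the closed box, are bounded by 1 and converge to the indicator of the open box.\<close>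

lemma integral_box_eq_0:
  fixes h :: "'a::euclidean_space \<Rightarrow> real"
  assumes h: "h \<in> Lp_loc 1 \<Omega>" and \<Omega>: "open \<Omega>"
    and zero: "\<And>\<phi>. \<phi> \<in> test_functions \<Omega> \<Longrightarrow> (\<integral>x. h x * \<phi> x \<partial>lebesgue) = 0"
    and sub: "cbox l r \<subseteq> \<Omega>"
  shows "(\<integral>x. indicator (box l r) x * h x \<partial>lebesgue) = 0"
proof -
  define \<phi> where "\<phi> n x = (\<Prod>b\<in>Basis. flat 0 (real n * (x \<bullet> b - l \<bullet> b)) * flat 0 (real n * (r \<bullet> b - x \<bullet> b)))" for n :: nat and x :: 'a
  have \<phi>0: "\<phi> n x = 0" if out: "x \<notin> cbox l r" for n x
  proof -
    obtain b where b: "b \<in> Basis" "x \<bullet> b < l \<bullet> b \<or> r \<bullet> b < x \<bullet> b" using out by (auto simp: mem_box not_le)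
    then have "flat 0 (real n * (x \<bullet> b - l \<bullet> b)) * flat 0 (real n * (r \<bullet> b - x \<bullet> b)) = 0"
      by (auto simp: mult_nonneg_nonpos)
    then show ?thesis unfolding \<phi>_def using b(1) by (intro prod_zero) auto
  qed
  have \<phi>: "\<phi> n \<in> test_functions \<Omega>" for n
  proof (rule test_functionsI[OF _ compact_cbox sub])
    show "Ck k (\<phi> n)" for k
      unfolding \<phi>_def
      by (intro Ck_prod Ck_mult Ck_compose[OF flat_Ck] Ck_cmult Ck_diff Ck_const Ck_bounded_linear bounded_linear_inner_left) auto
    show "\<phi> n x = 0" if "x \<notin> cbox l r" for x by (rule \<phi>0[OF that])
  qed
  have \<phi>01: "0 \<le> \<phi> n x" "\<phi> n x \<le> 1" for n x
    unfolding \<phi>_def by (auto intro!: prod_nonneg prod_le_1 mult_le_one flat_0_le_1)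

  have lim: "(\<lambda>n. \<phi> n x) \<longlonglongrightarrow> indicator (box l r) x" for x
  proof -
    have "(\<lambda>n. \<phi> n x) \<longlonglongrightarrow> (\<Prod>b\<in>Basis. (if x \<bullet> b - l \<bullet> b > 0 then 1 else 0) * (if r \<bullet> b - x \<bullet> b > 0 then 1 else 0))"
      unfolding \<phi>_def by (intro tendsto_prod tendsto_mult flat_tendsto_1)
    also have "(\<Prod>b\<in>Basis. (if x \<bullet> b - l \<bullet> b > 0 then 1 else 0) * (if r \<bullet> b - x \<bullet> b > 0 then 1 else 0::real)) = indicator (box l r) x"
      by (cases "x \<in> box l r") (auto simp: mem_box intro!: prod_zero)
    finally show ?thesis .
  qed
  have int: "integrable lebesgue (\<lambda>x. indicator (cbox l r) x *\<^sub>R h x)"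
    by (rule Lp_loc_compact_integrable[OF h \<Omega> compact_cbox sub])
  have hc: "h x * \<phi> n x = (indicator (cbox l r) x *\<^sub>R h x) * \<phi> n x" for n x
    using \<phi>0[of x n] by (auto split: split_indicator)
  have "(\<lambda>n. \<integral>x. (indicator (cbox l r) x *\<^sub>R h x) * \<phi> n x \<partial>lebesgue) \<longlonglongrightarrow> (\<integral>x. (indicator (cbox l r) x *\<^sub>R h x) * indicator (box l r) x \<partial>lebesgue)"
  proof (rule integral_dominated_convergence)
    show "integrable lebesgue (\<lambda>x. norm (indicator (cbox l r) x *\<^sub>R h x))" using int by (rule integrable_norm)
    show "AE x in lebesgue. norm ((indicator (cbox l r) x *\<^sub>R h x) * \<phi> n x) \<le> norm (indicator (cbox l r) x *\<^sub>R h x)" for n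
      using \<phi>01 by (auto simp: abs_mult intro!: mult_left_le split: split_indicator)
    show "AE x in lebesgue. (\<lambda>n. (indicator (cbox l r) x *\<^sub>R h x) * \<phi> n x) \<longlonglongrightarrow> (indicator (cbox l r) x *\<^sub>R h x) * indicator (box l r) x"
      by (intro AE_I2 tendsto_mult tendsto_const lim)
    show "(\<lambda>x. (indicator (cbox l r) x *\<^sub>R h x) * indicator (box l r) x) \<in> borel_measurable lebesgue"
      by (intro borel_measurable_times borel_measurable_integrable[OF int] borel_measurable_indicator) simp
    show "(\<lambda>x. (indicator (cbox l r) x *\<^sub>R h x) * \<phi> n x) \<in> borel_measurable lebesgue" for n
      by (intro borel_measurable_times borel_measurable_integrable[OF int] test_functions_measurable[OF \<phi>])
  qed
  then have "(\<lambda>n. 0) \<longlonglongrightarrow> (\<integral>x. (indicator (cbox l r) x *\<^sub>R h x) * indicator (box l r) x \<partial>lebesgue)"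
    by (simp only: hc[symmetric] zero[OF \<phi>])
  then have "(\<integral>x. (indicator (cbox l r) x *\<^sub>R h x) * indicator (box l r) x \<partial>lebesgue) = 0"
    using LIMSEQ_unique[OF _ tendsto_const] by metis
  moreover have "(\<lambda>x. (indicator (cbox l r) x *\<^sub>R h x) * indicator (box l r) x) = (\<lambda>x. indicator (box l r) x * h x)"
    using box_subset_cbox[of l r] by (auto simp: fun_eq_iff split: split_indicator)
  ultimately show ?thesis by simp
qed

text \<open>Open boxes form an intersection-stable generator of the Borel sets, so the measures
  whose densities are the positive and the negative part of \<open>H\<close> coincide.
  \<open>ennreal\<close> truncates at 0, which is how these parts are written.\<close>

lemma AE_0_if_integral_boxes_0:
  fixes H :: "'a::euclidean_space \<Rightarrow> real"
  assumes H: "integrable lborel H" and zero: "\<And>a b. (\<integral>x. indicator (box a b) x * H x \<partial>lborel) = 0"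
  shows "AE x in lborel. H x = 0"
proof -
  have [measurable]: "H \<in> borel_measurable borel" using borel_measurable_integrable[OF H] by simp
  let ?E = "range (\<lambda>(a, b). box a b :: 'a set)"
  let ?P = "density lborel (\<lambda>x. ennreal (H x))" and ?N = "density lborel (\<lambda>x. ennreal (- H x))"
  have fin: "(\<integral>\<^sup>+x. ennreal (H x) * indicator S x \<partial>lborel) \<noteq> \<infinity>" "(\<integral>\<^sup>+x. ennreal (- H x) * indicator S x \<partial>lborel) \<noteq> \<infinity>" for S
  proof -
    have "(\<integral>\<^sup>+x. ennreal (norm (H x)) \<partial>lborel) < \<infinity>" using H by (simp add: integrable_iff_bounded)
    moreover have "(\<integral>\<^sup>+x. ennreal (H x) * indicator S x \<partial>lborel) \<le> (\<integral>\<^sup>+x. ennreal (norm (H x)) \<partial>lborel)"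
      "(\<integral>\<^sup>+x. ennreal (- H x) * indicator S x \<partial>lborel) \<le> (\<integral>\<^sup>+x. ennreal (norm (H x)) \<partial>lborel)"
      by (auto intro!: nn_integral_mono ennreal_leI split: split_indicator)
    ultimately show "(\<integral>\<^sup>+x. ennreal (H x) * indicator S x \<partial>lborel) \<noteq> \<infinity>" "(\<integral>\<^sup>+x. ennreal (- H x) * indicator S x \<partial>lborel) \<noteq> \<infinity>"
      by (auto simp: top_unique)
  qed
  have "?P = ?N"
  proof (rule measure_eqI_generator_eq[where \<Omega>=UNIV and E="?E" and A="\<lambda>n. box (- (real n *\<^sub>R One)) (real n *\<^sub>R One)"])
    show "Int_stable ?E" by (auto simp: Int_stable_def box_Int_box)
    show "sets ?P = sigma_sets UNIV ?E" "sets ?N = sigma_sets UNIV ?E" by (simp_all add: borel_eq_box)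
    show "(\<Union>n. box (- (real n *\<^sub>R One)) (real n *\<^sub>R One)) = (UNIV :: 'a set)" by (rule UN_box_eq_UNIV)
    show "emeasure ?P (box (- (real n *\<^sub>R One)) (real n *\<^sub>R One)) \<noteq> \<infinity>" for n
      using fin by (subst emeasure_density) auto
    fix S assume "S \<in> ?E"
    then obtain a b where S: "S = box a b" by auto
    have i: "integrable lborel (\<lambda>x. indicator S x * H x)"
      unfolding S using integrable_mult_indicator[OF _ H, of "box a b"] by simp
    have pm: "ennreal (indicator S x * H x) = ennreal (H x) * indicator S x" "ennreal (- (indicator S x * H x)) = ennreal (- H x) * indicator S x" for x
      by (auto split: split_indicator)
    have e1: "enn2real (\<integral>\<^sup>+x. ennreal (H x) * indicator S x \<partial>lborel) = enn2real (\<integral>\<^sup>+x. ennreal (- H x) * indicator S x \<partial>lborel)"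
      using real_lebesgue_integral_def[OF i] zero[of a b, folded S] unfolding pm by linarith
    have e2: "ennreal (enn2real (\<integral>\<^sup>+x. ennreal (H x) * indicator S x \<partial>lborel)) = (\<integral>\<^sup>+x. ennreal (H x) * indicator S x \<partial>lborel)"
      "ennreal (enn2real (\<integral>\<^sup>+x. ennreal (- H x) * indicator S x \<partial>lborel)) = (\<integral>\<^sup>+x. ennreal (- H x) * indicator S x \<partial>lborel)"
      using fin[of S] by (simp_all add: less_top)
    have "(\<integral>\<^sup>+x. ennreal (H x) * indicator S x \<partial>lborel) = (\<integral>\<^sup>+x. ennreal (- H x) * indicator S x \<partial>lborel)"
      using e2(1) unfolding e1 e2(2) by (rule sym)
    then show "emeasure ?P S = emeasure ?N S"
      unfolding S by (simp add: emeasure_density)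
  qed auto
  then have "AE x in lborel. ennreal (H x) = ennreal (- H x)"
    by (subst (asm) sigma_finite_measure.density_unique_iff[OF sigma_finite_lborel]) auto
  then show ?thesis
  proof eventually_elim
    case (elim x)
    then show ?case by (cases "H x \<ge> 0") (auto simp: ennreal_neg not_le ennreal_eq_0_iff dest: sym)
  qed
qed

theorem fundamental_lemma_punctured:
  fixes h :: "'a::euclidean_space \<Rightarrow> real"
  assumes h: "h \<in> Lp_loc 1 (- {0})"
    and zero: "\<And>\<phi>. \<phi> \<in> test_functions (- {0}) \<Longrightarrow> (\<integral>x. h x * \<phi> x \<partial>lebesgue) = 0"
  shows "AE x in lebesgue. h x = 0"
proof -
  have op: "open (- {0::'a})" by auto
  have box: "AE x in lebesgue. x \<in> box p q \<longrightarrow> h x = 0" if sub: "cbox p q \<subseteq> - {0}" for p q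
  proof -
    have "integrable lebesgue (\<lambda>x. indicator (box p q) x *\<^sub>R (indicator (cbox p q) x *\<^sub>R h x))"
      by (intro integrable_mult_indicator Lp_loc_compact_integrable[OF h op compact_cbox sub]) auto
    moreover have "(\<lambda>x. indicator (box p q) x *\<^sub>R (indicator (cbox p q) x *\<^sub>R h x)) = (\<lambda>x. indicator (box p q) x * h x)"
      using box_subset_cbox[of p q] by (auto simp: fun_eq_iff split: split_indicator)
    ultimately have int: "integrable lebesgue (\<lambda>x. indicator (box p q) x * h x)" by simp
    obtain H where H: "H \<in> borel_measurable lborel" "AE x in lborel. indicator (box p q) x * h x = H x"
      using completion_ex_borel_measurable_real[OF borel_measurable_integrable[OF int]] by auto
    note [measurable] = H(1)
    have H2: "AE x in lebesgue. indicator (box p q) x * h x = H x" by (rule AE_completion[OF H(2)])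
    have Hm: "H \<in> borel_measurable lebesgue" using H(1) by (rule measurable_completion)
    have Hi: "integrable lebesgue H"
      using int by (rule Bochner_Integration.integrable_bound) (use H2 Hm in auto)
    then have "integrable lborel H" using integrable_completion[OF H(1)] by simp
    moreover have "(\<integral>x. indicator (box a b) x * H x \<partial>lborel) = 0" for a b
    proof -
      have "(\<integral>x. indicator (box a b) x * H x \<partial>lborel) = (\<integral>x. indicator (box a b) x * H x \<partial>lebesgue)"
        by (rule integral_completion[symmetric]) measurable
      also have "\<dots> = (\<integral>x. indicator (box a b \<inter> box p q) x * h x \<partial>lebesgue)"
      proof (rule integral_cong_AE)
        show "AE x in lebesgue. indicator (box a b) x * H x = indicator (box a b \<inter> box p q) x * h x"
          using H2 by eventually_elim (auto split: split_indicator)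
        then show "(\<lambda>x. indicator (box a b \<inter> box p q) x * h x) \<in> borel_measurable lebesgue"
          by (rule borel_measurable_AE[rotated]) (intro borel_measurable_times Hm borel_measurable_indicator, simp)
        show "(\<lambda>x. indicator (box a b) x * H x) \<in> borel_measurable lebesgue"
          by (intro borel_measurable_times Hm borel_measurable_indicator) simp
      qed
      also have "\<dots> = 0"
      proof -
        obtain l r where lr: "box a b \<inter> box p q = box l r" unfolding box_Int_box by blast
        show ?thesis
        proof (cases "box l r = {}")
          case False
          then have "cbox l r \<subseteq> cbox p q" using lr subset_box(2)[of l r p q] box_subset_cbox subset_box
            by (metis (no_types, lifting) box_ne_empty(2) inf_le2 order_trans closure_box closure_minimal closed_cbox)
          then show ?thesis unfolding lr using sub by (intro integral_box_eq_0[OF h op zero]) auto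
        qed (simp add: lr)
      qed
      finally show ?thesis .
    qed
    ultimately have "AE x in lborel. H x = 0" by (rule AE_0_if_integral_boxes_0)
    then have "AE x in lebesgue. H x = 0" by (rule AE_completion)
    then show ?thesis using H2 by eventually_elim (auto split: split_indicator)
  qed
  \<comment> \<open>Boxes with closure off the origin that cover the punctured space: the coordinate
    along \<open>b\<close> runs from 1/n to n or from -n to -1/n according to \<open>s\<close>, the
    others from -n to n.\<close>
  define P where "P s n b = - real n *\<^sub>R One + (if s then (real n + 1 / real n) *\<^sub>R b else 0)" for s :: bool and n :: nat and b :: 'a
  define Q where "Q s n b = real n *\<^sub>R One - (if s then 0 else (real n + 1 / real n) *\<^sub>R b)" for s :: bool and n :: nat and b :: 'a
  have "AE x in lebesgue. \<forall>b\<in>Basis. \<forall>n s. n > 0 \<longrightarrow> x \<in> box (P s n b) (Q s n b) \<longrightarrow> h x = 0"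
    unfolding AE_ball_countable[OF countable_finite[OF finite_Basis]] AE_all_countable
  proof (intro ballI allI)
    fix b :: 'a and n :: nat and s assume b: "b \<in> Basis"
    show "AE x in lebesgue. n > 0 \<longrightarrow> x \<in> box (P s n b) (Q s n b) \<longrightarrow> h x = 0"
    proof (cases "n > 0")
      case True
      have "P True n b \<bullet> b > 0" "Q False n b \<bullet> b < 0" using b True by (simp_all add: P_def Q_def inner_add_left inner_diff_left)
      then have "cbox (P s n b) (Q s n b) \<subseteq> - {0}" using b by (cases s) (auto simp: mem_box not_le intro!: bexI[of _ b])
      then show ?thesis using box by simp
    qed simp
  qed
  then show ?thesis using AE_nonzero
  proof eventually_elim
    case (elim x)
    then obtain b where b: "b \<in> Basis" "x \<bullet> b \<noteq> 0" using euclidean_all_zero_iff by metis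
    obtain n :: nat where n: "real n > max (norm x) (1 / \<bar>x \<bullet> b\<bar>)" using reals_Archimedean2 by blast
    have n0: "real n > 0" using n by (smt (verit) norm_ge_zero)
    have bn: "1 / real n < \<bar>x \<bullet> b\<bar>" using n n0 b by (simp add: field_simps)
    have c: "- real n < x \<bullet> i \<and> x \<bullet> i < real n" if "i \<in> Basis" for i
      using Basis_le_norm[OF that, of x] n by (auto simp: abs_le_iff)
    have "x \<in> box (P (x \<bullet> b > 0) n b) (Q (x \<bullet> b > 0) n b)"
      unfolding mem_box
    proof (intro ballI)
      fix i :: 'a assume i: "i \<in> Basis"
      show "P (x \<bullet> b > 0) n b \<bullet> i < x \<bullet> i \<and> x \<bullet> i < Q (x \<bullet> b > 0) n b \<bullet> i"
        using c[OF i] bn b i by (cases "i = b") (auto simp: P_def Q_def inner_add_left inner_diff_left inner_Basis abs_if)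
    qed
    then show ?case using elim b n0 by auto
  qed
qed

lemma weak_grad_unique:
  fixes u :: "'a::euclidean_space \<Rightarrow> real"
  assumes g: "is_weak_grad (- {0}) u g" and g': "is_weak_grad (- {0}) u g'"
  shows "AE x in lebesgue. g x = g' x"
proof -
  have op: "open (- {0::'a})" by auto
  have gl: "g \<in> Lp_loc 1 (- {0})" "g' \<in> Lp_loc 1 (- {0})" using g g' by (auto simp: is_weak_grad_def)
  have "AE x in lebesgue. (g x - g' x) \<bullet> b = 0" if b: "b \<in> Basis" for b
  proof (rule fundamental_lemma_punctured)
    show "(\<lambda>x. (g x - g' x) \<bullet> b) \<in> Lp_loc 1 (- {0})"
      unfolding Lp_loc_def
    proof (intro CollectI conjI allI impI)
      show "(\<lambda>x. (g x - g' x) \<bullet> b) \<in> borel_measurable (lebesgue_on (- {0}))"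
        using gl by (auto simp: Lp_loc_def)
      fix C :: "'a set" assume C: "compact C \<and> C \<subseteq> - {0}"
      have "integrable lebesgue (\<lambda>x. (indicator C x *\<^sub>R g x - indicator C x *\<^sub>R g' x) \<bullet> b)"
        using C op by (intro Bochner_Integration.integrable_inner_left Bochner_Integration.integrable_diff Lp_loc_compact_integrable[OF gl(1)] Lp_loc_compact_integrable[OF gl(2)]) auto
      then have "integrable lebesgue (\<lambda>x. norm ((indicator C x *\<^sub>R g x - indicator C x *\<^sub>R g' x) \<bullet> b))" by (rule integrable_norm)
      moreover have "(\<lambda>x. norm ((indicator C x *\<^sub>R g x - indicator C x *\<^sub>R g' x) \<bullet> b)) = (\<lambda>x. indicator C x *\<^sub>R (norm ((g x - g' x) \<bullet> b) powr 1))"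
        by (auto simp: fun_eq_iff split: split_indicator)
      ultimately show "(\<lambda>x. norm ((g x - g' x) \<bullet> b) powr 1) absolutely_integrable_on C"
        by (simp add: set_integrable_def)
    qed
    fix \<phi> assume \<phi>: "\<phi> \<in> test_functions (- {0::'a})"
    have i: "integrable lebesgue (\<lambda>x. (\<phi> x *\<^sub>R g x) \<bullet> b)" "integrable lebesgue (\<lambda>x. (\<phi> x *\<^sub>R g' x) \<bullet> b)"
      by (intro Bochner_Integration.integrable_inner_left Lp_loc_test_integrable[OF _ op \<phi>] gl)+
    have "(\<integral>x. (g x \<bullet> b) * \<phi> x \<partial>lebesgue) = (\<integral>x. (g' x \<bullet> b) * \<phi> x \<partial>lebesgue)"
    proof -
      have "(\<integral>x. u x * frechet_derivative \<phi> (at x) b \<partial>lebesgue) = - (\<integral>x. (g x \<bullet> b) * \<phi> x \<partial>lebesgue)"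
        using g \<phi> b by (simp add: is_weak_grad_def)
      moreover have "(\<integral>x. u x * frechet_derivative \<phi> (at x) b \<partial>lebesgue) = - (\<integral>x. (g' x \<bullet> b) * \<phi> x \<partial>lebesgue)"
        using g' \<phi> b by (simp add: is_weak_grad_def)
      ultimately show ?thesis by linarith
    qed
    moreover have "((g x - g' x) \<bullet> b) * \<phi> x = (\<phi> x *\<^sub>R g x) \<bullet> b - (\<phi> x *\<^sub>R g' x) \<bullet> b" for x
      by (simp add: inner_diff_left algebra_simps)
    ultimately show "(\<integral>x. ((g x - g' x) \<bullet> b) * \<phi> x \<partial>lebesgue) = 0"
      by (simp only: Bochner_Integration.integral_diff[OF i]) (simp add: mult.commute)
  qed
  then have "AE x in lebesgue. \<forall>b\<in>Basis. (g x - g' x) \<bullet> b = 0"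
    by (simp add: AE_ball_countable[OF countable_finite[OF finite_Basis]])
  then show ?thesis
  proof eventually_elim
    case (elim x)
    then have "g x - g' x = 0" using euclidean_all_zero_iff by blast
    then show ?case by simp
  qed
qed

subsection \<open>Weighted one-dimensional inequalities\<close>

text \<open>The fundamental theorem of calculus, then Cauchy-Schwarz after splitting
  \<open>W'\<close> by the powers -1/2 and 1/2 of \<open>h\<close>. In \<open>ennreal\<close> the
  weighted integrals may be infinite.\<close>

lemma weighted_cauchy_schwarz:
  fixes W W' h :: "real \<Rightarrow> real"
  assumes rs: "r \<le> s" and h: "h \<in> borel_measurable borel" "\<And>t. t \<in> {r..s} \<Longrightarrow> 0 < h t"
    and W: "\<And>t. (W has_real_derivative W' t) (at t)" and W': "continuous_on UNIV W'"
  shows "ennreal ((W r - W s)\<^sup>2) \<le>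
    (\<integral>\<^sup>+t. ennreal (1 / h t) * indicator {r..s} t \<partial>lborel) * (\<integral>\<^sup>+t. ennreal (h t * (W' t)\<^sup>2) * indicator {r..s} t \<partial>lborel)"
proof -
  note [measurable] = h(1)
  have [measurable]: "W' \<in> borel_measurable borel" using W' by (rule borel_measurable_continuous_onI)
  have "(\<integral>t. indicator {r..s} t *\<^sub>R W' t \<partial>lborel) = W s - W r"
    by (rule integral_FTC_Icc[OF rs])
       (use W W' in \<open>auto simp: has_real_derivative_iff_has_vector_derivative[symmetric] intro: DERIV_subset continuous_on_subset\<close>)
  then have "\<bar>W r - W s\<bar> = norm (\<integral>t. indicator {r..s} t *\<^sub>R W' t \<partial>lborel)" by (simp add: abs_minus_commute)
  also have "ennreal \<dots> \<le> (\<integral>\<^sup>+t. ennreal (norm (indicator {r..s} t *\<^sub>R W' t)) \<partial>lborel)"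
    by (rule integral_norm_bound_ennreal) (intro borel_integrable_compact continuous_on_subset[OF W'], auto)
  finally have "ennreal \<bar>W r - W s\<bar> \<le> (\<integral>\<^sup>+t. ennreal (norm (indicator {r..s} t *\<^sub>R W' t)) \<partial>lborel)" by simp
  also have "\<dots> = (\<integral>\<^sup>+t. (ennreal (sqrt (1 / h t)) * indicator {r..s} t) * (ennreal (sqrt (h t) * \<bar>W' t\<bar>) * indicator {r..s} t) \<partial>lborel)"
  proof (rule nn_integral_cong)
    fix t
    show "ennreal (norm (indicator {r..s} t *\<^sub>R W' t)) = (ennreal (sqrt (1 / h t)) * indicator {r..s} t) * (ennreal (sqrt (h t) * \<bar>W' t\<bar>) * indicator {r..s} t)"
    proof (cases "t \<in> {r..s}")
      case True
      have "sqrt (1 / h t) * (sqrt (h t) * \<bar>W' t\<bar>) = \<bar>W' t\<bar>" using h(2)[OF True] by (simp add: real_sqrt_divide)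
      then show ?thesis using True h(2)[OF True] by (simp add: ennreal_mult[symmetric])
    qed simp
  qed
  finally have "(ennreal \<bar>W r - W s\<bar>)\<^sup>2 \<le> \<dots>\<^sup>2" by (rule power_mono) simp
  also have "\<dots> \<le> (\<integral>\<^sup>+t. (ennreal (sqrt (1 / h t)) * indicator {r..s} t)\<^sup>2 \<partial>lborel) * (\<integral>\<^sup>+t. (ennreal (sqrt (h t) * \<bar>W' t\<bar>) * indicator {r..s} t)\<^sup>2 \<partial>lborel)"
    by (rule Cauchy_Schwarz_nn_integral) measurable
  also have "(\<integral>\<^sup>+t. (ennreal (sqrt (1 / h t)) * indicator {r..s} t)\<^sup>2 \<partial>lborel) = (\<integral>\<^sup>+t. ennreal (1 / h t) * indicator {r..s} t \<partial>lborel)"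
  proof (rule nn_integral_cong)
    fix t show "(ennreal (sqrt (1 / h t)) * indicator {r..s} t)\<^sup>2 = ennreal (1 / h t) * indicator {r..s} t"
      using h(2)[of t] by (cases "t \<in> {r..s}") (simp_all add: ennreal_power less_imp_le)
  qed
  also have "(\<integral>\<^sup>+t. (ennreal (sqrt (h t) * \<bar>W' t\<bar>) * indicator {r..s} t)\<^sup>2 \<partial>lborel) = (\<integral>\<^sup>+t. ennreal (h t * (W' t)\<^sup>2) * indicator {r..s} t \<partial>lborel)"
  proof (rule nn_integral_cong)
    fix t show "(ennreal (sqrt (h t) * \<bar>W' t\<bar>) * indicator {r..s} t)\<^sup>2 = ennreal (h t * (W' t)\<^sup>2) * indicator {r..s} t"
      using h(2)[of t] by (cases "t \<in> {r..s}") (simp_all add: ennreal_power less_imp_le power_mult_distrib)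
  qed
  finally show ?thesis by (simp add: ennreal_power)
qed

text \<open>Weights with one exponent near 0 and another at infinity, as in \<open>hyp_A\<close>;
  the two powers agree at 1.\<close>

definition pw :: "real \<Rightarrow> real \<Rightarrow> real \<Rightarrow> real" where
  "pw p q t = (if t \<le> 1 then t powr p else t powr q)"

lemma pw_measurable [measurable]: "pw p q \<in> borel_measurable borel"
  unfolding pw_def by measurable

lemma pw_nonneg [simp]: "0 \<le> pw p q t" by (simp add: pw_def)

lemma pw_pos: "t > 0 \<Longrightarrow> 0 < pw p q t" by (simp add: pw_def)

lemma pw_mult: "pw p q t * pw p' q' t = pw (p + p') (q + q') t"
  by (simp add: pw_def powr_add)

lemma pw_inverse: "1 / pw p q t = pw (- p) (- q) t"
  by (simp add: pw_def powr_minus_divide)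

lemma pw_powr: "0 \<le> t \<Longrightarrow> pw p q t powr s = pw (p * s) (q * s) t"
  by (simp add: pw_def powr_powr)

lemma pw_mono: "0 \<le> p \<Longrightarrow> 0 \<le> q \<Longrightarrow> 0 < s \<Longrightarrow> s \<le> t \<Longrightarrow> pw p q s \<le> pw p q t"
  unfolding pw_def
  by (auto intro!: powr_mono2 order_trans[of "s powr p" 1 "t powr q"] ge_one_powr_ge_zero simp: powr_le1)

lemma pw_antimono:
  assumes "0 \<le> p" "0 \<le> q" "0 < s" "s \<le> t"
  shows "pw (- p) (- q) t \<le> pw (- p) (- q) s"
proof -
  have "1 / pw p q t \<le> 1 / pw p q s"
    using assms by (intro divide_left_mono pw_mono mult_pos_pos pw_pos) auto
  then show ?thesis by (simp add: pw_inverse)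
qed

lemma nn_integral_pw_to_inf:
  assumes p: "p > 0" "q > 0" and r: "r > 0"
  shows "(\<integral>\<^sup>+t. ennreal (pw (- p - 1) (- q - 1) t) * indicator {r..} t \<partial>lborel) \<le> ennreal ((1/p + 1/q) * pw (- p) (- q) r)"
proof -
  have I: "(\<integral>\<^sup>+t. ennreal (t powr (- p' - 1)) * indicator {s..} t \<partial>lborel) = ennreal (s powr (- p') / p')" if "p' > 0" "s > 0" for p' s
  proof -
    have "((\<lambda>t. t powr (- p' - 1)) has_integral -(s powr ((- p' - 1) + 1)) / ((- p' - 1) + 1)) {s..}"
      using that by (intro has_integral_powr_to_inf) auto
    then have "((\<lambda>t. t powr (- p' - 1)) has_integral s powr (- p') / p') {s..}" by simp
    then show ?thesis by (intro nn_integral_has_integral_lebesgue') auto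
  qed
  show ?thesis
  proof (cases "r \<le> 1")
    case True
    have "(\<integral>\<^sup>+t. ennreal (pw (- p - 1) (- q - 1) t) * indicator {r..} t \<partial>lborel)
      \<le> (\<integral>\<^sup>+t. ennreal (t powr (- p - 1)) * indicator {r..} t + ennreal (t powr (- q - 1)) * indicator {1..} t \<partial>lborel)"
      by (rule nn_integral_mono) (auto simp: pw_def split: split_indicator)
    also have "\<dots> = ennreal (r powr (- p) / p) + ennreal (1 powr (- q) / q)"
      using p r by (subst nn_integral_add) (auto simp: I)
    also have "\<dots> = ennreal (r powr (- p) / p + 1 / q)" using p by (simp add: ennreal_plus[symmetric] del: ennreal_plus)
    also have "\<dots> \<le> ennreal ((1/p + 1/q) * pw (- p) (- q) r)"
    proof (rule ennreal_leI)
      \<comment> \<open>The tail beyond 1 contributes 1/q, which is absorbed because r^-p is at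
        least 1; this is why the constant adds 1/p and 1/q.\<close>
      have "1 \<le> r powr (- p)" using True r p powr_mono2'[of "-p" r 1] by simp
      then have "1 / q \<le> r powr (- p) / q" using p by (intro divide_right_mono) auto
      then show "r powr (- p) / p + 1 / q \<le> (1/p + 1/q) * pw (- p) (- q) r" using True by (simp add: pw_def algebra_simps)
    qed
    finally show ?thesis .
  next
    case False
    have "(\<integral>\<^sup>+t. ennreal (pw (- p - 1) (- q - 1) t) * indicator {r..} t \<partial>lborel)
      = (\<integral>\<^sup>+t. ennreal (t powr (- q - 1)) * indicator {r..} t \<partial>lborel)"
      by (rule nn_integral_cong) (use False in \<open>auto simp: pw_def split: split_indicator\<close>)
    also have "\<dots> = ennreal (r powr (- q) / q)" using p r by (intro I)
    also have "\<dots> \<le> ennreal ((1/p + 1/q) * pw (- p) (- q) r)"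
      using False p by (intro ennreal_leI) (simp add: pw_def algebra_simps)
    finally show ?thesis .
  qed
qed

lemma nn_integral_pw_from_0:
  assumes p: "p > 0" "q > 0" and s: "s > 0"
  shows "(\<integral>\<^sup>+t. ennreal (pw (p - 1) (q - 1) t) * indicator {0..s} t \<partial>lborel) \<le> ennreal ((1/p + 1/q) * pw p q s)"
proof -
  have I: "(\<integral>\<^sup>+t. ennreal (t powr (p' - 1)) * indicator {0..s'} t \<partial>lborel) = ennreal (s' powr p' / p')" if "p' > 0" "s' \<ge> 0" for p' s'
    using has_integral_powr_from_0[of "p' - 1" s'] that by (intro nn_integral_has_integral_lebesgue') auto
  show ?thesis
  proof (cases "s \<le> 1")
    case True
    have "(\<integral>\<^sup>+t. ennreal (pw (p - 1) (q - 1) t) * indicator {0..s} t \<partial>lborel)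
      = (\<integral>\<^sup>+t. ennreal (t powr (p - 1)) * indicator {0..s} t \<partial>lborel)"
      by (rule nn_integral_cong) (use True in \<open>auto simp: pw_def split: split_indicator\<close>)
    also have "\<dots> = ennreal (s powr p / p)" using p s by (intro I) auto
    also have "\<dots> \<le> ennreal ((1/p + 1/q) * pw p q s)"
      using True p by (intro ennreal_leI) (simp add: pw_def algebra_simps)
    finally show ?thesis .
  next
    case False
    have "(\<integral>\<^sup>+t. ennreal (pw (p - 1) (q - 1) t) * indicator {0..s} t \<partial>lborel)
      \<le> (\<integral>\<^sup>+t. ennreal (t powr (p - 1)) * indicator {0..1} t + ennreal (t powr (q - 1)) * indicator {0..s} t \<partial>lborel)"
      by (rule nn_integral_mono) (auto simp: pw_def split: split_indicator)
    also have "\<dots> = ennreal (1 powr p / p) + ennreal (s powr q / q)"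
      using p s by (subst nn_integral_add) (auto simp: I)
    also have "\<dots> = ennreal (1 / p + s powr q / q)" using p by (simp add: ennreal_plus[symmetric] del: ennreal_plus)
    also have "\<dots> \<le> ennreal ((1/p + 1/q) * pw p q s)"
    proof (rule ennreal_leI)
      have "1 \<le> s powr q" using False p by (intro ge_one_powr_ge_zero) auto
      then have "1 / p \<le> s powr q / p" using p by (intro divide_right_mono) auto
      then show "1 / p + s powr q / q \<le> (1/p + 1/q) * pw p q s" using False by (simp add: pw_def algebra_simps)
    qed
    finally show ?thesis .
  qed
qed

text \<open>Cauchy--Schwarz with the intermediate weight \<open>t\<^sup>k\<^sup>/\<^sup>2\<^sup>+\<^sup>1\<close>, followed by Tonelli.\<close>
lemma hardy:
  fixes W W' :: "real \<Rightarrow> real"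
  assumes k: "p > 0" "q > 0"
    and W: "\<And>t. (W has_real_derivative W' t) (at t)" and W': "continuous_on UNIV W'"
    and R: "\<And>t. t \<ge> R \<Longrightarrow> W t = 0"
  shows "(\<integral>\<^sup>+t. ennreal (pw (p - 1) (q - 1) t * (W t)\<^sup>2) * indicator {0<..} t \<partial>lborel)
    \<le> ennreal ((2/p + 2/q)\<^sup>2) * (\<integral>\<^sup>+t. ennreal (pw (p + 1) (q + 1) t * (W' t)\<^sup>2) * indicator {0<..} t \<partial>lborel)"
proof -
  \<comment> \<open>The constant \<open>1/(p/2) + 1/(q/2)\<close> of the power integrals at half the
    exponents. It enters once before and once after the exchange of integrals, hence its square in
    the result.\<close>
  define C where "C = 2/p + 2/q"
  have C: "C > 0" using k by (simp add: C_def add_pos_pos)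
  define h where "h = pw (p/2 + 1) (q/2 + 1)"
  have [measurable]: "W' \<in> borel_measurable borel" using W' by (rule borel_measurable_continuous_onI)
  have [measurable]: "W \<in> borel_measurable borel"
    using W DERIV_isCont by (intro borel_measurable_continuous_onI continuous_at_imp_continuous_on) blast
  have [measurable]: "h \<in> borel_measurable borel" by (simp add: h_def)
  define \<phi> where "\<phi> r = pw (p - 1) (q - 1) r * (C * pw (- (p/2)) (- (q/2)) r)" for r
  have \<phi>_eq: "\<phi> r = C * pw (p/2 - 1) (q/2 - 1) r" for r
    using pw_mult[of "p - 1" "q - 1" r "- (p/2)" "- (q/2)"] by (simp add: \<phi>_def field_simps)
  have [measurable]: "\<phi> \<in> borel_measurable borel" unfolding \<phi>_def by measurable
  have pointwise: "ennreal ((W r)\<^sup>2) \<le> ennreal (C * pw (- (p/2)) (- (q/2)) r) * (\<integral>\<^sup>+t. ennreal (h t * (W' t)\<^sup>2) * indicator {r..} t \<partial>lborel)" if r: "r > 0" for r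
  proof -
    \<comment> \<open>Beyond the support, so that \<open>W s = 0\<close>.\<close>
    define s where "s = max r R"
    have "ennreal ((W r)\<^sup>2) = ennreal ((W r - W s)\<^sup>2)" using R[of s] by (simp add: s_def)
    also have "\<dots> \<le> (\<integral>\<^sup>+t. ennreal (1 / h t) * indicator {r..s} t \<partial>lborel) * (\<integral>\<^sup>+t. ennreal (h t * (W' t)\<^sup>2) * indicator {r..s} t \<partial>lborel)"
      using r by (intro weighted_cauchy_schwarz W W') (auto simp: s_def h_def intro!: pw_pos)
    also have "\<dots> \<le> ennreal (C * pw (- (p/2)) (- (q/2)) r) * (\<integral>\<^sup>+t. ennreal (h t * (W' t)\<^sup>2) * indicator {r..} t \<partial>lborel)"
    proof (rule mult_mono)
      have "(\<integral>\<^sup>+t. ennreal (1 / h t) * indicator {r..s} t \<partial>lborel) \<le> (\<integral>\<^sup>+t. ennreal (pw (- (p/2) - 1) (- (q/2) - 1) t) * indicator {r..} t \<partial>lborel)"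
        by (rule nn_integral_mono) (auto simp: h_def pw_inverse split: split_indicator)
      also have "\<dots> \<le> ennreal ((1/(p/2) + 1/(q/2)) * pw (- (p/2)) (- (q/2)) r)"
        using k r by (intro nn_integral_pw_to_inf) auto
      finally show "(\<integral>\<^sup>+t. ennreal (1 / h t) * indicator {r..s} t \<partial>lborel) \<le> ennreal (C * pw (- (p/2)) (- (q/2)) r)"
        by (simp add: C_def)
      show "(\<integral>\<^sup>+t. ennreal (h t * (W' t)\<^sup>2) * indicator {r..s} t \<partial>lborel) \<le> (\<integral>\<^sup>+t. ennreal (h t * (W' t)\<^sup>2) * indicator {r..} t \<partial>lborel)"
        by (rule nn_integral_mono) (auto split: split_indicator)
    qed auto
    finally show ?thesis .
  qed
  have "(\<integral>\<^sup>+r. ennreal (pw (p - 1) (q - 1) r * (W r)\<^sup>2) * indicator {0<..} r \<partial>lborel)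
    \<le> (\<integral>\<^sup>+r. (\<integral>\<^sup>+t. ennreal (\<phi> r) * indicator {0<..} r * (ennreal (h t * (W' t)\<^sup>2) * (indicator {r..} t * indicator {0<..} t)) \<partial>lborel) \<partial>lborel)"
  proof (rule nn_integral_mono)
    fix r :: real
    show "ennreal (pw (p - 1) (q - 1) r * (W r)\<^sup>2) * indicator {0<..} r \<le> (\<integral>\<^sup>+t. ennreal (\<phi> r) * indicator {0<..} r * (ennreal (h t * (W' t)\<^sup>2) * (indicator {r..} t * indicator {0<..} t)) \<partial>lborel)"
    proof (cases "r > 0")
      case True
      have "ennreal (pw (p - 1) (q - 1) r * (W r)\<^sup>2) = ennreal (pw (p - 1) (q - 1) r) * ennreal ((W r)\<^sup>2)" by (simp add: ennreal_mult)
      also have "\<dots> \<le> ennreal (pw (p - 1) (q - 1) r) * (ennreal (C * pw (- (p/2)) (- (q/2)) r) * (\<integral>\<^sup>+t. ennreal (h t * (W' t)\<^sup>2) * indicator {r..} t \<partial>lborel))"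
        by (intro mult_left_mono pointwise True) simp
      also have "\<dots> = ennreal (\<phi> r) * (\<integral>\<^sup>+t. ennreal (h t * (W' t)\<^sup>2) * indicator {r..} t \<partial>lborel)"
        using C by (simp add: \<phi>_def ennreal_mult mult.assoc)
      also have "\<dots> = ennreal (\<phi> r) * (\<integral>\<^sup>+t. ennreal (h t * (W' t)\<^sup>2) * (indicator {r..} t * indicator {0<..} t) \<partial>lborel)"
        using True by (intro arg_cong2[where f="(*)"] refl nn_integral_cong) (auto split: split_indicator)
      also have "\<dots> = (\<integral>\<^sup>+t. ennreal (\<phi> r) * (ennreal (h t * (W' t)\<^sup>2) * (indicator {r..} t * indicator {0<..} t)) \<partial>lborel)"
        by (rule nn_integral_cmult[symmetric]) measurable
      finally show ?thesis using True by simp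
    qed simp
  qed
  also have "\<dots> = (\<integral>\<^sup>+t. (\<integral>\<^sup>+r. ennreal (\<phi> r) * indicator {0<..} r * (ennreal (h t * (W' t)\<^sup>2) * (indicator {r..} t * indicator {0<..} t)) \<partial>lborel) \<partial>lborel)"
  proof (rule lborel_pair.Fubini')
    \<comment> \<open>The indicator with a moving left end is rewritten as a comparison, whose
      measurability in the pair is evident.\<close>
    have "(\<lambda>(t, r). ennreal (\<phi> r) * indicator {0<..} r * (ennreal (h t * (W' t)\<^sup>2) * ((if r \<le> t then 1 else 0) * indicator {0<..} t)))
       \<in> borel_measurable (lborel \<Otimes>\<^sub>M lborel)" by measurable
    also have "(\<lambda>(t, r). ennreal (\<phi> r) * indicator {0<..} r * (ennreal (h t * (W' t)\<^sup>2) * ((if r \<le> t then 1 else 0) * indicator {0<..} t)))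
       = (\<lambda>(t, r). ennreal (\<phi> r) * indicator {0<..} r * (ennreal (h t * (W' t)\<^sup>2) * (indicator {r..} t * indicator {0<..} t)))"
      by (auto simp: fun_eq_iff split: split_indicator)
    finally show "(\<lambda>(t, r). ennreal (\<phi> r) * indicator {0<..} r * (ennreal (h t * (W' t)\<^sup>2) * (indicator {r..} t * indicator {0<..} t)))
       \<in> borel_measurable (lborel \<Otimes>\<^sub>M lborel)" .
  qed
  also have "\<dots> \<le> (\<integral>\<^sup>+t. ennreal (C\<^sup>2) * (ennreal (pw (p + 1) (q + 1) t * (W' t)\<^sup>2) * indicator {0<..} t) \<partial>lborel)"
  proof (rule nn_integral_mono)
    fix t :: real
    show "(\<integral>\<^sup>+r. ennreal (\<phi> r) * indicator {0<..} r * (ennreal (h t * (W' t)\<^sup>2) * (indicator {r..} t * indicator {0<..} t)) \<partial>lborel)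
      \<le> ennreal (C\<^sup>2) * (ennreal (pw (p + 1) (q + 1) t * (W' t)\<^sup>2) * indicator {0<..} t)"
    proof (cases "t > 0")
      case True
      have "(\<integral>\<^sup>+r. ennreal (\<phi> r) * indicator {0<..} r * (ennreal (h t * (W' t)\<^sup>2) * (indicator {r..} t * indicator {0<..} t)) \<partial>lborel)
        \<le> (\<integral>\<^sup>+r. ennreal (C * (h t * (W' t)\<^sup>2)) * (ennreal (pw (p/2 - 1) (q/2 - 1) r) * indicator {0..t} r) \<partial>lborel)"
        using C by (intro nn_integral_mono) (auto simp: \<phi>_eq h_def ennreal_mult[symmetric] ac_simps split: split_indicator)
      also have "\<dots> = ennreal (C * (h t * (W' t)\<^sup>2)) * (\<integral>\<^sup>+r. ennreal (pw (p/2 - 1) (q/2 - 1) r) * indicator {0..t} r \<partial>lborel)"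
        by (rule nn_integral_cmult) measurable
      also have "\<dots> \<le> ennreal (C * (h t * (W' t)\<^sup>2)) * ennreal ((1/(p/2) + 1/(q/2)) * pw (p/2) (q/2) t)"
        using k True by (intro mult_left_mono nn_integral_pw_from_0) auto
      also have "\<dots> = ennreal (C * (h t * (W' t)\<^sup>2) * (C * pw (p/2) (q/2) t))"
        using C by (subst ennreal_mult) (auto simp: h_def C_def)
      also have "C * (h t * (W' t)\<^sup>2) * (C * pw (p/2) (q/2) t) = C\<^sup>2 * ((h t * pw (p/2) (q/2) t) * (W' t)\<^sup>2)"
        by (simp add: power2_eq_square)
      also have "h t * pw (p/2) (q/2) t = pw (p + 1) (q + 1) t" by (simp add: h_def pw_mult add_ac)
      finally show ?thesis using True by (simp add: ennreal_mult)
    qed simp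
  qed
  also have "\<dots> = ennreal (C\<^sup>2) * (\<integral>\<^sup>+t. ennreal (pw (p + 1) (q + 1) t * (W' t)\<^sup>2) * indicator {0<..} t \<partial>lborel)"
    by (rule nn_integral_cmult) measurable
  finally show ?thesis by (simp add: C_def)
qed

subsection \<open>Weighted estimates for smooth radial functions\<close>

locale radial_weight =
  fixes A :: "real \<Rightarrow> real" and a0 ainf :: real and ty :: "'a::euclidean_space itself"
  assumes dim: "DIM('a) \<ge> 3" and hyp_A: "hyp_A DIM('a) A a0 ainf"
begin

text \<open>\<open>k0\<close> and \<open>kinf\<close> are the denominators of \<open>p_crit\<close>
  and \<open>q_star\<close>; half of them are the decay rates at 0 and at infinity. They are
  positive because a0 and ainf exceed 2 - N.\<close>

definition k0 :: real where "k0 = real DIM('a) + a0 - 2"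
definition kinf :: real where "kinf = real DIM('a) + ainf - 2"

lemma k_pos: "k0 > 0" "kinf > 0" and a_le: "a0 \<le> 2" "ainf \<le> 2"
  and A_pos: "r > 0 \<Longrightarrow> A r > 0" and A_cont: "continuous_on {0<..} A"
  using hyp_A by (auto simp: hyp_A_def k0_def kinf_def)

text \<open>The two lower limits give the bound near 0 and near infinity; in between, a positive
  continuous function has a positive minimum on a compact interval.\<close>

lemma A_lower: "\<exists>c>0. \<forall>r>0. c * pw a0 ainf r \<le> A r"
proof -
  obtain c0 cinf where c: "c0 > 0" "cinf > 0"
    "ereal c0 \<le> Liminf (at_right 0) (\<lambda>r. ereal (A r / r powr a0))"
    "ereal cinf \<le> Liminf at_top (\<lambda>r. ereal (A r / r powr ainf))"
    using hyp_A unfolding hyp_A_def by blast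
  have "ereal (c0/2) < Liminf (at_right 0) (\<lambda>r. ereal (A r / r powr a0))"
    using c by (intro less_le_trans[OF _ c(3)]) simp
  from less_LiminfD[OF this] have "\<forall>\<^sub>F r in at_right 0. c0/2 < A r / r powr a0" by simp
  then obtain b where b: "b > 0" "\<And>r. 0 < r \<Longrightarrow> r < b \<Longrightarrow> c0/2 < A r / r powr a0"
    by (auto simp: eventually_at_right_field)
  have "ereal (cinf/2) < Liminf at_top (\<lambda>r. ereal (A r / r powr ainf))"
    using c by (intro less_le_trans[OF _ c(4)]) simp
  from less_LiminfD[OF this] have "\<forall>\<^sub>F r in at_top. cinf/2 < A r / r powr ainf" by simp
  then obtain B where B: "\<And>r. B \<le> r \<Longrightarrow> cinf/2 < A r / r powr ainf" by (auto simp: eventually_at_top_linorder)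
  have mid: "\<exists>m>0. \<forall>r\<in>{s..t}. m \<le> A r / r powr e" if "0 < s" for s t e
  proof (cases "s \<le> t")
    case True
    have "continuous_on {s..t} (\<lambda>r. A r / r powr e)"
      using that by (intro continuous_intros continuous_on_subset[OF A_cont]) auto
    then obtain r where r: "r \<in> {s..t}" "\<And>r'. r' \<in> {s..t} \<Longrightarrow> A r / r powr e \<le> A r' / r' powr e"
      using continuous_attains_inf[of "{s..t}" "\<lambda>r. A r / r powr e"] True by auto
    then show ?thesis using that A_pos[of r] by (intro exI[of _ "A r / r powr e"]) auto
  qed (auto intro: exI[of _ 1])
  obtain m1 where m1: "m1 > 0" "\<And>r. r \<in> {b/2..1} \<Longrightarrow> m1 \<le> A r / r powr a0" using mid[of "b/2" 1 a0] b by auto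
  obtain m2 where m2: "m2 > 0" "\<And>r. r \<in> {1..B} \<Longrightarrow> m2 \<le> A r / r powr ainf" using mid[of 1 B ainf] by auto
  define c where "c = min (min (c0/2) m1) (min (cinf/2) m2)"
  have "c > 0" using c m1 m2 by (simp add: c_def)
  moreover have "c * pw a0 ainf r \<le> A r" if r: "r > 0" for r
  proof (cases "r \<le> 1")
    case True
    have "c \<le> A r / r powr a0"
    proof (cases "r < b")
      case True
      have "c \<le> c0/2" unfolding c_def by (meson min.cobounded1 order_trans)
      then show ?thesis using b(2)[OF r True] by linarith
    next
      case False
      then show ?thesis using m1(2)[of r] b \<open>r \<le> 1\<close> by (simp add: c_def)
    qed
    then show ?thesis using r True by (simp add: pw_def field_simps)
  next
    case False
    have "c \<le> A r / r powr ainf"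
    proof (cases "B \<le> r")
      case True
      have "c \<le> cinf/2" unfolding c_def by (meson min.cobounded1 min.cobounded2 order_trans)
      then show ?thesis using B[OF True] by linarith
    next
      case False
      then show ?thesis using m2(2)[of r] \<open>\<not> r \<le> 1\<close> by (simp add: c_def)
    qed
    then show ?thesis using r False by (simp add: pw_def field_simps)
  qed
  ultimately show ?thesis by blast
qed

definition cA :: real where "cA = (SOME c. c > 0 \<and> (\<forall>r>0. c * pw a0 ainf r \<le> A r))"

lemma cA: "cA > 0" "r > 0 \<Longrightarrow> cA * pw a0 ainf r \<le> A r"
  using someI_ex[of "\<lambda>c. c > 0 \<and> (\<forall>r>0. c * pw a0 ainf r \<le> A r)"] A_lower unfolding cA_def by auto

text \<open>The value of \<open>A\<close> at 0 is arbitrary; setting the weight to 0 there makes it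
  nonnegative and Borel on the whole space.\<close>

definition aw :: "'a \<Rightarrow> real" where "aw x = (if x = 0 then 0 else A (norm x))"

lemma aw_nonneg [simp]: "0 \<le> aw x" using A_pos[of "norm x"] by (simp add: aw_def less_imp_le)

lemma aw_pos: "x \<noteq> 0 \<Longrightarrow> 0 < aw x" using A_pos[of "norm x"] by (simp add: aw_def)

lemma aw_measurable [measurable]: "aw \<in> borel_measurable borel" "aw \<in> borel_measurable lebesgue"
proof -
  have "continuous_on (- {0}) (\<lambda>x::'a. A (norm x))"
    by (rule continuous_on_compose2[OF A_cont]) (auto intro: continuous_intros)
  then have "(\<lambda>x::'a. indicator (- {0}) x *\<^sub>R A (norm x)) \<in> borel_measurable borel"
    by (intro borel_measurable_continuous_on_indicator) auto
  also have "(\<lambda>x::'a. indicator (- {0}) x *\<^sub>R A (norm x)) = aw"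
    by (auto simp: fun_eq_iff aw_def split: split_indicator)
  finally show *: "aw \<in> borel_measurable borel" .
  then show "aw \<in> borel_measurable lebesgue" by (intro measurable_completion) simp
qed

lemma aw_AE: "AE x in lebesgue. aw x = A (norm x)"
  using AE_nonzero by eventually_elim (simp add: aw_def)

text \<open>With the square root of the weight absorbed, the energy norm is the plain
  \<open>L2\<close> norm of this field, see \<open>norm_A_smooth_eq\<close>.\<close>

definition wg :: "('a \<Rightarrow> real) \<Rightarrow> 'a \<Rightarrow> 'a" where "wg w x = sqrt (aw x) *\<^sub>R grad w x"

lemma norm_wg_sq: "(norm (wg w x))\<^sup>2 = aw x * (norm (grad w x))\<^sup>2"
  by (simp add: wg_def power_mult_distrib)

lemma S_A_test: "w \<in> S_A A \<Longrightarrow> w \<in> test_functions UNIV"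
  and S_A_radial: "w \<in> S_A A \<Longrightarrow> norm x = norm y \<Longrightarrow> w x = w y"
  unfolding S_A_def by blast+

lemma wg_measurable: "w \<in> test_functions \<Omega> \<Longrightarrow> wg w \<in> borel_measurable lebesgue"
  using test_functions_measurable[of w \<Omega>] unfolding wg_def by measurable

lemma wg_L2_iff:
  assumes w: "w \<in> test_functions \<Omega>"
  shows "wg w \<in> L2 \<longleftrightarrow> integrable lebesgue (\<lambda>x. A (norm x) * (norm (grad w x))\<^sup>2)"
proof -
  have ae: "AE x in lebesgue. (norm (wg w x))\<^sup>2 = A (norm x) * (norm (grad w x))\<^sup>2"
    using aw_AE by eventually_elim (simp add: norm_wg_sq)
  have m: "(\<lambda>x. (norm (wg w x))\<^sup>2) \<in> borel_measurable lebesgue" using wg_measurable[OF w] by measurable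
  have "integrable lebesgue (\<lambda>x. (norm (wg w x))\<^sup>2) \<longleftrightarrow> integrable lebesgue (\<lambda>x. A (norm x) * (norm (grad w x))\<^sup>2)"
    by (rule integrable_cong_AE[OF m borel_measurable_AE[OF m ae] ae])
  then show ?thesis using wg_measurable[OF w] by (simp add: L2_def)
qed

lemma wg_L2: "w \<in> S_A A \<Longrightarrow> wg w \<in> L2"
  using wg_L2_iff[of w UNIV] by (auto simp: S_A_def)

lemma norm_A_smooth_eq: "w \<in> test_functions \<Omega> \<Longrightarrow> norm_A_smooth A w = L2.nrm (wg w)"
proof -
  assume w: "w \<in> test_functions \<Omega>"
  have ae: "AE x in lebesgue. (norm (wg w x))\<^sup>2 = A (norm x) * (norm (grad w x))\<^sup>2"
    using aw_AE by eventually_elim (simp add: norm_wg_sq)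
  have m: "(\<lambda>x. (norm (wg w x))\<^sup>2) \<in> borel_measurable lebesgue" using wg_measurable[OF w] by measurable
  show ?thesis
    unfolding norm_A_smooth_def L2.nrm_def l2_ip_self
    by (rule arg_cong[where f=sqrt], rule integral_cong_AE[OF borel_measurable_AE[OF m ae] m]) (use ae in \<open>auto elim: eventually_mono\<close>)
qed

lemma wg_lincomb:
  assumes "u \<in> test_functions \<Omega>" "v \<in> test_functions \<Omega>'"
  shows "wg (\<lambda>x. c * u x + d * v x) = c *\<^sub>R wg u + d *\<^sub>R wg v"
  using test_functions_Ck[OF assms(1)] test_functions_Ck[OF assms(2)]
  by (auto simp: fun_eq_iff wg_def grad_add grad_cmult Ck_cmult scaleR_add_right mult.commute)

lemma S_A_lincomb:
  fixes u v :: "'a \<Rightarrow> real"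
  assumes u: "u \<in> S_A A" and v: "v \<in> S_A A"
  shows "(\<lambda>x. c * u x + d * v x) \<in> S_A A"
proof -
  let ?w = "\<lambda>x. c * u x + d * v x"
  have w: "?w \<in> test_functions UNIV" using u v by (intro test_functions_lincomb S_A_test)
  have "wg ?w \<in> L2" unfolding wg_lincomb[OF S_A_test[OF u] S_A_test[OF v]] using wg_L2[OF u] wg_L2[OF v] by simp
  moreover have "?w x = ?w y" if "norm x = norm y" for x y
    using S_A_radial[OF u that] S_A_radial[OF v that] by simp
  ultimately show ?thesis using w unfolding S_A_def wg_L2_iff[OF w] by blast
qed

lemma S_A_diff: "u \<in> S_A A \<Longrightarrow> v \<in> S_A A \<Longrightarrow> (\<lambda>x. u x - v x) \<in> S_A A"
  and wg_diff: "u \<in> S_A A \<Longrightarrow> v \<in> S_A A \<Longrightarrow> wg (\<lambda>x. u x - v x) = wg u - wg v"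
  using S_A_lincomb[of u v 1 "-1"] wg_lincomb[OF S_A_test S_A_test, of u v 1 "-1"] by simp_all

definition e1 :: 'a where "e1 = (SOME b. b \<in> Basis)"

lemma e1: "e1 \<in> Basis" "norm e1 = 1"
proof -
  show "e1 \<in> Basis" unfolding e1_def by (simp add: some_in_eq)
  then show "norm e1 = 1" by (rule norm_Basis)
qed

text \<open>The radial profile is read along the full line through \<open>e1\<close>, so that it is
  differentiable on all of \<open>real\<close>, 0 included.\<close>

definition prof :: "('a \<Rightarrow> real) \<Rightarrow> real \<Rightarrow> real" where "prof w t = w (t *\<^sub>R e1)"
definition prof' :: "('a \<Rightarrow> real) \<Rightarrow> real \<Rightarrow> real" where "prof' w t = grad w (t *\<^sub>R e1) \<bullet> e1"

lemma prof_norm: "w \<in> S_A A \<Longrightarrow> prof w (norm x) = w x"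
  unfolding prof_def using S_A_radial[of w "norm x *\<^sub>R e1" x] e1 by simp

lemma deriv_along_ray:
  assumes "w \<in> S_A A"
  shows "((\<lambda>t. w (t *\<^sub>R u)) has_real_derivative grad w (t *\<^sub>R u) \<bullet> u) (at t)"
proof -
  have "((\<lambda>s. s *\<^sub>R u) has_derivative (\<lambda>s. s *\<^sub>R u)) (at t)" by (auto intro!: derivative_eq_intros)
  from has_derivative_compose[OF this has_derivative_grad[OF test_functions_Ck[OF S_A_test[OF assms]]]]
  show ?thesis by (simp add: has_field_derivative_def mult_commute_abs)
qed

lemma prof_deriv: "w \<in> S_A A \<Longrightarrow> (prof w has_real_derivative prof' w t) (at t)"
  using deriv_along_ray[of w e1 t] by (simp add: prof_def[abs_def] prof'_def)

lemma prof'_cont: "w \<in> S_A A \<Longrightarrow> continuous_on UNIV (prof' w)"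
  unfolding prof'_def
  by (intro continuous_intros continuous_on_compose2[OF continuous_grad[OF test_functions_Ck[OF S_A_test]]]) auto

text \<open>Along the ray through \<open>x\<close> the function equals its profile, so the profile
  derivative is the gradient paired with a unit vector.\<close>

lemma prof'_le:
  assumes w: "w \<in> S_A A" and x: "x \<noteq> 0"
  shows "\<bar>prof' w (norm x)\<bar> \<le> norm (grad w x)"
proof -
  define u where "u = x /\<^sub>R norm x"
  have u: "norm u = 1" "norm x *\<^sub>R u = x" using x by (auto simp: u_def)
  have "((\<lambda>t. w (t *\<^sub>R u)) has_real_derivative prof' w (norm x)) (at (norm x))"
  proof (rule has_field_derivative_transform_within_open[OF prof_deriv[OF w]])
    show "prof w t = w (t *\<^sub>R u)" if "t \<in> {0<..}" for t
      using prof_norm[OF w, of "t *\<^sub>R u"] that u by simp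
  qed (use x in auto)
  then have "prof' w (norm x) = grad w x \<bullet> u"
    using DERIV_unique[OF deriv_along_ray[OF w, of u "norm x"]] u by simp
  then show ?thesis using Cauchy_Schwarz_ineq2[of "grad w x" u] u by simp
qed

lemma prof_support:
  assumes w: "w \<in> S_A A"
  obtains R where "\<And>t. t \<ge> R \<Longrightarrow> prof w t = 0"
proof -
  obtain C where C: "compact C" "\<And>x. x \<notin> C \<Longrightarrow> w x = 0" using test_functions_support[OF S_A_test[OF w]] by metis
  obtain R where R: "\<And>x. x \<in> C \<Longrightarrow> norm x \<le> R" using compact_imp_bounded[OF C(1)] by (auto simp: bounded_iff)
  have "prof w t = 0" if "t \<ge> \<bar>R\<bar> + 1" for t
    unfolding prof_def using R[of "t *\<^sub>R e1"] e1 that by (intro C(2)) auto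
  then show ?thesis by (rule that)
qed

section \<open>Energy, decay, Hardy and Sobolev inequalities for smooth radial functions\<close>

definition energy_const :: real where "energy_const = 1 / (sphere_area TYPE('a) * cA)"

lemma energy_const_pos: "energy_const > 0"
  using sphere_area_pos[where 'a='a] cA by (simp add: energy_const_def)

text \<open>In polar coordinates \<open>A\<close> is bounded below by \<open>cA\<close> times its
  two-power weight, and the Jacobian raises the exponents to \<open>k0 + 1\<close> and
  \<open>kinf + 1\<close>.\<close>

lemma energy_1d:
  assumes w: "w \<in> S_A A"
  shows "(\<integral>\<^sup>+t. ennreal (pw (k0 + 1) (kinf + 1) t * (prof' w t)\<^sup>2) * indicator {0<..} t \<partial>lborel)
     \<le> ennreal (energy_const * (L2.nrm (wg w))\<^sup>2)"
proof -
  let ?c = "sphere_area TYPE('a)"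
  have c: "?c > 0" by (rule sphere_area_pos)
  have [measurable]: "prof' w \<in> borel_measurable borel" using prof'_cont[OF w] by (rule borel_measurable_continuous_onI)
  define g where "g t = ennreal (pw a0 ainf t * (prof' w t)\<^sup>2) * indicator {0<..} t" for t
  have [measurable]: "g \<in> borel_measurable borel" unfolding g_def by measurable
  have "ennreal (cA * ?c) * (\<integral>\<^sup>+t. ennreal (pw (k0 + 1) (kinf + 1) t * (prof' w t)\<^sup>2) * indicator {0<..} t \<partial>lborel)
      = ennreal cA * (\<integral>\<^sup>+t. ennreal ?c * (ennreal (pw (k0 + 1) (kinf + 1) t * (prof' w t)\<^sup>2) * indicator {0<..} t) \<partial>lborel)"
    using c cA by (subst nn_integral_cmult) (auto simp: ennreal_mult mult.assoc)
  also have "(\<integral>\<^sup>+t. ennreal ?c * (ennreal (pw (k0 + 1) (kinf + 1) t * (prof' w t)\<^sup>2) * indicator {0<..} t) \<partial>lborel)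
      = (\<integral>\<^sup>+t. ennreal (?c * t ^ (DIM('a) - 1)) * (g t * indicator {0..} t) \<partial>lborel)"
  proof (rule nn_integral_cong)
    fix t :: real
    show "ennreal ?c * (ennreal (pw (k0 + 1) (kinf + 1) t * (prof' w t)\<^sup>2) * indicator {0<..} t) = ennreal (?c * t ^ (DIM('a) - 1)) * (g t * indicator {0..} t)"
    proof (cases "t > 0")
      case True
      have "t ^ (DIM('a) - 1) = t powr (real DIM('a) - 1)" using True dim by (simp add: powr_realpow[symmetric] of_nat_diff)
      also have "\<dots> = pw (real DIM('a) - 1) (real DIM('a) - 1) t" by (simp add: pw_def)
      finally have "t ^ (DIM('a) - 1) * pw a0 ainf t = pw (k0 + 1) (kinf + 1) t" by (simp add: pw_mult k0_def kinf_def add_ac)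
      then have "?c * (pw (k0 + 1) (kinf + 1) t * (prof' w t)\<^sup>2) = (?c * t ^ (DIM('a) - 1)) * (pw a0 ainf t * (prof' w t)\<^sup>2)"
        by (simp add: ac_simps)
      then show ?thesis using True c by (simp add: g_def ennreal_mult[symmetric])
    qed (simp add: g_def)
  qed
  also have "\<dots> = (\<integral>\<^sup>+x. g (norm (x::'a)) \<partial>lborel)" by (rule nn_integral_radial[symmetric]) measurable
  also have "\<dots> = (\<integral>\<^sup>+x. g (norm (x::'a)) \<partial>lebesgue)" by (rule nn_integral_completion[symmetric])
  also have "ennreal cA * \<dots> = (\<integral>\<^sup>+x. ennreal cA * g (norm (x::'a)) \<partial>lebesgue)"
    by (rule nn_integral_cmult[symmetric]) (rule measurable_completion, measurable)
  also have "\<dots> \<le> (\<integral>\<^sup>+x. ennreal ((norm (wg w x))\<^sup>2) \<partial>lebesgue)"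
  proof (rule nn_integral_mono)
    fix x :: 'a
    show "ennreal cA * g (norm x) \<le> ennreal ((norm (wg w x))\<^sup>2)"
    proof (cases "x = 0")
      case False
      have "(prof' w (norm x))\<^sup>2 \<le> (norm (grad w x))\<^sup>2"
        using power_mono[OF prof'_le[OF w False] abs_ge_zero, of 2] by simp
      then have "(cA * pw a0 ainf (norm x)) * (prof' w (norm x))\<^sup>2 \<le> aw x * (norm (grad w x))\<^sup>2"
        using cA(2)[of "norm x"] False A_pos[of "norm x"] by (intro mult_mono) (auto simp: aw_def)
      then show ?thesis using False cA(1) by (simp add: g_def norm_wg_sq ennreal_mult[symmetric] mult.assoc)
    qed (simp add: g_def)
  qed
  also have "\<dots> = ennreal ((L2.nrm (wg w))\<^sup>2)"
    using ennreal_l2_ip_self[OF wg_L2[OF w]] L2.nrm_sq[OF wg_L2[OF w]] by simp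
  finally have le: "ennreal (cA * ?c) * (\<integral>\<^sup>+t. ennreal (pw (k0 + 1) (kinf + 1) t * (prof' w t)\<^sup>2) * indicator {0<..} t \<partial>lborel)
      \<le> ennreal ((L2.nrm (wg w))\<^sup>2)" .
  have "ennreal energy_const * ennreal (cA * ?c) = 1"
    using cA c by (simp add: energy_const_def ennreal_mult[symmetric])
  then have "(\<integral>\<^sup>+t. ennreal (pw (k0 + 1) (kinf + 1) t * (prof' w t)\<^sup>2) * indicator {0<..} t \<partial>lborel)
    = ennreal energy_const * (ennreal (cA * ?c) * (\<integral>\<^sup>+t. ennreal (pw (k0 + 1) (kinf + 1) t * (prof' w t)\<^sup>2) * indicator {0<..} t \<partial>lborel))"
    by (simp flip: mult.assoc)
  also have "\<dots> \<le> ennreal energy_const * ennreal ((L2.nrm (wg w))\<^sup>2)" by (rule mult_left_mono[OF le]) simp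
  finally show ?thesis using energy_const_pos by (simp add: ennreal_mult)
qed

text \<open>\<open>P\<close> bounds the integral of the reciprocal weight: the tail integral yields
  decay, the length of an interval away from 0 yields equicontinuity.\<close>

lemma prof_diff_le:
  assumes w: "w \<in> S_A A" and r: "0 < r" "r \<le> s"
    and P: "(\<integral>\<^sup>+t. ennreal (pw (- k0 - 1) (- kinf - 1) t) * indicator {r..s} t \<partial>lborel) \<le> ennreal P" "0 \<le> P"
  shows "\<bar>prof w r - prof w s\<bar> \<le> sqrt (P * energy_const) * L2.nrm (wg w)"
proof -
  have "ennreal ((prof w r - prof w s)\<^sup>2) \<le> (\<integral>\<^sup>+t. ennreal (1 / pw (k0 + 1) (kinf + 1) t) * indicator {r..s} t \<partial>lborel)
     * (\<integral>\<^sup>+t. ennreal (pw (k0 + 1) (kinf + 1) t * (prof' w t)\<^sup>2) * indicator {r..s} t \<partial>lborel)"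
    using r by (intro weighted_cauchy_schwarz prof_deriv prof'_cont w) (auto intro!: pw_pos)
  also have "\<dots> \<le> ennreal P * ennreal (energy_const * (L2.nrm (wg w))\<^sup>2)"
  proof (rule mult_mono)
    show "(\<integral>\<^sup>+t. ennreal (1 / pw (k0 + 1) (kinf + 1) t) * indicator {r..s} t \<partial>lborel) \<le> ennreal P"
      using P(1) by (simp add: pw_inverse)
    have "(\<integral>\<^sup>+t. ennreal (pw (k0 + 1) (kinf + 1) t * (prof' w t)\<^sup>2) * indicator {r..s} t \<partial>lborel)
      \<le> (\<integral>\<^sup>+t. ennreal (pw (k0 + 1) (kinf + 1) t * (prof' w t)\<^sup>2) * indicator {0<..} t \<partial>lborel)"
      using r by (intro nn_integral_mono) (auto split: split_indicator)
    then show "(\<integral>\<^sup>+t. ennreal (pw (k0 + 1) (kinf + 1) t * (prof' w t)\<^sup>2) * indicator {r..s} t \<partial>lborel) \<le> ennreal (energy_const * (L2.nrm (wg w))\<^sup>2)"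
      using energy_1d[OF w] by (rule order_trans)
  qed auto
  also have "\<dots> = ennreal (P * energy_const * (L2.nrm (wg w))\<^sup>2)"
    using P energy_const_pos by (simp add: ennreal_mult[symmetric] mult.assoc)
  finally have "(prof w r - prof w s)\<^sup>2 \<le> P * energy_const * (L2.nrm (wg w))\<^sup>2"
    using P energy_const_pos by simp
  then have "sqrt ((prof w r - prof w s)\<^sup>2) \<le> sqrt (P * energy_const * (L2.nrm (wg w))\<^sup>2)" by (rule real_sqrt_le_mono)
  then show ?thesis using wg_L2[OF w] by (simp add: real_sqrt_mult)
qed

definition decay_const :: real where "decay_const = sqrt ((1/k0 + 1/kinf) * energy_const)"

lemma decay_const_pos: "decay_const > 0"
  using k_pos energy_const_pos by (simp add: decay_const_def add_pos_pos)

definition \<kappa> :: "real \<Rightarrow> real" where "\<kappa> r = decay_const * pw (- (k0/2)) (- (kinf/2)) r"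

lemma \<kappa>_nonneg [simp]: "0 \<le> \<kappa> r" using decay_const_pos by (simp add: \<kappa>_def)

text \<open>Comparison with a radius beyond the support, where the profile is 0.\<close>

lemma S_A_decay:
  assumes w: "w \<in> S_A A" and x: "x \<noteq> 0"
  shows "\<bar>w x\<bar> \<le> \<kappa> (norm x) * L2.nrm (wg w)"
proof -
  let ?r = "norm x"
  have r: "?r > 0" using x by simp
  obtain R where R: "\<And>t. t \<ge> R \<Longrightarrow> prof w t = 0" using prof_support[OF w] by blast
  define s where "s = max ?r R"
  let ?P = "(1/k0 + 1/kinf) * pw (- k0) (- kinf) ?r"
  have "(\<integral>\<^sup>+t. ennreal (pw (- k0 - 1) (- kinf - 1) t) * indicator {?r..s} t \<partial>lborel) \<le> (\<integral>\<^sup>+t. ennreal (pw (- k0 - 1) (- kinf - 1) t) * indicator {?r..} t \<partial>lborel)"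
    by (rule nn_integral_mono) (auto split: split_indicator)
  also have "\<dots> \<le> ennreal ?P" by (rule nn_integral_pw_to_inf[OF k_pos r])
  finally have "\<bar>prof w ?r - prof w s\<bar> \<le> sqrt (?P * energy_const) * L2.nrm (wg w)"
    using k_pos by (intro prof_diff_le w r) (auto simp: s_def)
  moreover have "sqrt (?P * energy_const) = \<kappa> ?r"
  proof -
    have "sqrt (pw (- k0) (- kinf) ?r) = pw (- (k0/2)) (- (kinf/2)) ?r"
      using pw_powr[of ?r "- k0" "- kinf" "1/2"] by (simp add: powr_half_sqrt)
    then show ?thesis by (simp add: \<kappa>_def decay_const_def real_sqrt_mult)
  qed
  moreover have "prof w s = 0" using R by (simp add: s_def)
  ultimately show ?thesis using prof_norm[OF w, of x] by simp
qed

text \<open>Beyond radius \<open>r\<close> the reciprocal weight is at most its value at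
  \<open>r\<close>, which makes the profile Hoelder continuous of order 1/2 there, with a constant
  proportional to the energy norm.\<close>

lemma S_A_equicont:
  assumes r: "0 < r" and x: "r \<le> norm x" and y: "r \<le> norm y" and w: "w \<in> S_A A"
  shows "\<bar>w x - w y\<bar> \<le> sqrt (\<bar>norm x - norm y\<bar> * pw (- k0 - 1) (- kinf - 1) r * energy_const) * L2.nrm (wg w)"
proof -
  have *: "\<bar>prof w s - prof w t\<bar> \<le> sqrt ((t - s) * pw (- k0 - 1) (- kinf - 1) r * energy_const) * L2.nrm (wg w)"
    if "r \<le> s" "s \<le> t" for s t
  proof (rule prof_diff_le[OF w])
    have le: "pw (- k0 - 1) (- kinf - 1) \<tau> \<le> pw (- k0 - 1) (- kinf - 1) r" if "r \<le> \<tau>" for \<tau>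
      using pw_antimono[of "k0 + 1" "kinf + 1" r \<tau>] k_pos r that by simp
    have "(\<integral>\<^sup>+\<tau>. ennreal (pw (- k0 - 1) (- kinf - 1) \<tau>) * indicator {s..t} \<tau> \<partial>lborel)
       \<le> (\<integral>\<^sup>+\<tau>. ennreal (pw (- k0 - 1) (- kinf - 1) r) * indicator {s..t} \<tau> \<partial>lborel)"
      using that le by (intro nn_integral_mono) (auto intro!: ennreal_leI split: split_indicator)
    also have "\<dots> = ennreal ((t - s) * pw (- k0 - 1) (- kinf - 1) r)"
      using that by (subst nn_integral_cmult_indicator) (simp_all add: ennreal_mult[symmetric] mult.commute)
    finally show "(\<integral>\<^sup>+\<tau>. ennreal (pw (- k0 - 1) (- kinf - 1) \<tau>) * indicator {s..t} \<tau> \<partial>lborel) \<le> ennreal ((t - s) * pw (- k0 - 1) (- kinf - 1) r)" .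
  qed (use that r in auto)
  show ?thesis
  proof (cases "norm x \<le> norm y")
    case True
    then show ?thesis using *[OF x True] prof_norm[OF w, of x] prof_norm[OF w, of y] by simp
  next
    case False
    then show ?thesis using *[OF y, of "norm x"] prof_norm[OF w, of x] prof_norm[OF w, of y] by (simp add: abs_minus_commute)
  qed
qed

definition hardy_const :: real where
  "hardy_const = sphere_area TYPE('a) * ((2/k0 + 2/kinf)\<^sup>2 * energy_const)"

lemma hardy_const_pos: "hardy_const > 0"
  using sphere_area_pos[where 'a='a] energy_const_pos k_pos unfolding hardy_const_def
  by (intro mult_pos_pos zero_less_power add_pos_pos divide_pos_pos) auto

text \<open>This is \<open>hardy\<close> for the profile: the Jacobian turns the exponents a - 2
  into k - 1.\<close>

lemma S_A_hardy:
  assumes w: "w \<in> S_A A"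
  shows "(\<integral>\<^sup>+x. ennreal (pw (a0 - 2) (ainf - 2) (norm x) * (w x)\<^sup>2) \<partial>lborel) \<le> ennreal (hardy_const * (L2.nrm (wg w))\<^sup>2)"
proof -
  let ?c = "sphere_area TYPE('a)"
  have c: "?c > 0" by (rule sphere_area_pos)
  obtain R where R: "\<And>t. t \<ge> R \<Longrightarrow> prof w t = 0" using prof_support[OF w] by blast
  have [measurable]: "prof w \<in> borel_measurable borel"
    using prof_deriv[OF w] DERIV_isCont by (intro borel_measurable_continuous_onI continuous_at_imp_continuous_on) blast
  have "(\<integral>\<^sup>+x. ennreal (pw (a0 - 2) (ainf - 2) (norm x) * (w x)\<^sup>2) \<partial>lborel) = (\<integral>\<^sup>+x. ennreal (pw (a0 - 2) (ainf - 2) (norm (x::'a)) * (prof w (norm x))\<^sup>2) \<partial>lborel)"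
    by (simp add: prof_norm[OF w])
  also have "\<dots> = (\<integral>\<^sup>+t. ennreal (?c * t ^ (DIM('a) - 1)) * (ennreal (pw (a0 - 2) (ainf - 2) t * (prof w t)\<^sup>2) * indicator {0..} t) \<partial>lborel)"
    by (rule nn_integral_radial) measurable
  also have "\<dots> = (\<integral>\<^sup>+t. ennreal ?c * (ennreal (pw (k0 - 1) (kinf - 1) t * (prof w t)\<^sup>2) * indicator {0<..} t) \<partial>lborel)"
  proof (rule nn_integral_cong)
    fix t :: real
    show "ennreal (?c * t ^ (DIM('a) - 1)) * (ennreal (pw (a0 - 2) (ainf - 2) t * (prof w t)\<^sup>2) * indicator {0..} t)
       = ennreal ?c * (ennreal (pw (k0 - 1) (kinf - 1) t * (prof w t)\<^sup>2) * indicator {0<..} t)"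
    proof (cases "t > 0")
      case True
      have "t ^ (DIM('a) - 1) = t powr (real DIM('a) - 1)" using True dim by (simp add: powr_realpow[symmetric] of_nat_diff)
      also have "\<dots> = pw (real DIM('a) - 1) (real DIM('a) - 1) t" by (simp add: pw_def)
      finally have eq: "t ^ (DIM('a) - 1) * pw (a0 - 2) (ainf - 2) t = pw (k0 - 1) (kinf - 1) t" by (simp add: pw_mult k0_def kinf_def algebra_simps)
      have "?c * (pw (k0 - 1) (kinf - 1) t * (prof w t)\<^sup>2) = (?c * t ^ (DIM('a) - 1)) * (pw (a0 - 2) (ainf - 2) t * (prof w t)\<^sup>2)"
        unfolding eq[symmetric] by (simp add: mult.assoc)
      moreover have "ennreal ?c * (ennreal (pw (k0 - 1) (kinf - 1) t * (prof w t)\<^sup>2) * indicator {0<..} t) = ennreal (?c * (pw (k0 - 1) (kinf - 1) t * (prof w t)\<^sup>2))"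
        using True c by (simp add: ennreal_mult)
      moreover have "ennreal (?c * t ^ (DIM('a) - 1)) * (ennreal (pw (a0 - 2) (ainf - 2) t * (prof w t)\<^sup>2) * indicator {0..} t)
        = ennreal ((?c * t ^ (DIM('a) - 1)) * (pw (a0 - 2) (ainf - 2) t * (prof w t)\<^sup>2))"
        using True c by (subst ennreal_mult[of "?c * t ^ (DIM('a) - 1)"]) auto
      ultimately show ?thesis by (simp only:)
    next
      case False
      have "DIM('a) - 1 > 0" using dim by simp
      then show ?thesis using False by (cases "t = 0") (auto simp: power_0_left)
    qed
  qed
  also have "\<dots> = ennreal ?c * (\<integral>\<^sup>+t. (ennreal (pw (k0 - 1) (kinf - 1) t * (prof w t)\<^sup>2) * indicator {0<..} t) \<partial>lborel)"
    by (rule nn_integral_cmult) measurable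
  also have "\<dots> \<le> ennreal ?c * (ennreal ((2/k0 + 2/kinf)\<^sup>2) * (\<integral>\<^sup>+t. ennreal (pw (k0 + 1) (kinf + 1) t * (prof' w t)\<^sup>2) * indicator {0<..} t \<partial>lborel))"
    by (intro mult_left_mono hardy[OF k_pos prof_deriv[OF w] prof'_cont[OF w] R]) auto
  also have "\<dots> \<le> ennreal ?c * (ennreal ((2/k0 + 2/kinf)\<^sup>2) * ennreal (energy_const * (L2.nrm (wg w))\<^sup>2))"
    by (intro mult_left_mono energy_1d w) auto
  also have "\<dots> = ennreal (hardy_const * (L2.nrm (wg w))\<^sup>2)"
    using c energy_const_pos by (simp add: hardy_const_def ennreal_mult[symmetric] mult.assoc)
  finally show ?thesis .
qed

text \<open>The factor |w|^(p-2), with p >= 2 because a <= 2, is estimated by decay, and the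
  remaining w^2 goes to the Hardy inequality; \<open>p_crit\<close> is exactly the p with -(k/2) (p
  - 2) = a - 2. The set \<open>S\<close> selects the side of the unit sphere on which
  \<open>a\<close> is the relevant exponent.\<close>

lemma sobolev_aux:
  assumes w: "w \<in> S_A A" and k: "k > 0" and a: "a \<le> 2" "k = real DIM('a) + a - 2" and p: "p = p_crit DIM('a) a"
    and S: "S \<in> sets borel"
    and on_S: "\<And>t. 0 < t \<Longrightarrow> t \<in> S \<Longrightarrow> \<kappa> t = decay_const * t powr (- (k/2)) \<and> pw (a0 - 2) (ainf - 2) t = t powr (a - 2)"
  shows "(\<integral>\<^sup>+x. ennreal (\<bar>w x\<bar> powr p) * indicator S (norm x) \<partial>lborel)
    \<le> ennreal (decay_const powr (p - 2) * hardy_const * L2.nrm (wg w) powr p)"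
proof -
  let ?n = "L2.nrm (wg w)"
  have n: "?n \<ge> 0" using wg_L2[OF w] by simp
  have p2: "p \<ge> 2" using a k by (simp add: p p_crit_def field_simps)
  have pointwise: "\<bar>w x\<bar> powr p \<le> decay_const powr (p - 2) * ?n powr (p - 2) * (pw (a0 - 2) (ainf - 2) (norm x) * (w x)\<^sup>2)"
    if x: "x \<noteq> 0" "norm x \<in> S" for x
  proof (cases "w x = 0")
    case False
    have "\<bar>w x\<bar> powr p = \<bar>w x\<bar> powr (p - 2) * (w x)\<^sup>2"
      using False by (simp add: powr_diff powr_numeral)
    also have "\<dots> \<le> (decay_const * norm x powr (- (k/2)) * ?n) powr (p - 2) * (w x)\<^sup>2"
      using S_A_decay[OF w x(1)] on_S[of "norm x"] x p2 by (intro mult_right_mono powr_mono2) auto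
    also have "(decay_const * norm x powr (- (k/2)) * ?n) powr (p - 2) = decay_const powr (p - 2) * ?n powr (p - 2) * norm x powr (a - 2)"
    proof -
      have "p * k = 2 * real DIM('a)" using k by (simp add: p p_crit_def a(2))
      moreover have "- (k/2) * (p - 2) = k - (p * k) / 2" by (simp add: field_simps)
      ultimately have "- (k/2) * (p - 2) = a - 2" using a(2) by simp
      then show ?thesis using n decay_const_pos x by (simp add: powr_mult powr_powr)
    qed
    finally show ?thesis using on_S[of "norm x"] x by (simp add: mult.assoc)
  qed (use p2 n in simp)
  have [measurable]: "w \<in> borel_measurable borel"
    using test_functions_Ck[OF S_A_test[OF w], of 0] by (auto intro: borel_measurable_continuous_onI)
  have "(\<integral>\<^sup>+x. ennreal (\<bar>w x\<bar> powr p) * indicator S (norm x) \<partial>lborel)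
    \<le> (\<integral>\<^sup>+x. ennreal (decay_const powr (p - 2) * ?n powr (p - 2)) * ennreal (pw (a0 - 2) (ainf - 2) (norm x) * (w x)\<^sup>2) \<partial>lborel)"
  proof (rule nn_integral_mono_AE)
    show "AE x in lborel. ennreal (\<bar>w x\<bar> powr p) * indicator S (norm x) \<le> ennreal (decay_const powr (p - 2) * ?n powr (p - 2)) * ennreal (pw (a0 - 2) (ainf - 2) (norm x) * (w x)\<^sup>2)"
      using AE_lborel_singleton[of 0]
    proof eventually_elim
      case (elim x)
      then show ?case using pointwise[of x] decay_const_pos n
        by (cases "norm x \<in> S") (auto simp: ennreal_mult[symmetric])
    qed
  qed
  also have "\<dots> = ennreal (decay_const powr (p - 2) * ?n powr (p - 2)) * (\<integral>\<^sup>+x. ennreal (pw (a0 - 2) (ainf - 2) (norm x) * (w x)\<^sup>2) \<partial>lborel)"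
    by (rule nn_integral_cmult) measurable
  also have "\<dots> \<le> ennreal (decay_const powr (p - 2) * ?n powr (p - 2)) * ennreal (hardy_const * ?n\<^sup>2)"
    by (intro mult_left_mono S_A_hardy w) simp
  also have "\<dots> = ennreal (decay_const powr (p - 2) * hardy_const * (?n powr (p - 2) * ?n\<^sup>2))"
    using hardy_const_pos by (subst ennreal_mult[symmetric]) (auto simp: ac_simps)
  also have "?n powr (p - 2) * ?n\<^sup>2 = ?n powr p"
    using n by (cases "?n = 0") (simp_all add: powr_diff powr_numeral)
  finally show ?thesis .
qed

theorem S_A_sobolev:
  assumes w: "w \<in> S_A A"
  shows "(\<integral>\<^sup>+x. ennreal (\<bar>w x\<bar> powr p_crit DIM('a) a0) * indicator {..1} (norm x) \<partial>lborel)
      \<le> ennreal (decay_const powr (p_crit DIM('a) a0 - 2) * hardy_const * L2.nrm (wg w) powr p_crit DIM('a) a0)"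
    and "(\<integral>\<^sup>+x. ennreal (\<bar>w x\<bar> powr p_crit DIM('a) ainf) * indicator {1<..} (norm x) \<partial>lborel)
      \<le> ennreal (decay_const powr (p_crit DIM('a) ainf - 2) * hardy_const * L2.nrm (wg w) powr p_crit DIM('a) ainf)"
  by (rule sobolev_aux[OF w k_pos(1) a_le(1) k0_def refl], simp, simp add: \<kappa>_def pw_def)
     (rule sobolev_aux[OF w k_pos(2) a_le(2) kinf_def refl], simp, simp add: \<kappa>_def pw_def)

end

subsection \<open>Lebesgue sums\<close>

lemma Lp_lincomb_aux: "\<bar>a - b\<bar> powr p \<le> 2 powr p * (\<bar>a\<bar> powr p + \<bar>b\<bar> powr p)" if "p \<ge> 0" for a b p :: real
proof -
  have "\<bar>a - b\<bar> powr p \<le> (2 * max \<bar>a\<bar> \<bar>b\<bar>) powr p" using that by (intro powr_mono2) auto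
  also have "\<dots> = 2 powr p * max \<bar>a\<bar> \<bar>b\<bar> powr p" by (simp add: powr_mult)
  also have "max \<bar>a\<bar> \<bar>b\<bar> powr p \<le> \<bar>a\<bar> powr p + \<bar>b\<bar> powr p" by (auto simp: max_def)
  finally show ?thesis by simp
qed

lemma Lp_diff:
  assumes u: "u \<in> Lp p" and v: "v \<in> Lp p" and p: "p \<ge> 0"
  shows "(\<lambda>x. u x - v x) \<in> Lp p"
proof -
  have [measurable]: "u \<in> borel_measurable lebesgue" "v \<in> borel_measurable lebesgue" using u v by (auto simp: Lp_def)
  have "integrable lebesgue (\<lambda>x. \<bar>u x - v x\<bar> powr p)"
  proof (rule Bochner_Integration.integrable_bound)
    show "integrable lebesgue (\<lambda>x. 2 powr p * (\<bar>u x\<bar> powr p + \<bar>v x\<bar> powr p))"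
      using u v by (auto simp: Lp_def)
  qed (use Lp_lincomb_aux[OF p] in auto)
  then show ?thesis by (simp add: Lp_def)
qed

lemma Lp_zero: "(\<lambda>x. 0) \<in> Lp p"
  by (simp add: Lp_def)

lemma test_functions_Lp:
  assumes u: "u \<in> test_functions \<Omega>" and p: "p \<ge> 0"
  shows "u \<in> Lp p"
proof -
  have [measurable]: "u \<in> borel_measurable lebesgue" by (rule test_functions_measurable[OF u])
  obtain C where C: "compact C" "\<And>x. x \<notin> C \<Longrightarrow> u x = 0" using test_functions_support[OF u] by metis
  obtain M where M: "M > 0" "\<And>x. \<bar>u x\<bar> \<le> M" using test_functions_bounded[OF u] by metis
  have "integrable lebesgue (\<lambda>x. \<bar>u x\<bar> powr p)"
  proof (rule Bochner_Integration.integrable_bound)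
    have "emeasure lborel C < \<infinity>" using C(1) by (intro emeasure_bounded_finite compact_imp_bounded)
    then show "integrable lebesgue (\<lambda>x. M powr p * indicator C x)"
      using C(1) by (intro integrable_mult_right integrable_real_indicator) (auto simp: borel_compact)
    have "\<bar>u x\<bar> powr p \<le> M powr p * indicator C x" for x
      using C(2)[of x] M(2)[of x] p by (cases "x \<in> C") (auto intro: powr_mono2)
    then show "AE x in lebesgue. norm (\<bar>u x\<bar> powr p) \<le> norm (M powr p * indicator C x)" by simp
  qed measurable
  then show ?thesis by (simp add: Lp_def)
qed

lemma Lp_norm_powr:
  assumes "u \<in> Lp p" "p > 0"
  shows "(\<integral>x. \<bar>u x\<bar> powr p \<partial>lebesgue) = Lp_norm p u powr p"
  using assms by (simp add: Lp_norm_def powr_powr integral_nonneg_AE)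

lemma Lp_norm_nonneg [simp]: "0 \<le> Lp_norm p u" by (simp add: Lp_norm_def)

lemma Lp_norm_tendsto_AE_subseq:
  assumes u: "\<And>n. u n \<in> Lp p" and p: "p > 0" and lim: "(\<lambda>n. Lp_norm p (u n)) \<longlonglongrightarrow> 0"
  obtains r :: "nat \<Rightarrow> nat" where "strict_mono r" "AE x in lebesgue. (\<lambda>n. u (r n) x) \<longlonglongrightarrow> 0"
proof -
  have "(\<lambda>n. Lp_norm p (u n) powr p) \<longlonglongrightarrow> 0 powr p"
    using p by (intro tendsto_powr'[OF lim tendsto_const]) auto
  then have "(\<lambda>n. \<integral>x. norm (\<bar>u n x\<bar> powr p) \<partial>lebesgue) \<longlonglongrightarrow> 0"
    using Lp_norm_powr[OF u p] by simp
  moreover have "integrable lebesgue (\<lambda>x. \<bar>u n x\<bar> powr p)" for n using u by (simp add: Lp_def)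
  ultimately obtain r :: "nat \<Rightarrow> nat" where r: "strict_mono r" "AE x in lebesgue. (\<lambda>n. \<bar>u (r n) x\<bar> powr p) \<longlonglongrightarrow> 0"
    using tendsto_L1_AE_subseq[of lebesgue "\<lambda>n x. \<bar>u n x\<bar> powr p"] by metis
  from r(2) have "AE x in lebesgue. (\<lambda>n. u (r n) x) \<longlonglongrightarrow> 0"
  proof eventually_elim
    case (elim x)
    have "(\<lambda>n. (\<bar>u (r n) x\<bar> powr p) powr (1/p)) \<longlonglongrightarrow> 0 powr (1/p)"
      using p by (intro tendsto_powr'[OF elim tendsto_const]) auto
    then have "(\<lambda>n. \<bar>u (r n) x\<bar>) \<longlonglongrightarrow> 0" using p by (simp add: powr_powr)
    then show ?case by (simp add: tendsto_rabs_zero_iff)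
  qed
  then show ?thesis using that r by blast
qed

lemma Lp_sum_diff:
  assumes "u \<in> Lp_sum p q" "v \<in> Lp_sum p q" "p \<ge> 0" "q \<ge> 0"
  shows "(\<lambda>x. u x - v x) \<in> Lp_sum p q"
proof -
  obtain u1 u2 v1 v2 where *: "u1 \<in> Lp p" "u2 \<in> Lp q" "u = (\<lambda>x. u1 x + u2 x)" "v1 \<in> Lp p" "v2 \<in> Lp q" "v = (\<lambda>x. v1 x + v2 x)"
    using assms unfolding Lp_sum_def by blast
  have "(\<lambda>x. u1 x - v1 x) \<in> Lp p" "(\<lambda>x. u2 x - v2 x) \<in> Lp q" using * assms by (auto intro: Lp_diff)
  moreover have "(\<lambda>x. u x - v x) = (\<lambda>x. (u1 x - v1 x) + (u2 x - v2 x))" using * by (auto simp: fun_eq_iff)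
  ultimately show ?thesis unfolding Lp_sum_def by fastforce
qed

lemma test_functions_Lp_sum: "u \<in> test_functions \<Omega> \<Longrightarrow> p \<ge> 0 \<Longrightarrow> u \<in> Lp_sum p q"
  unfolding Lp_sum_def using test_functions_Lp[of u \<Omega> p] Lp_zero[of q] by force

lemma Lp_sum_norm_le:
  assumes "u1 \<in> Lp p" "u2 \<in> Lp q" "u = (\<lambda>x. u1 x + u2 x)"
  shows "Lp_sum_norm p q u \<le> max (Lp_norm p u1) (Lp_norm q u2)"
  unfolding Lp_sum_norm_def
  by (rule cInf_lower) (use assms in \<open>auto intro!: bdd_belowI[of _ 0] simp: le_max_iff_disj\<close>)

lemma Lp_sum_norm_nonneg:
  assumes "u \<in> Lp_sum p q"
  shows "0 \<le> Lp_sum_norm p q u"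
  unfolding Lp_sum_norm_def
  by (rule cInf_greatest) (use assms in \<open>auto simp: Lp_sum_def le_max_iff_disj\<close>)

lemma Lp_sum_norm_decomp:
  assumes u: "u \<in> Lp_sum p q" and e: "e > 0"
  obtains u1 u2 where "u1 \<in> Lp p" "u2 \<in> Lp q" "u = (\<lambda>x. u1 x + u2 x)"
    "Lp_norm p u1 < Lp_sum_norm p q u + e" "Lp_norm q u2 < Lp_sum_norm p q u + e"
proof -
  define S where "S = {max (Lp_norm p u1) (Lp_norm q u2) | u1 u2. u1 \<in> Lp p \<and> u2 \<in> Lp q \<and> u = (\<lambda>x. u1 x + u2 x)}"
  have "S \<noteq> {}" using u by (auto simp: Lp_sum_def S_def)
  moreover have "Inf S < Lp_sum_norm p q u + e" using e by (simp add: Lp_sum_norm_def S_def)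
  ultimately obtain z where z: "z \<in> S" "z < Lp_sum_norm p q u + e" using cInf_lessD by metis
  then show ?thesis using that by (auto simp: S_def)
qed

lemma Lp_sum_tendsto_AE_subseq:
  assumes u: "\<And>n. u n \<in> Lp_sum p q" and pq: "p > 0" "q > 0" and lim: "(\<lambda>n. Lp_sum_norm p q (u n)) \<longlonglongrightarrow> 0"
  obtains r :: "nat \<Rightarrow> nat" where "strict_mono r" "AE x in lebesgue. (\<lambda>n. u (r n) x) \<longlonglongrightarrow> 0"
proof -
  \<comment> \<open>The infimum defining the norm need not be attained, so decompositions within
    1/(n+1) of it are used.\<close>
  define Q where "Q n v w \<longleftrightarrow> v \<in> Lp p \<and> w \<in> Lp q \<and> u n = (\<lambda>x. v x + w x) \<and>
    Lp_norm p v < Lp_sum_norm p q (u n) + 1 / real (Suc n) \<and> Lp_norm q w < Lp_sum_norm p q (u n) + 1 / real (Suc n)" for n v w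
  have "\<exists>v w. Q n v w" for n
    by (rule Lp_sum_norm_decomp[OF u[of n], of "1 / real (Suc n)"]) (simp, auto simp: Q_def)
  then obtain v w where "\<And>n. Q n (v n) (w n)" by metis
  then have vw: "\<And>n. v n \<in> Lp p" "\<And>n. w n \<in> Lp q" "\<And>n. u n = (\<lambda>x. v n x + w n x)"
    "\<And>n. Lp_norm p (v n) < Lp_sum_norm p q (u n) + 1 / real (Suc n)" "\<And>n. Lp_norm q (w n) < Lp_sum_norm p q (u n) + 1 / real (Suc n)"
    unfolding Q_def by blast+
  have z: "(\<lambda>n. Lp_sum_norm p q (u n) + 1 / real (Suc n)) \<longlonglongrightarrow> 0"
    using tendsto_add[OF lim LIMSEQ_Suc[OF lim_const_over_n[of 1]]] by simp
  have lv: "(\<lambda>n. Lp_norm p (v n)) \<longlonglongrightarrow> 0"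
    by (rule Lim_null_comparison[OF _ z]) (use vw(4) in \<open>auto intro!: always_eventually less_imp_le\<close>)
  have lw: "(\<lambda>n. Lp_norm q (w n)) \<longlonglongrightarrow> 0"
    by (rule Lim_null_comparison[OF _ z]) (use vw(5) in \<open>auto intro!: always_eventually less_imp_le\<close>)
  obtain r :: "nat \<Rightarrow> nat" where r: "strict_mono r" "AE x in lebesgue. (\<lambda>n. v (r n) x) \<longlonglongrightarrow> 0"
    using Lp_norm_tendsto_AE_subseq[OF vw(1) pq(1) lv] by blast
  have "(\<lambda>n. Lp_norm q (w (r n))) \<longlonglongrightarrow> 0" using LIMSEQ_subseq_LIMSEQ[OF lw r(1)] by (simp add: o_def)
  then obtain r' :: "nat \<Rightarrow> nat" where r': "strict_mono r'" "AE x in lebesgue. (\<lambda>n. w (r (r' n)) x) \<longlonglongrightarrow> 0"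
    using Lp_norm_tendsto_AE_subseq[of "\<lambda>n. w (r n)" q] vw(2) pq(2) by metis
  have "AE x in lebesgue. (\<lambda>n. u (r (r' n)) x) \<longlonglongrightarrow> 0"
    using r(2) r'(2)
  proof eventually_elim
    case (elim x)
    have "(\<lambda>n. v (r (r' n)) x) \<longlonglongrightarrow> 0" using LIMSEQ_subseq_LIMSEQ[OF elim(1) r'(1)] by (simp add: o_def)
    from tendsto_add[OF this elim(2)] show ?case by (simp add: vw(3))
  qed
  then show ?thesis using that[of "\<lambda>n. r (r' n)"] strict_mono_o[OF r(1) r'(1)] by (simp add: o_def)
qed

context semi_hilbert
begin

lemma nrm_tendsto:
  assumes "\<And>n. s n \<in> X" "l \<in> X" "(\<lambda>n::nat. nrm (s n - l)) \<longlonglongrightarrow> 0"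
  shows "(\<lambda>n. nrm (s n)) \<longlonglongrightarrow> nrm l"
proof -
  have "(\<lambda>n. nrm (s n) - nrm l) \<longlonglongrightarrow> 0"
    by (rule Lim_null_comparison[OF _ assms(3)]) (use assms nrm_diff_abs in auto)
  then show ?thesis by (simp add: LIM_zero_iff)
qed

lemma tendsto_cauchy:
  assumes s: "\<And>n. s n \<in> X" "l \<in> X" "(\<lambda>n::nat. nrm (s n - l)) \<longlonglongrightarrow> 0" and e: "e > 0"
  shows "\<exists>N. \<forall>m\<ge>N. \<forall>n\<ge>N. nrm (s m - s n) < e"
proof -
  obtain N where N: "\<And>n. n \<ge> N \<Longrightarrow> norm (nrm (s n - l) - 0) < e/2" using LIMSEQ_D[OF s(3), of "e/2"] e by auto
  have "nrm (s m - s n) < e" if "m \<ge> N" "n \<ge> N" for m n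
    using nrm_diff_triangle[of "s m" l "s n"] nrm_minus_commute[of l "s n"] s N[OF that(1)] N[OF that(2)] by simp
  then show ?thesis by blast
qed

lemma add_tendsto:
  assumes "\<And>n. s n \<in> X" "l \<in> X" "(\<lambda>n::nat. nrm (s n - l)) \<longlonglongrightarrow> 0"
    and "\<And>n. s' n \<in> X" "l' \<in> X" "(\<lambda>n::nat. nrm (s' n - l')) \<longlonglongrightarrow> 0"
  shows "(\<lambda>n. nrm ((c *\<^sub>R s n + d *\<^sub>R s' n) - (c *\<^sub>R l + d *\<^sub>R l'))) \<longlonglongrightarrow> 0"
proof (rule Lim_null_comparison)
  show "(\<lambda>n. \<bar>c\<bar> * nrm (s n - l) + \<bar>d\<bar> * nrm (s' n - l')) \<longlonglongrightarrow> 0"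
    using tendsto_add[OF tendsto_mult_right_zero[OF assms(3), of "\<bar>c\<bar>"] tendsto_mult_right_zero[OF assms(6), of "\<bar>d\<bar>"]] by simp
  have "nrm ((c *\<^sub>R s n + d *\<^sub>R s' n) - (c *\<^sub>R l + d *\<^sub>R l')) \<le> \<bar>c\<bar> * nrm (s n - l) + \<bar>d\<bar> * nrm (s' n - l')" for n
  proof -
    have "(c *\<^sub>R s n + d *\<^sub>R s' n) - (c *\<^sub>R l + d *\<^sub>R l') = c *\<^sub>R (s n - l) + d *\<^sub>R (s' n - l')" by (simp add: algebra_simps)
    then show ?thesis using nrm_triangle[of "c *\<^sub>R (s n - l)" "d *\<^sub>R (s' n - l')"] nrm_scale assms by simp
  qed
  then show "\<forall>\<^sub>F n in sequentially. norm (nrm ((c *\<^sub>R s n + d *\<^sub>R s' n) - (c *\<^sub>R l + d *\<^sub>R l'))) \<le> \<bar>c\<bar> * nrm (s n - l) + \<bar>d\<bar> * nrm (s' n - l')"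
    using assms by (auto intro!: always_eventually)
qed

end

subsection \<open>The space obtained by completing smooth radial functions\<close>

context radial_weight
begin

text \<open>\<open>H\<close> plays the role of \<open>A\<^sup>1\<^sup>/\<^sup>2 \<nabla>u\<close>; \<open>DG_Hg\<close> identifies the two.\<close>
definition approximates :: "(nat \<Rightarrow> 'a \<Rightarrow> real) \<Rightarrow> ('a \<Rightarrow> real) \<Rightarrow> ('a \<Rightarrow> 'a) \<Rightarrow> bool" where
  "approximates w u H \<longleftrightarrow> (\<forall>n. w n \<in> S_A A) \<and> (AE x in lebesgue. (\<lambda>n. w n x) \<longlonglongrightarrow> u x) \<and>
      (\<lambda>n. L2.nrm (wg (w n) - H)) \<longlonglongrightarrow> 0 \<and> H \<in> L2"

text \<open>The closure of the graph of \<open>wg\<close>. Almost everywhere convergence stands in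
  for convergence in the Lebesgue sum; both lead to the same space, by
  \<open>D_A_iff\<close>.\<close>

definition DG :: "('a \<Rightarrow> real) \<Rightarrow> ('a \<Rightarrow> 'a) \<Rightarrow> bool" where
  "DG u H \<longleftrightarrow> (\<exists>w. approximates w u H)"

lemma DG_E:
  assumes "DG u H"
  obtains w where "approximates w u H"
  using assms unfolding DG_def by blast

lemma approximatesD:
  assumes "approximates w u H"
  shows "w n \<in> S_A A" "AE x in lebesgue. (\<lambda>n. w n x) \<longlonglongrightarrow> u x" "(\<lambda>n. L2.nrm (wg (w n) - H)) \<longlonglongrightarrow> 0" "H \<in> L2"
  using assms by (simp_all add: approximates_def)

lemma DG_L2: "DG u H \<Longrightarrow> H \<in> L2" by (auto simp: DG_def approximates_def)

lemma DG_cong_AE: "DG u H \<Longrightarrow> AE x in lebesgue. u x = v x \<Longrightarrow> DG v H"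
  unfolding DG_def
proof (elim exE, intro exI)
  fix w assume w: "approximates w u H" and uv: "AE x in lebesgue. u x = v x"
  have "AE x in lebesgue. (\<lambda>n. w n x) \<longlonglongrightarrow> v x" using approximatesD(2)[OF w] uv by eventually_elim simp
  then show "approximates w v H" using w by (simp add: approximates_def)
qed

lemma S_A_DG: "w \<in> S_A A \<Longrightarrow> DG w (wg w)"
  unfolding DG_def approximates_def using wg_L2[of w] by (auto intro!: exI[of _ "\<lambda>_. w"])

lemma DG_lincomb:
  assumes "DG u H" "DG v G"
  shows "DG (\<lambda>x. c * u x + d * v x) (c *\<^sub>R H + d *\<^sub>R G)"
proof -
  obtain w where "approximates w u H" by (rule DG_E[OF assms(1)])
  note w = approximatesD[OF this]
  obtain z where "approximates z v G" by (rule DG_E[OF assms(2)])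
  note z = approximatesD[OF this]
  show ?thesis
    unfolding DG_def approximates_def
  proof (intro conjI exI allI)
    show "c *\<^sub>R H + d *\<^sub>R G \<in> L2" using w z by simp
    show "(\<lambda>x. c * w n x + d * z n x) \<in> S_A A" for n by (intro S_A_lincomb w z)
    show "AE x in lebesgue. (\<lambda>n. c * w n x + d * z n x) \<longlonglongrightarrow> c * u x + d * v x"
      using w(2) z(2) by eventually_elim (intro tendsto_intros)
    show "(\<lambda>n. L2.nrm (wg (\<lambda>x. c * w n x + d * z n x) - (c *\<^sub>R H + d *\<^sub>R G))) \<longlonglongrightarrow> 0"
      unfolding wg_lincomb[OF S_A_test[OF w(1)] S_A_test[OF z(1)]]
      by (intro L2.add_tendsto wg_L2 w z)
  qed
qed

lemma DG_diff: "DG u H \<Longrightarrow> DG v G \<Longrightarrow> DG (\<lambda>x. u x - v x) (H - G)"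
  using DG_lincomb[of u H v G 1 "-1"] by simp

lemma S_A_convergent:
  assumes w: "\<And>n. w n \<in> S_A A" and H: "H \<in> L2" "(\<lambda>n. L2.nrm (wg (w n) - H)) \<longlonglongrightarrow> 0" and x: "x \<noteq> 0"
  shows "convergent (\<lambda>n. w n x)"
proof (rule real_Cauchy_convergent, rule CauchyI)
  fix e :: real assume e: "e > 0"
  define d where "d = e / (\<kappa> (norm x) + 1)"
  have k1: "\<kappa> (norm x) + 1 > 0" using \<kappa>_nonneg[of "norm x"] by linarith
  have d: "d > 0" using e k1 by (simp add: d_def)
  obtain N where N: "\<And>m n. m \<ge> N \<Longrightarrow> n \<ge> N \<Longrightarrow> L2.nrm (wg (w m) - wg (w n)) < d"
    using L2.tendsto_cauchy[OF wg_L2[OF w] H d] by blast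
  have "norm (w m x - w n x) < e" if "m \<ge> N" "n \<ge> N" for m n
  proof -
    have "\<bar>w m x - w n x\<bar> \<le> \<kappa> (norm x) * L2.nrm (wg (w m) - wg (w n))"
      using S_A_decay[OF S_A_diff[OF w[of m] w[of n]] x] by (simp add: wg_diff[OF w w])
    also have "\<dots> \<le> \<kappa> (norm x) * d" using N[OF that] by (intro mult_left_mono) auto
    also have "\<dots> < (\<kappa> (norm x) + 1) * d" using d by (simp add: algebra_simps)
    finally show ?thesis using k1 by (simp add: d_def)
  qed
  then show "\<exists>N. \<forall>m\<ge>N. \<forall>n\<ge>N. norm (w m x - w n x) < e" by blast
qed

definition equicont_const :: "real \<Rightarrow> real \<Rightarrow> real" where
  "equicont_const r d = sqrt (d * pw (- k0 - 1) (- kinf - 1) r * energy_const)"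

lemma equicont_const_nonneg [simp]: "0 \<le> d \<Longrightarrow> 0 \<le> equicont_const r d"
  using energy_const_pos by (simp add: equicont_const_def)

text \<open>Decay applied to differences makes the limit exist at every nonzero point, not only
  almost everywhere; decay and equicontinuity then pass to it.\<close>

lemma DG_limit:
  assumes w: "\<And>n. w n \<in> S_A A" and H: "H \<in> L2" "(\<lambda>n. L2.nrm (wg (w n) - H)) \<longlonglongrightarrow> 0"
  obtains u where "DG u H" "\<And>x. x \<noteq> 0 \<Longrightarrow> (\<lambda>n. w n x) \<longlonglongrightarrow> u x" "\<And>x. x \<noteq> 0 \<Longrightarrow> \<bar>u x\<bar> \<le> \<kappa> (norm x) * L2.nrm H"
    "\<And>x y r. 0 < r \<Longrightarrow> r \<le> norm x \<Longrightarrow> r \<le> norm y \<Longrightarrow> \<bar>u x - u y\<bar> \<le> equicont_const r \<bar>norm x - norm y\<bar> * L2.nrm H"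
proof -
  define u where "u x = lim (\<lambda>n. w n x)" for x
  have lim: "(\<lambda>n. w n x) \<longlonglongrightarrow> u x" if "x \<noteq> 0" for x
    using S_A_convergent[OF w H that] by (simp add: u_def convergent_LIMSEQ_iff)
  have n: "(\<lambda>n. L2.nrm (wg (w n))) \<longlonglongrightarrow> L2.nrm H" by (rule L2.nrm_tendsto[OF wg_L2[OF w] H])
  show ?thesis
  proof (rule that)
    have "AE x in lebesgue. (\<lambda>n. w n x) \<longlonglongrightarrow> u x" using AE_nonzero by eventually_elim (rule lim)
    then show "DG u H" unfolding DG_def approximates_def using w H by blast
    show "\<bar>u x\<bar> \<le> \<kappa> (norm x) * L2.nrm H" if "x \<noteq> 0" for x
    proof (rule LIMSEQ_le)
      show "(\<lambda>n. \<bar>w n x\<bar>) \<longlonglongrightarrow> \<bar>u x\<bar>" by (intro tendsto_intros lim that)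
      show "(\<lambda>n. \<kappa> (norm x) * L2.nrm (wg (w n))) \<longlonglongrightarrow> \<kappa> (norm x) * L2.nrm H" by (intro tendsto_intros n)
      show "\<exists>N. \<forall>n\<ge>N. \<bar>w n x\<bar> \<le> \<kappa> (norm x) * L2.nrm (wg (w n))" using S_A_decay[OF w that] by blast
    qed
    show "\<bar>u x - u y\<bar> \<le> equicont_const r \<bar>norm x - norm y\<bar> * L2.nrm H" if "0 < r" "r \<le> norm x" "r \<le> norm y" for x y r
    proof (rule LIMSEQ_le)
      show "(\<lambda>n. \<bar>w n x - w n y\<bar>) \<longlonglongrightarrow> \<bar>u x - u y\<bar>" using that by (intro tendsto_intros lim) auto
      show "(\<lambda>n. equicont_const r \<bar>norm x - norm y\<bar> * L2.nrm (wg (w n))) \<longlonglongrightarrow> equicont_const r \<bar>norm x - norm y\<bar> * L2.nrm H"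
        by (intro tendsto_intros n)
      show "\<exists>N. \<forall>n\<ge>N. \<bar>w n x - w n y\<bar> \<le> equicont_const r \<bar>norm x - norm y\<bar> * L2.nrm (wg (w n))"
        unfolding equicont_const_def using S_A_equicont[OF that w] by blast
    qed
  qed (use lim in auto)
qed

text \<open>Arzela-Ascoli needs its estimates at every point; this version of \<open>u\<close> has
  them off the origin.\<close>

lemma DG_representative:
  assumes "DG u H"
  obtains v where "AE x in lebesgue. u x = v x" "\<And>x. x \<noteq> 0 \<Longrightarrow> \<bar>v x\<bar> \<le> \<kappa> (norm x) * L2.nrm H"
    "\<And>x y r. 0 < r \<Longrightarrow> r \<le> norm x \<Longrightarrow> r \<le> norm y \<Longrightarrow> \<bar>v x - v y\<bar> \<le> equicont_const r \<bar>norm x - norm y\<bar> * L2.nrm H"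
proof -
  obtain w where "approximates w u H" by (rule DG_E[OF assms])
  note w = approximatesD[OF this]
  obtain v where v: "\<And>x. x \<noteq> 0 \<Longrightarrow> (\<lambda>n. w n x) \<longlonglongrightarrow> v x" "\<And>x. x \<noteq> 0 \<Longrightarrow> \<bar>v x\<bar> \<le> \<kappa> (norm x) * L2.nrm H"
    "\<And>x y r. 0 < r \<Longrightarrow> r \<le> norm x \<Longrightarrow> r \<le> norm y \<Longrightarrow> \<bar>v x - v y\<bar> \<le> equicont_const r \<bar>norm x - norm y\<bar> * L2.nrm H"
    using DG_limit[OF w(1,4,3)] by metis
  have "AE x in lebesgue. u x = v x"
    using w(2) AE_nonzero by eventually_elim (use v(1) LIMSEQ_unique in blast)
  then show ?thesis using that v by blast
qed

lemma DG_decay: "DG u H \<Longrightarrow> AE x in lebesgue. \<bar>u x\<bar> \<le> \<kappa> (norm x) * L2.nrm H"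
proof (erule DG_representative)
  fix v assume v: "AE x in lebesgue. u x = v x" "\<And>x. x \<noteq> 0 \<Longrightarrow> \<bar>v x\<bar> \<le> \<kappa> (norm x) * L2.nrm H"
  show "AE x in lebesgue. \<bar>u x\<bar> \<le> \<kappa> (norm x) * L2.nrm H" using v(1) AE_nonzero by eventually_elim (use v(2) in simp)
qed

lemma DG_measurable:
  assumes "DG u H"
  shows "u \<in> borel_measurable lebesgue"
proof -
  obtain w where "approximates w u H" by (rule DG_E[OF assms])
  note w = approximatesD[OF this]
  have [measurable]: "w n \<in> borel_measurable lebesgue" for n by (rule test_functions_measurable[OF S_A_test[OF w(1)]])
  have "(\<lambda>x. lim (\<lambda>n. w n x)) \<in> borel_measurable lebesgue" by measurable
  then show ?thesis
    by (rule borel_measurable_AE) (use w(2) in \<open>eventually_elim, auto intro: limI\<close>)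
qed

text \<open>A diagonal choice: each \<open>H n\<close> is replaced by a smooth field within 1/(n+1)
  of it. Pointwise convergence then follows from the decay estimate for the differences with the
  limit.\<close>

lemma DG_complete:
  assumes u: "\<And>n. DG (u n) (H n)" and H: "G \<in> L2" "(\<lambda>n. L2.nrm (H n - G)) \<longlonglongrightarrow> 0"
  obtains v where "DG v G" "AE x in lebesgue. (\<lambda>n. u n x) \<longlonglongrightarrow> v x"
proof -
  have HL: "H n \<in> L2" for n using u DG_L2 by blast
  have "\<exists>w. w \<in> S_A A \<and> L2.nrm (wg w - H n) < 1 / real (Suc n)" for n
  proof -
    obtain w where "approximates w (u n) (H n)" by (rule DG_E[OF u[of n]])
  note w = approximatesD[OF this]
    obtain N where "\<And>k. k \<ge> N \<Longrightarrow> norm (L2.nrm (wg (w k) - H n) - 0) < 1 / real (Suc n)"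
      using LIMSEQ_D[OF w(3), of "1 / real (Suc n)"] by auto
    from this[of N] show ?thesis using w(1) by (intro exI[of _ "w N"]) auto
  qed
  then obtain w where w: "\<And>n. w n \<in> S_A A" "\<And>n. L2.nrm (wg (w n) - H n) < 1 / real (Suc n)" by metis
  have lim: "(\<lambda>n. L2.nrm (wg (w n) - G)) \<longlonglongrightarrow> 0"
  proof (rule Lim_null_comparison)
    show "(\<lambda>n. 1 / real (Suc n) + L2.nrm (H n - G)) \<longlonglongrightarrow> 0"
      using tendsto_add[OF LIMSEQ_Suc[OF lim_const_over_n[of 1]] H(2)] by simp
    have "L2.nrm (wg (w n) - G) \<le> 1 / real (Suc n) + L2.nrm (H n - G)" for n
      using L2.nrm_diff_triangle[OF wg_L2[OF w(1)] HL H(1), of n n] w(2)[of n] by linarith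
    then show "\<forall>\<^sub>F n in sequentially. norm (L2.nrm (wg (w n) - G)) \<le> 1 / real (Suc n) + L2.nrm (H n - G)"
      using wg_L2[OF w(1)] H(1) by (auto intro!: always_eventually)
  qed
  obtain v where v: "DG v G" using DG_limit[OF w(1) H(1) lim] by metis
  have "AE x in lebesgue. \<forall>n. \<bar>u n x - v x\<bar> \<le> \<kappa> (norm x) * L2.nrm (H n - G)"
    unfolding AE_all_countable using DG_decay[OF DG_diff[OF u v]] by blast
  then have "AE x in lebesgue. (\<lambda>n. u n x) \<longlonglongrightarrow> v x"
  proof eventually_elim
    case (elim x)
    have "(\<lambda>n. u n x - v x) \<longlonglongrightarrow> 0"
      by (rule Lim_null_comparison[OF _ tendsto_mult_right_zero[OF H(2), of "\<kappa> (norm x)"]]) (use elim in auto)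
    then show ?case by (simp add: LIM_zero_iff)
  qed
  then show ?thesis using that v by blast
qed

section \<open>Sobolev estimates for limits and the description of \<open>D_A\<close>\<close>

definition sob_const :: "real \<Rightarrow> real" where
  "sob_const p = (decay_const powr (p - 2) * hardy_const) powr (1 / p)"

text \<open>Fatou for the p-th powers. The bound \<open>l\<close> is the limit of the energy norms
  along the sequence, so that the lemma can be applied to \<open>w n - w m\<close> as m
  grows.\<close>

lemma sobolev_limit_aux:
  assumes z: "\<And>m. z m \<in> S_A A" and lim: "AE x in lebesgue. (\<lambda>m. z m x) \<longlonglongrightarrow> v x"
    and l: "(\<lambda>m. L2.nrm (wg (z m))) \<longlonglongrightarrow> l" and p: "p > 0" and S: "S \<in> sets borel"
    and sob: "\<And>m. (\<integral>\<^sup>+x. ennreal (\<bar>z m x\<bar> powr p) * indicator S (norm x) \<partial>lborel)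
      \<le> ennreal (decay_const powr (p - 2) * hardy_const * L2.nrm (wg (z m)) powr p)"
  shows "(\<lambda>x. v x * indicator S (norm x)) \<in> Lp p" "Lp_norm p (\<lambda>x. v x * indicator S (norm x)) \<le> sob_const p * l"
proof -
  let ?C = "decay_const powr (p - 2) * hardy_const"
  have C: "?C \<ge> 0" using hardy_const_pos by simp
  have l0: "l \<ge> 0" by (rule LIMSEQ_le_const[OF l]) (use wg_L2[OF z] in auto)
  have [measurable]: "z m \<in> borel_measurable lebesgue" for m by (rule test_functions_measurable[OF S_A_test[OF z]])
  have "(\<lambda>x. lim (\<lambda>m. z m x)) \<in> borel_measurable lebesgue" by measurable
  then have [measurable]: "v \<in> borel_measurable lebesgue"
    by (rule borel_measurable_AE) (use lim in \<open>eventually_elim, auto intro: limI\<close>)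
  have "(norm :: 'a \<Rightarrow> real) -` S \<in> sets borel" using measurable_sets_borel[OF _ S, of norm] by simp
  then have "(norm :: 'a \<Rightarrow> real) -` S \<in> sets lebesgue" by simp
  then have [measurable]: "(\<lambda>x::'a. indicator S (norm x) :: real) \<in> borel_measurable lebesgue"
    "(\<lambda>x::'a. indicator S (norm x) :: ennreal) \<in> borel_measurable lebesgue"
    using borel_measurable_indicator[of "(norm :: 'a \<Rightarrow> real) -` S" lebesgue] by (auto simp: indicator_vimage[symmetric] o_def)
  define I where "I = (\<integral>\<^sup>+x. ennreal (\<bar>v x\<bar> powr p) * indicator S (norm x) \<partial>lebesgue)"
  have "I = (\<integral>\<^sup>+x. liminf (\<lambda>m. ennreal (\<bar>z m x\<bar> powr p) * indicator S (norm x)) \<partial>lebesgue)"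
    unfolding I_def
  proof (rule nn_integral_cong_AE)
    show "AE x in lebesgue. ennreal (\<bar>v x\<bar> powr p) * indicator S (norm x) = liminf (\<lambda>m. ennreal (\<bar>z m x\<bar> powr p) * indicator S (norm x))"
      using lim
    proof eventually_elim
      case (elim x)
      have "(\<lambda>m. \<bar>z m x\<bar> powr p) \<longlonglongrightarrow> \<bar>v x\<bar> powr p"
        using p by (intro tendsto_powr'[OF tendsto_rabs[OF elim] tendsto_const]) auto
      then have "(\<lambda>m. ennreal (\<bar>z m x\<bar> powr p)) \<longlonglongrightarrow> ennreal (\<bar>v x\<bar> powr p)" by (rule tendsto_ennrealI)
      then have "(\<lambda>m. ennreal (\<bar>z m x\<bar> powr p) * indicator S (norm x)) \<longlonglongrightarrow> ennreal (\<bar>v x\<bar> powr p) * indicator S (norm x)"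
        by (cases "norm x \<in> S") auto
      then show ?case using lim_imp_Liminf trivial_limit_sequentially by metis
    qed
  qed
  also have "\<dots> \<le> liminf (\<lambda>m. \<integral>\<^sup>+x. ennreal (\<bar>z m x\<bar> powr p) * indicator S (norm x) \<partial>lebesgue)"
    by (rule nn_integral_liminf) measurable
  also have "\<dots> \<le> liminf (\<lambda>m. ennreal (?C * L2.nrm (wg (z m)) powr p))"
    unfolding nn_integral_completion by (intro Liminf_mono always_eventually allI sob)
  also have "\<dots> = ennreal (?C * l powr p)"
  proof -
    have "(\<lambda>m. ?C * L2.nrm (wg (z m)) powr p) \<longlonglongrightarrow> ?C * l powr p"
      using p wg_L2[OF z] by (intro tendsto_mult tendsto_const tendsto_powr'[OF l tendsto_const]) auto
    then show ?thesis using lim_imp_Liminf[OF trivial_limit_sequentially tendsto_ennrealI] by blast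
  qed
  finally have I: "I \<le> ennreal (?C * l powr p)" .
  have eq: "I = (\<integral>\<^sup>+x. ennreal (\<bar>v x * indicator S (norm x)\<bar> powr p) \<partial>lebesgue)"
    unfolding I_def using p by (intro nn_integral_cong) (auto split: split_indicator)
  have int: "integrable lebesgue (\<lambda>x. \<bar>v x * indicator S (norm x)\<bar> powr p)"
  proof (rule integrableI_nonneg)
    show "(\<lambda>x. \<bar>v x * indicator S (norm x)\<bar> powr p) \<in> borel_measurable lebesgue" by measurable
    show "(\<integral>\<^sup>+x. ennreal (\<bar>v x * indicator S (norm x)\<bar> powr p) \<partial>lebesgue) < \<infinity>"
      using order_le_less_trans[OF I] eq by simp
  qed simp
  then show "(\<lambda>x. v x * indicator S (norm x)) \<in> Lp p" by (simp add: Lp_def)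
  have "ennreal (\<integral>x. \<bar>v x * indicator S (norm x)\<bar> powr p \<partial>lebesgue) = I"
    unfolding eq by (rule nn_integral_eq_integral[OF int, symmetric]) simp
  then have "ennreal (\<integral>x. \<bar>v x * indicator S (norm x)\<bar> powr p \<partial>lebesgue) \<le> ennreal (?C * l powr p)" using I by simp
  then have "(\<integral>x. \<bar>v x * indicator S (norm x)\<bar> powr p \<partial>lebesgue) \<le> ?C * l powr p" using C by simp
  then have "Lp_norm p (\<lambda>x. v x * indicator S (norm x)) \<le> (?C * l powr p) powr (1/p)"
    unfolding Lp_norm_def using p by (intro powr_mono2) (auto intro!: integral_nonneg_AE)
  also have "\<dots> = sob_const p * l" using C l0 p by (simp add: sob_const_def powr_mult powr_powr)
  finally show "Lp_norm p (\<lambda>x. v x * indicator S (norm x)) \<le> sob_const p * l" .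
qed

definition p0 :: real where "p0 = p_crit DIM('a) a0"
definition pinf :: real where "pinf = p_crit DIM('a) ainf"

lemma p_crit_pos: "p0 > 0" "pinf > 0"
  using k_pos dim by (auto simp: p0_def pinf_def p_crit_def k0_def kinf_def)

lemma sobolev_limit:
  assumes z: "\<And>m. z m \<in> S_A A" and lim: "AE x in lebesgue. (\<lambda>m. z m x) \<longlonglongrightarrow> v x"
    and l: "(\<lambda>m. L2.nrm (wg (z m))) \<longlonglongrightarrow> l"
  shows "v \<in> Lp_sum p0 pinf" "Lp_sum_norm p0 pinf v \<le> max (sob_const p0) (sob_const pinf) * l"
proof -
  have l0: "l \<ge> 0" by (rule LIMSEQ_le_const[OF l]) (use wg_L2[OF z] in auto)
  note a = sobolev_limit_aux[OF z lim l p_crit_pos(1) _ S_A_sobolev(1)[OF z, folded p0_def]]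
  note b = sobolev_limit_aux[OF z lim l p_crit_pos(2) _ S_A_sobolev(2)[OF z, folded pinf_def]]
  have eq: "v = (\<lambda>x. v x * indicator {..1} (norm x) + v x * indicator {1<..} (norm x))"
    by (auto simp: fun_eq_iff split: split_indicator)
  show "v \<in> Lp_sum p0 pinf" unfolding Lp_sum_def using a(1) b(1) eq by (auto intro!: bexI)
  have "Lp_sum_norm p0 pinf v \<le> max (Lp_norm p0 (\<lambda>x. v x * indicator {..1} (norm x))) (Lp_norm pinf (\<lambda>x. v x * indicator {1<..} (norm x)))"
    by (rule Lp_sum_norm_le[OF a(1) b(1) eq]) auto
  also have "\<dots> \<le> max (sob_const p0 * l) (sob_const pinf * l)"
    using a(2) b(2) by (intro max.mono) auto
  also have "\<dots> \<le> max (sob_const p0) (sob_const pinf) * l"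
    using l0 by (auto intro: mult_right_mono)
  finally show "Lp_sum_norm p0 pinf v \<le> max (sob_const p0) (sob_const pinf) * l" .
qed

text \<open>Forwards, convergence in the Lebesgue sum gives an a.e. convergent subsequence.
  Backwards, the Sobolev estimate for \<open>w n - w m\<close> with m tending to infinity recovers
  convergence in the Lebesgue sum.\<close>

theorem D_A_iff: "u \<in> D_A A a0 ainf \<longleftrightarrow> (\<exists>H. DG u H)"
proof
  assume "u \<in> D_A A a0 ainf"
  then obtain w where u: "u \<in> Lp_sum p0 pinf" and w: "\<And>n. w n \<in> S_A A"
    and lim: "(\<lambda>n. Lp_sum_norm p0 pinf (\<lambda>x. w n x - u x)) \<longlonglongrightarrow> 0"
    and cauchy: "\<And>e. e > 0 \<Longrightarrow> \<exists>n0. \<forall>m\<ge>n0. \<forall>n\<ge>n0. norm_A_smooth A (\<lambda>x. w m x - w n x) < e"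
    unfolding D_A_def Let_def p0_def[symmetric] pinf_def[symmetric] by blast
  have eq: "norm_A_smooth A (\<lambda>x. w m x - w n x) = L2.nrm (wg (w m) - wg (w n))" for m n
    using norm_A_smooth_eq[OF S_A_test[OF S_A_diff[OF w[of m] w[of n]]]] by (simp add: wg_diff[OF w w])
  obtain H where H: "H \<in> L2" "(\<lambda>n. L2.nrm (wg (w n) - H)) \<longlonglongrightarrow> 0"
    using L2.complete'[of "\<lambda>n. wg (w n)"] wg_L2[OF w] cauchy unfolding eq by metis
  have "(\<lambda>x. w n x - u x) \<in> Lp_sum p0 pinf" for n
    using p_crit_pos by (intro Lp_sum_diff u test_functions_Lp_sum[OF S_A_test[OF w]]) auto
  then obtain r :: "nat \<Rightarrow> nat" where r: "strict_mono r" "AE x in lebesgue. (\<lambda>n. w (r n) x - u x) \<longlonglongrightarrow> 0"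
    using Lp_sum_tendsto_AE_subseq[OF _ p_crit_pos lim] by blast
  have "DG u H"
    unfolding DG_def approximates_def
  proof (intro conjI exI allI)
    show "w (r n) \<in> S_A A" for n by (rule w)
    show "AE x in lebesgue. (\<lambda>n. w (r n) x) \<longlonglongrightarrow> u x" using r(2) by (simp add: LIM_zero_iff)
    show "(\<lambda>n. L2.nrm (wg (w (r n)) - H)) \<longlonglongrightarrow> 0" using LIMSEQ_subseq_LIMSEQ[OF H(2) r(1)] by (simp add: o_def)
  qed (rule H)
  then show "\<exists>H. DG u H" by blast
next
  assume "\<exists>H. DG u H"
  then obtain H where "DG u H" by blast
  then obtain w where "approximates w u H" by (rule DG_E)
  note w = approximatesD[OF this]
  let ?C = "max (sob_const p0) (sob_const pinf)"
  have u: "u \<in> Lp_sum p0 pinf"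
    by (rule sobolev_limit(1)[OF w(1,2) L2.nrm_tendsto[OF wg_L2[OF w(1)] w(4,3)]])
  have le: "Lp_sum_norm p0 pinf (\<lambda>x. w n x - u x) \<le> ?C * L2.nrm (wg (w n) - H)" for n
  proof (rule sobolev_limit(2))
    show "(\<lambda>x. w n x - w m x) \<in> S_A A" for m by (intro S_A_diff w)
    show "AE x in lebesgue. (\<lambda>m. w n x - w m x) \<longlonglongrightarrow> w n x - u x" using w(2) by eventually_elim (intro tendsto_intros)
    have "(\<lambda>m. L2.nrm (wg (w n) - wg (w m))) \<longlonglongrightarrow> L2.nrm (wg (w n) - H)"
    proof (rule L2.nrm_tendsto)
      show "(\<lambda>m. L2.nrm ((wg (w n) - wg (w m)) - (wg (w n) - H))) \<longlonglongrightarrow> 0"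
        using w(3) L2.nrm_minus_commute[OF wg_L2[OF w(1)] w(4)] by simp
    qed (use wg_L2[OF w(1)] w(4) in auto)
    then show "(\<lambda>m. L2.nrm (wg (\<lambda>x. w n x - w m x))) \<longlonglongrightarrow> L2.nrm (wg (w n) - H)" by (simp add: wg_diff[OF w(1) w(1)])
  qed
  have mem: "(\<lambda>x. w n x - u x) \<in> Lp_sum p0 pinf" for n
    using p_crit_pos by (intro Lp_sum_diff u test_functions_Lp_sum[OF S_A_test[OF w(1)]]) auto
  have "(\<lambda>n. Lp_sum_norm p0 pinf (\<lambda>x. w n x - u x)) \<longlonglongrightarrow> 0"
    by (rule Lim_null_comparison[OF _ tendsto_mult_right_zero[OF w(3), of ?C]])
       (use le Lp_sum_norm_nonneg[OF mem] in auto)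
  moreover have "\<exists>n0. \<forall>m\<ge>n0. \<forall>n\<ge>n0. norm_A_smooth A (\<lambda>x. w m x - w n x) < e" if "e > 0" for e
  proof -
    have eq: "norm_A_smooth A (\<lambda>x. w m x - w n x) = L2.nrm (wg (w m) - wg (w n))" for m n
      using norm_A_smooth_eq[OF S_A_test[OF S_A_diff[OF w(1)[of m] w(1)[of n]]]] by (simp add: wg_diff[OF w(1) w(1)])
    show ?thesis unfolding eq by (rule L2.tendsto_cauchy[OF wg_L2[OF w(1)] w(4,3) that])
  qed
  ultimately show "u \<in> D_A A a0 ainf"
    unfolding D_A_def Let_def p0_def[symmetric] pinf_def[symmetric] using u w(1) by blast
qed

section \<open>Identification of the weak gradient\<close>

lemma aw_compact_lower:
  assumes C: "compact C" "C \<subseteq> - {0}"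
  obtains c where "c > 0" "\<And>x. x \<in> C \<Longrightarrow> c \<le> aw x"
proof (cases "C = {}")
  case False
  have "continuous_on C aw"
  proof (rule continuous_on_eq)
    show "continuous_on C (\<lambda>x. A (norm x))"
      by (rule continuous_on_compose2[OF A_cont]) (use C in \<open>auto intro!: continuous_intros\<close>)
  qed (use C in \<open>auto simp: aw_def\<close>)
  then obtain x where "x \<in> C" "\<And>y. y \<in> C \<Longrightarrow> aw x \<le> aw y" using continuous_attains_inf[OF C(1) False] by blast
  then show ?thesis using that[of "aw x"] aw_pos[of x] C by auto
qed (use that[of 1] in auto)

lemma \<kappa>_compact_bound:
  assumes C: "compact C" "C \<subseteq> - {0::'a}"
  obtains M where "M > 0" "\<And>x. x \<in> C \<Longrightarrow> \<kappa> (norm x) \<le> M"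
proof (cases "C = {}")
  case False
  obtain x where x: "x \<in> C" "\<And>y. y \<in> C \<Longrightarrow> norm x \<le> norm y"
    using continuous_attains_inf[OF C(1) False, of norm] by (auto intro: continuous_intros)
  have "\<kappa> (norm y) \<le> \<kappa> (norm x)" if "y \<in> C" for y
    unfolding \<kappa>_def using x that C k_pos decay_const_pos by (intro mult_left_mono pw_antimono) auto
  moreover have "\<kappa> (norm x) > 0" unfolding \<kappa>_def using x C decay_const_pos by (auto intro!: mult_pos_pos pw_pos)
  ultimately show ?thesis using that by blast
qed (use that[of 1] in auto)

lemma measurable_lebesgue_on: "f \<in> borel_measurable lebesgue \<Longrightarrow> f \<in> borel_measurable (lebesgue_on S)"
  by (rule measurable_restrict_space1)

text \<open>Integration by parts holds for the smooth approximations and passes to the limit on both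
  sides: for the functions by dominated convergence from the decay bound, for the gradients as an
  \<open>L2\<close> inner product with a fixed field.\<close>

lemma DG_is_weak_grad:
  assumes "DG u H"
  shows "is_weak_grad (- {0}) u (\<lambda>x. H x /\<^sub>R sqrt (aw x))" "(\<lambda>x. H x /\<^sub>R sqrt (aw x)) \<in> Lp_loc 2 (- {0})"
proof -
  let ?G = "\<lambda>x. H x /\<^sub>R sqrt (aw x)"
  have H: "H \<in> L2" using assms by (rule DG_L2)
  have [measurable]: "H \<in> borel_measurable lebesgue" "u \<in> borel_measurable lebesgue"
    using L2_measurable[OF H] DG_measurable[OF assms] by auto
  have [measurable]: "aw \<in> borel_measurable lebesgue" by (rule aw_measurable)
  have G [measurable]: "?G \<in> borel_measurable lebesgue" by measurable
  have sq: "integrable lebesgue (\<lambda>x. indicator C x * (norm (?G x))\<^sup>2)" if C: "compact C" "C \<subseteq> - {0}" for C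
  proof -
    obtain c where c: "c > 0" "\<And>x. x \<in> C \<Longrightarrow> c \<le> aw x" using aw_compact_lower[OF C] by metis
    have [measurable]: "C \<in> sets lebesgue" using C(1) by (simp add: borel_compact)
    show ?thesis
    proof (rule Bochner_Integration.integrable_bound)
      show "integrable lebesgue (\<lambda>x. (1/c) * (norm (H x))\<^sup>2)" by (intro integrable_mult_right L2_integrable H)
      have "indicator C x * (norm (?G x))\<^sup>2 \<le> (1/c) * (norm (H x))\<^sup>2" for x
      proof (cases "x \<in> C")
        case True
        have "(norm (?G x))\<^sup>2 = (norm (H x))\<^sup>2 / aw x" by (simp add: power_mult_distrib field_simps power_inverse)
        also have "\<dots> \<le> (norm (H x))\<^sup>2 / c" using c(1) c(2)[OF True] by (intro divide_left_mono) auto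
        finally show ?thesis using True by simp
      qed (use c in simp)
      then show "AE x in lebesgue. norm (indicator C x * (norm (?G x))\<^sup>2) \<le> norm ((1/c) * (norm (H x))\<^sup>2)"
        using c by simp
    qed measurable
  qed
  have fin: "integrable lebesgue (indicator C :: 'a \<Rightarrow> real)" if C: "compact C" for C
  proof -
    have "emeasure lborel C < \<infinity>" using C by (intro emeasure_bounded_finite compact_imp_bounded)
    then show ?thesis using C by (intro integrable_real_indicator) (auto simp: borel_compact)
  qed
  show L2: "?G \<in> Lp_loc 2 (- {0})"
    unfolding Lp_loc_def using sq measurable_lebesgue_on[OF G] by (auto simp: set_integrable_def powr_numeral)
  have G1: "?G \<in> Lp_loc 1 (- {0})"
    unfolding Lp_loc_def
  proof (intro CollectI conjI allI impI measurable_lebesgue_on[OF G])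
    fix C :: "'a set" assume C: "compact C \<and> C \<subseteq> - {0}"
    have [measurable]: "C \<in> sets lebesgue" using C by (simp add: borel_compact)
    have "integrable lebesgue (\<lambda>x. indicator C x *\<^sub>R norm (?G x))"
    proof (rule Bochner_Integration.integrable_bound)
      show "integrable lebesgue (\<lambda>x. indicator C x + indicator C x * (norm (?G x))\<^sup>2)"
        using C by (intro Bochner_Integration.integrable_add sq fin) auto
      have "t \<le> 1 + t\<^sup>2" for t :: real using zero_le_power2[of "t - 1"] by (simp add: power2_diff) (smt (verit) zero_le_power2)
      then show "AE x in lebesgue. norm (indicator C x *\<^sub>R norm (?G x)) \<le> norm (indicator C x + indicator C x * (norm (?G x))\<^sup>2)"
        by (auto split: split_indicator)
    qed measurable
    then show "(\<lambda>x. norm (?G x) powr 1) absolutely_integrable_on C" by (simp add: set_integrable_def)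
  qed
  have decay: "AE x in lebesgue. \<bar>u x\<bar> \<le> \<kappa> (norm x) * L2.nrm H" by (rule DG_decay[OF assms])
  have U1: "u \<in> Lp_loc 1 (- {0})"
    unfolding Lp_loc_def
  proof (intro CollectI conjI allI impI measurable_lebesgue_on)
    fix C :: "'a set" assume C: "compact C \<and> C \<subseteq> - {0}"
    have [measurable]: "C \<in> sets lebesgue" using C by (simp add: borel_compact)
    obtain M where M: "M > 0" "\<And>x. x \<in> C \<Longrightarrow> \<kappa> (norm x) \<le> M" using \<kappa>_compact_bound C by metis
    have "integrable lebesgue (\<lambda>x. indicator C x *\<^sub>R \<bar>u x\<bar>)"
    proof (rule Bochner_Integration.integrable_bound)
      show "integrable lebesgue (\<lambda>x. (M * L2.nrm H) * indicator C x)" using C by (intro integrable_mult_right fin) auto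
      show "AE x in lebesgue. norm (indicator C x *\<^sub>R \<bar>u x\<bar>) \<le> norm ((M * L2.nrm H) * indicator C x)"
        using decay
      proof eventually_elim
        case (elim x)
        then show ?case using M mult_right_mono[OF M(2)[of x] L2.nrm_nonneg[OF H]] L2.nrm_nonneg[OF H]
          by (cases "x \<in> C") auto
      qed
    qed measurable
    then show "(\<lambda>x. norm (u x) powr 1) absolutely_integrable_on C" by (simp add: set_integrable_def)
  qed measurable
  obtain w where "approximates w u H" by (rule DG_E[OF assms])
  note w = approximatesD[OF this]
  have "(\<integral>x. u x * frechet_derivative \<phi> (at x) b \<partial>lebesgue) = - (\<integral>x. (?G x \<bullet> b) * \<phi> x \<partial>lebesgue)"
    if \<phi>: "\<phi> \<in> test_functions (- {0})" and b: "b \<in> Basis" for \<phi> b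
  proof -
    have \<phi>U: "\<phi> \<in> test_functions UNIV" using \<phi> test_functions_mono by blast
    have [measurable]: "\<phi> \<in> borel_measurable lebesgue" "grad \<phi> \<in> borel_measurable lebesgue" by (rule test_functions_measurable[OF \<phi>])+
    have [measurable]: "w n \<in> borel_measurable lebesgue" for n by (rule test_functions_measurable[OF S_A_test[OF w(1)]])
    obtain C where C: "compact C" "C \<subseteq> - {0}" "\<And>x. x \<notin> C \<Longrightarrow> \<phi> x = 0" "\<And>x. x \<notin> C \<Longrightarrow> grad \<phi> x = 0"
      using test_functions_support[OF \<phi>] by metis
    have [measurable]: "C \<in> sets lebesgue" using C(1) by (simp add: borel_compact)
    obtain B where B: "B > 0" "\<And>x. \<bar>\<phi> x\<bar> \<le> B" "\<And>x. norm (grad \<phi> x) \<le> B" using test_functions_bounded[OF \<phi>] by metis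
    obtain M where M: "M > 0" "\<And>x. x \<in> C \<Longrightarrow> \<kappa> (norm x) \<le> M" using \<kappa>_compact_bound C(1,2) by metis
    obtain c where c: "c > 0" "\<And>x. x \<in> C \<Longrightarrow> c \<le> aw x" using aw_compact_lower[OF C(1,2)] by metis
    have "convergent (\<lambda>n. L2.nrm (wg (w n)))" using L2.nrm_tendsto[OF wg_L2[OF w(1)] H w(3)] by (auto simp: convergent_def)
    then obtain Q where Q: "\<And>n. norm (L2.nrm (wg (w n))) \<le> Q" using convergent_imp_Bseq BseqE by metis
    have gb: "\<bar>grad \<phi> x \<bullet> b\<bar> \<le> B" for x
      using Cauchy_Schwarz_ineq2[of "grad \<phi> x" b] B(3)[of x] b by (simp add: norm_Basis)
    have L: "(\<lambda>n. \<integral>x. w n x * (grad \<phi> x \<bullet> b) \<partial>lebesgue) \<longlonglongrightarrow> (\<integral>x. u x * (grad \<phi> x \<bullet> b) \<partial>lebesgue)"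
    proof (rule integral_dominated_convergence)
      show "integrable lebesgue (\<lambda>x. (M * Q * B) * indicator C x)" using C by (intro integrable_mult_right fin)
      show "AE x in lebesgue. (\<lambda>n. w n x * (grad \<phi> x \<bullet> b)) \<longlonglongrightarrow> u x * (grad \<phi> x \<bullet> b)"
        using w(2) by eventually_elim (intro tendsto_intros)
      fix n
      have "\<bar>w n x * (grad \<phi> x \<bullet> b)\<bar> \<le> (M * Q * B) * indicator C x" for x
      proof (cases "x \<in> C")
        case True
        then have "x \<noteq> 0" using C by auto
        then have "\<bar>w n x\<bar> \<le> \<kappa> (norm x) * L2.nrm (wg (w n))" by (rule S_A_decay[OF w(1)])
        also have "\<dots> \<le> M * Q" using M(1) M(2)[OF True] Q[of n] wg_L2[OF w(1)] by (intro mult_mono) auto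
        finally have "\<bar>w n x\<bar> * \<bar>grad \<phi> x \<bullet> b\<bar> \<le> (M * Q) * B" using gb by (intro mult_mono) auto
        then show ?thesis using True by (simp add: abs_mult)
      qed (simp add: C(4))
      then show "AE x in lebesgue. norm (w n x * (grad \<phi> x \<bullet> b)) \<le> (M * Q * B) * indicator C x" by simp
    qed measurable
    \<comment> \<open>Dividing by the square root of the weight writes the integral of gradient
      times test function as an inner product with \<open>wg\<close>. The weight is bounded below on
      the support of the test function, so \<open>K\<close> is in \<open>L2\<close>.\<close>
    define K where "K x = (\<phi> x / sqrt (aw x)) *\<^sub>R b" for x
    have Km: "K \<in> borel_measurable lebesgue" unfolding K_def by measurable
    have K: "K \<in> L2"
    proof (rule L2_bound[OF Km, of "\<lambda>x. (B\<^sup>2 / c) * indicator C x"])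
      show "integrable lebesgue (\<lambda>x. (B\<^sup>2 / c) * indicator C x)" using C by (intro integrable_mult_right fin)
      have "(norm (K x))\<^sup>2 \<le> (B\<^sup>2 / c) * indicator C x" for x
      proof (cases "x \<in> C")
        case True
        have "(norm (K x))\<^sup>2 = (\<phi> x)\<^sup>2 / aw x" using b by (simp add: K_def norm_Basis power_mult_distrib power_divide)
        also have "\<dots> \<le> B\<^sup>2 / c" using c(1) c(2)[OF True] power_mono[OF B(2)[of x], of 2] by (intro frac_le) auto
        finally show ?thesis using True by simp
      qed (simp add: K_def C(3))
      then show "AE x in lebesgue. (norm (K x))\<^sup>2 \<le> (B\<^sup>2 / c) * indicator C x" by simp
    qed
    have \<phi>0: "\<phi> 0 = 0" using C by auto
    have wK: "wg (w n) x \<bullet> K x = (grad (w n) x \<bullet> b) * \<phi> x" for n x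
      using aw_pos[of x] \<phi>0 by (cases "x = 0") (simp_all add: wg_def K_def)
    have HK: "H x \<bullet> K x = (?G x \<bullet> b) * \<phi> x" for x
      by (simp add: K_def field_simps)
    have "(\<lambda>n. l2_ip (wg (w n)) K) \<longlonglongrightarrow> l2_ip H K" by (rule L2.ip_tendsto[OF wg_L2[OF w(1)] H w(3) K])
    then have R: "(\<lambda>n. \<integral>x. (grad (w n) x \<bullet> b) * \<phi> x \<partial>lebesgue) \<longlonglongrightarrow> (\<integral>x. (?G x \<bullet> b) * \<phi> x \<partial>lebesgue)"
      unfolding l2_ip_def wK HK .
    have "(\<integral>x. w n x * (grad \<phi> x \<bullet> b) \<partial>lebesgue) = - (\<integral>x. (grad (w n) x \<bullet> b) * \<phi> x \<partial>lebesgue)" for n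
      by (rule integral_by_parts[OF S_A_test[OF w(1)] \<phi>U])
    then have "(\<integral>x. u x * (grad \<phi> x \<bullet> b) \<partial>lebesgue) = - (\<integral>x. (?G x \<bullet> b) * \<phi> x \<partial>lebesgue)"
      using LIMSEQ_unique[OF L] tendsto_minus[OF R] by simp
    then show ?thesis using grad_inner[OF test_functions_Ck[OF \<phi>]] by simp
  qed
  then show "is_weak_grad (- {0}) u ?G" unfolding is_weak_grad_def using U1 G1 by blast
qed

definition Hg :: "('a \<Rightarrow> real) \<Rightarrow> 'a \<Rightarrow> 'a" where "Hg u x = sqrt (aw x) *\<^sub>R wgrad u x"

text \<open>By uniqueness of weak gradients \<open>H\<close> depends on \<open>u\<close> alone up to
  null sets, whatever sequence produced it.\<close>

theorem DG_Hg:
  assumes "DG u H"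
  shows "AE x in lebesgue. Hg u x = H x"
proof -
  have "is_weak_grad (- {0}) u (wgrad u) \<and> wgrad u \<in> Lp_loc 2 (- {0})"
    using someI_ex[of "\<lambda>g. is_weak_grad (- {0}) u g \<and> g \<in> Lp_loc 2 (- {0})"] DG_is_weak_grad[OF assms]
    unfolding wgrad_def by blast
  then have "AE x in lebesgue. wgrad u x = H x /\<^sub>R sqrt (aw x)"
    using weak_grad_unique DG_is_weak_grad(1)[OF assms] by blast
  then show ?thesis using AE_nonzero
  proof eventually_elim
    case (elim x)
    then show ?case using aw_pos[of x] by (simp add: Hg_def)
  qed
qed

lemma DG_self:
  assumes "DG u H"
  shows "DG u (Hg u)"
proof -
  have ae: "AE x in lebesgue. H x = Hg u x" using DG_Hg[OF assms] by (auto elim: eventually_mono)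
  have H: "H \<in> L2" by (rule DG_L2[OF assms])
  have Hg: "Hg u \<in> L2" by (rule L2_cong_AE[OF H ae])
  obtain w where "approximates w u H" by (rule DG_E[OF assms])
  note w = approximatesD[OF this]
  have "L2.nrm (wg (w n) - Hg u) = L2.nrm (wg (w n) - H)" for n
  proof -
    have "AE x in lebesgue. (wg (w n) - Hg u) x = (wg (w n) - H) x" using ae by eventually_elim simp
    then show ?thesis unfolding L2.nrm_def using wg_L2[OF w(1)] Hg by (subst l2_ip_cong_AE) auto
  qed
  then have "(\<lambda>n. L2.nrm (wg (w n) - Hg u)) \<longlonglongrightarrow> 0" using w(3) by simp
  then show ?thesis unfolding DG_def approximates_def using Hg w(1,2) by blast
qed

lemma D_A_DG: "u \<in> D_A A a0 ainf \<longleftrightarrow> DG u (Hg u)"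
  using D_A_iff DG_self by blast

lemma energy_A_eq:
  assumes "u \<in> D_A A a0 ainf"
  shows "energy_A A u = (L2.nrm (Hg u))\<^sup>2"
proof -
  have H: "Hg u \<in> L2" using assms D_A_DG DG_L2 by blast
  have ae: "AE x in lebesgue. (norm (Hg u x))\<^sup>2 = A (norm x) * (norm (wgrad u x))\<^sup>2"
  proof -
    have "(norm (Hg u x))\<^sup>2 = aw x * (norm (wgrad u x))\<^sup>2" for x by (simp add: Hg_def power_mult_distrib)
    then show ?thesis using aw_AE by (auto elim: eventually_mono)
  qed
  have m: "(\<lambda>x. (norm (Hg u x))\<^sup>2) \<in> borel_measurable lebesgue" using L2_measurable[OF H] by measurable
  have "(\<integral>x. (norm (Hg u x))\<^sup>2 \<partial>lebesgue) = energy_A A u"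
    unfolding energy_A_def by (rule integral_cong_AE[OF m borel_measurable_AE[OF m ae] ae])
  then show ?thesis using L2.nrm_sq[OF H] by (simp add: l2_ip_self)
qed

text \<open>The field of the composed approximation differs from the claimed limit by two terms: one
  where the bounded factor multiplies the error of \<open>wg (w n)\<close>, and one where the error
  of that factor multiplies the fixed \<open>H\<close>, which dominated convergence handles. A
  smooth function vanishing at 0 keeps the approximations in \<open>S_A\<close>.\<close>

theorem DG_chain:
  assumes u: "DG u H" and \<psi>: "\<And>k. Ck k \<psi>" "\<psi> 0 = 0" and d: "\<And>t. (\<psi> has_real_derivative \<psi>' t) (at t)"
    and \<psi>': "continuous_on UNIV \<psi>'" "\<And>t. \<bar>\<psi>' t\<bar> \<le> M"
  shows "DG (\<lambda>x. \<psi> (u x)) (\<lambda>x. \<psi>' (u x) *\<^sub>R H x)"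
proof -
  have H: "H \<in> L2" using u by (rule DG_L2)
  have M: "M \<ge> 0" using \<psi>'(2)[of 0] by linarith
  obtain w where "approximates w u H" by (rule DG_E[OF u])
  note w = approximatesD[OF this]
  have [measurable]: "u \<in> borel_measurable lebesgue" by (rule DG_measurable[OF u])
  have [measurable]: "w n \<in> borel_measurable lebesgue" for n by (rule test_functions_measurable[OF S_A_test[OF w(1)]])
  have [measurable]: "H \<in> borel_measurable lebesgue" by (rule L2_measurable[OF H])
  have [measurable]: "\<psi>' \<in> borel_measurable borel" using \<psi>'(1) by (rule borel_measurable_continuous_onI)
  have mult: "(\<lambda>x. \<psi>' (v x) *\<^sub>R F x) \<in> L2 \<and> L2.nrm (\<lambda>x. \<psi>' (v x) *\<^sub>R F x) \<le> M * L2.nrm F"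
    if F: "F \<in> L2" and v [measurable]: "v \<in> borel_measurable lebesgue" for v and F :: "'a \<Rightarrow> 'a"
  proof -
    have [measurable]: "F \<in> borel_measurable lebesgue" by (rule L2_measurable[OF F])
    have le: "(norm (\<psi>' (v x) *\<^sub>R F x))\<^sup>2 \<le> M\<^sup>2 * (norm (F x))\<^sup>2" for x
      using power_mono[OF \<psi>'(2)[of "v x"], of 2] by (simp add: power_mult_distrib mult_right_mono)
    have mem: "(\<lambda>x. \<psi>' (v x) *\<^sub>R F x) \<in> L2"
      by (rule L2_bound[of _ "\<lambda>x. M\<^sup>2 * (norm (F x))\<^sup>2"]) (use le L2_integrable[OF F] in auto)
    have "(L2.nrm (\<lambda>x. \<psi>' (v x) *\<^sub>R F x))\<^sup>2 \<le> (\<integral>x. M\<^sup>2 * (norm (F x))\<^sup>2 \<partial>lebesgue)"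
      unfolding L2.nrm_sq[OF mem] l2_ip_self using le L2_integrable[OF F] L2_integrable[OF mem] by (intro integral_mono) auto
    also have "\<dots> = (M * L2.nrm F)\<^sup>2" by (simp add: power_mult_distrib L2.nrm_sq[OF F] l2_ip_self)
    finally have "L2.nrm (\<lambda>x. \<psi>' (v x) *\<^sub>R F x) \<le> M * L2.nrm F"
      by (rule power2_le_imp_le) (use M F in simp)
    then show ?thesis using mem by blast
  qed
  let ?H = "\<lambda>x. \<psi>' (u x) *\<^sub>R H x"
  have HL: "?H \<in> L2" using mult[OF H] by simp
  define z where "z n x = \<psi> (w n x)" for n x
  have wz: "wg (z n) = (\<lambda>x. \<psi>' (w n x) *\<^sub>R wg (w n) x)" for n
    unfolding z_def wg_def by (simp add: grad_compose[OF d test_functions_Ck[OF S_A_test[OF w(1)]]] fun_eq_iff)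
  have z: "z n \<in> S_A A" for n
  proof -
    obtain C where C: "compact C" "\<And>x. x \<notin> C \<Longrightarrow> w n x = 0" using test_functions_support[OF S_A_test[OF w(1)]] by metis
    have t: "z n \<in> test_functions UNIV"
      by (rule test_functionsI[of _ C]) (use C \<psi>(2) in \<open>auto simp: z_def[abs_def] intro!: Ck_compose[OF \<psi>(1)] test_functions_Ck[OF S_A_test[OF w(1)]]\<close>)
    have "wg (z n) \<in> L2" unfolding wz using mult[OF wg_L2[OF w(1)]] by simp
    moreover have "z n x = z n y" if "norm x = norm y" for x y unfolding z_def using S_A_radial[OF w(1) that] by simp
    ultimately show ?thesis using t unfolding S_A_def wg_L2_iff[OF t] by blast
  qed
  define E where "E n x = (\<psi>' (w n x) - \<psi>' (u x)) *\<^sub>R H x" for n x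
  have EL: "E n \<in> L2" for n
  proof -
    have "E n = (\<lambda>x. \<psi>' (w n x) *\<^sub>R H x) - ?H" by (auto simp: fun_eq_iff E_def algebra_simps)
    then show ?thesis using mult[OF H] by simp
  qed
  have "(\<lambda>n. \<integral>x. (norm (E n x))\<^sup>2 \<partial>lebesgue) \<longlonglongrightarrow> (\<integral>x. 0 \<partial>(lebesgue :: 'a measure))"
  proof (rule integral_dominated_convergence)
    show "integrable lebesgue (\<lambda>x. (2*M)\<^sup>2 * (norm (H x))\<^sup>2)" by (intro integrable_mult_right L2_integrable H)
    have "\<bar>\<psi>' a - \<psi>' b\<bar> \<le> 2*M" for a b using \<psi>'(2)[of a] \<psi>'(2)[of b] by linarith
    then show "AE x in lebesgue. norm ((norm (E n x))\<^sup>2) \<le> (2*M)\<^sup>2 * (norm (H x))\<^sup>2" for n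
      using power_mono[of "\<bar>\<psi>' _ - \<psi>' _\<bar>" "2*M" 2] by (auto simp: E_def power_mult_distrib intro!: AE_I2 mult_right_mono)
    show "AE x in lebesgue. (\<lambda>n. (norm (E n x))\<^sup>2) \<longlonglongrightarrow> 0"
      using w(2)
    proof eventually_elim
      case (elim x)
      have "(\<lambda>n. \<psi>' (w n x)) \<longlonglongrightarrow> \<psi>' (u x)"
        using \<psi>'(1) elim by (auto simp: continuous_on_eq_continuous_at intro: isCont_tendsto_compose)
      then have "(\<lambda>n. (norm (E n x))\<^sup>2) \<longlonglongrightarrow> (norm ((\<psi>' (u x) - \<psi>' (u x)) *\<^sub>R H x))\<^sup>2"
        unfolding E_def by (intro tendsto_intros)
      then show ?case by simp
    qed
  qed (auto simp: E_def)
  then have "(\<lambda>n. sqrt (l2_ip (E n) (E n))) \<longlonglongrightarrow> sqrt 0" unfolding l2_ip_self by (intro tendsto_real_sqrt) simp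
  then have E0: "(\<lambda>n. L2.nrm (E n)) \<longlonglongrightarrow> 0" by (simp add: L2.nrm_def)
  have "(\<lambda>n. L2.nrm (wg (z n) - ?H)) \<longlonglongrightarrow> 0"
  proof (rule Lim_null_comparison)
    show "(\<lambda>n. M * L2.nrm (wg (w n) - H) + L2.nrm (E n)) \<longlonglongrightarrow> 0"
      using tendsto_add[OF tendsto_mult_right_zero[OF w(3), of M] E0] by simp
    have "L2.nrm (wg (z n) - ?H) \<le> M * L2.nrm (wg (w n) - H) + L2.nrm (E n)" for n
    proof -
      have D: "wg (w n) - H \<in> L2" using wg_L2[OF w(1)] H by simp
      have eq: "wg (z n) - ?H = (\<lambda>x. \<psi>' (w n x) *\<^sub>R (wg (w n) - H) x) + E n"
        unfolding wz by (auto simp: fun_eq_iff E_def algebra_simps)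
      have "L2.nrm (wg (z n) - ?H) \<le> L2.nrm (\<lambda>x. \<psi>' (w n x) *\<^sub>R (wg (w n) - H) x) + L2.nrm (E n)"
        unfolding eq using mult[OF D] EL by (intro L2.nrm_triangle) auto
      then show ?thesis using mult[OF D, of "w n"] by simp
    qed
    then show "\<forall>\<^sub>F n in sequentially. norm (L2.nrm (wg (z n) - ?H)) \<le> M * L2.nrm (wg (w n) - H) + L2.nrm (E n)"
      using wg_L2[OF z] HL by (auto intro!: always_eventually)
  qed
  moreover have "AE x in lebesgue. (\<lambda>n. z n x) \<longlonglongrightarrow> \<psi> (u x)"
    using w(2)
  proof eventually_elim
    case (elim x)
    show ?case unfolding z_def using DERIV_isCont[OF d] elim by (rule isCont_tendsto_compose)
  qed
  ultimately show ?thesis unfolding DG_def approximates_def using z HL by blast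
qed

end

subsection \<open>Pointwise domination of the nonlinear term\<close>

text \<open>Both factors grow when their base is replaced by X + Y, and the exponents add up to
  1.\<close>

lemma powr_interpolate:
  fixes X Y \<beta> :: real
  assumes "X > 0" "Y > 0" "0 \<le> \<beta>" "\<beta> \<le> 1"
  shows "X powr \<beta> * Y powr (1 - \<beta>) \<le> X + Y"
proof -
  have "X powr \<beta> * Y powr (1 - \<beta>) \<le> (X + Y) powr \<beta> * (X + Y) powr (1 - \<beta>)"
    using assms by (intro mult_mono powr_mono2) auto
  also have "\<dots> = X + Y" using assms by (simp add: powr_add[symmetric])
  finally show ?thesis .
qed

text \<open>Splitting \<open>v\<^sup>\<beta> \<bar>t\<bar>\<^sup>q\<close> as \<open>(v t\<^sup>2)\<^sup>\<beta> \<bar>t\<bar>\<^sup>q\<^sup>-\<^sup>2\<^sup>\<beta>\<close> and using the decay of \<open>t\<close> for the second factor;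
  the strict inequality between \<open>q\<close> and the critical exponent is the condition \<open>\<sigma> \<noteq> 0\<close>.\<close>
lemma weighted_power_bound:
  fixes k v t r :: real
  assumes \<beta>: "0 \<le> \<beta>" "\<beta> \<le> 1" and r: "r > 0" and v: "v \<ge> 0" and q: "q > 0" "q \<ge> 2 * \<beta>" and CD: "C > 0" "D > 0"
    and k: "\<beta> = 0 \<Longrightarrow> k \<le> C * r powr \<alpha>" "\<beta> > 0 \<Longrightarrow> v > 0 \<and> k \<le> C * (r powr \<alpha> * v powr \<beta>)"
    and t: "\<bar>t\<bar> \<le> D * r powr (- h)"
    and \<sigma>: "2 * \<sigma> = \<alpha> - h * (q - 2 * \<beta>) + N * (1 - \<beta>)" and r\<sigma>: "r powr \<sigma> \<le> 1"
  shows "k * \<bar>t\<bar> powr q \<le> C * D powr (q - 2 * \<beta>) * r powr \<sigma> * (v * t\<^sup>2 + r powr (\<sigma> - N))"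
proof (cases "t = 0")
  case True
  then show ?thesis using q CD v by simp
next
  case t0: False
  have tp: "\<bar>t\<bar> powr (q - 2 * \<beta>) \<le> D powr (q - 2 * \<beta>) * r powr (- h * (q - 2 * \<beta>))"
  proof -
    have "\<bar>t\<bar> powr (q - 2 * \<beta>) \<le> (D * r powr (- h)) powr (q - 2 * \<beta>)" using t q by (intro powr_mono2) auto
    then show ?thesis using CD by (simp add: powr_mult powr_powr)
  qed
  show ?thesis
  proof (cases "\<beta> = 0")
    case True
    have "k * \<bar>t\<bar> powr q \<le> (C * r powr \<alpha>) * (D powr q * r powr (- h * q))"
      using k(1)[OF True] tp CD True by (intro mult_mono) auto
    also have "\<dots> = C * D powr q * (r powr (\<alpha> - h * q))" by (simp add: powr_add[symmetric] flip: powr_add)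
    also have "\<alpha> - h * q = \<sigma> + (\<sigma> - N)" using \<sigma> True by simp
    also have "C * D powr q * r powr (\<sigma> + (\<sigma> - N)) = C * D powr q * r powr \<sigma> * r powr (\<sigma> - N)" by (simp only: powr_add mult.assoc)
    also have "\<dots> \<le> C * D powr q * r powr \<sigma> * (v * t\<^sup>2 + r powr (\<sigma> - N))"
      using CD v by (intro mult_left_mono) auto
    finally show ?thesis using True by simp
  next
    case False
    then have b: "\<beta> > 0" using \<beta> by simp
    have v0: "v > 0" and kb: "k \<le> C * (r powr \<alpha> * v powr \<beta>)" using k(2)[OF b] by auto
    have "\<bar>t\<bar> powr q = \<bar>t\<bar> powr (2 * \<beta>) * \<bar>t\<bar> powr (q - 2 * \<beta>)" by (simp add: powr_add[symmetric])
    also have "\<bar>t\<bar> powr (2 * \<beta>) = (t\<^sup>2) powr \<beta>" using t0 by (simp add: powr_powr[symmetric] powr_numeral)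
    finally have tq: "\<bar>t\<bar> powr q = (t\<^sup>2) powr \<beta> * \<bar>t\<bar> powr (q - 2 * \<beta>)" .
    have "k * \<bar>t\<bar> powr q \<le> (C * (r powr \<alpha> * v powr \<beta>)) * ((t\<^sup>2) powr \<beta> * (D powr (q - 2 * \<beta>) * r powr (- h * (q - 2 * \<beta>))))"
      unfolding tq using kb tp CD by (intro mult_mono mult_left_mono) auto
    also have "\<dots> = C * D powr (q - 2 * \<beta>) * ((v * t\<^sup>2) powr \<beta> * r powr (\<alpha> - h * (q - 2 * \<beta>)))"
      using v0 by (simp add: powr_mult powr_add[of r \<alpha> "- (h * (q - 2 * \<beta>))", simplified] )
    \<comment> \<open>One power of order sigma is set aside as the small factor; the remaining
      exponent is split in the proportion beta to 1 - beta so that \<open>powr_interpolate\<close>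
      applies.\<close>
    also have "\<alpha> - h * (q - 2 * \<beta>) = \<sigma> + (\<sigma> * \<beta> + (\<sigma> - N) * (1 - \<beta>))" using \<sigma> by (simp add: algebra_simps)
    also have "r powr (\<sigma> + (\<sigma> * \<beta> + (\<sigma> - N) * (1 - \<beta>))) = r powr \<sigma> * ((r powr \<sigma>) powr \<beta> * (r powr (\<sigma> - N)) powr (1 - \<beta>))"
      by (simp add: powr_add powr_powr)
    also have "C * D powr (q - 2 * \<beta>) * ((v * t\<^sup>2) powr \<beta> * (r powr \<sigma> * ((r powr \<sigma>) powr \<beta> * (r powr (\<sigma> - N)) powr (1 - \<beta>))))
      = C * D powr (q - 2 * \<beta>) * r powr \<sigma> * ((r powr \<sigma>) powr \<beta> * ((v * t\<^sup>2) powr \<beta> * (r powr (\<sigma> - N)) powr (1 - \<beta>)))"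
      by (simp only: ac_simps)
    also have "\<dots> \<le> C * D powr (q - 2 * \<beta>) * r powr \<sigma> * (1 * (v * t\<^sup>2 + r powr (\<sigma> - N)))"
    proof (rule mult_left_mono, rule mult_mono)
      show "(r powr \<sigma>) powr \<beta> \<le> 1" using r\<sigma> r \<beta> by (intro powr_le1) auto
      show "(v * t\<^sup>2) powr \<beta> * (r powr (\<sigma> - N)) powr (1 - \<beta>) \<le> v * t\<^sup>2 + r powr (\<sigma> - N)"
        using v0 t0 r \<beta> by (intro powr_interpolate) auto
    qed (use CD in auto)
    finally show ?thesis by simp
  qed
qed

text \<open>Supplies the fixed part of the majorant in \<open>domination\<close> near 0 and near
  infinity.\<close>

lemma integrable_pw_radial:
  assumes p: "p > 0" "q > 0" and N: "DIM('a::euclidean_space) \<ge> 1"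
  shows "integrable lebesgue (\<lambda>x::'a. pw (p - real DIM('a)) (- q - real DIM('a)) (norm x))"
proof -
  let ?N = "real DIM('a)" and ?c = "sphere_area TYPE('a)"
  have c: "?c > 0" by (rule sphere_area_pos)
  have m: "(\<lambda>x::'a. pw (p - ?N) (- q - ?N) (norm x)) \<in> borel_measurable lborel" by measurable
  have "(\<integral>\<^sup>+x. ennreal (pw (p - ?N) (- q - ?N) (norm (x::'a))) \<partial>lborel)
    = (\<integral>\<^sup>+t. ennreal (?c * t ^ (DIM('a) - 1)) * (ennreal (pw (p - ?N) (- q - ?N) t) * indicator {0..} t) \<partial>lborel)"
    by (rule nn_integral_radial) measurable
  \<comment> \<open>From 1 on only the exponent at infinity is seen, so the exponent at 0 may be
    replaced by one that suits \<open>nn_integral_pw_to_inf\<close>.\<close>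
  also have "\<dots> \<le> (\<integral>\<^sup>+t. ennreal ?c * (ennreal (pw (p - 1) (- q - 1) t) * indicator {0..1} t + ennreal (pw (- p - 1) (- q - 1) t) * indicator {1..} t) \<partial>lborel)"
  proof (rule nn_integral_mono)
    fix t :: real
    show "ennreal (?c * t ^ (DIM('a) - 1)) * (ennreal (pw (p - ?N) (- q - ?N) t) * indicator {0..} t)
      \<le> ennreal ?c * (ennreal (pw (p - 1) (- q - 1) t) * indicator {0..1} t + ennreal (pw (- p - 1) (- q - 1) t) * indicator {1..} t)"
    proof (cases "t > 0")
      case True
      have "t ^ (DIM('a) - 1) = t powr (?N - 1)" using True N by (simp add: powr_realpow[symmetric] of_nat_diff)
      also have "\<dots> = pw (?N - 1) (?N - 1) t" by (simp add: pw_def)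
      finally have "t ^ (DIM('a) - 1) * pw (p - ?N) (- q - ?N) t = pw (p - 1) (- q - 1) t"
        by (auto simp: pw_mult intro!: arg_cong2[where f="\<lambda>a b. pw a b t"])
      then have "ennreal (?c * t ^ (DIM('a) - 1)) * (ennreal (pw (p - ?N) (- q - ?N) t) * indicator {0..} t) = ennreal ?c * ennreal (pw (p - 1) (- q - 1) t)"
        using True c by (simp add: ennreal_mult[symmetric] mult.assoc)
      also have "\<dots> \<le> ennreal ?c * (ennreal (pw (p - 1) (- q - 1) t) * indicator {0..1} t + ennreal (pw (- p - 1) (- q - 1) t) * indicator {1..} t)"
        using True by (intro mult_left_mono) (auto simp: pw_def split: split_indicator)
      finally show ?thesis .
    next
      case False
      then show ?thesis by (cases "t = 0") (auto simp: pw_def)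
    qed
  qed
  also have "\<dots> = ennreal ?c * ((\<integral>\<^sup>+t. ennreal (pw (p - 1) (- q - 1) t) * indicator {0..1} t \<partial>lborel) + (\<integral>\<^sup>+t. ennreal (pw (- p - 1) (- q - 1) t) * indicator {1..} t \<partial>lborel))"
    by (subst nn_integral_cmult, measurable, subst nn_integral_add, measurable)
  also have "\<dots> < \<infinity>"
  proof -
    have "(\<integral>\<^sup>+t. ennreal (pw (p - 1) (- q - 1) t) * indicator {0..1} t \<partial>lborel) = (\<integral>\<^sup>+t. ennreal (pw (p - 1) (p - 1) t) * indicator {0..1} t \<partial>lborel)"
      by (rule nn_integral_cong) (auto simp: pw_def split: split_indicator)
    also have "\<dots> \<le> ennreal ((1/p + 1/p) * pw p p 1)" by (rule nn_integral_pw_from_0) (use p in auto)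
    finally have 1: "(\<integral>\<^sup>+t. ennreal (pw (p - 1) (- q - 1) t) * indicator {0..1} t \<partial>lborel) < \<infinity>" by (rule order_le_less_trans) simp
    have 2: "(\<integral>\<^sup>+t. ennreal (pw (- p - 1) (- q - 1) t) * indicator {1..} t \<partial>lborel) < \<infinity>"
      by (rule order_le_less_trans[OF nn_integral_pw_to_inf[OF p]]) auto
    show ?thesis using 1 2 by (simp add: ennreal_mult_less_top)
  qed
  finally have "integrable lborel (\<lambda>x::'a. pw (p - ?N) (- q - ?N) (norm x))"
    by (intro integrableI_nonneg m) auto
  then show ?thesis using integrable_completion[OF m] by simp
qed

text \<open>Dominated convergence with a majorant that moves with n, where the moving part has
  bounded integrals and an arbitrarily small coefficient. In the application the moving part
  consists of terms V u_n^2.\<close>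

lemma almost_dominated_convergence:
  fixes h g :: "nat \<Rightarrow> 'a \<Rightarrow> real"
  assumes h: "\<And>n. h n \<in> borel_measurable M" and lim: "AE x in M. (\<lambda>n. h n x) \<longlonglongrightarrow> 0"
    and g: "\<And>n. integrable M (g n)" "\<And>n. AE x in M. 0 \<le> g n x" "\<And>n. (\<integral>x. g n x \<partial>M) \<le> C"
    and dom: "\<And>\<epsilon>. \<epsilon> > 0 \<Longrightarrow> \<exists>\<eta>. integrable M \<eta> \<and> (\<forall>n. AE x in M. \<bar>h n x\<bar> \<le> \<epsilon> * g n x + \<eta> x)"
  shows "(\<lambda>n. \<integral>x. h n x \<partial>M) \<longlonglongrightarrow> 0" "integrable M (h n)"
proof -
  note [measurable] = h
  have [measurable]: "g n \<in> borel_measurable M" for n using g(1) by (rule borel_measurable_integrable)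
  show int: "integrable M (h n)" for n
  proof -
    obtain \<eta> where \<eta>: "integrable M \<eta>" "\<forall>n. AE x in M. \<bar>h n x\<bar> \<le> 1 * g n x + \<eta> x" using dom[of 1] by auto
    show ?thesis
    proof (rule Bochner_Integration.integrable_bound)
      show "integrable M (\<lambda>x. g n x + \<eta> x)" using g(1) \<eta>(1) by (rule Bochner_Integration.integrable_add)
      show "AE x in M. norm (h n x) \<le> norm (g n x + \<eta> x)" using \<eta>(2)[rule_format, of n] by eventually_elim simp
    qed measurable
  qed
  show "(\<lambda>n. \<integral>x. h n x \<partial>M) \<longlonglongrightarrow> 0"
  proof (rule LIMSEQ_I)
    fix e :: real assume e: "e > 0"
    define \<epsilon> where "\<epsilon> = e / (2 * (\<bar>C\<bar> + 1))"
    have \<epsilon>: "\<epsilon> > 0" using e by (simp add: \<epsilon>_def)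
    obtain \<eta> where \<eta>: "integrable M \<eta>" "\<And>n. AE x in M. \<bar>h n x\<bar> \<le> \<epsilon> * g n x + \<eta> x" using dom[OF \<epsilon>] by blast
    note [measurable] = borel_measurable_integrable[OF \<eta>(1)]
    \<comment> \<open>The excess over the moving part is dominated by the fixed
      \<open>\<eta>\<close> and still tends to 0, so ordinary dominated convergence applies to
      it.\<close>
    define d where "d n x = max 0 (\<bar>h n x\<bar> - \<epsilon> * g n x)" for n x
    have dm [measurable]: "d n \<in> borel_measurable M" for n unfolding d_def by measurable
    have gall: "AE x in M. \<forall>n. 0 \<le> g n x" using g(2) by (simp add: AE_all_countable)
    have db: "AE x in M. norm (d n x) \<le> \<bar>\<eta> x\<bar>" for n using \<eta>(2)[of n] by eventually_elim (auto simp: d_def)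
    have \<eta>a: "integrable M (\<lambda>x. \<bar>\<eta> x\<bar>)" using \<eta>(1) by (rule integrable_abs)
    have dlim: "AE x in M. (\<lambda>n. d n x) \<longlonglongrightarrow> 0"
      using lim gall
    proof eventually_elim
      case (elim x)
      have "norm (d n x) \<le> \<bar>h n x\<bar>" for n
        using elim(2) mult_nonneg_nonneg[of \<epsilon> "g n x"] \<epsilon> by (auto simp: d_def)
      then show ?case by (intro Lim_null_comparison[OF _ tendsto_rabs_zero[OF elim(1)]]) auto
    qed
    have di: "integrable M (d n)" for n by (rule Bochner_Integration.integrable_bound[OF \<eta>a]) (use db in auto)
    have "(\<lambda>n. \<integral>x. d n x \<partial>M) \<longlonglongrightarrow> (\<integral>x. 0 \<partial>M)"
      by (rule integral_dominated_convergence[OF _ dm \<eta>a dlim db]) simp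
    then obtain N where N: "\<And>n. n \<ge> N \<Longrightarrow> norm ((\<integral>x. d n x \<partial>M) - 0) < e/2" using LIMSEQ_D[of _ _ "e/2"] e by fastforce
    have "norm ((\<integral>x. h n x \<partial>M) - 0) < e" if n: "n \<ge> N" for n
    proof -
      have "\<bar>\<integral>x. h n x \<partial>M\<bar> \<le> (\<integral>x. \<bar>h n x\<bar> \<partial>M)" by (rule integral_abs_bound)
      also have "\<dots> \<le> (\<integral>x. \<epsilon> * g n x + d n x \<partial>M)"
        using int di g(1) by (intro integral_mono) (auto simp: d_def)
      also have "\<dots> = \<epsilon> * (\<integral>x. g n x \<partial>M) + (\<integral>x. d n x \<partial>M)"
        using di g(1) by (subst Bochner_Integration.integral_add) auto
      also have "\<dots> < \<epsilon> * (\<bar>C\<bar> + 1) + e/2"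
      proof (rule add_less_le_mono)
        show "\<epsilon> * (\<integral>x. g n x \<partial>M) < \<epsilon> * (\<bar>C\<bar> + 1)" using g(3)[of n] \<epsilon> by (intro mult_strict_left_mono) auto
        show "(\<integral>x. d n x \<partial>M) \<le> e/2" using N[OF n] by simp
      qed
      also have "\<epsilon> * (\<bar>C\<bar> + 1) = e/2" by (simp add: \<epsilon>_def field_simps)
      finally show ?thesis by simp
    qed
    then show "\<exists>N. \<forall>n\<ge>N. norm ((\<integral>x. h n x \<partial>M) - 0) < e" by blast
  qed
qed

subsection \<open>The energy space\<close>

locale potentials = radial_weight A a0 ainf ty
  for A a0 ainf and ty :: "'a::euclidean_space itself" +
  fixes V K :: "real \<Rightarrow> real" and R1 R2 \<alpha>0 \<alpha>inf \<beta>0 \<beta>inf q1 q2 :: real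
  assumes hyp_V: "hyp_V V" and hyp_K: "hyp_K DIM('a) K a0 ainf"
    and R: "R1 > 0" "R2 > 0" and \<beta>: "0 \<le> \<beta>0" "\<beta>0 \<le> 1" "0 \<le> \<beta>inf" "\<beta>inf \<le> 1"
    and ess0: "esssup (lebesgue_on {x::'a. norm x < R1}) (\<lambda>x. KV_quotient K V \<alpha>0 \<beta>0 (norm x)) < \<infinity>"
    and essinf: "esssup (lebesgue_on {x::'a. norm x \<ge> R2}) (\<lambda>x. KV_quotient K V \<alpha>inf \<beta>inf (norm x)) < \<infinity>"
    and q: "q1 > 2" "q2 > 2" "q1 < q_star DIM('a) a0 \<alpha>0 \<beta>0" "q2 > q_star DIM('a) ainf \<alpha>inf \<beta>inf"
begin

text \<open>The origin gets the value 0, for the same reason as in \<open>aw\<close>.\<close>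

definition vw :: "'a \<Rightarrow> real" where "vw x = (if x = 0 then 0 else V (norm x))"
definition kw :: "'a \<Rightarrow> real" where "kw x = (if x = 0 then 0 else K (norm x))"

lemma vw_nonneg [simp]: "0 \<le> vw x" using hyp_V by (auto simp: vw_def hyp_V_def)
lemma kw_nonneg [simp]: "0 \<le> kw x" using hyp_K by (auto simp: kw_def hyp_K_def less_imp_le)

lemma V_meas: "V \<in> borel_measurable (lebesgue_on {0<..})" and K_meas: "K \<in> borel_measurable (lebesgue_on {0<..})"
  using hyp_V hyp_K by (auto simp: hyp_V_def hyp_K_def Lp_loc_def)

lemma vw_AE: "AE x in lebesgue. V (norm x) = vw x" and kw_AE: "AE x in lebesgue. K (norm x) = kw x"
  using AE_nonzero by (eventually_elim, simp add: vw_def)+ (use AE_nonzero in \<open>eventually_elim, simp add: kw_def\<close>)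

lemma vw_measurable [measurable]: "vw \<in> borel_measurable lebesgue"
  and kw_measurable [measurable]: "kw \<in> borel_measurable lebesgue"
  by (rule borel_measurable_AE[OF measurable_radial[OF V_meas] vw_AE], rule borel_measurable_AE[OF measurable_radial[OF K_meas] kw_AE])

text \<open>For beta > 0 a finite essential supremum forces \<open>V\<close> to be positive almost
  everywhere on \<open>S\<close>, since the quotient is infinite where \<open>V\<close> vanishes.
  The case beta = 0 is kept apart because \<open>0 powr 0 = 0\<close>.\<close>

lemma esssup_bound:
  assumes ess: "esssup (lebesgue_on S) (\<lambda>x::'a. KV_quotient K V \<alpha> \<beta> (norm x)) < \<infinity>" and S: "S \<in> sets lebesgue" and b: "\<beta> \<ge> 0"
  obtains C where "C > 0" "AE x in lebesgue. x \<in> S \<longrightarrow> (\<beta> = 0 \<longrightarrow> kw x \<le> C * norm x powr \<alpha>) \<and>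
    (\<beta> > 0 \<longrightarrow> vw x > 0 \<and> kw x \<le> C * (norm x powr \<alpha> * vw x powr \<beta>))"
proof -
  obtain C where C: "C > 0" "esssup (lebesgue_on S) (\<lambda>x::'a. KV_quotient K V \<alpha> \<beta> (norm x)) \<le> ereal C"
  proof (cases "esssup (lebesgue_on S) (\<lambda>x::'a. KV_quotient K V \<alpha> \<beta> (norm x))")
    case (real r)
    then show ?thesis using that[of "\<bar>r\<bar> + 1"] by auto
  next
    case MInf
    then show ?thesis using that[of 1] by auto
  qed (use ess in auto)
  have "AE x in lebesgue_on S. KV_quotient K V \<alpha> \<beta> (norm x) \<le> ereal C"
    using esssup_AE[of "\<lambda>x. KV_quotient K V \<alpha> \<beta> (norm x)" "lebesgue_on S"] by eventually_elim (use C(2) in \<open>auto intro: order_trans\<close>)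
  then have "AE x in lebesgue. x \<in> S \<longrightarrow> KV_quotient K V \<alpha> \<beta> (norm x) \<le> ereal C"
    using S by (subst (asm) AE_restrict_space_iff) auto
  then have "AE x in lebesgue. x \<in> S \<longrightarrow> (\<beta> = 0 \<longrightarrow> kw x \<le> C * norm x powr \<alpha>) \<and>
    (\<beta> > 0 \<longrightarrow> vw x > 0 \<and> kw x \<le> C * (norm x powr \<alpha> * vw x powr \<beta>))"
    using AE_nonzero
  proof eventually_elim
    case (elim x)
    have nx: "norm x powr \<alpha> > 0" using elim(2) by simp
    show ?case
    proof (intro impI conjI)
      assume S: "x \<in> S" and "\<beta> = 0"
      then show "kw x \<le> C * norm x powr \<alpha>" using elim nx by (simp add: KV_quotient_def kw_def field_simps)
    next
      assume S: "x \<in> S" and b: "\<beta> > 0"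
      then have v: "V (norm x) \<noteq> 0" using elim by (auto simp: KV_quotient_def)
      then show v0: "vw x > 0" using vw_nonneg[of x] elim(2) by (simp add: vw_def)
      show "kw x \<le> C * (norm x powr \<alpha> * vw x powr \<beta>)"
        using elim S b v v0 nx by (simp add: KV_quotient_def kw_def vw_def pos_divide_le_eq)
    qed
  qed
  then show ?thesis using that C by blast
qed

definition mq :: "real \<Rightarrow> real" where "mq t = min (\<bar>t\<bar> powr q1) (\<bar>t\<bar> powr q2)"

lemma mq_nonneg [simp]: "0 \<le> mq t" by (simp add: mq_def)

lemma norm_sets: "{x::'a. norm x < r} \<in> sets lebesgue" "{x::'a. r \<le> norm x} \<in> sets lebesgue"
proof -
  have "{x::'a. norm x < r} \<in> sets borel" "{x::'a. r \<le> norm x} \<in> sets borel" by measurable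
  then show "{x::'a. norm x < r} \<in> sets lebesgue" "{x::'a. r \<le> norm x} \<in> sets lebesgue" by simp_all
qed

text \<open>Half the surplus exponent in \<open>weighted_power_bound\<close>, positive exactly when
  q1 is below its critical value \<open>q_star\<close>. \<open>\<sigma>inf\<close> carries the
  opposite sign, so that it is positive for q2 above its own.\<close>

definition \<sigma>0 :: real where "\<sigma>0 = (\<alpha>0 - (k0/2) * (q1 - 2 * \<beta>0) + real DIM('a) * (1 - \<beta>0)) / 2"
definition \<sigma>inf :: real where "\<sigma>inf = - (\<alpha>inf - (kinf/2) * (q2 - 2 * \<beta>inf) + real DIM('a) * (1 - \<beta>inf)) / 2"

lemma \<sigma>_pos: "\<sigma>0 > 0" "\<sigma>inf > 0"
proof -
  have "q1 * k0 < 2 * (\<alpha>0 - 2 * \<beta>0 + real DIM('a) + a0 * \<beta>0)"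
    using q(3) k_pos(1) unfolding q_star_def k0_def[symmetric] by (simp add: k0_def field_simps)
  then show "\<sigma>0 > 0" by (simp add: \<sigma>0_def k0_def field_simps)
  have "q2 * kinf > 2 * (\<alpha>inf - 2 * \<beta>inf + real DIM('a) + ainf * \<beta>inf)"
    using q(4) k_pos(2) unfolding q_star_def kinf_def[symmetric] by (simp add: kinf_def field_simps)
  then show "\<sigma>inf > 0" by (simp add: \<sigma>inf_def kinf_def field_simps)
qed

lemma near_0:
  assumes B: "B > 0" and \<epsilon>: "\<epsilon> > 0"
  obtains r where "0 < r" "r \<le> 1" "AE x in lebesgue. norm x < r \<longrightarrow> (\<forall>t. \<bar>t\<bar> \<le> B * \<kappa> (norm x) \<longrightarrow>
    kw x * \<bar>t\<bar> powr q1 \<le> \<epsilon> * (vw x * t\<^sup>2 + norm x powr (\<sigma>0 - real DIM('a))))"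
proof -
  obtain C where C: "C > 0" "AE x in lebesgue. x \<in> {x. norm x < R1} \<longrightarrow> (\<beta>0 = 0 \<longrightarrow> kw x \<le> C * norm x powr \<alpha>0) \<and>
    (\<beta>0 > 0 \<longrightarrow> vw x > 0 \<and> kw x \<le> C * (norm x powr \<alpha>0 * vw x powr \<beta>0))"
    using esssup_bound[OF ess0 norm_sets(1) \<beta>(1)] by blast
  define D where "D = B * decay_const"
  have D: "D > 0" using B decay_const_pos by (simp add: D_def)
  define E where "E = C * D powr (q1 - 2 * \<beta>0)"
  have E: "E > 0" using C D by (simp add: E_def)
  \<comment> \<open>The last term makes \<open>E\<close> times the power \<open>\<sigma>0\<close> of
    the radius at most epsilon. Below 1 the exponent of \<open>\<kappa>\<close> is the one at 0, and
    below \<open>R1\<close> the bound on the quotient holds.\<close>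
  define r where "r = min (min R1 1) ((\<epsilon> / E) powr (1 / \<sigma>0))"
  show ?thesis
  proof (rule that)
    show "0 < r" using R E \<epsilon> by (simp add: r_def)
    show "r \<le> 1" by (simp add: r_def)
    show "AE x in lebesgue. norm x < r \<longrightarrow> (\<forall>t. \<bar>t\<bar> \<le> B * \<kappa> (norm x) \<longrightarrow>
      kw x * \<bar>t\<bar> powr q1 \<le> \<epsilon> * (vw x * t\<^sup>2 + norm x powr (\<sigma>0 - real DIM('a))))"
      using C(2) AE_nonzero
    proof (eventually_elim, intro impI allI)
      fix x t assume *: "x \<in> {x. norm x < R1} \<longrightarrow> (\<beta>0 = 0 \<longrightarrow> kw x \<le> C * norm x powr \<alpha>0) \<and>
        (\<beta>0 > 0 \<longrightarrow> vw x > 0 \<and> kw x \<le> C * (norm x powr \<alpha>0 * vw x powr \<beta>0))"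
        "x \<noteq> 0" "norm x < r" "\<bar>t\<bar> \<le> B * \<kappa> (norm x)"
      have n: "norm x > 0" "norm x < R1" "norm x < 1" "norm x \<le> (\<epsilon> / E) powr (1 / \<sigma>0)" using * by (auto simp: r_def)
      have "kw x * \<bar>t\<bar> powr q1 \<le> C * D powr (q1 - 2 * \<beta>0) * norm x powr \<sigma>0 * (vw x * t\<^sup>2 + norm x powr (\<sigma>0 - real DIM('a)))"
      proof (rule weighted_power_bound[where h="k0/2" and \<alpha>=\<alpha>0])
        show "\<bar>t\<bar> \<le> D * norm x powr (- (k0/2))" using *(4) n by (simp add: \<kappa>_def pw_def D_def)
        show "norm x powr \<sigma>0 \<le> 1" using n \<sigma>_pos by (intro powr_le1) auto
        show "2 * \<sigma>0 = \<alpha>0 - k0 / 2 * (q1 - 2 * \<beta>0) + real DIM('a) * (1 - \<beta>0)" by (simp add: \<sigma>0_def)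
      qed (use *(1) n \<beta> q C D in auto)
      also have "\<dots> \<le> \<epsilon> * (vw x * t\<^sup>2 + norm x powr (\<sigma>0 - real DIM('a)))"
      proof (rule mult_right_mono)
        have "norm x powr \<sigma>0 \<le> ((\<epsilon> / E) powr (1 / \<sigma>0)) powr \<sigma>0" using n \<sigma>_pos by (intro powr_mono2) auto
        also have "\<dots> = \<epsilon> / E" using \<sigma>_pos \<epsilon> E by (simp add: powr_powr)
        finally have "E * norm x powr \<sigma>0 \<le> \<epsilon>" using E by (simp add: field_simps)
        then show "C * D powr (q1 - 2 * \<beta>0) * norm x powr \<sigma>0 \<le> \<epsilon>" by (simp only: E_def)
      qed simp
      finally show "kw x * \<bar>t\<bar> powr q1 \<le> \<epsilon> * (vw x * t\<^sup>2 + norm x powr (\<sigma>0 - real DIM('a)))" .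
    qed
  qed
qed

lemma near_infinity:
  assumes B: "B > 0" and \<epsilon>: "\<epsilon> > 0"
  obtains S where "1 \<le> S" "AE x in lebesgue. S < norm x \<longrightarrow> (\<forall>t. \<bar>t\<bar> \<le> B * \<kappa> (norm x) \<longrightarrow>
    kw x * \<bar>t\<bar> powr q2 \<le> \<epsilon> * (vw x * t\<^sup>2 + norm x powr (- \<sigma>inf - real DIM('a))))"
proof -
  obtain C where C: "C > 0" "AE x in lebesgue. x \<in> {x. R2 \<le> norm x} \<longrightarrow> (\<beta>inf = 0 \<longrightarrow> kw x \<le> C * norm x powr \<alpha>inf) \<and>
    (\<beta>inf > 0 \<longrightarrow> vw x > 0 \<and> kw x \<le> C * (norm x powr \<alpha>inf * vw x powr \<beta>inf))"
    using esssup_bound[OF essinf norm_sets(2) \<beta>(3)] by blast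
  define D where "D = B * decay_const"
  have D: "D > 0" using B decay_const_pos by (simp add: D_def)
  define E where "E = C * D powr (q2 - 2 * \<beta>inf)"
  have E: "E > 0" using C D by (simp add: E_def)
  \<comment> \<open>The mirror image of the radius in \<open>near_0\<close>: beyond \<open>S\<close>
    the quantity \<open>E\<close> times the power \<open>- \<sigma>inf\<close> of the radius is at
    most epsilon.\<close>
  define S where "S = max (max R2 1) ((E / \<epsilon>) powr (1 / \<sigma>inf))"
  show ?thesis
  proof (rule that)
    show "1 \<le> S" by (simp add: S_def)
    show "AE x in lebesgue. S < norm x \<longrightarrow> (\<forall>t. \<bar>t\<bar> \<le> B * \<kappa> (norm x) \<longrightarrow>
      kw x * \<bar>t\<bar> powr q2 \<le> \<epsilon> * (vw x * t\<^sup>2 + norm x powr (- \<sigma>inf - real DIM('a))))"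
      using C(2)
    proof (eventually_elim, intro impI allI)
      fix x t assume *: "x \<in> {x. R2 \<le> norm x} \<longrightarrow> (\<beta>inf = 0 \<longrightarrow> kw x \<le> C * norm x powr \<alpha>inf) \<and>
        (\<beta>inf > 0 \<longrightarrow> vw x > 0 \<and> kw x \<le> C * (norm x powr \<alpha>inf * vw x powr \<beta>inf))"
        "S < norm x" "\<bar>t\<bar> \<le> B * \<kappa> (norm x)"
      have n: "norm x > 1" "R2 \<le> norm x" "(E / \<epsilon>) powr (1 / \<sigma>inf) \<le> norm x" using * by (auto simp: S_def)
      have x0: "x \<noteq> 0" using n(1) by auto
      have "(E / \<epsilon>) = ((E / \<epsilon>) powr (1 / \<sigma>inf)) powr \<sigma>inf" using \<sigma>_pos \<epsilon> E by (simp add: powr_powr)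
      also have "\<dots> \<le> norm x powr \<sigma>inf" using n \<sigma>_pos by (intro powr_mono2) auto
      finally have ss: "E * norm x powr (- \<sigma>inf) \<le> \<epsilon>" using \<epsilon> x0 by (simp add: powr_minus field_simps)
      have "kw x * \<bar>t\<bar> powr q2 \<le> C * D powr (q2 - 2 * \<beta>inf) * norm x powr (- \<sigma>inf) * (vw x * t\<^sup>2 + norm x powr (- \<sigma>inf - real DIM('a)))"
      proof (rule weighted_power_bound[where h="kinf/2" and \<alpha>=\<alpha>inf])
        show "\<bar>t\<bar> \<le> D * norm x powr (- (kinf/2))" using *(3) n by (simp add: \<kappa>_def pw_def D_def)
        show "norm x powr - \<sigma>inf \<le> 1" using n \<sigma>_pos powr_mono[of "- \<sigma>inf" 0 "norm x"] x0 by simp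
        show "2 * - \<sigma>inf = \<alpha>inf - kinf / 2 * (q2 - 2 * \<beta>inf) + real DIM('a) * (1 - \<beta>inf)" by (simp add: \<sigma>inf_def field_simps)
      qed (use *(1) n \<beta> q C D in auto)
      also have "\<dots> \<le> \<epsilon> * (vw x * t\<^sup>2 + norm x powr (- \<sigma>inf - real DIM('a)))"
        using ss by (intro mult_right_mono) (auto simp: E_def)
      finally show "kw x * \<bar>t\<bar> powr q2 \<le> \<epsilon> * (vw x * t\<^sup>2 + norm x powr (- \<sigma>inf - real DIM('a)))" .
    qed
  qed
qed

text \<open>Positivity of \<open>k0\<close> makes the first lower bound in \<open>hyp_K\<close> at
  least 1, so the exponent p there exceeds 1, and y <= 1 + y^p gives local integrability.\<close>

lemma K_annulus_integrable:
  assumes "0 < r"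
  shows "integrable lebesgue (\<lambda>x::'a. indicator {x. r \<le> norm x \<and> norm x \<le> s} x * K (norm x))"
proof (rule integrable_radial_annulus[OF K_meas assms])
  obtain p where p: "p > max (2 * real DIM('a) / (real DIM('a) - a0 + 2)) (2 * real DIM('a) / (real DIM('a) - ainf + 2))" "K \<in> Lp_loc p {0<..}"
    using hyp_K by (auto simp: hyp_K_def)
  have "1 \<le> 2 * real DIM('a) / (real DIM('a) - a0 + 2)"
    using a_le dim k_pos by (simp add: k0_def field_simps)
  then have p1: "p \<ge> 1" using p(1) by simp
  have "compact {r..s} \<and> {r..s} \<subseteq> {0<..}" using assms by auto
  then have "(\<lambda>t. norm (K t) powr p) absolutely_integrable_on {r..s}" using p(2) unfolding Lp_loc_def by blast
  then have int: "integrable lebesgue (\<lambda>t. indicator {r..s} t + indicator {r..s} t *\<^sub>R (norm (K t) powr p))"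
    unfolding set_integrable_def
    by (intro Bochner_Integration.integrable_add integrable_real_indicator) (auto simp: emeasure_lborel_Icc_eq)
  have "(\<lambda>t. indicator {0<..} t *\<^sub>R K t) \<in> borel_measurable lebesgue"
    using K_meas by (subst borel_measurable_restrict_space_iff[symmetric]) auto
  then have "(\<lambda>t. indicator {r..s} t *\<^sub>R \<bar>indicator {0<..} t *\<^sub>R K t\<bar>) \<in> borel_measurable lebesgue"
    using borel_measurable_abs by (intro borel_measurable_scaleR borel_measurable_indicator) auto
  moreover have "(\<lambda>t. indicator {r..s} t *\<^sub>R \<bar>indicator {0<..} t *\<^sub>R K t\<bar>) = (\<lambda>t. indicator {r..s} t *\<^sub>R \<bar>K t\<bar>)"
    using assms by (auto simp: fun_eq_iff split: split_indicator)
  ultimately have m: "(\<lambda>t. indicator {r..s} t *\<^sub>R \<bar>K t\<bar>) \<in> borel_measurable lebesgue" by simp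
  have le: "y \<le> 1 + y powr p" if "y \<ge> 0" for y :: real
  proof (cases "y \<le> 1")
    case False
    then have "y powr 1 \<le> y powr p" using p1 by (intro powr_mono) auto
    then show ?thesis using False by simp
  qed (simp add: add_increasing2)
  show "(\<lambda>t. \<bar>K t\<bar>) absolutely_integrable_on {r..s}"
    unfolding set_integrable_def
    by (rule Bochner_Integration.integrable_bound[OF int m]) (use le in \<open>auto split: split_indicator\<close>)
qed

text \<open>The quantifier over \<open>t\<close> stands inside the almost-everywhere statement, so
  one exceptional set and one \<open>\<eta>\<close> serve every function obeying the decay
  bound.\<close>

theorem domination:
  assumes B: "B > 0" and \<epsilon>: "\<epsilon> > 0"
  obtains \<eta> where "integrable lebesgue \<eta>" "AE x in lebesgue. \<forall>t. \<bar>t\<bar> \<le> B * \<kappa> (norm x) \<longrightarrow> kw x * mq t \<le> \<epsilon> * (vw x * t\<^sup>2) + \<eta> x"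
proof -
  obtain r where r: "0 < r" "r \<le> 1" "AE x in lebesgue. norm x < r \<longrightarrow> (\<forall>t. \<bar>t\<bar> \<le> B * \<kappa> (norm x) \<longrightarrow>
    kw x * \<bar>t\<bar> powr q1 \<le> \<epsilon> * (vw x * t\<^sup>2 + norm x powr (\<sigma>0 - real DIM('a))))" using near_0[OF assms] by blast
  obtain S where S: "1 \<le> S" "AE x in lebesgue. S < norm x \<longrightarrow> (\<forall>t. \<bar>t\<bar> \<le> B * \<kappa> (norm x) \<longrightarrow>
    kw x * \<bar>t\<bar> powr q2 \<le> \<epsilon> * (vw x * t\<^sup>2 + norm x powr (- \<sigma>inf - real DIM('a))))" using near_infinity[OF assms] by blast
  \<comment> \<open>On the annulus between \<open>r\<close> and \<open>S\<close> the decay function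
    is largest at \<open>r\<close>, so |t|^q1 is at most \<open>M\<close>, and \<open>K\<close> is
    integrable there.\<close>
  define M where "M = (B * \<kappa> r) powr q1"
  define \<eta> where "\<eta> x = \<epsilon> * pw (\<sigma>0 - real DIM('a)) (- \<sigma>inf - real DIM('a)) (norm x) + M * (indicator {x. r \<le> norm x \<and> norm x \<le> S} x * K (norm x))" for x :: 'a
  show ?thesis
  proof (rule that)
    show "integrable lebesgue \<eta>"
      unfolding \<eta>_def[abs_def] using dim
      by (intro Bochner_Integration.integrable_add integrable_mult_right integrable_pw_radial K_annulus_integrable \<sigma>_pos r) auto
    show "AE x in lebesgue. \<forall>t. \<bar>t\<bar> \<le> B * \<kappa> (norm x) \<longrightarrow> kw x * mq t \<le> \<epsilon> * (vw x * t\<^sup>2) + \<eta> x"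
      using r(3) S(2) AE_nonzero
    proof (eventually_elim, intro allI impI)
      fix x t assume *: "norm x < r \<longrightarrow> (\<forall>t. \<bar>t\<bar> \<le> B * \<kappa> (norm x) \<longrightarrow> kw x * \<bar>t\<bar> powr q1 \<le> \<epsilon> * (vw x * t\<^sup>2 + norm x powr (\<sigma>0 - real DIM('a))))"
        "S < norm x \<longrightarrow> (\<forall>t. \<bar>t\<bar> \<le> B * \<kappa> (norm x) \<longrightarrow> kw x * \<bar>t\<bar> powr q2 \<le> \<epsilon> * (vw x * t\<^sup>2 + norm x powr (- \<sigma>inf - real DIM('a))))"
        "x \<noteq> 0" "\<bar>t\<bar> \<le> B * \<kappa> (norm x)"
      have mq: "kw x * mq t \<le> kw x * \<bar>t\<bar> powr q1" "kw x * mq t \<le> kw x * \<bar>t\<bar> powr q2"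
        by (auto simp: mq_def intro!: mult_left_mono)
      have K: "K (norm x) = kw x" using *(3) by (simp add: kw_def)
      have M: "M \<ge> 0" by (simp add: M_def)
      consider "norm x < r" | "r \<le> norm x" "norm x \<le> S" | "S < norm x" by linarith
      then show "kw x * mq t \<le> \<epsilon> * (vw x * t\<^sup>2) + \<eta> x"
      proof cases
        case 1
        then have "kw x * \<bar>t\<bar> powr q1 \<le> \<epsilon> * (vw x * t\<^sup>2 + norm x powr (\<sigma>0 - real DIM('a)))" using * by blast
        then show ?thesis using mq(1) 1 r by (simp add: \<eta>_def pw_def algebra_simps)
      next
        case 2
        have "\<kappa> (norm x) \<le> \<kappa> r" unfolding \<kappa>_def using 2 r k_pos decay_const_pos by (intro mult_left_mono pw_antimono) auto
        then have "\<bar>t\<bar> \<le> B * \<kappa> r" using *(4) B by (meson mult_left_mono less_imp_le order_trans)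
        then have "\<bar>t\<bar> powr q1 \<le> M" unfolding M_def using q by (intro powr_mono2) auto
        then have "kw x * \<bar>t\<bar> powr q1 \<le> kw x * M" by (intro mult_left_mono) auto
        moreover have "M * kw x \<le> \<eta> x" using 2 \<epsilon> K by (simp add: \<eta>_def)
        moreover have "0 \<le> \<epsilon> * (vw x * t\<^sup>2)" using \<epsilon> by simp
        ultimately show ?thesis using mq(1) by (simp add: mult.commute)
      next
        case 3
        then have "kw x * \<bar>t\<bar> powr q2 \<le> \<epsilon> * (vw x * t\<^sup>2 + norm x powr (- \<sigma>inf - real DIM('a)))" using * by blast
        then show ?thesis using mq(2) 3 S(1) by (simp add: \<eta>_def pw_def algebra_simps)
      qed
    qed
  qed
qed

section \<open>The energy space as a semi-Hilbert space\<close>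

definition X :: "('a \<Rightarrow> real) set" where "X = X_space A V a0 ainf"

definition Vg :: "('a \<Rightarrow> real) \<Rightarrow> 'a \<Rightarrow> real" where "Vg u x = sqrt (vw x) * u x"

lemma Vg_sq: "(Vg u x)\<^sup>2 = vw x * (u x)\<^sup>2"
  by (simp add: Vg_def power_mult_distrib)

lemma Vg_L2_iff:
  assumes [measurable]: "u \<in> borel_measurable lebesgue"
  shows "Vg u \<in> L2 \<longleftrightarrow> integrable lebesgue (\<lambda>x. V (norm x) * (u x)\<^sup>2)"
proof -
  have m: "Vg u \<in> borel_measurable lebesgue" unfolding Vg_def by measurable
  then have m2: "(\<lambda>x. (norm (Vg u x))\<^sup>2) \<in> borel_measurable lebesgue" by measurable
  have ae: "AE x in lebesgue. (norm (Vg u x))\<^sup>2 = V (norm x) * (u x)\<^sup>2"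
    using vw_AE by eventually_elim (simp add: Vg_sq)
  have "integrable lebesgue (\<lambda>x. (norm (Vg u x))\<^sup>2) \<longleftrightarrow> integrable lebesgue (\<lambda>x. V (norm x) * (u x)\<^sup>2)"
    by (rule integrable_cong_AE[OF m2 borel_measurable_AE[OF m2 ae] ae])
  then show ?thesis using m by (simp add: L2_def)
qed

lemma X_iff: "u \<in> X \<longleftrightarrow> DG u (Hg u) \<and> Vg u \<in> L2"
  unfolding X_def X_space_def using D_A_DG[of u] Vg_L2_iff[OF DG_measurable, of u "Hg u"] by blast

lemma X_I: "DG u H \<Longrightarrow> Vg u \<in> L2 \<Longrightarrow> u \<in> X"
  using X_iff DG_self by blast

lemma X_DG: "u \<in> X \<Longrightarrow> DG u (Hg u)" and X_Hg: "u \<in> X \<Longrightarrow> Hg u \<in> L2" and X_Vg: "u \<in> X \<Longrightarrow> Vg u \<in> L2"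
  and X_measurable: "u \<in> X \<Longrightarrow> u \<in> borel_measurable lebesgue"
  using X_iff DG_L2 DG_measurable by blast+

text \<open>Pulled back from the pairs (\<open>Hg u\<close>, \<open>Vg u\<close>), so that
  completeness reduces to that of \<open>L2\<close>.\<close>

definition ip :: "('a \<Rightarrow> real) \<Rightarrow> ('a \<Rightarrow> real) \<Rightarrow> real" where
  "ip u v = l2_ip (Hg u) (Hg v) + l2_ip (Vg u) (Vg v)"

lemma Vg_add: "Vg (u + v) = Vg u + Vg v" and Vg_scale: "Vg (c *\<^sub>R u) = c *\<^sub>R Vg u" and Vg_diff: "Vg (u - v) = Vg u - Vg v"
  by (auto simp: fun_eq_iff Vg_def algebra_simps)

text \<open>\<open>Hg\<close> is linear only almost everywhere, because \<open>wgrad\<close> chooses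
  a representative for each function separately.\<close>

lemma X_lincomb:
  assumes u: "u \<in> X" and v: "v \<in> X"
  shows "c *\<^sub>R u + d *\<^sub>R v \<in> X" "AE x in lebesgue. Hg (c *\<^sub>R u + d *\<^sub>R v) x = (c *\<^sub>R Hg u + d *\<^sub>R Hg v) x"
proof -
  have eq: "c *\<^sub>R u + d *\<^sub>R v = (\<lambda>x. c * u x + d * v x)" by (auto simp: fun_eq_iff)
  have DG: "DG (c *\<^sub>R u + d *\<^sub>R v) (c *\<^sub>R Hg u + d *\<^sub>R Hg v)" unfolding eq by (intro DG_lincomb X_DG u v)
  moreover have "Vg (c *\<^sub>R u + d *\<^sub>R v) \<in> L2" using X_Vg[OF u] X_Vg[OF v] by (simp add: Vg_add Vg_scale)
  ultimately show "c *\<^sub>R u + d *\<^sub>R v \<in> X" by (rule X_I)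
  show "AE x in lebesgue. Hg (c *\<^sub>R u + d *\<^sub>R v) x = (c *\<^sub>R Hg u + d *\<^sub>R Hg v) x" by (rule DG_Hg[OF DG])
qed

lemma subspace_X: "subspace X"
proof (rule subspaceI)
  have "DG (\<lambda>x. 0) (\<lambda>x. 0)"
  proof -
    have t: "(\<lambda>x::'a. 0) \<in> test_functions UNIV" by (rule test_functionsI[of _ "{}"]) (auto intro: Ck_const)
    have g: "grad (\<lambda>x::'a. 0) = (\<lambda>x. 0)" by (auto simp: fun_eq_iff intro!: grad_eqI)
    have "(\<lambda>x::'a. 0) \<in> S_A A" using t by (simp add: S_A_def g)
    moreover have "wg (\<lambda>x::'a. 0) = (\<lambda>x. 0)" by (simp add: fun_eq_iff wg_def g)
    ultimately show ?thesis using S_A_DG[of "\<lambda>x. 0"] by metis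
  qed
  moreover have "Vg (\<lambda>x. 0) \<in> L2" by (simp add: Vg_def[abs_def] L2_def)
  ultimately have "(\<lambda>x. 0) \<in> X" by (rule X_I)
  then show "0 \<in> X" by (simp add: zero_fun_def)
  show "u + v \<in> X" if "u \<in> X" "v \<in> X" for u v using X_lincomb(1)[OF that, of 1 1] by simp
  show "c *\<^sub>R u \<in> X" if "u \<in> X" for u c using X_lincomb(1)[OF that that, of c 0] by simp
qed

lemma Hg_add: "u \<in> X \<Longrightarrow> v \<in> X \<Longrightarrow> AE x in lebesgue. Hg (u + v) x = (Hg u + Hg v) x"
  and Hg_scale: "u \<in> X \<Longrightarrow> AE x in lebesgue. Hg (c *\<^sub>R u) x = (c *\<^sub>R Hg u) x"
  and Hg_diff: "u \<in> X \<Longrightarrow> v \<in> X \<Longrightarrow> AE x in lebesgue. Hg (u - v) x = (Hg u - Hg v) x"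
  using X_lincomb(2)[of u v 1 1] X_lincomb(2)[of u u c 0] X_lincomb(2)[of u v 1 "-1"] by simp_all

lemma ip_self: "u \<in> X \<Longrightarrow> ip u u = (L2.nrm (Hg u))\<^sup>2 + (L2.nrm (Vg u))\<^sup>2"
  by (simp add: ip_def L2.nrm_sq X_Hg X_Vg)

lemma ip_diff_self:
  assumes "u \<in> X" "v \<in> X"
  shows "ip (u - v) (u - v) = (L2.nrm (Hg u - Hg v))\<^sup>2 + (L2.nrm (Vg u - Vg v))\<^sup>2"
proof -
  have d: "u - v \<in> X" using assms subspace_X by (simp add: subspace_diff)
  have "l2_ip (Hg (u - v)) (Hg (u - v)) = l2_ip (Hg u - Hg v) (Hg u - Hg v)"
    by (intro l2_ip_cong_AE Hg_diff X_Hg d assms)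
  then show ?thesis using assms by (simp add: ip_def Vg_diff L2.nrm_sq X_Hg X_Vg)
qed

sublocale XH: semi_hilbert X ip
proof
  show "subspace X" by (rule subspace_X)
  fix u v w :: "'a \<Rightarrow> real" and c :: real
  assume u: "u \<in> X"
  show "0 \<le> ip u u" using u by (simp add: ip_self)
  assume w: "w \<in> X"
  show "ip u w = ip w u" by (simp add: ip_def l2_ip_def inner_commute mult.commute)
  have "l2_ip (Hg (c *\<^sub>R u)) (Hg w) = l2_ip (c *\<^sub>R Hg u) (Hg w)"
    using u w subspace_scale[OF subspace_X u] by (intro l2_ip_cong_AE Hg_scale X_Hg) auto
  then show "ip (c *\<^sub>R u) w = c * ip u w"
    using u w by (simp add: ip_def Vg_scale L2.ip_scale X_Hg X_Vg distrib_left)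
  assume v: "v \<in> X"
  have "l2_ip (Hg (u + v)) (Hg w) = l2_ip (Hg u + Hg v) (Hg w)"
    using u v w subspace_add[OF subspace_X u v] by (intro l2_ip_cong_AE Hg_add X_Hg) auto
  then show "ip (u + v) w = ip u w + ip v w"
    using u v w by (simp add: ip_def Vg_add L2.ip_add X_Hg X_Vg)
next
  fix s :: "nat \<Rightarrow> 'a \<Rightarrow> real"
  assume s: "\<And>n. s n \<in> X" and cauchy: "\<And>e. e > 0 \<Longrightarrow> \<exists>N. \<forall>m\<ge>N. \<forall>n\<ge>N. sqrt (ip (s m - s n) (s m - s n)) < e"
  have le: "L2.nrm (Hg (s m) - Hg (s n)) \<le> sqrt (ip (s m - s n) (s m - s n))" "L2.nrm (Vg (s m) - Vg (s n)) \<le> sqrt (ip (s m - s n) (s m - s n))" for m n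
    unfolding ip_diff_self[OF s s] by (auto intro!: real_le_rsqrt)
  have "\<exists>N. \<forall>m\<ge>N. \<forall>n\<ge>N. L2.nrm (Hg (s m) - Hg (s n)) < e" if "e > 0" for e
    using cauchy[OF that] le(1) by (meson order_le_less_trans)
  then obtain H where H: "H \<in> L2" "(\<lambda>n. L2.nrm (Hg (s n) - H)) \<longlonglongrightarrow> 0"
    using L2.complete'[of "\<lambda>n. Hg (s n)"] X_Hg[OF s] by metis
  have "\<exists>N. \<forall>m\<ge>N. \<forall>n\<ge>N. L2.nrm (Vg (s m) - Vg (s n)) < e" if "e > 0" for e
    using cauchy[OF that] le(2) by (meson order_le_less_trans)
  then obtain W where W: "W \<in> L2" "(\<lambda>n. L2.nrm (Vg (s n) - W)) \<longlonglongrightarrow> 0"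
    using L2.complete'[of "\<lambda>n. Vg (s n)"] X_Vg[OF s] by metis
  obtain l where l: "DG l H" "AE x in lebesgue. (\<lambda>n. s n x) \<longlonglongrightarrow> l x"
    using DG_complete[OF X_DG[OF s] H] by metis
  obtain r :: "nat \<Rightarrow> nat" where r: "strict_mono r" "AE x in lebesgue. (\<lambda>k. Vg (s (r k)) x) \<longlonglongrightarrow> W x"
    using L2_tendsto_AE_subseq[OF X_Vg[OF s] W] by metis
  \<comment> \<open>The two parts converge separately in \<open>L2\<close>; pointwise convergence
    along a subsequence identifies the limit of the \<open>V\<close> parts with
    \<open>Vg l\<close>.\<close>
  have ae: "AE x in lebesgue. W x = Vg l x"
    using l(2) r(2)
  proof eventually_elim
    case (elim x)
    have "(\<lambda>k. s (r k) x) \<longlonglongrightarrow> l x" using LIMSEQ_subseq_LIMSEQ[OF elim(1) r(1)] by (simp add: o_def)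
    then have "(\<lambda>k. Vg (s (r k)) x) \<longlonglongrightarrow> Vg l x" unfolding Vg_def by (intro tendsto_intros)
    then show ?case using elim(2) LIMSEQ_unique by blast
  qed
  have VL: "Vg l \<in> L2" by (rule L2_cong_AE[OF W(1) ae])
  have lX: "l \<in> X" by (rule X_I[OF l(1) VL])
  have "sqrt (ip (s n - l) (s n - l)) = sqrt ((L2.nrm (Hg (s n) - H))\<^sup>2 + (L2.nrm (Vg (s n) - W))\<^sup>2)" for n
  proof -
    have D: "Hg (s n) - Hg l \<in> L2" "Vg (s n) - Vg l \<in> L2" using X_Hg[OF s] X_Vg[OF s] X_Hg[OF lX] VL by simp_all
    have "AE x in lebesgue. (Hg (s n) - Hg l) x = (Hg (s n) - H) x" using DG_Hg[OF l(1)] by eventually_elim simp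
    moreover have "AE x in lebesgue. (Vg (s n) - Vg l) x = (Vg (s n) - W) x" using ae by eventually_elim simp
    ultimately have "L2.nrm (Hg (s n) - Hg l) = L2.nrm (Hg (s n) - H)" "L2.nrm (Vg (s n) - Vg l) = L2.nrm (Vg (s n) - W)"
      unfolding L2.nrm_def using D l2_ip_cong_AE by metis+
    then show ?thesis by (simp add: ip_diff_self[OF s lX])
  qed
  moreover have "(\<lambda>n. sqrt ((L2.nrm (Hg (s n) - H))\<^sup>2 + (L2.nrm (Vg (s n) - W))\<^sup>2)) \<longlonglongrightarrow> sqrt (0\<^sup>2 + 0\<^sup>2)"
    by (intro tendsto_intros H W)
  ultimately have "(\<lambda>n. sqrt (ip (s n - l) (s n - l))) \<longlonglongrightarrow> 0" by simp
  then show "\<exists>l\<in>X. (\<lambda>n. sqrt (ip (s n - l) (s n - l))) \<longlonglongrightarrow> 0" using lX by blast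
qed

lemma nrm_Hg_le: "u \<in> X \<Longrightarrow> L2.nrm (Hg u) \<le> XH.nrm u" and nrm_Vg_le: "u \<in> X \<Longrightarrow> L2.nrm (Vg u) \<le> XH.nrm u"
  unfolding XH.nrm_def by (auto simp: ip_self intro!: real_le_rsqrt)

lemma X_norm_eq: "u \<in> X \<Longrightarrow> X_norm A V u = XH.nrm u"
  and energy_eq: "u \<in> X \<Longrightarrow> energy_A A u + energy_V V u = (XH.nrm u)\<^sup>2"
proof -
  assume u: "u \<in> X"
  have m: "(\<lambda>x. (norm (Vg u x))\<^sup>2) \<in> borel_measurable lebesgue" using L2_measurable[OF X_Vg[OF u]] by measurable
  have ae: "AE x in lebesgue. (norm (Vg u x))\<^sup>2 = V (norm x) * (u x)\<^sup>2"
    using vw_AE by eventually_elim (simp add: Vg_sq)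
  have "(\<integral>x. (norm (Vg u x))\<^sup>2 \<partial>lebesgue) = energy_V V u"
    unfolding energy_V_def by (rule integral_cong_AE[OF m borel_measurable_AE[OF m ae] ae])
  then have "energy_V V u = (L2.nrm (Vg u))\<^sup>2" using L2.nrm_sq[OF X_Vg[OF u]] by (simp add: l2_ip_self)
  moreover have "energy_A A u = (L2.nrm (Hg u))\<^sup>2" using u by (intro energy_A_eq) (simp add: X_def X_space_def)
  ultimately show *: "energy_A A u + energy_V V u = (XH.nrm u)\<^sup>2" using u by (simp add: XH.nrm_sq ip_self)
  show "X_norm A V u = XH.nrm u" unfolding X_norm_def * using u by simp
qed

lemma X_decay:
  assumes u: "u \<in> X"
  shows "AE x in lebesgue. \<bar>u x\<bar> \<le> \<kappa> (norm x) * XH.nrm u"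
  using DG_decay[OF X_DG[OF u]]
proof eventually_elim
  case (elim x)
  then show ?case using mult_left_mono[OF nrm_Hg_le[OF u] \<kappa>_nonneg, of "norm x"] by linarith
qed

lemma X_integrable_V:
  assumes u: "u \<in> X"
  shows "integrable lebesgue (\<lambda>x. vw x * (u x)\<^sup>2)" "(\<integral>x. vw x * (u x)\<^sup>2 \<partial>lebesgue) \<le> (XH.nrm u)\<^sup>2"
  using L2_integrable[OF X_Vg[OF u]] L2.nrm_sq[OF X_Vg[OF u]] power_mono[OF nrm_Vg_le[OF u], of 2] X_Vg[OF u]
  by (simp_all add: Vg_sq l2_ip_self)

text \<open>A diagonal subsequence converges on a countable dense set; equicontinuity of the
  representatives away from 0 carries the convergence to every nonzero point.\<close>

theorem pointwise_subseq:
  assumes s: "\<And>n. s n \<in> X" "\<And>n. XH.nrm (s n) \<le> B"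
  obtains r :: "nat \<Rightarrow> nat" where "strict_mono r" "AE x in lebesgue. convergent (\<lambda>n. s (r n) x)"
proof -
  define P where "P n v \<longleftrightarrow> (AE x in lebesgue. s n x = v x) \<and> (\<forall>x. x \<noteq> 0 \<longrightarrow> \<bar>v x\<bar> \<le> \<kappa> (norm x) * B) \<and>
    (\<forall>x y r. 0 < r \<longrightarrow> r \<le> norm x \<longrightarrow> r \<le> norm y \<longrightarrow> \<bar>v x - v y\<bar> \<le> equicont_const r \<bar>norm x - norm y\<bar> * B)" for n v
  have "\<exists>v. P n v" for n
  proof -
    obtain v where v: "AE x in lebesgue. s n x = v x" "\<And>x. x \<noteq> 0 \<Longrightarrow> \<bar>v x\<bar> \<le> \<kappa> (norm x) * L2.nrm (Hg (s n))"
      "\<And>x y r. 0 < r \<Longrightarrow> r \<le> norm x \<Longrightarrow> r \<le> norm y \<Longrightarrow> \<bar>v x - v y\<bar> \<le> equicont_const r \<bar>norm x - norm y\<bar> * L2.nrm (Hg (s n))"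
      using DG_representative[OF X_DG[OF s(1)[of n]]] by auto
    have b: "L2.nrm (Hg (s n)) \<le> B" using nrm_Hg_le[OF s(1)[of n]] s(2)[of n] by linarith
    show ?thesis
      unfolding P_def
    proof (intro exI[of _ v] conjI allI impI v(1))
      show "\<bar>v x\<bar> \<le> \<kappa> (norm x) * B" if "x \<noteq> 0" for x
        using v(2)[OF that] mult_left_mono[OF b \<kappa>_nonneg, of "norm x"] by linarith
      show "\<bar>v x - v y\<bar> \<le> equicont_const r \<bar>norm x - norm y\<bar> * B" if "0 < r" "r \<le> norm x" "r \<le> norm y" for x y r
        using v(3)[OF that] mult_left_mono[OF b equicont_const_nonneg, of "\<bar>norm x - norm y\<bar>" r] by linarith
    qed
  qed
  then obtain v where "\<And>n. P n (v n)" by metis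
  then have v: "\<And>n. AE x in lebesgue. s n x = v n x" "\<And>n x. x \<noteq> 0 \<Longrightarrow> \<bar>v n x\<bar> \<le> \<kappa> (norm x) * B"
    "\<And>n x y r. 0 < r \<Longrightarrow> r \<le> norm x \<Longrightarrow> r \<le> norm y \<Longrightarrow> \<bar>v n x - v n y\<bar> \<le> equicont_const r \<bar>norm x - norm y\<bar> * B"
    unfolding P_def by blast+
  have B: "B \<ge> 0" using s(2)[of 0] XH.nrm_nonneg[OF s(1)[of 0]] by linarith
  obtain D :: "'a set" where D: "countable D" "\<And>S. open S \<Longrightarrow> S \<noteq> {} \<Longrightarrow> \<exists>d\<in>D. d \<in> S"
    using countable_dense_setE by metis
  \<comment> \<open>\<open>function_convergent_subsequence\<close> wants one bound for all points,
    hence the division by \<open>\<kappa> (norm x) + 1\<close>.\<close>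
  define f where "f n x = v n x / (\<kappa> (norm x) + 1)" for n x
  have fb: "norm (f n x) \<le> B" if x: "x \<in> D - {0}" for n x
  proof -
    have k: "\<kappa> (norm x) + 1 > 0" using \<kappa>_nonneg[of "norm x"] by linarith
    have "\<bar>v n x\<bar> \<le> B * (\<kappa> (norm x) + 1)" using v(2)[of x n] x B by (simp add: algebra_simps)
    then show ?thesis using k by (simp add: f_def pos_divide_le_eq)
  qed
  obtain r :: "nat \<Rightarrow> nat" where r: "strict_mono r" "\<And>x. x \<in> D - {0} \<Longrightarrow> \<exists>l. (\<lambda>n. f (r n) x) \<longlonglongrightarrow> l"
    using function_convergent_subsequence[of "D - {0}" f B] D(1) fb by auto
  have convD: "Cauchy (\<lambda>n. v (r n) x)" if x: "x \<in> D - {0}" for x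
  proof -
    have k: "\<kappa> (norm x) + 1 > 0" using \<kappa>_nonneg[of "norm x"] by linarith
    obtain l where "(\<lambda>n. f (r n) x) \<longlonglongrightarrow> l" using r(2)[OF x] by blast
    then have "(\<lambda>n. f (r n) x * (\<kappa> (norm x) + 1)) \<longlonglongrightarrow> l * (\<kappa> (norm x) + 1)" by (intro tendsto_intros)
    then show ?thesis using k by (simp add: f_def LIMSEQ_imp_Cauchy)
  qed
  have conv: "convergent (\<lambda>n. v (r n) x)" if x: "x \<noteq> 0" for x
  proof (rule real_Cauchy_convergent, rule CauchyI)
    fix e :: real assume e: "e > 0"
    \<comment> \<open>Half the norm: a point \<open>y\<close> of the dense set close to
      \<open>x\<close> still has norm at least \<open>\<rho>\<close>, so the equicontinuity estimate
      applies to the pair.\<close>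
    define \<rho> where "\<rho> = norm x / 2"
    have \<rho>: "\<rho> > 0" using x by (simp add: \<rho>_def)
    have "isCont (\<lambda>d. equicont_const \<rho> d * B) 0"
      unfolding equicont_const_def by (intro continuous_intros)
    then have "((\<lambda>d. equicont_const \<rho> d * B) \<longlongrightarrow> equicont_const \<rho> 0 * B) (at 0)" by (simp add: isCont_def)
    from tendstoD[OF this, of "e/3"] have "\<forall>\<^sub>F d in at 0. dist (equicont_const \<rho> d * B) (equicont_const \<rho> 0 * B) < e/3"
      using e by simp
    moreover have "equicont_const \<rho> 0 = 0" by (simp add: equicont_const_def)
    ultimately have "\<forall>\<^sub>F d in at 0. \<bar>equicont_const \<rho> d * B\<bar> < e/3" by (simp add: dist_real_def)
    then obtain \<delta> where \<delta>: "\<delta> > 0" "\<And>d. d \<noteq> 0 \<Longrightarrow> \<bar>d\<bar> < \<delta> \<Longrightarrow> \<bar>equicont_const \<rho> d * B\<bar> < e/3"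
      by (auto simp: eventually_at dist_real_def)
    obtain y where y: "y \<in> D" "y \<in> ball x (min \<delta> \<rho>)" using D(2)[of "ball x (min \<delta> \<rho>)"] \<delta> \<rho> by fastforce
    have d: "\<bar>norm x - norm y\<bar> < \<delta>" "\<bar>norm x - norm y\<bar> < \<rho>" using y(2) norm_triangle_ineq3[of x y] by (auto simp: dist_norm)
    then have ny: "\<rho> \<le> norm y" "\<rho> \<le> norm x" unfolding \<rho>_def by linarith+
    then have "y \<in> D - {0}" using y \<rho> by auto
    then obtain N where N: "\<And>m n. m \<ge> N \<Longrightarrow> n \<ge> N \<Longrightarrow> norm (v (r m) y - v (r n) y) < e/3"
      using CauchyD[OF convD, of y "e/3"] e by auto
    have close: "\<bar>v n x - v n y\<bar> < e/3" for n
    proof -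
      have "\<bar>v n x - v n y\<bar> \<le> equicont_const \<rho> \<bar>norm x - norm y\<bar> * B" by (rule v(3)[OF \<rho> ny(2,1)])
      also have "\<dots> < e/3"
        using \<delta>(2)[of "\<bar>norm x - norm y\<bar>"] d(1) e by (cases "norm x = norm y") (auto simp: equicont_const_def)
      finally show ?thesis .
    qed
    have "norm (v (r m) x - v (r n) x) < e" if "m \<ge> N" "n \<ge> N" for m n
      using close[of "r m"] close[of "r n"] N[OF that] unfolding real_norm_def by linarith
    then show "\<exists>N. \<forall>m\<ge>N. \<forall>n\<ge>N. norm (v (r m) x - v (r n) x) < e" by blast
  qed
  have "AE x in lebesgue. \<forall>n. s n x = v n x" using v(1) by (simp add: AE_all_countable)
  then have "AE x in lebesgue. convergent (\<lambda>n. s (r n) x)"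
    using AE_nonzero by eventually_elim (simp add: conv)
  then show ?thesis using that r(1) by blast
qed

end

subsection \<open>Primitives\<close>

lemma primitive_deriv:
  assumes "continuous_on UNIV f"
  shows "(primitive f has_real_derivative f t) (at t)"
proof -
  \<comment> \<open>An interval having both 0 and \<open>t\<close> in it, the latter in the
    interior, so that the one-sided derivative within the interval is a full one.\<close>
  define a where "a = - \<bar>t\<bar> - 1"
  define b where "b = \<bar>t\<bar> + 1"
  have ab: "a \<le> 0" "0 \<le> b" "a < t" "t < b" by (auto simp: a_def b_def)
  have "((\<lambda>u. LBINT y=ereal 0..ereal u. f y) has_vector_derivative f t) (at t within {a..b})"
    by (rule interval_integral_FTC2) (use ab in \<open>auto intro: continuous_on_subset[OF assms]\<close>)
  then have "(primitive f has_vector_derivative f t) (at t)"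
    using ab at_within_Icc_at[of a t b] by (simp add: primitive_def[abs_def])
  then show ?thesis
    by (simp add: has_real_derivative_iff_has_vector_derivative)
qed

lemma primitive_0 [simp]: "primitive f 0 = 0"
  by (simp add: primitive_def)

lemma primitive_continuous: "continuous_on UNIV f \<Longrightarrow> continuous_on UNIV (primitive f)"
  using primitive_deriv DERIV_isCont by (intro continuous_at_imp_continuous_on) blast

text \<open>The mean value inequality for the primitive minus a linear function. With
  \<open>c = 0\<close> it gives the growth of the primitive, with \<open>c = f a\<close> the
  remainder of its linearisation.\<close>

lemma primitive_increment:
  assumes f: "continuous_on UNIV f" and B: "\<And>s. s \<in> closed_segment a b \<Longrightarrow> \<bar>f s - c\<bar> \<le> B"
  shows "\<bar>primitive f b - primitive f a - c * (b - a)\<bar> \<le> B * \<bar>b - a\<bar>"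
proof -
  have "norm ((primitive f b - c * b) - (primitive f a - c * a)) \<le> B * norm (b - a)"
  proof (rule field_differentiable_bound[of "closed_segment a b" "\<lambda>t. primitive f t - c * t" "\<lambda>t. f t - c"])
    show "((\<lambda>t. primitive f t - c * t) has_field_derivative f z - c) (at z within closed_segment a b)" for z
      by (auto intro!: derivative_eq_intros DERIV_subset[OF primitive_deriv[OF f]])
  qed (use B in auto)
  then show ?thesis by (simp add: algebra_simps)
qed

lemma primitive_positive_part:
  assumes f: "continuous_on UNIV f" and f0: "f 0 = 0"
  shows "primitive (\<lambda>t. f (max t 0)) t = primitive f (max t 0)"
proof -
  let ?g = "\<lambda>t. f (max t 0)"
  have g: "continuous_on UNIV ?g" by (rule continuous_on_compose2[OF f]) (auto intro!: continuous_intros)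
  show ?thesis
  proof (cases "t \<ge> 0")
    case True
    have "primitive ?g t = primitive f t"
      unfolding primitive_def using True
      by (intro interval_lebesgue_integral_cong) (auto simp: einterval_def min_def max_def zero_ereal_def split: if_splits)
    then show ?thesis using True by (simp add: max_def)
  next
    case False
    have "\<bar>primitive ?g t - primitive ?g 0 - 0 * (t - 0)\<bar> \<le> 0 * \<bar>t - 0\<bar>"
      by (rule primitive_increment[OF g]) (use False f0 in \<open>auto simp: closed_segment_eq_real_ivl max_def\<close>)
    then show ?thesis using False by (simp add: max_def)
  qed
qed

subsection \<open>The functional\<close>

context potentials
begin

section \<open>The growth functions and limits of weighted integrals over bounded sets of
  \<open>X\<close>\<close>

definition mm :: "real \<Rightarrow> real" where "mm t = min (\<bar>t\<bar> powr (q1 - 1)) (\<bar>t\<bar> powr (q2 - 1))"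

lemma mm_nonneg [simp]: "0 \<le> mm t" by (simp add: mm_def)

lemma mm_0 [simp]: "mm 0 = 0" by (simp add: mm_def)

lemma mm_mono: "\<bar>s\<bar> \<le> \<bar>t\<bar> \<Longrightarrow> mm s \<le> mm t"
  unfolding mm_def using q by (intro min.mono powr_mono2) auto

lemma mm_times: "mm t * \<bar>t\<bar> = mq t"
proof -
  have "\<bar>t\<bar> powr (p - 1) * \<bar>t\<bar> = \<bar>t\<bar> powr p" for p
    by (cases "t = 0") (simp_all add: powr_diff)
  then show ?thesis unfolding mm_def mq_def by (simp add: min_mult_distrib_right)
qed

text \<open>Takes the place of Young's inequality: the larger of the two arguments absorbs the
  product.\<close>

lemma mm_mult_le: "mm a * \<bar>b\<bar> \<le> mq a + mq b"
proof (cases "\<bar>a\<bar> \<le> \<bar>b\<bar>")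
  case True
  then have "mm a * \<bar>b\<bar> \<le> mm b * \<bar>b\<bar>" by (intro mult_right_mono mm_mono) auto
  then show ?thesis using mq_nonneg[of a] unfolding mm_times by linarith
next
  case False
  then have "mm a * \<bar>b\<bar> \<le> mm a * \<bar>a\<bar>" by (intro mult_left_mono) auto
  then show ?thesis using mq_nonneg[of b] unfolding mm_times by linarith
qed

text \<open>A doubling constant for \<open>mm\<close>: both exponents q1 - 1 and q2 - 1 are below q1
  + q2.\<close>

definition mm_const :: real where "mm_const = 2 powr (q1 + q2)"

lemma mm_const_ge: "mm_const \<ge> 1" using q by (simp add: mm_const_def ge_one_powr_ge_zero)

lemma mm_add: "mm (\<bar>a\<bar> + \<bar>b\<bar>) \<le> mm_const * (mm a + mm b)"
proof -
  have two: "mm (2 * c) \<le> mm_const * mm c" if "c \<ge> 0" for c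
  proof -
    have "\<bar>2 * c\<bar> powr p \<le> mm_const * \<bar>c\<bar> powr p" if "p \<le> q1 + q2" for p
    proof -
      have "\<bar>2 * c\<bar> powr p = 2 powr p * \<bar>c\<bar> powr p" by (simp add: abs_mult powr_mult)
      also have "\<dots> \<le> mm_const * \<bar>c\<bar> powr p" unfolding mm_const_def using that by (intro mult_right_mono powr_mono) auto
      finally show ?thesis .
    qed
    from this[of "q1 - 1"] this[of "q2 - 1"] show ?thesis
      unfolding mm_def using q mm_const_ge by (auto simp: min_mult_distrib_left min_le_iff_disj)
  qed
  have "mm (\<bar>a\<bar> + \<bar>b\<bar>) \<le> mm (2 * max \<bar>a\<bar> \<bar>b\<bar>)" by (intro mm_mono) auto
  also have "\<dots> \<le> mm_const * mm (max \<bar>a\<bar> \<bar>b\<bar>)" by (intro two) auto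
  also have "\<dots> \<le> mm_const * (mm a + mm b)"
    using mm_const_ge by (intro mult_left_mono) (auto simp: max_def mm_def)
  finally show ?thesis .
qed

text \<open>For a factor at most 1 the smaller exponent gives the larger power, which therefore
  serves both terms of the minimum.\<close>

lemma mq_scale: "0 \<le> c \<Longrightarrow> c \<le> 1 \<Longrightarrow> mq (c * t) \<le> c powr min q1 q2 * mq t"
proof -
  assume c: "0 \<le> c" "c \<le> 1"
  have "\<bar>c * t\<bar> powr p \<le> c powr min q1 q2 * \<bar>t\<bar> powr p" if "min q1 q2 \<le> p" for p
  proof -
    have "\<bar>c * t\<bar> powr p = c powr p * \<bar>t\<bar> powr p" using c by (simp add: abs_mult powr_mult)
    also have "\<dots> \<le> c powr min q1 q2 * \<bar>t\<bar> powr p" using c that q by (intro mult_right_mono powr_mono') auto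
    finally show ?thesis .
  qed
  from this[of q1] this[of q2] show "mq (c * t) \<le> c powr min q1 q2 * mq t"
    unfolding mq_def by (auto simp: min_mult_distrib_left min_le_iff_disj)
qed

lemma X_domination:
  assumes B: "B > 0" and \<epsilon>: "\<epsilon> > 0"
  obtains \<eta> where "integrable lebesgue \<eta>"
    "\<And>u. u \<in> X \<Longrightarrow> XH.nrm u \<le> B \<Longrightarrow> AE x in lebesgue. kw x * mq (u x) \<le> \<epsilon> * (vw x * (u x)\<^sup>2) + \<eta> x"
proof -
  obtain \<eta> where \<eta>: "integrable lebesgue \<eta>" "AE x in lebesgue. \<forall>t. \<bar>t\<bar> \<le> B * \<kappa> (norm x) \<longrightarrow> kw x * mq t \<le> \<epsilon> * (vw x * t\<^sup>2) + \<eta> x"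
    using domination[OF assms] by blast
  have "AE x in lebesgue. kw x * mq (u x) \<le> \<epsilon> * (vw x * (u x)\<^sup>2) + \<eta> x" if u: "u \<in> X" "XH.nrm u \<le> B" for u
    using \<eta>(2) X_decay[OF u(1)]
  proof eventually_elim
    case (elim x)
    have "\<bar>u x\<bar> \<le> B * \<kappa> (norm x)" using elim(2) mult_left_mono[OF u(2) \<kappa>_nonneg, of "norm x"] by (simp add: mult.commute)
    then show ?case using elim(1) by blast
  qed
  then show ?thesis using that \<eta>(1) by blast
qed

lemma integrable_kw:
  assumes u: "u \<in> X" and v: "v \<in> X" and a [measurable]: "a \<in> borel_measurable lebesgue"
    and le: "AE x in lebesgue. \<bar>a x\<bar> \<le> C * (mq (u x) + mq (v x))" and C: "C \<ge> 0"
  shows "integrable lebesgue (\<lambda>x. kw x * a x)"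
proof -
  have n: "XH.nrm u \<ge> 0" "XH.nrm v \<ge> 0" using u v by auto
  obtain \<eta> where \<eta>: "integrable lebesgue \<eta>"
    "\<And>w. w \<in> X \<Longrightarrow> XH.nrm w \<le> XH.nrm u + XH.nrm v + 1 \<Longrightarrow> AE x in lebesgue. kw x * mq (w x) \<le> 1 * (vw x * (w x)\<^sup>2) + \<eta> x"
    by (rule X_domination[of "XH.nrm u + XH.nrm v + 1" 1]) (use n in auto)
  have ae: "AE x in lebesgue. kw x * mq (u x) \<le> 1 * (vw x * (u x)\<^sup>2) + \<eta> x" "AE x in lebesgue. kw x * mq (v x) \<le> 1 * (vw x * (v x)\<^sup>2) + \<eta> x"
    by (rule \<eta>(2); use n u v in linarith | fact)+
  show ?thesis
  proof (rule Bochner_Integration.integrable_bound)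
    show "integrable lebesgue (\<lambda>x. C * ((vw x * (u x)\<^sup>2 + \<eta> x) + (vw x * (v x)\<^sup>2 + \<eta> x)))"
      using X_integrable_V(1)[OF u] X_integrable_V(1)[OF v] \<eta>(1) by (intro integrable_mult_right Bochner_Integration.integrable_add)
    show "(\<lambda>x. kw x * a x) \<in> borel_measurable lebesgue" by measurable
    show "AE x in lebesgue. norm (kw x * a x) \<le> norm (C * ((vw x * (u x)\<^sup>2 + \<eta> x) + (vw x * (v x)\<^sup>2 + \<eta> x)))"
      using le ae
    proof eventually_elim
      case (elim x)
      have "\<bar>kw x * a x\<bar> \<le> kw x * (C * (mq (u x) + mq (v x)))" using elim(1) by (simp add: abs_mult mult_left_mono)
      also have "\<dots> = C * (kw x * mq (u x) + kw x * mq (v x))" by (simp add: algebra_simps)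
      also have "\<dots> \<le> C * ((vw x * (u x)\<^sup>2 + \<eta> x) + (vw x * (v x)\<^sup>2 + \<eta> x))"
        using elim C by (intro mult_left_mono add_mono) auto
      finally show ?case by simp
    qed
  qed
qed

text \<open>The integrand is bounded through \<open>mm_mult_le\<close> by sums of \<open>kw\<close>
  times \<open>mq\<close>, which \<open>X_domination\<close> bounds by small multiples of V times
  squares plus a fixed function; the energy bounds control the former. The functions
  \<open>v n\<close> are bounded in norm but not assumed to converge, which is what yields estimates
  uniform over the unit sphere.\<close>

lemma vanishing:
  assumes u: "\<And>n. u n \<in> X" "\<And>n. XH.nrm (u n) \<le> B" and w: "\<And>n. w n \<in> X" "\<And>n. XH.nrm (w n) \<le> B"
    and v: "\<And>n. v n \<in> X" "\<And>n. XH.nrm (v n) \<le> B"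
    and z: "\<And>n. z n \<in> borel_measurable lebesgue"
    and bound: "\<And>n x. \<bar>z n x\<bar> \<le> C * (mm (u n x) + mm (w n x))" and C: "C > 0"
    and lim: "AE x in lebesgue. (\<lambda>n. z n x) \<longlonglongrightarrow> 0"
  shows "(\<lambda>n. \<integral>x. kw x * (z n x * v n x) \<partial>lebesgue) \<longlonglongrightarrow> 0"
proof (rule almost_dominated_convergence(1))
  note [measurable] = z X_measurable[OF v(1)]
  define B' where "B' = \<bar>B\<bar> + 1"
  have B': "B' > 0" "B \<le> B'" by (auto simp: B'_def)
  show "(\<lambda>x. kw x * (z n x * v n x)) \<in> borel_measurable lebesgue" for n by measurable
  have "AE x in lebesgue. \<forall>n. \<bar>v n x\<bar> \<le> \<kappa> (norm x) * XH.nrm (v n)"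
    unfolding AE_all_countable using X_decay[OF v(1)] by blast
  then show "AE x in lebesgue. (\<lambda>n. kw x * (z n x * v n x)) \<longlonglongrightarrow> 0"
    using lim
  proof eventually_elim
    case (elim x)
    have "norm (v n x) \<le> \<kappa> (norm x) * B" for n
      using elim(1) mult_left_mono[OF v(2)[of n] \<kappa>_nonneg, of "norm x"] by (auto intro: order_trans)
    then have le: "norm (z n x * v n x) \<le> \<bar>z n x\<bar> * (\<kappa> (norm x) * B)" for n
      unfolding real_norm_def abs_mult by (intro mult_left_mono) auto
    have "(\<lambda>n. \<bar>z n x\<bar> * (\<kappa> (norm x) * B)) \<longlonglongrightarrow> 0"
      by (intro tendsto_mult_left_zero tendsto_rabs_zero elim(2))
    then have "(\<lambda>n. z n x * v n x) \<longlonglongrightarrow> 0"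
      by (rule Lim_null_comparison[OF always_eventually[OF allI[OF le]]])
    then show ?case by (rule tendsto_mult_right_zero)
  qed
  let ?g = "\<lambda>n x. C * ((vw x * (u n x)\<^sup>2 + vw x * (w n x)\<^sup>2) + 2 * (vw x * (v n x)\<^sup>2))"
  show "integrable lebesgue (?g n)" for n
    using X_integrable_V(1)[OF u(1)] X_integrable_V(1)[OF v(1)] X_integrable_V(1)[OF w(1)]
    by (intro integrable_mult_right Bochner_Integration.integrable_add)
  show "AE x in lebesgue. 0 \<le> ?g n x" for n using C by (intro AE_I2 mult_nonneg_nonneg add_nonneg_nonneg) auto
  have V: "(\<integral>x. vw x * (y x)\<^sup>2 \<partial>lebesgue) \<le> B'\<^sup>2" if "y \<in> X" "XH.nrm y \<le> B" for y
    using X_integrable_V(2)[OF that(1)] power_mono[OF order_trans[OF that(2) B'(2)] XH.nrm_nonneg[OF that(1)], of 2] by linarith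
  show "(\<integral>x. ?g n x \<partial>lebesgue) \<le> C * ((B'\<^sup>2 + B'\<^sup>2) + 2 * B'\<^sup>2)" for n
  proof -
    have "(\<integral>x. ?g n x \<partial>lebesgue) = C * (((\<integral>x. vw x * (u n x)\<^sup>2 \<partial>lebesgue) + (\<integral>x. vw x * (w n x)\<^sup>2 \<partial>lebesgue)) + 2 * (\<integral>x. vw x * (v n x)\<^sup>2 \<partial>lebesgue))"
      using X_integrable_V(1)[OF u(1)] X_integrable_V(1)[OF v(1)] X_integrable_V(1)[OF w(1)] by simp
    also have "\<dots> \<le> C * ((B'\<^sup>2 + B'\<^sup>2) + 2 * B'\<^sup>2)"
      using C V u w v by (intro mult_left_mono add_mono) auto
    finally show ?thesis .
  qed
  fix \<epsilon> :: real assume \<epsilon>: "\<epsilon> > 0"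
  obtain \<eta> where \<eta>: "integrable lebesgue \<eta>"
    "\<And>y. y \<in> X \<Longrightarrow> XH.nrm y \<le> B' \<Longrightarrow> AE x in lebesgue. kw x * mq (y x) \<le> \<epsilon> * (vw x * (y x)\<^sup>2) + \<eta> x"
    by (rule X_domination[OF B'(1) \<epsilon>]) auto
  show "\<exists>\<eta>. integrable lebesgue \<eta> \<and> (\<forall>n. AE x in lebesgue. \<bar>kw x * (z n x * v n x)\<bar> \<le> \<epsilon> * ?g n x + \<eta> x)"
  proof (intro exI[of _ "\<lambda>x. (4 * C) * \<eta> x"] conjI allI integrable_mult_right \<eta>(1))
    fix n
    have "AE x in lebesgue. kw x * mq (u n x) \<le> \<epsilon> * (vw x * (u n x)\<^sup>2) + \<eta> x" "AE x in lebesgue. kw x * mq (w n x) \<le> \<epsilon> * (vw x * (w n x)\<^sup>2) + \<eta> x"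
      "AE x in lebesgue. kw x * mq (v n x) \<le> \<epsilon> * (vw x * (v n x)\<^sup>2) + \<eta> x"
      using u w v B' by (auto intro!: \<eta>(2) order_trans[OF _ B'(2)])
    then show "AE x in lebesgue. \<bar>kw x * (z n x * v n x)\<bar> \<le> \<epsilon> * ?g n x + (4 * C) * \<eta> x"
    proof eventually_elim
      case (elim x)
      have "\<bar>z n x\<bar> * \<bar>v n x\<bar> \<le> (C * (mm (u n x) + mm (w n x))) * \<bar>v n x\<bar>" by (intro mult_right_mono bound) auto
      also have "\<dots> = C * (mm (u n x) * \<bar>v n x\<bar> + mm (w n x) * \<bar>v n x\<bar>)" by (simp add: algebra_simps)
      also have "\<dots> \<le> C * ((mq (u n x) + mq (v n x)) + (mq (w n x) + mq (v n x)))"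
        using C by (intro mult_left_mono add_mono mm_mult_le) auto
      finally have "kw x * (\<bar>z n x\<bar> * \<bar>v n x\<bar>) \<le> kw x * (C * ((mq (u n x) + mq (v n x)) + (mq (w n x) + mq (v n x))))"
        by (intro mult_left_mono) auto
      also have "\<dots> = C * ((kw x * mq (u n x) + kw x * mq (v n x)) + (kw x * mq (w n x) + kw x * mq (v n x)))" by (simp add: algebra_simps)
      also have "\<dots> \<le> C * (((\<epsilon> * (vw x * (u n x)\<^sup>2) + \<eta> x) + (\<epsilon> * (vw x * (v n x)\<^sup>2) + \<eta> x)) + ((\<epsilon> * (vw x * (w n x)\<^sup>2) + \<eta> x) + (\<epsilon> * (vw x * (v n x)\<^sup>2) + \<eta> x)))"
        using elim C by (intro mult_left_mono add_mono) auto
      also have "\<dots> = \<epsilon> * ?g n x + (4 * C) * \<eta> x" by (simp add: algebra_simps)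
      finally show ?case by (simp add: abs_mult)
    qed
  qed
qed

lemma nrm_0_AE:
  assumes "u \<in> X" "XH.nrm u = 0"
  shows "AE x in lebesgue. u x = 0"
  using X_decay[OF assms(1)] by eventually_elim (simp add: assms(2))

lemma nrm_normalized: "u \<in> X \<Longrightarrow> XH.nrm u \<noteq> 0 \<Longrightarrow> XH.nrm ((1 / XH.nrm u) *\<^sub>R u) = 1"
  by (simp add: XH.nrm_scale)

end

section \<open>Boundedness, continuity, compactness and differentiability of the nonlinear
  term\<close>

locale growth = potentials A a0 ainf ty V K R1 R2 \<alpha>0 \<alpha>inf \<beta>0 \<beta>inf q1 q2
  for A a0 ainf and ty :: "'a::euclidean_space itself" and V K R1 R2 \<alpha>0 \<alpha>inf \<beta>0 \<beta>inf q1 q2 +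
  fixes f :: "real \<Rightarrow> real" and M :: real
  assumes f_cont: "continuous_on UNIV f" and M: "M > 0"
    and f_bound: "\<bar>f t\<bar> \<le> M * min (\<bar>t\<bar> powr (q1 - 1)) (\<bar>t\<bar> powr (q2 - 1))"
begin

abbreviation F :: "real \<Rightarrow> real" where "F \<equiv> primitive f"

lemma f_le: "\<bar>f t\<bar> \<le> M * mm t" using f_bound by (simp add: mm_def)

lemma f_0 [simp]: "f 0 = 0" using f_le[of 0] by simp

lemma F_le: "\<bar>F t\<bar> \<le> M * mq t"
proof -
  have "\<bar>F t - F 0 - 0 * (t - 0)\<bar> \<le> (M * mm t) * \<bar>t - 0\<bar>"
  proof (rule primitive_increment[OF f_cont])
    fix s assume "s \<in> closed_segment 0 t"
    then have "\<bar>s\<bar> \<le> \<bar>t\<bar>" by (auto simp: closed_segment_eq_real_ivl split: if_splits)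
    then show "\<bar>f s - 0\<bar> \<le> M * mm t" using f_le[of s] mult_left_mono[OF mm_mono, of s t M] M by linarith
  qed
  then show ?thesis by (simp add: mult.assoc mm_times)
qed

lemma f_measurable [measurable]: "f \<in> borel_measurable borel" using f_cont by (rule borel_measurable_continuous_onI)
lemma F_measurable [measurable]: "F \<in> borel_measurable borel"
  using primitive_continuous[OF f_cont] by (rule borel_measurable_continuous_onI)

definition \<Phi> :: "('a \<Rightarrow> real) \<Rightarrow> real" where "\<Phi> u = (\<integral>x. kw x * F (u x) \<partial>lebesgue)"
definition D\<Phi> :: "('a \<Rightarrow> real) \<Rightarrow> ('a \<Rightarrow> real) \<Rightarrow> real" where "D\<Phi> u v = (\<integral>x. kw x * (f (u x) * v x) \<partial>lebesgue)"

lemma F_integrable: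
  assumes u: "u \<in> X"
  shows "integrable lebesgue (\<lambda>x. kw x * F (u x))"
proof (rule integrable_kw[OF u u])
  have [measurable]: "u \<in> borel_measurable lebesgue" by (rule X_measurable[OF u])
  show "(\<lambda>x. F (u x)) \<in> borel_measurable lebesgue" by measurable
  show "AE x in lebesgue. \<bar>F (u x)\<bar> \<le> M * (mq (u x) + mq (u x))"
  proof (rule AE_I2)
    fix x
    have "M * mq (u x) \<le> M * (mq (u x) + mq (u x))" using M by (intro mult_left_mono) auto
    then show "\<bar>F (u x)\<bar> \<le> M * (mq (u x) + mq (u x))" using F_le[of "u x"] by linarith
  qed
qed (use M in simp)

lemma f_integrable:
  assumes u: "u \<in> X" and v: "v \<in> X"
  shows "integrable lebesgue (\<lambda>x. kw x * (f (u x) * v x))"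
proof (rule integrable_kw[OF u v])
  have [measurable]: "u \<in> borel_measurable lebesgue" "v \<in> borel_measurable lebesgue" using u v by (auto intro: X_measurable)
  show "(\<lambda>x. f (u x) * v x) \<in> borel_measurable lebesgue" by measurable
  show "AE x in lebesgue. \<bar>f (u x) * v x\<bar> \<le> M * (mq (u x) + mq (v x))"
  proof (rule AE_I2)
    fix x
    have "\<bar>f (u x)\<bar> * \<bar>v x\<bar> \<le> (M * mm (u x)) * \<bar>v x\<bar>" by (intro mult_right_mono f_le) auto
    also have "\<dots> \<le> M * (mq (u x) + mq (v x))" using mult_left_mono[OF mm_mult_le, of M "u x" "v x"] M by (simp add: mult.assoc)
    finally show "\<bar>f (u x) * v x\<bar> \<le> M * (mq (u x) + mq (v x))" by (simp add: abs_mult)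
  qed
qed (use M in simp)

lemma D\<Phi>_add: "u \<in> X \<Longrightarrow> v \<in> X \<Longrightarrow> w \<in> X \<Longrightarrow> D\<Phi> u (v + w) = D\<Phi> u v + D\<Phi> u w"
  using f_integrable[of u v] f_integrable[of u w] by (simp add: D\<Phi>_def distrib_left)

lemma D\<Phi>_scale: "D\<Phi> u (c *\<^sub>R v) = c * D\<Phi> u v"
  by (simp add: D\<Phi>_def mult.left_commute[of _ c])

lemma D\<Phi>_cong_0: "AE x in lebesgue. v x = 0 \<Longrightarrow> D\<Phi> u v = 0"
  unfolding D\<Phi>_def by (rule integral_eq_zero_AE) (auto elim: eventually_mono)

lemma D\<Phi>_normalized:
  assumes "v \<in> X" "XH.nrm v \<noteq> 0"
  shows "D\<Phi> u v = XH.nrm v * D\<Phi> u ((1 / XH.nrm v) *\<^sub>R v)"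
  using assms by (simp add: D\<Phi>_scale)

text \<open>The domination estimate is not homogeneous in \<open>v\<close>, so it is used on the
  unit sphere and then scaled; a \<open>v\<close> of norm 0 vanishes almost everywhere.\<close>

lemma D\<Phi>_bounded:
  assumes u: "u \<in> X"
  shows "\<exists>C. \<forall>v\<in>X. \<bar>D\<Phi> u v\<bar> \<le> C * XH.nrm v"
proof -
  define B where "B = XH.nrm u + 1"
  have B: "B > 0" using XH.nrm_nonneg[OF u] by (simp add: B_def)
  obtain \<eta> where \<eta>: "integrable lebesgue \<eta>"
    "\<And>y. y \<in> X \<Longrightarrow> XH.nrm y \<le> B \<Longrightarrow> AE x in lebesgue. kw x * mq (y x) \<le> 1 * (vw x * (y x)\<^sup>2) + \<eta> x"
    using X_domination[OF B, of 1] by auto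
  define C where "C = M * (((XH.nrm u)\<^sup>2 + 1) + 2 * (\<integral>x. \<eta> x \<partial>lebesgue))"
  have one: "\<bar>D\<Phi> u v\<bar> \<le> C" if v: "v \<in> X" "XH.nrm v = 1" for v
  proof -
    note iv = X_integrable_V(1)[OF u] X_integrable_V(1)[OF v(1)]
    have ae: "AE x in lebesgue. kw x * mq (u x) \<le> 1 * (vw x * (u x)\<^sup>2) + \<eta> x" "AE x in lebesgue. kw x * mq (v x) \<le> 1 * (vw x * (v x)\<^sup>2) + \<eta> x"
      by (rule \<eta>(2); use v u XH.nrm_nonneg[OF u] B_def in linarith | fact)+
    have "\<bar>D\<Phi> u v\<bar> \<le> (\<integral>x. \<bar>kw x * (f (u x) * v x)\<bar> \<partial>lebesgue)" unfolding D\<Phi>_def by (rule integral_abs_bound)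
    also have "\<dots> \<le> (\<integral>x. M * ((vw x * (u x)\<^sup>2 + vw x * (v x)\<^sup>2) + 2 * \<eta> x) \<partial>lebesgue)"
    proof (rule integral_mono_AE)
      show "integrable lebesgue (\<lambda>x. \<bar>kw x * (f (u x) * v x)\<bar>)" using f_integrable[OF u v(1)] by (rule integrable_abs)
      show "integrable lebesgue (\<lambda>x. M * ((vw x * (u x)\<^sup>2 + vw x * (v x)\<^sup>2) + 2 * \<eta> x))"
        using iv \<eta>(1) by (intro integrable_mult_right Bochner_Integration.integrable_add)
      show "AE x in lebesgue. \<bar>kw x * (f (u x) * v x)\<bar> \<le> M * ((vw x * (u x)\<^sup>2 + vw x * (v x)\<^sup>2) + 2 * \<eta> x)"
        using ae
      proof eventually_elim
        case (elim x)
        have "\<bar>f (u x)\<bar> * \<bar>v x\<bar> \<le> (M * mm (u x)) * \<bar>v x\<bar>" by (intro mult_right_mono f_le) auto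
        also have "\<dots> \<le> M * (mq (u x) + mq (v x))" using mult_left_mono[OF mm_mult_le, of M "u x" "v x"] M by (simp add: mult.assoc)
        finally have "kw x * (\<bar>f (u x)\<bar> * \<bar>v x\<bar>) \<le> kw x * (M * (mq (u x) + mq (v x)))" by (intro mult_left_mono) auto
        also have "\<dots> = M * (kw x * mq (u x) + kw x * mq (v x))" by (simp add: algebra_simps)
        also have "\<dots> \<le> M * ((1 * (vw x * (u x)\<^sup>2) + \<eta> x) + (1 * (vw x * (v x)\<^sup>2) + \<eta> x))"
          using elim M by (intro mult_left_mono add_mono) auto
        finally show ?case by (simp add: abs_mult algebra_simps)
      qed
    qed
    also have "\<dots> = M * (((\<integral>x. vw x * (u x)\<^sup>2 \<partial>lebesgue) + (\<integral>x. vw x * (v x)\<^sup>2 \<partial>lebesgue)) + 2 * (\<integral>x. \<eta> x \<partial>lebesgue))"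
      using iv \<eta>(1) by simp
    also have "\<dots> \<le> C"
      unfolding C_def using M X_integrable_V(2)[OF u] X_integrable_V(2)[OF v(1)] v by (intro mult_left_mono add_mono) auto
    finally show ?thesis .
  qed
  have "\<bar>D\<Phi> u v\<bar> \<le> C * XH.nrm v" if v: "v \<in> X" for v
  proof (cases "XH.nrm v = 0")
    case True
    then show ?thesis using D\<Phi>_cong_0[OF nrm_0_AE[OF v]] by simp
  next
    case False
    then have p: "XH.nrm v > 0" using XH.nrm_nonneg[OF v] by linarith
    have "\<bar>D\<Phi> u ((1 / XH.nrm v) *\<^sub>R v)\<bar> \<le> C" using v nrm_normalized[OF v False] by (intro one) auto
    then show ?thesis using p D\<Phi>_normalized[OF v False, of u] by (simp add: abs_mult mult.commute)
  qed
  then show ?thesis by blast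
qed

lemma f_tendsto:
  assumes "(\<lambda>n. a n) \<longlonglongrightarrow> l" shows "(\<lambda>n. f (a n)) \<longlonglongrightarrow> f l"
  using f_cont assms by (auto simp: continuous_on_eq_continuous_at intro: isCont_tendsto_compose)

text \<open>A common pointwise limit of \<open>u n\<close> and \<open>w n\<close> is enough: the
  difference of the values of \<open>f\<close> then tends to 0 almost everywhere.\<close>

lemma difference_vanishes:
  assumes u: "\<And>n. u n \<in> X" "\<And>n. XH.nrm (u n) \<le> B" and w: "\<And>n. w n \<in> X" "\<And>n. XH.nrm (w n) \<le> B"
    and v: "\<And>n. v n \<in> X" "\<And>n. XH.nrm (v n) \<le> 1"
    and lim: "AE x in lebesgue. \<exists>l. (\<lambda>n. u n x) \<longlonglongrightarrow> l \<and> (\<lambda>n. w n x) \<longlonglongrightarrow> l"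
  shows "(\<lambda>n. D\<Phi> (u n) (v n) - D\<Phi> (w n) (v n)) \<longlonglongrightarrow> 0"
proof -
  have [measurable]: "u n \<in> borel_measurable lebesgue" "w n \<in> borel_measurable lebesgue" for n using u w by (auto intro: X_measurable)
  have "(\<lambda>n. \<integral>x. kw x * ((f (u n x) - f (w n x)) * v n x) \<partial>lebesgue) \<longlonglongrightarrow> 0"
  proof (rule vanishing[OF u(1) _ w(1) _ v(1), where B="max B 1"])
    show "(\<lambda>x. f (u n x) - f (w n x)) \<in> borel_measurable lebesgue" for n by measurable
    show "\<bar>f (u n x) - f (w n x)\<bar> \<le> M * (mm (u n x) + mm (w n x))" for n x
      using f_le[of "u n x"] f_le[of "w n x"] by (simp add: distrib_left)
    show "AE x in lebesgue. (\<lambda>n. f (u n x) - f (w n x)) \<longlonglongrightarrow> 0"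
      using lim
    proof eventually_elim
      case (elim x)
      then obtain l where l: "(\<lambda>n. u n x) \<longlonglongrightarrow> l" "(\<lambda>n. w n x) \<longlonglongrightarrow> l" by blast
      from tendsto_diff[OF f_tendsto[OF l(1)] f_tendsto[OF l(2)]] show ?case by simp
    qed
  qed (use u w v M in \<open>auto intro: le_max_iff_disj[THEN iffD2]\<close>)
  moreover have "(\<integral>x. kw x * ((f (u n x) - f (w n x)) * v n x) \<partial>lebesgue) = D\<Phi> (u n) (v n) - D\<Phi> (w n) (v n)" for n
    using f_integrable[OF u(1) v(1)] f_integrable[OF w(1) v(1)] by (simp add: D\<Phi>_def left_diff_distrib right_diff_distrib)
  ultimately show ?thesis by simp
qed

text \<open>Otherwise there are violating sequences with normalised test functions. A subsequence of
  \<open>u n\<close> converges pointwise, and \<open>w n\<close> has the same limit because the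
  decay estimate makes \<open>u n - w n\<close> tend to 0 pointwise.\<close>

lemma D\<Phi>_unif_cont:
  assumes e: "e > 0"
  shows "\<exists>d>0. \<forall>u\<in>X. \<forall>w\<in>X. \<forall>v\<in>X. XH.nrm u \<le> B \<longrightarrow> XH.nrm w \<le> B \<longrightarrow> XH.nrm (u - w) < d \<longrightarrow> \<bar>D\<Phi> u v - D\<Phi> w v\<bar> \<le> e * XH.nrm v"
proof (rule ccontr)
  assume neg: "\<not> ?thesis"
  define P where "P n u w v \<longleftrightarrow> u \<in> X \<and> w \<in> X \<and> v \<in> X \<and> XH.nrm u \<le> B \<and> XH.nrm w \<le> B \<and> XH.nrm (u - w) < 1 / real (Suc n) \<and> XH.nrm v = 1 \<and> e < \<bar>D\<Phi> u v - D\<Phi> w v\<bar>" for n u w v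
  have "\<exists>u w v. P n u w v" for n
  proof -
    obtain u w v where *: "u \<in> X" "w \<in> X" "v \<in> X" "XH.nrm u \<le> B" "XH.nrm w \<le> B" "XH.nrm (u - w) < 1 / real (Suc n)" "\<not> \<bar>D\<Phi> u v - D\<Phi> w v\<bar> \<le> e * XH.nrm v"
      using neg by (auto dest: spec[of _ "1 / real (Suc n)"])
    have nz: "XH.nrm v \<noteq> 0" using * D\<Phi>_cong_0[OF nrm_0_AE[OF *(3)]] by auto
    then have p: "XH.nrm v > 0" using XH.nrm_nonneg[OF *(3)] by linarith
    define v' where "v' = (1 / XH.nrm v) *\<^sub>R v"
    have "e * XH.nrm v < XH.nrm v * \<bar>D\<Phi> u v' - D\<Phi> w v'\<bar>"
      using *(7) p D\<Phi>_normalized[OF *(3) nz] unfolding v'_def by (simp add: not_le abs_mult flip: right_diff_distrib)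
    then have "e < \<bar>D\<Phi> u v' - D\<Phi> w v'\<bar>" using p by (simp add: mult.commute[of e])
    moreover have "v' \<in> X" "XH.nrm v' = 1" using *(3) nrm_normalized[OF *(3) nz] by (simp_all add: v'_def)
    ultimately have "P n u w v'" unfolding P_def using *(1,2,4-6) by blast
    then show ?thesis by blast
  qed
  then obtain u w v where "\<And>n. P n (u n) (w n) (v n)" by metis
  then have *: "\<And>n. u n \<in> X" "\<And>n. w n \<in> X" "\<And>n. v n \<in> X" "\<And>n. XH.nrm (u n) \<le> B" "\<And>n. XH.nrm (w n) \<le> B"
    "\<And>n. XH.nrm (u n - w n) < 1 / real (Suc n)" "\<And>n. XH.nrm (v n) = 1" "\<And>n. e < \<bar>D\<Phi> (u n) (v n) - D\<Phi> (w n) (v n)\<bar>"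
    unfolding P_def by blast+
  obtain r :: "nat \<Rightarrow> nat" where r: "strict_mono r" "AE x in lebesgue. convergent (\<lambda>n. u (r n) x)"
    by (rule pointwise_subseq[of u B]) (use * in auto)
  have "AE x in lebesgue. \<forall>n. \<bar>(u n - w n) x\<bar> \<le> \<kappa> (norm x) * XH.nrm (u n - w n)"
    unfolding AE_all_countable by (intro allI X_decay XH.X_diff *)
  then have "AE x in lebesgue. \<exists>l. (\<lambda>n. u (r n) x) \<longlonglongrightarrow> l \<and> (\<lambda>n. w (r n) x) \<longlonglongrightarrow> l"
    using r(2)
  proof eventually_elim
    case (elim x)
    obtain l where l: "(\<lambda>n. u (r n) x) \<longlonglongrightarrow> l" using elim(2) by (auto simp: convergent_def)
    have z: "(\<lambda>n. \<kappa> (norm x) * (1 / real (Suc n))) \<longlonglongrightarrow> 0"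
      by (intro tendsto_mult_right_zero LIMSEQ_Suc[OF lim_const_over_n])
    have "norm (u n x - w n x) \<le> \<kappa> (norm x) * (1 / real (Suc n))" for n
      using elim(1)[rule_format, of n] mult_left_mono[OF less_imp_le[OF *(6)[of n]] \<kappa>_nonneg, of "norm x"] by (simp only: minus_apply real_norm_def)
    then have "(\<lambda>n. u n x - w n x) \<longlonglongrightarrow> 0" by (intro Lim_null_comparison[OF _ z]) auto
    then have "(\<lambda>n. u (r n) x - w (r n) x) \<longlonglongrightarrow> 0" using LIMSEQ_subseq_LIMSEQ[OF _ r(1)] by (auto simp: o_def)
    from tendsto_diff[OF l this] l show ?case by auto
  qed
  then have "(\<lambda>n. D\<Phi> (u (r n)) (v (r n)) - D\<Phi> (w (r n)) (v (r n))) \<longlonglongrightarrow> 0"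
    using * by (intro difference_vanishes[where B=B]) auto
  then obtain N where "norm (D\<Phi> (u (r N)) (v (r N)) - D\<Phi> (w (r N)) (v (r N)) - 0) < e" using LIMSEQ_D[OF _ e] by fastforce
  then show False using *(8)[of "r N"] by simp
qed

text \<open>If the claim fails along a pointwise convergent subsequence, the violating index pairs
  tend to infinity, so both members of the pairs share one pointwise limit.\<close>

lemma D\<Phi>_compact:
  assumes s: "\<And>n. s n \<in> X" "\<And>n. XH.nrm (s n) \<le> B"
  shows "\<exists>r::nat\<Rightarrow>nat. strict_mono r \<and> (\<forall>e>0. \<exists>N. \<forall>m\<ge>N. \<forall>n\<ge>N. \<forall>v\<in>X. \<bar>D\<Phi> (s (r m)) v - D\<Phi> (s (r n)) v\<bar> \<le> e * XH.nrm v)"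
proof -
  obtain r :: "nat \<Rightarrow> nat" where r: "strict_mono r" "AE x in lebesgue. convergent (\<lambda>n. s (r n) x)"
    by (rule pointwise_subseq[of s B]) (use s in auto)
  have "\<exists>N. \<forall>m\<ge>N. \<forall>n\<ge>N. \<forall>v\<in>X. \<bar>D\<Phi> (s (r m)) v - D\<Phi> (s (r n)) v\<bar> \<le> e * XH.nrm v" if e: "e > 0" for e
  proof (rule ccontr)
    assume neg: "\<not> ?thesis"
    define P where "P N m n v \<longleftrightarrow> m \<ge> N \<and> n \<ge> N \<and> v \<in> X \<and> XH.nrm v = 1 \<and> e < \<bar>D\<Phi> (s (r m)) v - D\<Phi> (s (r n)) v\<bar>" for N m n v
    have "\<exists>m n v. P N m n v" for N
    proof -
      obtain m n v where *: "m \<ge> N" "n \<ge> N" "v \<in> X" "\<not> \<bar>D\<Phi> (s (r m)) v - D\<Phi> (s (r n)) v\<bar> \<le> e * XH.nrm v"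
        using neg by blast
      have nz: "XH.nrm v \<noteq> 0" using * D\<Phi>_cong_0[OF nrm_0_AE[OF *(3)]] by auto
      then have p: "XH.nrm v > 0" using XH.nrm_nonneg[OF *(3)] by linarith
      define v' where "v' = (1 / XH.nrm v) *\<^sub>R v"
      have "e * XH.nrm v < XH.nrm v * \<bar>D\<Phi> (s (r m)) v' - D\<Phi> (s (r n)) v'\<bar>"
        using *(4) p D\<Phi>_normalized[OF *(3) nz] unfolding v'_def by (simp add: not_le abs_mult flip: right_diff_distrib)
      then have "e < \<bar>D\<Phi> (s (r m)) v' - D\<Phi> (s (r n)) v'\<bar>" using p by (simp add: mult.commute[of e])
      then have "P N m n v'" unfolding P_def v'_def using * nrm_normalized[OF *(3) nz] by simp
      then show ?thesis by blast
    qed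
    then obtain m n v where "\<And>N. P N (m N) (n N) (v N)" by metis
    then have *: "\<And>N. m N \<ge> N" "\<And>N. n N \<ge> N" "\<And>N. v N \<in> X" "\<And>N. XH.nrm (v N) = 1"
      "\<And>N. e < \<bar>D\<Phi> (s (r (m N))) (v N) - D\<Phi> (s (r (n N))) (v N)\<bar>"
      unfolding P_def by blast+
    have m: "filterlim m at_top sequentially" "filterlim n at_top sequentially"
      using * by (auto intro!: filterlim_at_top_mono[OF filterlim_ident])
    have "AE x in lebesgue. \<exists>l. (\<lambda>N. s (r (m N)) x) \<longlonglongrightarrow> l \<and> (\<lambda>N. s (r (n N)) x) \<longlonglongrightarrow> l"
      using r(2)
    proof eventually_elim
      case (elim x)
      then obtain l where "(\<lambda>n. s (r n) x) \<longlonglongrightarrow> l" by (auto simp: convergent_def)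
      then show ?case using filterlim_compose[OF _ m(1)] filterlim_compose[OF _ m(2)] by blast
    qed
    then have "(\<lambda>N. D\<Phi> (s (r (m N))) (v N) - D\<Phi> (s (r (n N))) (v N)) \<longlonglongrightarrow> 0"
      using * s by (intro difference_vanishes[where B=B]) auto
    then obtain N where "norm (D\<Phi> (s (r (m N))) (v N) - D\<Phi> (s (r (n N))) (v N) - 0) < e" using LIMSEQ_D[OF _ e] by fastforce
    then show False using *(5)[of N] by simp
  qed
  then show ?thesis using r(1) by blast
qed

lemma \<Phi>_frechet:
  assumes e: "e > 0"
  shows "\<exists>d>0. \<forall>u\<in>X. \<forall>h\<in>X. XH.nrm u \<le> B \<longrightarrow> XH.nrm h < d \<longrightarrow> \<bar>\<Phi> (u + h) - \<Phi> u - D\<Phi> u h\<bar> \<le> e * XH.nrm h"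
proof (rule ccontr)
  assume neg: "\<not> ?thesis"
  define P where "P n u h \<longleftrightarrow> u \<in> X \<and> h \<in> X \<and> XH.nrm u \<le> B \<and> XH.nrm h < 1 / real (Suc n) \<and> e * XH.nrm h < \<bar>\<Phi> (u + h) - \<Phi> u - D\<Phi> u h\<bar>" for n u h
  have "\<exists>u h. P n u h" for n
    unfolding P_def using neg by (force simp: not_le dest: spec[of _ "1 / real (Suc n)"])
  then obtain u h where "\<And>n. P n (u n) (h n)" by metis
  then have *: "\<And>n. u n \<in> X" "\<And>n. h n \<in> X" "\<And>n. XH.nrm (u n) \<le> B" "\<And>n. XH.nrm (h n) < 1 / real (Suc n)"
    "\<And>n. e * XH.nrm (h n) < \<bar>\<Phi> (u n + h n) - \<Phi> (u n) - D\<Phi> (u n) (h n)\<bar>"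
    unfolding P_def by blast+
  have [measurable]: "u n \<in> borel_measurable lebesgue" "h n \<in> borel_measurable lebesgue" for n using * by (auto intro: X_measurable)
  have nz: "XH.nrm (h n) \<noteq> 0" for n
  proof
    assume z: "XH.nrm (h n) = 0"
    have ae: "AE x in lebesgue. h n x = 0" by (rule nrm_0_AE[OF *(2) z])
    have "\<Phi> (u n + h n) = \<Phi> (u n)"
      unfolding \<Phi>_def using ae
      by (intro integral_cong_AE) (auto intro!: borel_measurable_integrable[OF F_integrable] * elim: eventually_mono)
    then show False using *(5)[of n] D\<Phi>_cong_0[OF ae, of "u n"] z by simp
  qed
  then have p: "XH.nrm (h n) > 0" for n using XH.nrm_nonneg[OF *(2), of n] by (simp add: order_le_less)
  define v where "v n = (1 / XH.nrm (h n)) *\<^sub>R h n" for n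
  have v: "v n \<in> X" "XH.nrm (v n) = 1" for n using * nrm_normalized[OF *(2) nz] by (simp_all add: v_def)
  \<comment> \<open>The remainder of the linearisation divided by the increment, so that the
    remainder takes the form \<open>z\<close> times \<open>h\<close> required by
    \<open>vanishing\<close>. Where \<open>h n x\<close> is 0 the quotient is 0, and so is the
    remainder.\<close>
  define z where "z n x = (F (u n x + h n x) - F (u n x) - f (u n x) * h n x) / h n x" for n x
  have zh: "z n x * h n x = F (u n x + h n x) - F (u n x) - f (u n x) * h n x" for n x
    by (cases "h n x = 0") (simp_all add: z_def)
  have z_le: "\<bar>z n x\<bar> \<le> S" if "\<And>s. \<bar>s - u n x\<bar> \<le> \<bar>h n x\<bar> \<Longrightarrow> \<bar>f s - f (u n x)\<bar> \<le> S" for n x S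
  proof (cases "h n x = 0")
    case False
    have "\<bar>F (u n x + h n x) - F (u n x) - f (u n x) * ((u n x + h n x) - u n x)\<bar> \<le> S * \<bar>(u n x + h n x) - u n x\<bar>"
    proof (rule primitive_increment[OF f_cont])
      fix s assume "s \<in> closed_segment (u n x) (u n x + h n x)"
      then have "\<bar>s - u n x\<bar> \<le> \<bar>h n x\<bar>" by (auto simp: closed_segment_eq_real_ivl split: if_splits)
      then show "\<bar>f s - f (u n x)\<bar> \<le> S" by (rule that)
    qed
    then show ?thesis using False by (simp add: z_def abs_divide pos_divide_le_eq)
  next
    case True
    then show ?thesis using that[of "u n x"] by (simp add: z_def)
  qed
  \<comment> \<open>Passing from \<open>mm\<close> of |u| + |h| to the sum of the two values costs
    \<open>mm_const\<close>; the term with f(u) costs 1 more.\<close>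
  define C where "C = M * (mm_const + 1)"
  have C: "C > 0" using M mm_const_ge by (simp add: C_def)
  have z_bound: "\<bar>z n x\<bar> \<le> C * (mm (u n x) + mm (h n x))" for n x
  proof (rule z_le)
    fix s assume "\<bar>s - u n x\<bar> \<le> \<bar>h n x\<bar>"
    then have "\<bar>s\<bar> \<le> \<bar>\<bar>u n x\<bar> + \<bar>h n x\<bar>\<bar>" by linarith
    then have "mm s \<le> mm_const * (mm (u n x) + mm (h n x))" using mm_mono[of s "\<bar>u n x\<bar> + \<bar>h n x\<bar>"] mm_add[of "u n x" "h n x"] by linarith
    moreover have "mm (u n x) \<le> mm (u n x) + mm (h n x)" by simp
    ultimately have "M * mm s + M * mm (u n x) \<le> M * (mm_const * (mm (u n x) + mm (h n x))) + M * (mm (u n x) + mm (h n x))"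
      using M by (intro add_mono mult_left_mono) auto
    also have "\<dots> = C * (mm (u n x) + mm (h n x))" by (simp add: C_def algebra_simps)
    finally show "\<bar>f s - f (u n x)\<bar> \<le> C * (mm (u n x) + mm (h n x))" using f_le[of s] f_le[of "u n x"] by linarith
  qed
  have zm [measurable]: "z n \<in> borel_measurable lebesgue" for n unfolding z_def by measurable
  obtain r :: "nat \<Rightarrow> nat" where r: "strict_mono r" "AE x in lebesgue. convergent (\<lambda>n. u (r n) x)"
    by (rule pointwise_subseq[of u B]) (use * in auto)
  have "AE x in lebesgue. \<forall>n. \<bar>h n x\<bar> \<le> \<kappa> (norm x) * XH.nrm (h n)"
    unfolding AE_all_countable by (intro allI X_decay *)
  then have lim: "AE x in lebesgue. (\<lambda>n. z (r n) x) \<longlonglongrightarrow> 0"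
    using r(2)
  proof eventually_elim
    case (elim x)
    obtain l where l: "(\<lambda>n. u (r n) x) \<longlonglongrightarrow> l" using elim(2) by (auto simp: convergent_def)
    have k: "(\<lambda>n. \<kappa> (norm x) * (1 / real (Suc n))) \<longlonglongrightarrow> 0"
      by (intro tendsto_mult_right_zero LIMSEQ_Suc[OF lim_const_over_n])
    have "norm (h n x) \<le> \<kappa> (norm x) * (1 / real (Suc n))" for n
      using elim(1)[rule_format, of n] mult_left_mono[OF less_imp_le[OF *(4)[of n]] \<kappa>_nonneg, of "norm x"] by (simp only: real_norm_def)
    then have "(\<lambda>n. h n x) \<longlonglongrightarrow> 0" by (intro Lim_null_comparison[OF _ k]) auto
    then have hl: "(\<lambda>n. h (r n) x) \<longlonglongrightarrow> 0" using LIMSEQ_subseq_LIMSEQ[OF _ r(1)] by (auto simp: o_def)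
    show ?case
    proof (rule LIMSEQ_I)
      fix \<epsilon> :: real assume \<epsilon>: "\<epsilon> > 0"
      have "isCont f l" using f_cont by (simp add: continuous_on_eq_continuous_at)
      then obtain \<delta> where \<delta>: "\<delta> > 0" "\<And>s. \<bar>s - l\<bar> < \<delta> \<Longrightarrow> \<bar>f s - f l\<bar> < \<epsilon>/3"
        using \<epsilon> unfolding continuous_at_eps_delta dist_real_def by (meson divide_pos_pos zero_less_numeral)
      obtain N1 where N1: "\<And>n. n \<ge> N1 \<Longrightarrow> norm (u (r n) x - l) < \<delta>/2" using LIMSEQ_D[OF l, of "\<delta>/2"] \<delta> by auto
      obtain N2 where N2: "\<And>n. n \<ge> N2 \<Longrightarrow> norm (h (r n) x - 0) < \<delta>/2" using LIMSEQ_D[OF hl, of "\<delta>/2"] \<delta> by auto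
      have "norm (z (r n) x - 0) < \<epsilon>" if n: "n \<ge> max N1 N2" for n
      proof -
        have ul: "\<bar>u (r n) x - l\<bar> < \<delta>/2" and hn: "\<bar>h (r n) x\<bar> < \<delta>/2" using N1[of n] N2[of n] n by auto
        have "\<bar>z (r n) x\<bar> \<le> 2 * (\<epsilon>/3)"
        proof (rule z_le)
          fix s assume "\<bar>s - u (r n) x\<bar> \<le> \<bar>h (r n) x\<bar>"
          then have "\<bar>s - l\<bar> < \<delta>" "\<bar>u (r n) x - l\<bar> < \<delta>" using ul hn by linarith+
          then show "\<bar>f s - f (u (r n) x)\<bar> \<le> 2 * (\<epsilon>/3)" using \<delta>(2)[of s] \<delta>(2)[of "u (r n) x"] by linarith
        qed
        then show ?thesis using \<epsilon> by simp
      qed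
      then show "\<exists>N. \<forall>n\<ge>N. norm (z (r n) x - 0) < \<epsilon>" by blast
    qed
  qed
  have hB: "XH.nrm (h n) \<le> 1" for n
  proof -
    have "1 / real (Suc n) \<le> 1" by simp
    then show ?thesis using *(4)[of n] by linarith
  qed
  have "(\<lambda>n. \<integral>x. kw x * (z (r n) x * v (r n) x) \<partial>lebesgue) \<longlonglongrightarrow> 0"
    by (rule vanishing[of "\<lambda>n. u (r n)" "max B 1" "\<lambda>n. h (r n)" "\<lambda>n. v (r n)" "\<lambda>n. z (r n)" C])
       (use * v hB C lim z_bound zm in \<open>auto intro: le_max_iff_disj[THEN iffD2]\<close>)
  then obtain N where N: "norm ((\<integral>x. kw x * (z (r N) x * v (r N) x) \<partial>lebesgue) - 0) < e" using LIMSEQ_D[OF _ e] by fastforce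
  define n where "n = r N"
  have "\<Phi> (u n + h n) - \<Phi> (u n) - D\<Phi> (u n) (h n) = (\<integral>x. kw x * (z n x * h n x) \<partial>lebesgue)"
    using F_integrable[OF *(1), of n] F_integrable[of "u n + h n"] f_integrable[OF *(1,2), of n n] *(1,2)
    unfolding zh \<Phi>_def D\<Phi>_def by (simp add: right_diff_distrib)
  also have "\<dots> = XH.nrm (h n) * (\<integral>x. kw x * (z n x * v n x) \<partial>lebesgue)"
  proof -
    have "kw x * (z n x * h n x) = XH.nrm (h n) * (kw x * (z n x * v n x))" for x using nz[of n] by (simp add: v_def)
    then show ?thesis by (simp only: integral_mult_right_zero)
  qed
  finally have "e * XH.nrm (h n) < XH.nrm (h n) * \<bar>\<integral>x. kw x * (z n x * v n x) \<partial>lebesgue\<bar>"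
    using *(5)[of n] p[of n] by (simp add: abs_mult)
  then have "e < \<bar>\<integral>x. kw x * (z n x * v n x) \<partial>lebesgue\<bar>" using p[of n] by (simp add: mult.commute[of e])
  then show False using N by (simp add: n_def)
qed

text \<open>Writing \<open>u\<close> as its norm times a unit vector, \<open>mq_scale\<close>
  extracts the power of the norm, and the domination estimate with epsilon = 1 bounds what remains
  uniformly over the unit sphere.\<close>

lemma \<Phi>_superquadratic: "\<exists>C>0. \<forall>u\<in>X. XH.nrm u \<le> 1 \<longrightarrow> \<Phi> u \<le> C * XH.nrm u powr min q1 q2"
proof -
  obtain \<eta> where \<eta>: "integrable lebesgue \<eta>"
    "\<And>y. y \<in> X \<Longrightarrow> XH.nrm y \<le> 1 \<Longrightarrow> AE x in lebesgue. kw x * mq (y x) \<le> 1 * (vw x * (y x)\<^sup>2) + \<eta> x"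
    using X_domination[of 1 1] by auto
  define C where "C = M * (1 + (\<integral>x. \<bar>\<eta> x\<bar> \<partial>lebesgue))"
  have C: "C > 0" using M by (simp add: C_def add_pos_nonneg)
  have "\<Phi> u \<le> C * XH.nrm u powr min q1 q2" if u: "u \<in> X" "XH.nrm u \<le> 1" for u
  proof (cases "XH.nrm u = 0")
    case True
    have "\<Phi> u = 0" unfolding \<Phi>_def
      by (rule integral_eq_zero_AE) (use nrm_0_AE[OF u(1) True] in \<open>auto elim: eventually_mono\<close>)
    then show ?thesis using C by simp
  next
    case False
    let ?n = "XH.nrm u"
    have n: "?n > 0" using False XH.nrm_nonneg[OF u(1)] by linarith
    define v where "v = (1 / ?n) *\<^sub>R u"
    have v: "v \<in> X" "XH.nrm v = 1" using u nrm_normalized[OF u(1) False] by (simp_all add: v_def)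
    have uv: "u x = ?n * v x" for x using False by (simp add: v_def)
    have "\<Phi> u \<le> (\<integral>x. (M * ?n powr min q1 q2) * (vw x * (v x)\<^sup>2 + \<bar>\<eta> x\<bar>) \<partial>lebesgue)"
      unfolding \<Phi>_def
    proof (rule integral_mono_AE[OF F_integrable[OF u(1)]])
      show "integrable lebesgue (\<lambda>x. (M * ?n powr min q1 q2) * (vw x * (v x)\<^sup>2 + \<bar>\<eta> x\<bar>))"
        using X_integrable_V(1)[OF v(1)] \<eta>(1) by (intro integrable_mult_right Bochner_Integration.integrable_add integrable_abs)
      have "AE x in lebesgue. kw x * mq (v x) \<le> 1 * (vw x * (v x)\<^sup>2) + \<eta> x" using v by (intro \<eta>(2)) auto
      then show "AE x in lebesgue. kw x * F (u x) \<le> (M * ?n powr min q1 q2) * (vw x * (v x)\<^sup>2 + \<bar>\<eta> x\<bar>)"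
      proof eventually_elim
        case (elim x)
        have "F (u x) \<le> M * mq (?n * v x)" using F_le[of "u x"] uv[of x] by simp
        also have "\<dots> \<le> M * (?n powr min q1 q2 * mq (v x))" using M n u(2) by (intro mult_left_mono mq_scale) auto
        finally have "kw x * F (u x) \<le> kw x * (M * (?n powr min q1 q2 * mq (v x)))" by (intro mult_left_mono) auto
        also have "\<dots> = (M * ?n powr min q1 q2) * (kw x * mq (v x))" by simp
        also have "\<dots> \<le> (M * ?n powr min q1 q2) * (vw x * (v x)\<^sup>2 + \<bar>\<eta> x\<bar>)" using elim M by (intro mult_left_mono) auto
        finally show ?case .
      qed
    qed
    also have "\<dots> = (M * ?n powr min q1 q2) * ((\<integral>x. vw x * (v x)\<^sup>2 \<partial>lebesgue) + (\<integral>x. \<bar>\<eta> x\<bar> \<partial>lebesgue))"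
      using X_integrable_V(1)[OF v(1)] \<eta>(1) by simp
    also have "\<dots> \<le> (M * ?n powr min q1 q2) * (1 + (\<integral>x. \<bar>\<eta> x\<bar> \<partial>lebesgue))"
      using M X_integrable_V(2)[OF v(1)] v by (intro mult_left_mono add_right_mono) auto
    finally show ?thesis by (simp add: C_def mult_ac)
  qed
  then show ?thesis using C by blast
qed

end

subsection \<open>A test element\<close>

text \<open>A smooth radial function living on the annulus between radii 1 and 2, away from the
  possible singularities of the weights at 0. The squared norm is used because it is smooth at the
  origin too.\<close>

definition bump :: "'a::euclidean_space \<Rightarrow> real" where
  "bump x = flat 0 ((norm x)\<^sup>2 - 1) * flat 0 (4 - (norm x)\<^sup>2)"

lemma bump_radial: "norm x = norm y \<Longrightarrow> bump x = bump y" by (simp add: bump_def)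

lemma bump_outside: "\<not> (1 \<le> norm x \<and> norm x \<le> 2) \<Longrightarrow> bump x = 0"
proof -
  assume "\<not> (1 \<le> norm x \<and> norm x \<le> 2)"
  then have "(norm x)\<^sup>2 \<le> 1\<^sup>2 \<or> 2\<^sup>2 \<le> (norm x)\<^sup>2" by (smt (verit) norm_ge_zero power_mono)
  then show "bump x = 0" by (auto simp: bump_def)
qed

lemma bump_nonneg: "0 \<le> bump x" and bump_le_1: "bump x \<le> 1"
  unfolding bump_def using flat_0_le_1 by (auto intro: mult_le_one)

lemma bump_pos:
  assumes "norm x = 3/2"
  shows "0 < bump x"
proof -
  have "(norm x)\<^sup>2 = 9/4" unfolding assms by (simp add: power2_eq_square)
  then show ?thesis unfolding bump_def by (intro mult_pos_pos flat_pos) auto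
qed

lemma bump_test: "bump \<in> test_functions (- {0::'a::euclidean_space})"
proof (rule test_functionsI[where C="cball 0 2 - ball 0 1"])
  show "Ck k (bump :: 'a \<Rightarrow> real)" for k
    unfolding bump_def[abs_def]
    by (rule Ck_mult; rule Ck_compose[OF flat_Ck]; rule Ck_diff; rule Ck_norm_sq Ck_const)
  show "compact (cball 0 2 - ball (0::'a) 1)" by (rule compact_diff) auto
  show "bump x = 0" if "x \<notin> cball 0 2 - ball 0 1" for x :: 'a
    using that by (intro bump_outside) auto
qed auto

context radial_weight
begin

lemma wg_L2_punctured:
  assumes w: "w \<in> test_functions (- {0})"
  shows "wg w \<in> L2"
proof -
  obtain C where C: "compact C" "C \<subseteq> - {0}" "\<And>x. x \<notin> C \<Longrightarrow> grad w x = 0" using test_functions_support[OF w] by metis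
  obtain M where M: "M > 0" "\<And>x. norm (grad w x) \<le> M" using test_functions_bounded[OF w] by metis
  have "continuous_on C (\<lambda>x. A (norm x))"
    by (rule continuous_on_compose2[OF A_cont]) (use C in \<open>auto intro!: continuous_intros\<close>)
  then have "bounded ((\<lambda>x. A (norm x)) ` C)" using C(1) compact_imp_bounded compact_continuous_image by blast
  then obtain B where B: "\<And>x. x \<in> C \<Longrightarrow> \<bar>A (norm x)\<bar> \<le> B" by (auto simp: bounded_iff)
  show ?thesis
  proof (rule L2_bound[OF wg_measurable[OF w]])
    show "integrable lebesgue (\<lambda>x. (B * M\<^sup>2) * indicator C x)"
      using emeasure_bounded_finite[OF compact_imp_bounded[OF C(1)]] borel_compact[OF C(1)]
      by (intro integrable_mult_right integrable_real_indicator) auto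
    show "AE x in lebesgue. (norm (wg w x))\<^sup>2 \<le> (B * M\<^sup>2) * indicator C x"
    proof (rule AE_I2)
      fix x
      show "(norm (wg w x))\<^sup>2 \<le> (B * M\<^sup>2) * indicator C x"
      proof (cases "x \<in> C")
        case True
        have x0: "x \<noteq> 0" using True C(2) by blast
        have a: "aw x \<le> B" using B[OF True] x0 by (simp add: aw_def)
        then have "aw x * (norm (grad w x))\<^sup>2 \<le> B * M\<^sup>2"
          using order_trans[OF aw_nonneg a] by (intro mult_mono power_mono M) auto
        then show ?thesis using True by (simp add: norm_wg_sq)
      qed (simp add: norm_wg_sq C(3))
    qed
  qed
qed

lemma bump_S_A: "(bump :: 'a \<Rightarrow> real) \<in> S_A A"
  unfolding S_A_def mem_Collect_eq
proof (intro conjI allI impI)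
  show "bump \<in> test_functions (UNIV :: 'a set)" using test_functions_mono[of "- {0::'a}" UNIV] bump_test by blast
  show "integrable lebesgue (\<lambda>x::'a. A (norm x) * (norm (grad bump x))\<^sup>2)"
    using wg_L2_punctured[OF bump_test] wg_L2_iff[OF bump_test] by simp
qed (rule bump_radial)

end

context potentials
begin

lemma bump_X: "bump \<in> X"
proof (rule X_I[OF S_A_DG[OF bump_S_A]])
  have m [measurable]: "bump \<in> borel_measurable lebesgue" by (rule test_functions_measurable[OF bump_test])
  have "(\<lambda>t. \<bar>V t\<bar>) absolutely_integrable_on C" if "compact C" "C \<subseteq> {0<..}" for C
    using hyp_V that by (simp add: hyp_V_def Lp_loc_def)
  then have "(\<lambda>t. \<bar>V t\<bar>) absolutely_integrable_on {1..2}" by (auto simp: subset_iff)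
  then have i: "integrable lebesgue (\<lambda>x::'a. indicator {x. 1 \<le> norm x \<and> norm x \<le> 2} x * V (norm x))"
    by (intro integrable_radial_annulus V_meas) auto
  show "Vg bump \<in> L2"
  proof (rule L2_bound[OF _ i])
    show "Vg bump \<in> borel_measurable lebesgue" unfolding Vg_def by measurable
    show "AE x in lebesgue. (norm (Vg bump x))\<^sup>2 \<le> indicator {x. 1 \<le> norm x \<and> norm x \<le> 2} x * V (norm x)"
      using vw_AE
    proof eventually_elim
      case (elim x)
      have "(bump x)\<^sup>2 \<le> indicator {x. 1 \<le> norm x \<and> norm x \<le> 2} x"
        using bump_outside[of x] bump_nonneg[of x] bump_le_1[of x] by (auto simp: indicator_def power_le_one)
      then have "vw x * (bump x)\<^sup>2 \<le> vw x * indicator {x. 1 \<le> norm x \<and> norm x \<le> 2} x" by (intro mult_left_mono) auto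
      then show ?case by (simp add: Vg_sq elim mult.commute)
    qed
  qed
qed

lemma kw_pos: "x \<noteq> 0 \<Longrightarrow> 0 < kw x" using hyp_K by (simp add: kw_def hyp_K_def)

end

subsection \<open>Existence and sign of a critical point\<close>

locale superquadratic_growth = growth A a0 ainf ty V K R1 R2 \<alpha>0 \<alpha>inf \<beta>0 \<beta>inf q1 q2 f M
  for A a0 ainf and ty :: "'a::euclidean_space itself" and V K R1 R2 \<alpha>0 \<alpha>inf \<beta>0 \<beta>inf q1 q2 f M +
  fixes \<theta> t0 :: real
  assumes \<theta>: "\<theta> > 2" and AR: "0 \<le> \<theta> * primitive f t" "\<theta> * primitive f t \<le> f t * t"
    and t0: "primitive f t0 > 0"
begin

lemma F_nonneg: "0 \<le> F t" using AR(1)[of t] \<theta> by (simp add: zero_le_mult_iff)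

text \<open>The function F(r s) r^(-theta) is nondecreasing for r >= 1: its derivative is
  r^(-theta-1) times f(r s) r s - theta F(r s), which \<open>AR\<close> makes nonnegative.\<close>

lemma F_homogeneous_ge:
  assumes "l \<ge> 1"
  shows "l powr \<theta> * F s \<le> F (l * s)"
proof -
  define h where "h r = F (r * s) * r powr (- \<theta>)" for r
  have "h 1 \<le> h l"
  proof (rule DERIV_nonneg_imp_nondecreasing[OF assms])
    fix r :: real assume r: "1 \<le> r"
    have "((\<lambda>r. F (r * s)) has_real_derivative f (r * s) * s) (at r)"
      by (rule DERIV_chain2[where f=F and g="\<lambda>r. r * s"]) (auto intro!: derivative_eq_intros primitive_deriv f_cont)
    moreover have "((\<lambda>r. r powr (- \<theta>)) has_real_derivative (- \<theta>) * r powr (- \<theta> - 1)) (at r)"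
      using r has_real_derivative_powr[of r "- \<theta>"] by simp
    ultimately have "(h has_real_derivative f (r * s) * s * r powr (- \<theta>) + (- \<theta>) * r powr (- \<theta> - 1) * F (r * s)) (at r)"
      unfolding h_def[abs_def] by (rule DERIV_mult)
    moreover have "f (r * s) * s * r powr (- \<theta>) + (- \<theta>) * r powr (- \<theta> - 1) * F (r * s)
      = r powr (- \<theta> - 1) * (f (r * s) * (r * s) - \<theta> * F (r * s))"
    proof -
      have "r powr (- \<theta>) = r powr (- \<theta> - 1) * r" using r by (simp add: powr_diff)
      then show ?thesis by (simp add: algebra_simps)
    qed
    moreover have "\<dots> \<ge> 0" using AR(2)[of "r * s"] by simp
    ultimately show "\<exists>y. (h has_real_derivative y) (at r) \<and> 0 \<le> y" by metis
  qed
  then show ?thesis using assms by (simp add: h_def powr_minus field_simps)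
qed

lemma \<Phi>_nonneg: "u \<in> X \<Longrightarrow> 0 \<le> \<Phi> u"
  unfolding \<Phi>_def using F_nonneg by (intro integral_nonneg_AE AE_I2 mult_nonneg_nonneg) auto

lemma \<Phi>_le_D\<Phi>: "u \<in> X \<Longrightarrow> \<theta> * \<Phi> u \<le> D\<Phi> u u"
proof -
  assume u: "u \<in> X"
  have "(\<integral>x. \<theta> * (kw x * F (u x)) \<partial>lebesgue) \<le> D\<Phi> u u"
    unfolding D\<Phi>_def
  proof (rule integral_mono)
    show "\<theta> * (kw x * F (u x)) \<le> kw x * (f (u x) * u x)" for x
      using mult_left_mono[OF AR(2)[of "u x"] kw_nonneg[of x]] by (simp add: mult.left_commute)
  qed (intro integrable_mult_right F_integrable f_integrable u)+
  then show ?thesis by (simp add: \<Phi>_def)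
qed

lemma \<Phi>_homogeneous_ge:
  assumes "u \<in> X" "l \<ge> 1"
  shows "l powr \<theta> * \<Phi> u \<le> \<Phi> (l *\<^sub>R u)"
proof -
  have "(\<integral>x. l powr \<theta> * (kw x * F (u x)) \<partial>lebesgue) \<le> \<Phi> (l *\<^sub>R u)"
    unfolding \<Phi>_def
  proof (rule integral_mono)
    show "integrable lebesgue (\<lambda>x. kw x * F ((l *\<^sub>R u) x))" by (intro F_integrable subspace_scale[OF subspace_X] assms)
    show "l powr \<theta> * (kw x * F (u x)) \<le> kw x * F ((l *\<^sub>R u) x)" for x
      using mult_left_mono[OF F_homogeneous_ge[OF assms(2), of "u x"] kw_nonneg[of x]] by (simp add: mult.left_commute)
  qed (intro integrable_mult_right F_integrable assms)
  then show ?thesis by (simp add: \<Phi>_def)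
qed

text \<open>A multiple of \<open>bump\<close> that takes the value \<open>t0\<close> has positive
  \<open>F\<close> on a nonempty open set, hence positive \<open>\<Phi>\<close>. Along the ray
  through it \<open>\<Phi>\<close> grows at least with the power theta > 2 and beats the quadratic
  term.\<close>

lemma ex_negative: "\<exists>e\<in>X. ip e e / 2 < \<Phi> e"
proof -
  obtain y :: 'a where y: "norm y = 3/2" using vector_choose_size[of "3/2"] by auto
  define e where "e = (t0 / bump y) *\<^sub>R (bump :: 'a \<Rightarrow> real)"
  have e: "e \<in> X" using bump_X by (simp add: e_def)
  have ey: "e y = t0" using bump_pos[OF y] by (simp add: e_def)
  have ce: "continuous_on UNIV e"
    using test_functions_Ck[OF bump_test, of 0] unfolding e_def scaleR_fun_def by (intro continuous_intros) simp
  have e0: "e 0 = 0" by (simp add: e_def bump_outside)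
  have "\<Phi> e \<noteq> 0"
  proof
    assume "\<Phi> e = 0"
    then have "AE x in lebesgue. kw x * F (e x) = 0"
      unfolding \<Phi>_def using integral_nonneg_eq_0_iff_AE[OF F_integrable[OF e]] F_nonneg by simp
    then obtain N where N: "{x \<in> space lebesgue. \<not> (kw x * F (e x) = 0)} \<subseteq> N" "emeasure lebesgue N = 0" "N \<in> sets lebesgue"
      by (rule AE_E)
    have "{x. 0 < F (e x)} \<subseteq> N"
    proof
      fix x assume "x \<in> {x. 0 < F (e x)}"
      then have x: "0 < F (e x)" by simp
      then have "x \<noteq> 0" using e0 by auto
      then have "kw x * F (e x) \<noteq> 0" using x kw_pos[of x] by simp
      then show "x \<in> N" using N(1) by auto
    qed
    moreover have "negligible N" using N(2,3) by (simp add: negligible_iff_null_sets null_sets_def)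
    ultimately have "negligible {x. 0 < F (e x)}" using negligible_subset by blast
    moreover have "open {x. 0 < F (e x)}"
      by (intro open_Collect_less continuous_intros continuous_on_compose2[OF primitive_continuous[OF f_cont] ce]) auto
    moreover have "y \<in> {x. 0 < F (e x)}" using t0 ey by simp
    ultimately show False using open_not_negligible by blast
  qed
  then have p: "\<Phi> e > 0" using \<Phi>_nonneg[OF e] by simp
  define b where "b = ip e e / (2 * \<Phi> e)"
  have b: "b \<ge> 0" using p XH.ip_nonneg[OF e] by (simp add: b_def)
  \<comment> \<open>Then l^(theta-2) equals b + 1, which exceeds the ratio \<open>b\<close> of half
    the squared norm to \<open>\<Phi>\<close>.\<close>
  define l where "l = (b + 1) powr (1 / (\<theta> - 2))"
  have "l \<ge> 1" using b \<theta> by (simp add: l_def ge_one_powr_ge_zero)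
  moreover have "b < l powr (\<theta> - 2)" using b \<theta> by (simp add: l_def powr_powr)
  ultimately have l: "l \<ge> 1" "ip e e / (2 * \<Phi> e) < l powr (\<theta> - 2)" by (simp_all add: b_def)
  have "ip (l *\<^sub>R e) (l *\<^sub>R e) / 2 = l\<^sup>2 * \<Phi> e * (ip e e / (2 * \<Phi> e))"
    using e p by (simp add: XH.ip_scale XH.ip_scale2 power2_eq_square)
  also have "\<dots> < l\<^sup>2 * \<Phi> e * l powr (\<theta> - 2)" using l p by (intro mult_strict_left_mono) auto
  also have "\<dots> = l powr \<theta> * \<Phi> e" using l by (simp add: powr_diff)
  also have "\<dots> \<le> \<Phi> (l *\<^sub>R e)" by (rule \<Phi>_homogeneous_ge[OF e l(1)])
  finally show ?thesis using e by (intro bexI[of _ "l *\<^sub>R e"]) auto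
qed

lemma ex_critical: "\<exists>u\<in>X. XH.nrm u \<noteq> 0 \<and> (\<forall>v\<in>X. ip u v = D\<Phi> u v)"
proof -
  obtain C where C: "C > 0" "\<And>u. u \<in> X \<Longrightarrow> XH.nrm u \<le> 1 \<Longrightarrow> \<Phi> u \<le> C * XH.nrm u powr min q1 q2"
    using \<Phi>_superquadratic by blast
  interpret MP: mountain_pass X ip \<Phi> D\<Phi> \<theta> "min q1 q2" C
  proof unfold_locales
    show "D\<Phi> u (v + w) = D\<Phi> u v + D\<Phi> u w" if "u \<in> X" "v \<in> X" "w \<in> X" for u v w using that by (rule D\<Phi>_add)
    show "D\<Phi> u (c *\<^sub>R v) = c * D\<Phi> u v" for u v c by (rule D\<Phi>_scale)
    show "\<exists>C. \<forall>v\<in>X. \<bar>D\<Phi> u v\<bar> \<le> C * sqrt (ip v v)" if "u \<in> X" for u using D\<Phi>_bounded[OF that] unfolding XH.nrm_def .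
    show "D\<Phi> 0 v = 0" for v by (simp add: D\<Phi>_def)
    show "\<exists>d>0. \<forall>u\<in>X. \<forall>h\<in>X. sqrt (ip u u) \<le> B \<longrightarrow> sqrt (ip h h) < d \<longrightarrow>
        \<bar>\<Phi> (u + h) - \<Phi> u - D\<Phi> u h\<bar> \<le> e * sqrt (ip h h)" if "e > 0" for e B
      using \<Phi>_frechet[OF that, of B] unfolding XH.nrm_def .
    show "\<exists>d>0. \<forall>u\<in>X. \<forall>w\<in>X. \<forall>v\<in>X. sqrt (ip u u) \<le> B \<longrightarrow> sqrt (ip w w) \<le> B \<longrightarrow>
        sqrt (ip (u - w) (u - w)) < d \<longrightarrow> \<bar>D\<Phi> u v - D\<Phi> w v\<bar> \<le> e * sqrt (ip v v)" if "e > 0" for e B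
      using D\<Phi>_unif_cont[OF that, of B] unfolding XH.nrm_def .
    show "\<exists>r::nat\<Rightarrow>nat. strict_mono r \<and> (\<forall>e>0. \<exists>N. \<forall>m\<ge>N. \<forall>n\<ge>N. \<forall>v\<in>X.
          \<bar>D\<Phi> (s (r m)) v - D\<Phi> (s (r n)) v\<bar> \<le> e * sqrt (ip v v))"
      if "\<And>n. s n \<in> X" "\<And>n. sqrt (ip (s n) (s n)) \<le> B" for s B
      using D\<Phi>_compact[of s B] that unfolding XH.nrm_def by blast
    show "\<Phi> u \<le> C * sqrt (ip u u) powr min q1 q2" if "u \<in> X" "sqrt (ip u u) \<le> 1" for u
      using C(2)[of u] that unfolding XH.nrm_def by blast
  qed (use \<theta> q C(1) ex_negative \<Phi>_nonneg \<Phi>_le_D\<Phi> in auto)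
  show ?thesis by (rule MP.ex_critical)
qed

end

text \<open>Testing the equation with \<open>flat_neg \<circ> u\<close> replaces testing with the negative part of \<open>u\<close>,
  which would need a chain rule for Lipschitz functions.\<close>
definition flat_neg :: "real \<Rightarrow> real" where "flat_neg t = - flat 0 (- t)"

lemma flat_neg_deriv: "(flat_neg has_real_derivative flat 2 (- t)) (at t)"
  unfolding flat_neg_def[abs_def]
  using DERIV_minus[OF DERIV_chain2[OF flat_DERIV[of 0 "- t"] DERIV_minus[OF DERIV_ident]]] by (simp add: numeral_2_eq_2)

lemma flat_neg_Ck: "Ck k flat_neg"
  unfolding flat_neg_def[abs_def]
  by (intro Ck_uminus Ck_compose[OF flat_Ck] Ck_bounded_linear bounded_linear_ident)

lemma flat_neg_0 [simp]: "0 \<le> t \<Longrightarrow> flat_neg t = 0" by (simp add: flat_neg_def)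

lemma flat_neg_nonpos: "flat_neg t \<le> 0" by (simp add: flat_neg_def)

lemma flat_neg_neg: "t < 0 \<Longrightarrow> flat_neg t < 0" using flat_pos[of "- t" 0] by (simp add: flat_neg_def)

text \<open>With s = -t > 0 this is exp (-1/s) <= s, which follows from exp y > y. It keeps the
  \<open>V\<close> part of the composition finite.\<close>

lemma flat_neg_abs_le: "\<bar>flat_neg t\<bar> \<le> \<bar>t\<bar>"
proof (cases "t < 0")
  case True
  have "1 / (- t) < exp (1 / (- t))" using exp_ge_add_one_self[of "1 / (- t)"] by linarith
  then show ?thesis using True by (simp add: flat_neg_def flat_def exp_minus field_simps)
qed simp

section \<open>Nonnegativity of the solution and the Frechet derivative of
  \<open>I_functional\<close>\<close>

context growth
begin

lemma nonneg_if_critical: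
  assumes u: "u \<in> X" and crit: "\<And>v. v \<in> X \<Longrightarrow> ip u v = D\<Phi> u v" and f: "\<And>t. t \<le> 0 \<Longrightarrow> f t = 0"
  shows "AE x in lebesgue. 0 \<le> u x"
proof -
  define v where "v = (\<lambda>x. flat_neg (u x))"
  have DG: "DG v (\<lambda>x. flat 2 (- u x) *\<^sub>R Hg u x)"
    unfolding v_def
  proof (rule DG_chain[OF X_DG[OF u] flat_neg_Ck _ flat_neg_deriv])
    have "continuous_on UNIV (flat 2)" using flat_Ck[of 0 2] by simp
    then show "continuous_on UNIV (\<lambda>t. flat 2 (- t))" by (rule continuous_on_compose2) (auto intro!: continuous_intros)
    show "\<bar>flat 2 (- t)\<bar> \<le> 2" for t using flat_2_le[of "- t"] by simp
  qed simp
  have [measurable]: "v \<in> borel_measurable lebesgue" "u \<in> borel_measurable lebesgue" using DG_measurable[OF DG] X_measurable[OF u] .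
  have "Vg v \<in> L2"
  proof (rule L2_bound[OF _ L2_integrable[OF X_Vg[OF u]]])
    show "Vg v \<in> borel_measurable lebesgue" unfolding Vg_def by measurable
    show "AE x in lebesgue. (norm (Vg v x))\<^sup>2 \<le> (norm (Vg u x))\<^sup>2"
      using flat_neg_abs_le by (intro AE_I2) (auto simp: Vg_sq v_def abs_le_square_iff intro!: mult_left_mono)
  qed
  then have v: "v \<in> X" by (rule X_I[OF DG])
  have "D\<Phi> u v = 0"
  proof -
    have z: "f (u x) * v x = 0" for x using f[of "u x"] by (cases "u x \<le> 0") (auto simp: v_def)
    show ?thesis unfolding D\<Phi>_def z by simp
  qed
  then have "l2_ip (Hg u) (Hg v) + l2_ip (Vg u) (Vg v) = 0" using crit[OF v] by (simp add: ip_def)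
  moreover have "0 \<le> l2_ip (Vg u) (Vg v)"
    unfolding l2_ip_def
  proof (rule integral_nonneg_AE, rule AE_I2)
    fix x
    have "0 \<le> u x * v x" using flat_neg_nonpos[of "u x"] unfolding v_def by (cases "u x \<ge> 0") (simp_all add: mult_nonpos_nonpos)
    then have "0 \<le> vw x * (u x * v x)" by (rule mult_nonneg_nonneg[OF vw_nonneg])
    also have "\<dots> = (sqrt (vw x) * sqrt (vw x)) * (u x * v x)" by simp
    also have "\<dots> = Vg u x \<bullet> Vg v x" by (simp only: Vg_def inner_real_def mult_ac)
    finally show "0 \<le> Vg u x \<bullet> Vg v x" .
  qed
  \<comment> \<open>\<open>Hg v\<close> is \<open>Hg u\<close> times the factor
    \<open>flat 2 (- u x)\<close>, which lies between 0 and 2; so its square is at most twice the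
    pairing with \<open>Hg u\<close>. As the \<open>V\<close> pairing is nonnegative and both
    pairings sum to 0, the gradient part of \<open>v\<close> must vanish.\<close>
  moreover have "l2_ip (Hg v) (Hg v) \<le> 2 * l2_ip (Hg u) (Hg v)"
  proof -
    have "l2_ip (Hg v) (Hg v) \<le> (\<integral>x. 2 * (Hg u x \<bullet> Hg v x) \<partial>lebesgue)"
      unfolding l2_ip_def
    proof (rule integral_mono_AE)
      show "integrable lebesgue (\<lambda>x. Hg v x \<bullet> Hg v x)" by (intro L2_inner_integrable X_Hg v)
      show "integrable lebesgue (\<lambda>x. 2 * (Hg u x \<bullet> Hg v x))" by (intro integrable_mult_right L2_inner_integrable X_Hg u v)
      show "AE x in lebesgue. Hg v x \<bullet> Hg v x \<le> 2 * (Hg u x \<bullet> Hg v x)"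
        using DG_Hg[OF DG]
      proof eventually_elim
        case (elim x)
        have "flat 2 (- u x) * (flat 2 (- u x) * (Hg u x \<bullet> Hg u x)) \<le> 2 * (flat 2 (- u x) * (Hg u x \<bullet> Hg u x))"
          by (intro mult_right_mono flat_2_le) auto
        then show ?case by (simp add: elim)
      qed
    qed
    then show ?thesis by (simp add: l2_ip_def)
  qed
  ultimately have "(L2.nrm (Hg v))\<^sup>2 \<le> 0" using L2.nrm_sq[OF X_Hg[OF v]] by linarith
  \<comment> \<open>The decay estimate involves only the gradient part, so \<open>v\<close> is 0
    almost everywhere, whereas \<open>flat_neg\<close> is strictly negative on negative
    arguments.\<close>
  then have n: "L2.nrm (Hg v) = 0" by simp
  show ?thesis
    using DG_decay[OF X_DG[OF v]]
  proof eventually_elim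
    case (elim x)
    then have "v x = 0" by (simp add: n)
    then have "flat_neg (u x) = 0" by (simp add: v_def)
    then show ?case using flat_neg_neg[of "u x"] by linarith
  qed
qed

text \<open>The linear parts \<open>ip u h\<close> and \<open>D\<Phi> u h\<close> cancel, leaving
  half the squared norm of \<open>h\<close> and the remainder of \<open>\<Phi>\<close>, each at most
  half of epsilon times the norm.\<close>

lemma critical_point_I:
  assumes u: "u \<in> X" and crit: "\<And>v. v \<in> X \<Longrightarrow> ip u v = D\<Phi> u v"
  shows "critical_point X (X_norm A V) (I_functional A V K F) u"
proof -
  define J :: "('a \<Rightarrow> real) \<Rightarrow> real" where "J = I_functional A V K F"
  have J: "J w = (XH.nrm w)\<^sup>2 / 2 - \<Phi> w" if w: "w \<in> X" for w
  proof -
    have [measurable]: "w \<in> borel_measurable lebesgue" by (rule X_measurable[OF w])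
    have m: "(\<lambda>x. kw x * F (w x)) \<in> borel_measurable lebesgue" by measurable
    have ae: "AE x in lebesgue. kw x * F (w x) = K (norm x) * F (w x)" using kw_AE by eventually_elim simp
    have "\<Phi> w = (\<integral>x. K (norm x) * F (w x) \<partial>lebesgue)"
      unfolding \<Phi>_def by (rule integral_cong_AE[OF m borel_measurable_AE[OF m ae] ae])
    then show ?thesis using energy_eq[OF w] by (simp add: J_def I_functional_def flip: distrib_left)
  qed
  have "\<exists>d>0. \<forall>h\<in>X. X_norm A V h < d \<longrightarrow> \<bar>J (\<lambda>x. u x + h x) - J u - 0\<bar> \<le> e * X_norm A V h" if e: "e > 0" for e
  proof -
    obtain d where d: "d > 0" "\<And>w h. w \<in> X \<Longrightarrow> h \<in> X \<Longrightarrow> XH.nrm w \<le> XH.nrm u \<Longrightarrow> XH.nrm h < d \<Longrightarrow>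
        \<bar>\<Phi> (w + h) - \<Phi> w - D\<Phi> w h\<bar> \<le> e / 2 * XH.nrm h"
      using \<Phi>_frechet[of "e / 2" "XH.nrm u"] e by auto
    have "\<bar>J (\<lambda>x. u x + h x) - J u - 0\<bar> \<le> e * X_norm A V h" if h: "h \<in> X" "X_norm A V h < min d e" for h
    proof -
      have n: "XH.nrm h < d" "XH.nrm h \<le> e" "0 \<le> XH.nrm h" using h by (auto simp: X_norm_eq)
      have uh: "u + h \<in> X" using u h by simp
      have "(XH.nrm (u + h))\<^sup>2 = (XH.nrm u)\<^sup>2 + 2 * ip u h + (XH.nrm h)\<^sup>2"
        by (rule XH.nrm_add_sq[OF u h(1)])
      then have "J (u + h) - J u = (XH.nrm h)\<^sup>2 / 2 - (\<Phi> (u + h) - \<Phi> u - D\<Phi> u h)"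
        using J[OF u] J[OF uh] crit[OF h(1)] by (simp add: field_simps)
      moreover have "\<bar>\<Phi> (u + h) - \<Phi> u - D\<Phi> u h\<bar> \<le> e / 2 * XH.nrm h" using d(2)[OF u h(1) order_refl n(1)] .
      moreover have "(XH.nrm h)\<^sup>2 \<le> e * XH.nrm h" using mult_right_mono[OF n(2,3)] by (simp add: power2_eq_square)
      moreover have "(\<lambda>x. u x + h x) = u + h" by (simp add: plus_fun_def)
      moreover have "0 \<le> (XH.nrm h)\<^sup>2" by simp
      ultimately show ?thesis unfolding X_norm_eq[OF h(1)] abs_le_iff by (simp only:) linarith
    qed
    then show ?thesis using d(1) e by (intro exI[of _ "min d e"]) auto
  qed
  moreover have "\<exists>C. \<forall>v\<in>X. \<bar>0::real\<bar> \<le> C * X_norm A V v" by (intro exI[of _ 0]) simp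
  ultimately show ?thesis using u unfolding critical_point_def has_frechet_derivative_in_def J_def by simp
qed

end

theorem theorem5p3:
  fixes A V K f :: "real \<Rightarrow> real"
    and a0 ainf R1 R2 \<alpha>0 \<alpha>inf \<beta>0 \<beta>inf q1 q2 :: real
  defines "X \<equiv> (X_space A V a0 ainf :: ('a::euclidean_space \<Rightarrow> real) set)"
  assumes "DIM('a) \<ge> 3"
    and "hyp_A DIM('a) A a0 ainf"
    and "hyp_V V"
    and "hyp_K DIM('a) K a0 ainf"
    and "R1 > 0" "R2 > 0"
    and "\<beta>0 \<in> {0..1}" "\<beta>inf \<in> {0..1}"
    and "esssup (lebesgue_on {x::'a. norm x < R1})
           (\<lambda>x. KV_quotient K V \<alpha>0 \<beta>0 (norm x)) < \<infinity>"
    and "esssup (lebesgue_on {x::'a. norm x \<ge> R2})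
           (\<lambda>x. KV_quotient K V \<alpha>inf \<beta>inf (norm x)) < \<infinity>"
    and "q1 > 2" "q2 > 2"
    and "q1 \<in> {max 1 (2 * \<beta>0) <..< q_star DIM('a) a0 \<alpha>0 \<beta>0}"
    and "q2 \<in> {Max {1, 2 * \<beta>inf, q_star DIM('a) ainf \<alpha>inf \<beta>inf} <..}"
    and "continuous_on UNIV f"
    and f1: "\<exists>M>0. \<forall>t. \<bar>f t\<bar> \<le> M * min (\<bar>t\<bar> powr (q1 - 1)) (\<bar>t\<bar> powr (q2 - 1))"
    and f2: "\<exists>\<theta>>2. \<forall>t. 0 \<le> \<theta> * primitive f t \<and> \<theta> * primitive f t \<le> f t * t"
            "\<exists>t0>0. primitive f t0 > 0"
  shows "(\<forall>u\<in>X. integrable lebesgue (\<lambda>x. K (norm x) * primitive f (u x))) \<and>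
    (\<exists>u. critical_point X (X_norm A V) (I_functional A V K (primitive f)) u \<and>
         (AE x in lebesgue. 0 \<le> u x) \<and> \<not> (AE x in lebesgue. u x = 0))"
proof -
  obtain M where M: "M > 0" "\<And>t. \<bar>f t\<bar> \<le> M * min (\<bar>t\<bar> powr (q1 - 1)) (\<bar>t\<bar> powr (q2 - 1))" using f1 by blast
  obtain \<theta> where \<theta>: "\<theta> > 2" "\<And>t. 0 \<le> \<theta> * primitive f t" "\<And>t. \<theta> * primitive f t \<le> f t * t" using f2(1) by blast
  obtain t0 where t0: "t0 > 0" "primitive f t0 > 0" using f2(2) by blast
  \<comment> \<open>Cutting off at 0 makes the nonlinearity vanish on the negative half-line, as
    \<open>nonneg_if_critical\<close> requires. The constants \<open>M\<close>,
    \<open>\<theta>\<close> and \<open>t0\<close> survive, since both sides of the conditions at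
    \<open>t\<close> become those of \<open>f\<close> at \<open>max t 0\<close>.\<close>
  define f' where "f' t = f (max t 0)" for t
  \<comment> \<open>\<open>G\<close> carries the functional of the claim, built from
    \<open>f\<close>; \<open>P\<close> carries the truncated one, to which the mountain pass
    argument applies.\<close>
  interpret G: growth A a0 ainf "TYPE('a)" V K R1 R2 \<alpha>0 \<alpha>inf \<beta>0 \<beta>inf q1 q2 f M
    by unfold_locales (use assms M in auto)
  have f'_cont: "continuous_on UNIV f'"
    unfolding f'_def by (rule continuous_on_compose2[OF G.f_cont]) (auto intro!: continuous_intros)
  have prim: "primitive f' t = primitive f (max t 0)" for t
    unfolding f'_def[abs_def] by (rule primitive_positive_part[OF G.f_cont G.f_0])
  have f'_t: "f' t * t = f (max t 0) * max t 0" for t by (simp add: f'_def max_def)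
  interpret P: superquadratic_growth A a0 ainf "TYPE('a)" V K R1 R2 \<alpha>0 \<alpha>inf \<beta>0 \<beta>inf q1 q2 f' M \<theta> t0
  proof unfold_locales
    show "\<bar>f' t\<bar> \<le> M * min (\<bar>t\<bar> powr (q1 - 1)) (\<bar>t\<bar> powr (q2 - 1))" for t
      using M(2)[of t] M(1) by (cases "t \<le> 0") (simp_all add: f'_def max_def)
    show "0 \<le> \<theta> * primitive f' t" "\<theta> * primitive f' t \<le> f' t * t" for t
      unfolding prim f'_t by (rule \<theta>)+
    show "0 < primitive f' t0" using t0 by (simp add: prim max_def)
  qed (fact f'_cont M(1) \<theta>(1))+
  have X: "X = G.X" by (simp add: G.X_def assms(1))
  obtain u where u: "u \<in> G.X" "G.XH.nrm u \<noteq> 0" "\<And>v. v \<in> G.X \<Longrightarrow> G.ip u v = P.D\<Phi> u v" using P.ex_critical by blast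
  have pos: "AE x in lebesgue. 0 \<le> u x"
    by (rule P.nonneg_if_critical[OF u(1,3)]) (auto simp: f'_def max_def)
  \<comment> \<open>On nonnegative values \<open>f'\<close> and \<open>f\<close> agree, so the
    derivatives of the two nonlinear terms at \<open>u\<close> coincide.\<close>
  have crit: "G.ip u v = G.D\<Phi> u v" if v: "v \<in> G.X" for v
  proof -
    have ae: "AE x in lebesgue. G.kw x * (f' (u x) * v x) = G.kw x * (f (u x) * v x)"
      using pos by eventually_elim (simp add: f'_def max_def)
    have "P.D\<Phi> u v = G.D\<Phi> u v"
      unfolding P.D\<Phi>_def G.D\<Phi>_def
      by (rule integral_cong_AE[OF _ _ ae])
         (auto intro: borel_measurable_integrable P.f_integrable G.f_integrable u(1) v)
    then show ?thesis using u(3)[OF v] by simp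
  qed
  \<comment> \<open>The norm is nonzero, but nontriviality is claimed for the function; the equation
    tested with \<open>u\<close> links the two.\<close>
  have "\<not> (AE x in lebesgue. u x = 0)"
  proof
    assume "AE x in lebesgue. u x = 0"
    then have "G.ip u u = 0" using u(3)[OF u(1)] P.D\<Phi>_cong_0[of u u] by simp
    then show False using u(2) by (simp add: G.XH.nrm_def)
  qed
  \<comment> \<open>This shows that the integral in the functional is a genuine one, not the default
    value 0 of a non-integrable function.\<close>
  moreover have "integrable lebesgue (\<lambda>x. K (norm x) * primitive f (w x))" if w: "w \<in> G.X" for w
  proof -
    have i: "integrable lebesgue (\<lambda>x. G.kw x * primitive f (w x))" by (rule G.F_integrable[OF w])
    have ae: "AE x in lebesgue. G.kw x * primitive f (w x) = K (norm x) * primitive f (w x)"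
      using G.kw_AE by eventually_elim simp
    show ?thesis
      using i integrable_cong_AE[OF borel_measurable_integrable[OF i] borel_measurable_AE[OF borel_measurable_integrable[OF i] ae] ae] by blast
  qed
  ultimately show ?thesis unfolding X using G.critical_point_I[OF u(1) crit] pos by blast
qed

end
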